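(* Let $K$ be a field and let $(V,c,b)$ be a braided Lie algebra over $K$ such that the Nichols algebra $\mathcal{B}(V,c)$ is a quadratic algebra. Let $b^{2}:E_2(V,c)\to V$ denote the restriction of $b$ to $E_2(V,c)$. Then $(V,c,b^{2})$ is a QLie algebra and $U(V,c,b)=U_Q(V,c,b^{2})$ (i.e. the two quotients of the tensor algebra $T(V,c)$ coincide).
   Context: All vector spaces and tensor products are over $K$. A braided vector space $(V,c)$ is a vector space $V$ with a linear map $c:V\otimes V\to V\otimes V$ satisfying $c_1c_2c_1=c_2c_1c_2$ on $V^{\otimes 3}$, where $c_1=c\otimes \mathrm{Id}_V$, $c_2=\mathrm{Id}_V\otimes c$. Tensor algebra: $T=T(V,c)$ is the tensor algebra of $V$ with its unique structure of graded braided bialgebra whose braiding $c_T$ extends $c$ (compatibly with the multiplication and unit: $c_T(m\otimes T)=(T\otimes m)(c_T\otimes T)(T\otimes c_T)$, $c_T(T\otimes m)=(m\otimes T)(T\otimes c_T)(c_T\otimes T)$, $c_T(1\otimes x)=x\otimes 1$, $c_T(x\otimes 1)=1\otimes x$), whose comultiplication $\Delta_T$ satisfies $\Delta_T m=(m\otimes m)(T\otimes c_T\otimes T)(\Delta_T\otimes\Delta_T)$, and for which elements of $V$ are primitive. $\Delta_T^{a,b}:V^{\otimes (a+b)}\to V^{\otimes a}\otimes V^{\otimes b}$ denotes the homogeneous components of $\Delta_T$. $E(V,c)=\bigoplus_{n\ge 0}E_n(V,c)$ with $E_0=E_1=0$ and $E_n(V,c)=\bigcap_{a,b\ge1,\,a+b=n}\ker(\Delta_T^{a,b})$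 for $n\ge2$; in particular $E_2(V,c)=\ker(c+\mathrm{Id}_{V^{\otimes2}})$. The braiding $c_T$ restricts to maps $c_{E(V,c),V}:E(V,c)\otimes V\to V\otimes E(V,c)$ and $c_{V,E(V,c)}:V\otimes E(V,c)\to E(V,c)\otimes V$, and similarly with $E_2(V,c)$ in place of $E(V,c)$. A bracket on $(V,c)$ is a linear map $b:E(V,c)\to V$ with $c(b\otimes V)=(V\otimes b)c_{E(V,c),V}$ and $c(V\otimes b)=(b\otimes V)c_{V,E(V,c)}$. Its universal enveloping algebra is $U(V,c,b)=T(V,c)/\big((\mathrm{Id}-b)[E(V,c)]\big)$ (quotient by the two-sided ideal generated). $(V,c,b)$ is a braided Lie algebra if $b$ is a bracket on the braided vector space $(V,c)$ and the canonical map $V\to U(V,c,b)$ is injective. A Qbracket on $(V,c)$ is a linear map $\overline\beta:E_2(V,c)\to V$ with $c\overline\beta_1=\overline\beta_2c_{E_2(V,c),V}$ and $c\overline\beta_2=\overline\beta_1c_{V,E_2(V,c)}$, where $\overline\beta_1=\overline\beta\otimes \mathrm{Id}_V$ on $E_2(V,c)\otimes V$ and $\overline\beta_2=\mathrm{Id}_V\otimes\overline\beta$ on $V\otimes E_2(V,c)$. Let $\overline{E_2(V,c)}=(E_2(V,c)\otimes V)\cap(V\otimes E_2(V,c))$. For a Qbracket, $(\overline\beta_1-\overline\beta_2)(\overline{E_2(V,c)})\subseteq E_2(V,c)$. $(V,c,\overline\beta)$ is a quadratic Lie algebra (QLie algebra) if $\overline\beta$ is a Qbracket and $\overline\beta(\overline\beta_1-\overline\beta_2)(\overline{E_2(V,c)})=0$.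 For a Qbracket, $U_Q(V,c,\overline\beta)=T(V,c)/\big((\mathrm{Id}-\overline\beta)[E_2(V,c)]\big)$. Nichols algebra: $\mathcal{B}(V,c)=T(V,c)/\ker(\Gamma^T)$, where $\Gamma^T$ is the unique algebra map from $T(V,c)$ to the quantum shuffle algebra $T^c(V,c)$ that is the identity on $V$; in degree $n$ it is the quantum symmetrizer $\sum_{\sigma\in S_n}c_\sigma$, where $c_\sigma=c_{i_1}\cdots c_{i_k}$ for a reduced expression $\sigma=s_{i_1}\cdots s_{i_k}$. A graded algebra $A=\bigoplus_n A^n$ is quadratic if $A^0=K$, $A$ is generated by $A^1$, and the kernel of $T_K(A^1)\to A$ is generated as a two-sided ideal by its intersection with $A^1\otimes A^1$. *)

theory Defs
  imports Complex_Main "HOL-Algebra.QuotRing" "HOL-Algebra.Module" "HOL-Combinatorics.Permutations"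
begin

text \<open>
  Scalars form a type \<open>'k\<close> of class \<open>field\<close>.  A \<open>K\<close>-vector space is a HOL-Algebra record of type
  \<open>('k, 'a) module\<close>, of which only \<open>carrier\<close>, \<open>zero\<close>, \<open>add\<close> and \<open>smult\<close> matter; a \<open>K\<close>-algebra is
  such a record in which \<open>mult\<close> and \<open>one\<close> are the multiplication and the unit of the algebra.
  The record \<open>space_of s\<close> is the vector space on a whole type given by \<open>vector_space s\<close>; its
  multiplicative fields are dummies.
\<close>

definition space_of :: "('k::field \<Rightarrow> 'v::ab_group_add \<Rightarrow> 'v) \<Rightarrow> ('k, 'v) module" where
  "space_of s = \<lparr>carrier = UNIV, monoid.mult = (\<lambda>_ _. 0), one = 0, zero = 0, add = (+), smult = s\<rparr>"

definition linear_on ::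
    "('k, 'a) module \<Rightarrow> 'a set \<Rightarrow> ('k, 'b) module \<Rightarrow> ('a \<Rightarrow> 'b) \<Rightarrow> bool" where
  "linear_on M S N f \<longleftrightarrow>
     (\<forall>x\<in>S. f x \<in> carrier N) \<and>
     (\<forall>x\<in>S. \<forall>y\<in>S. f (x \<oplus>\<^bsub>M\<^esub> y) = f x \<oplus>\<^bsub>N\<^esub> f y) \<and>
     (\<forall>k. \<forall>x\<in>S. f (k \<odot>\<^bsub>M\<^esub> x) = k \<odot>\<^bsub>N\<^esub> f x)"

definition lincomb :: "('k, 'a) module \<Rightarrow> ('k \<times> 'a) list \<Rightarrow> 'a" where
  "lincomb M ps = foldr (\<lambda>(k, x) y. (k \<odot>\<^bsub>M\<^esub> x) \<oplus>\<^bsub>M\<^esub> y) ps \<zero>\<^bsub>M\<^esub>"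

definition lspan :: "('k, 'a) module \<Rightarrow> 'a set \<Rightarrow> 'a set" where
  "lspan M S = {lincomb M ps | ps. snd ` set ps \<subseteq> S}"

text \<open>
  \<open>lin_ext M N I p h\<close> is the linear map from the span of \<open>p ` I\<close> in \<open>M\<close> to \<open>N\<close> that sends \<open>p i\<close> to
  \<open>h i\<close> for all \<open>i\<close> in \<open>I\<close>.  It is used for maps on tensor products, \<open>p\<close> giving the pure tensors
  and \<open>h\<close> being multilinear, where such a map exists and is unique.
\<close>

definition lin_ext :: "('k, 'a) module \<Rightarrow> ('k, 'b) module \<Rightarrow> 'i set \<Rightarrow>
    ('i \<Rightarrow> 'a) \<Rightarrow> ('i \<Rightarrow> 'b) \<Rightarrow> 'a \<Rightarrow> 'b" where
  "lin_ext M N I p h t =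
     (THE s. \<exists>ps. snd ` set ps \<subseteq> I \<and>
        t = lincomb M (map (apsnd p) ps) \<and> s = lincomb N (map (apsnd h) ps))"


section \<open>The tensor algebra\<close>

text \<open>
  The library has no tensor products of vector spaces.  The pure tensor
  \<open>v\<^sub>1 \<otimes> \<dots> \<otimes> v\<^sub>n\<close> is realised as the evaluation functional \<open>\<phi> \<mapsto> \<phi> [v\<^sub>1, \<dots>, v\<^sub>n]\<close> on the
  functions \<open>\<phi>\<close> on words over \<open>V\<close> that are multilinear on the words of each length, and the tensor
  algebra is the span of these functionals.  Over a field multilinear forms separate the elements
  of a tensor power, so this is the usual tensor algebra.
\<close>

definition multilinear_form :: "('k::field, 'a) module \<Rightarrow> ('a list \<Rightarrow> 'k) \<Rightarrow> bool" where
  "multilinear_form M \<phi> \<longleftrightarrow>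
     (\<forall>us\<in>lists (carrier M). \<forall>ws\<in>lists (carrier M). \<forall>x\<in>carrier M. \<forall>y\<in>carrier M. \<forall>k.
        \<phi> (us @ [x \<oplus>\<^bsub>M\<^esub> y] @ ws) = \<phi> (us @ [x] @ ws) + \<phi> (us @ [y] @ ws) \<and>
        \<phi> (us @ [k \<odot>\<^bsub>M\<^esub> x] @ ws) = k * \<phi> (us @ [x] @ ws))"

definition tens :: "('k::field, 'a) module \<Rightarrow> 'a list \<Rightarrow> ('a list \<Rightarrow> 'k) \<Rightarrow> 'k" where
  "tens M w = (\<lambda>\<phi>. if multilinear_form M \<phi> then \<phi> w else 0)"

definition tensor_algebra ::
    "('k::field, 'a) module \<Rightarrow> ('k, ('a list \<Rightarrow> 'k) \<Rightarrow> 'k) module" (\<open>\<T>\<close>) where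
  "\<T> M =
     \<lparr>carrier = {\<lambda>\<phi>. \<Sum>(k, w)\<leftarrow>ps. k * tens M w \<phi> | ps. snd ` set ps \<subseteq> lists (carrier M)},
      monoid.mult = (\<lambda>x y \<phi>. if multilinear_form M \<phi> then x (\<lambda>u. y (\<lambda>w. \<phi> (u @ w))) else 0),
      one = tens M [],
      zero = (\<lambda>\<phi>. 0),
      add = (\<lambda>x y \<phi>. x \<phi> + y \<phi>),
      smult = (\<lambda>k x \<phi>. k * x \<phi>)\<rparr>"

lemma tens_mult:
  fixes s :: "'k::field \<Rightarrow> 'v::ab_group_add \<Rightarrow> 'v"
  shows "tens (space_of s) u \<otimes>\<^bsub>\<T> (space_of s)\<^esub> tens (space_of s) w = tens (space_of s) (u @ w)"
proof
  fix \<phi>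
  show "(tens (space_of s) u \<otimes>\<^bsub>\<T> (space_of s)\<^esub> tens (space_of s) w) \<phi> = tens (space_of s) (u @ w) \<phi>"
  proof (cases "multilinear_form (space_of s) \<phi>")
    case True
    have ml: "\<phi> (us @ (x + y) # ws) = \<phi> (us @ x # ws) + \<phi> (us @ y # ws)"
             "\<phi> (us @ s k x # ws) = k * \<phi> (us @ x # ws)" for us ws x y k
      using True by (auto simp: multilinear_form_def space_of_def lists_UNIV)
    have "multilinear_form (space_of s) (\<lambda>w. \<phi> (v @ w))" for v
      using ml[of "v @ _"] by (simp add: multilinear_form_def space_of_def)
    moreover have "multilinear_form (space_of s) (\<lambda>v. \<phi> (v @ w))"
      using ml by (simp add: multilinear_form_def space_of_def)
    ultimately show ?thesis using True by (simp add: tensor_algebra_def tens_def)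
  qed (simp add: tensor_algebra_def tens_def)
qed

text \<open>
  The universal property: a multilinear map \<open>f\<close> into a vector space respects all linear relations
  between pure tensors, hence extends to a linear map on the tensor algebra.
\<close>

lemma tens_universal:
  fixes s :: "'k::field \<Rightarrow> 'v::ab_group_add \<Rightarrow> 'v" and t :: "'k \<Rightarrow> 'w::ab_group_add \<Rightarrow> 'w"
  assumes vs: "vector_space t"
    and f: "\<And>us x y ws. f (us @ (x+y) # ws) = f (us @ x # ws) + f (us @ y # ws)"
           "\<And>us x k ws. f (us @ s k x # ws) = t k (f (us @ x # ws))"
    and rel: "(\<lambda>\<phi>. \<Sum>(k, w)\<leftarrow>ps. k * tens (space_of s) w \<phi>) = (\<lambda>\<phi>. 0)"
  shows "(\<Sum>(k, w)\<leftarrow>ps. t k (f w)) = 0"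
proof (rule ccontr)
  interpret t: vector_space t by fact
  interpret vp: vector_space_pair t "(*) :: 'k \<Rightarrow> 'k \<Rightarrow> 'k" 
    by unfold_locales (auto simp: algebra_simps)
  let ?z = "\<Sum>(k, w)\<leftarrow>ps. t k (f w)"
  assume nz: "?z \<noteq> 0"
  have "t.independent {?z}" using nz by (simp add: t.independent_insert)
  then obtain g where g: "Vector_Spaces.linear t (*) g" "g ?z = 1"
    using vp.linear_independent_extend[of "{?z}" "\<lambda>_. 1"] by auto
  interpret g: Vector_Spaces.linear t "(*)" g by fact
  have ml: "multilinear_form (space_of s) (\<lambda>w. g (f w))"
    unfolding multilinear_form_def by (auto simp: space_of_def f g.add g.scale)
  have "g ?z = (\<Sum>(k, w)\<leftarrow>ps. k * tens (space_of s) w (\<lambda>w. g (f w)))"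
    by (induction ps) (auto simp: g.add g.scale tens_def ml)
  also have "\<dots> = 0" using fun_cong[OF rel] by simp
  finally show False using g(2) by simp
qed

definition incl :: "('k::field, 'a) module \<Rightarrow> 'a \<Rightarrow> ('a list \<Rightarrow> 'k) \<Rightarrow> 'k" where
  "incl M v = tens M [v]"

definition tpow :: "('k::field, 'a) module \<Rightarrow> nat \<Rightarrow> (('a list \<Rightarrow> 'k) \<Rightarrow> 'k) set" where
  "tpow M n = lspan (\<T> M) (tens M ` {w \<in> lists (carrier M). length w = n})"

text \<open>
  For subspaces \<open>X\<close>, \<open>Y\<close> of \<open>M\<close>, \<open>pair_tensor M X Y\<close> is \<open>X \<otimes> Y\<close> as a subspace of
  \<open>M \<otimes> M = tpow M 2\<close>.
\<close>

definition pair_tensor ::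
    "('k::field, 'a) module \<Rightarrow> 'a set \<Rightarrow> 'a set \<Rightarrow> (('a list \<Rightarrow> 'k) \<Rightarrow> 'k) set" where
  "pair_tensor M X Y = lspan (\<T> M) {tens M [x, y] | x y. x \<in> X \<and> y \<in> Y}"

text \<open>
  \<open>pair_ext M N X Y h\<close> is the linear map \<open>X \<otimes> Y \<rightarrow> N\<close> with \<open>x \<otimes> y \<mapsto> h x y\<close>, on \<open>X \<otimes> Y \<subseteq> M \<otimes> M\<close>.
\<close>

definition pair_ext :: "('k::field, 'a) module \<Rightarrow> ('k, 'b) module \<Rightarrow> 'a set \<Rightarrow> 'a set \<Rightarrow>
    ('a \<Rightarrow> 'a \<Rightarrow> 'b) \<Rightarrow> (('a list \<Rightarrow> 'k) \<Rightarrow> 'k) \<Rightarrow> 'b" where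
  "pair_ext M N X Y h = lin_ext (\<T> M) N (X \<times> Y) (\<lambda>(x, y). tens M [x, y]) (\<lambda>(x, y). h x y)"

text \<open>
  If \<open>X\<close> and \<open>Y\<close> are subspaces of \<open>tpow M m\<close> and \<open>tpow M n\<close>, then \<open>X \<otimes> Y\<close> is also identified
  with a subspace of \<open>tpow M (m + n)\<close>, namely with \<open>sub_prod (\<T> M) X Y\<close>;
  \<open>tensor_map (\<T> M) X Y f g\<close> is \<open>f \<otimes> g\<close> with this identification in source and target.
\<close>

definition sub_prod :: "('k, 'a) module \<Rightarrow> 'a set \<Rightarrow> 'a set \<Rightarrow> 'a set" where
  "sub_prod A X Y = lspan A {x \<otimes>\<^bsub>A\<^esub> y | x y. x \<in> X \<and> y \<in> Y}"

definition tensor_map :: "('k, 'a) module \<Rightarrow> 'a set \<Rightarrow> 'a set \<Rightarrow>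
    ('a \<Rightarrow> 'a) \<Rightarrow> ('a \<Rightarrow> 'a) \<Rightarrow> 'a \<Rightarrow> 'a" where
  "tensor_map A X Y f g =
     lin_ext A A (X \<times> Y) (\<lambda>(x, y). x \<otimes>\<^bsub>A\<^esub> y) (\<lambda>(x, y). f x \<otimes>\<^bsub>A\<^esub> g y)"


section \<open>Braided vector spaces and braided bialgebras\<close>

text \<open>\<open>V \<otimes> V\<close> is \<open>tpow V 2\<close>, so the braiding is a map on (a subspace of) \<open>\<T> V\<close>.\<close>

definition braided_vector_space ::
    "('k::field, 'v) module \<Rightarrow> ((('v list \<Rightarrow> 'k) \<Rightarrow> 'k) \<Rightarrow> (('v list \<Rightarrow> 'k) \<Rightarrow> 'k)) \<Rightarrow> bool" where
  "braided_vector_space V c \<longleftrightarrow>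
     linear_on (\<T> V) (tpow V 2) (\<T> V) c \<and> c ` tpow V 2 \<subseteq> tpow V 2 \<and>
     (let c1 = tensor_map (\<T> V) (tpow V 2) (tpow V 1) c id;
          c2 = tensor_map (\<T> V) (tpow V 1) (tpow V 2) id c
      in \<forall>t\<in>tpow V 3. c1 (c2 (c1 t)) = c2 (c1 (c2 t)))"

text \<open>
  For an algebra \<open>A\<close> the tensor power \<open>A\<^sup>\<otimes>\<^sup>n\<close> is \<open>tpow A n\<close>.  The multiplication and a
  comultiplication \<open>\<Delta>\<close> (with values in \<open>tpow A 2\<close>) are transported to maps
  \<open>tpow A 2 \<rightarrow> tpow A 1\<close> and \<open>tpow A 1 \<rightarrow> tpow A 2\<close>, and \<open>tmap A i j f g\<close> is \<open>f \<otimes> g\<close> on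
  \<open>A\<^sup>\<otimes>\<^sup>i \<otimes> A\<^sup>\<otimes>\<^sup>j\<close>.
\<close>

abbreviation tmap where
  "tmap A i j \<equiv> tensor_map (\<T> A) (tpow A i) (tpow A j)"

definition mult_map ::
    "('k::field, 'a) module \<Rightarrow> (('a list \<Rightarrow> 'k) \<Rightarrow> 'k) \<Rightarrow> (('a list \<Rightarrow> 'k) \<Rightarrow> 'k)" where
  "mult_map A = pair_ext A (\<T> A) (carrier A) (carrier A) (\<lambda>x y. incl A (x \<otimes>\<^bsub>A\<^esub> y))"

definition comult_map :: "('k::field, 'a) module \<Rightarrow> ('a \<Rightarrow> ('a list \<Rightarrow> 'k) \<Rightarrow> 'k) \<Rightarrow>
    (('a list \<Rightarrow> 'k) \<Rightarrow> 'k) \<Rightarrow> (('a list \<Rightarrow> 'k) \<Rightarrow> 'k)" where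
  "comult_map A \<Delta> = lin_ext (\<T> A) (\<T> A) (carrier A) (incl A) \<Delta>"

definition braided_algebra ::
    "('k::field, 'a) module \<Rightarrow> ((('a list \<Rightarrow> 'k) \<Rightarrow> 'k) \<Rightarrow> (('a list \<Rightarrow> 'k) \<Rightarrow> 'k)) \<Rightarrow> bool" where
  "braided_algebra A F \<longleftrightarrow>
     braided_vector_space A F \<and>
     (\<forall>z\<in>tpow A 3. F (tmap A 2 1 (mult_map A) id z) =
        tmap A 1 2 id (mult_map A) (tmap A 2 1 F id (tmap A 1 2 id F z))) \<and>
     (\<forall>z\<in>tpow A 3. F (tmap A 1 2 id (mult_map A) z) =
        tmap A 2 1 (mult_map A) id (tmap A 1 2 id F (tmap A 2 1 F id z))) \<and>
     (\<forall>x\<in>carrier A. F (tens A [\<one>\<^bsub>A\<^esub>, x]) = tens A [x, \<one>\<^bsub>A\<^esub>] \<and>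
                     F (tens A [x, \<one>\<^bsub>A\<^esub>]) = tens A [\<one>\<^bsub>A\<^esub>, x])"

definition braided_coalgebra ::
    "('k::field, 'a) module \<Rightarrow> ((('a list \<Rightarrow> 'k) \<Rightarrow> 'k) \<Rightarrow> (('a list \<Rightarrow> 'k) \<Rightarrow> 'k)) \<Rightarrow>
     ('a \<Rightarrow> ('a list \<Rightarrow> 'k) \<Rightarrow> 'k) \<Rightarrow> ('a \<Rightarrow> 'k) \<Rightarrow> bool" where
  "braided_coalgebra A F \<Delta> \<epsilon> \<longleftrightarrow>
     braided_vector_space A F \<and>
     linear_on A (carrier A) (\<T> A) \<Delta> \<and> \<Delta> ` carrier A \<subseteq> tpow A 2 \<and>
     (\<forall>x\<in>carrier A. \<forall>y\<in>carrier A. \<epsilon> (x \<oplus>\<^bsub>A\<^esub> y) = \<epsilon> x + \<epsilon> y) \<and>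
     (\<forall>k. \<forall>x\<in>carrier A. \<epsilon> (k \<odot>\<^bsub>A\<^esub> x) = k * \<epsilon> x) \<and>
     (let D = comult_map A \<Delta>;
          eL = pair_ext A A (carrier A) (carrier A) (\<lambda>x y. \<epsilon> x \<odot>\<^bsub>A\<^esub> y);
          eR = pair_ext A A (carrier A) (carrier A) (\<lambda>x y. \<epsilon> y \<odot>\<^bsub>A\<^esub> x)
      in (\<forall>x\<in>carrier A. tmap A 1 1 D id (\<Delta> x) = tmap A 1 1 id D (\<Delta> x)) \<and>
         (\<forall>x\<in>carrier A. eL (\<Delta> x) = x \<and> eR (\<Delta> x) = x) \<and>
         (\<forall>z\<in>tpow A 2. tmap A 1 1 id D (F z) =
            tmap A 2 1 F id (tmap A 1 2 id F (tmap A 1 1 D id z))) \<and>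
         (\<forall>z\<in>tpow A 2. tmap A 1 1 D id (F z) =
            tmap A 1 2 id F (tmap A 2 1 F id (tmap A 1 1 id D z))) \<and>
         (\<forall>z\<in>tpow A 2. eL (F z) = eR z \<and> eR (F z) = eL z))"

definition braided_bialgebra ::
    "('k::field, 'a) module \<Rightarrow> ((('a list \<Rightarrow> 'k) \<Rightarrow> 'k) \<Rightarrow> (('a list \<Rightarrow> 'k) \<Rightarrow> 'k)) \<Rightarrow>
     ('a \<Rightarrow> ('a list \<Rightarrow> 'k) \<Rightarrow> 'k) \<Rightarrow> ('a \<Rightarrow> 'k) \<Rightarrow> bool" where
  "braided_bialgebra A F \<Delta> \<epsilon> \<longleftrightarrow>
     braided_algebra A F \<and> braided_coalgebra A F \<Delta> \<epsilon> \<and>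
     (\<forall>x\<in>carrier A. \<forall>y\<in>carrier A. \<Delta> (x \<otimes>\<^bsub>A\<^esub> y) =
        tmap A 2 2 (mult_map A) (mult_map A)
          (tmap A 1 3 id (tmap A 2 1 F id) (\<Delta> x \<otimes>\<^bsub>\<T> A\<^esub> \<Delta> y))) \<and>
     \<Delta> \<one>\<^bsub>A\<^esub> = tens A [\<one>\<^bsub>A\<^esub>, \<one>\<^bsub>A\<^esub>] \<and>
     (\<forall>x\<in>carrier A. \<forall>y\<in>carrier A. \<epsilon> (x \<otimes>\<^bsub>A\<^esub> y) = \<epsilon> x * \<epsilon> y) \<and> \<epsilon> \<one>\<^bsub>A\<^esub> = 1"

type_synonym ('k, 'v) T = "('v list \<Rightarrow> 'k) \<Rightarrow> 'k"
type_synonym ('k, 'v) TT = "('k, ('k, 'v) T) T"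

text \<open>
  \<open>tensor_bialgebra V c cT \<Delta>\<close>: \<open>cT\<close> and \<open>\<Delta>\<close> are the braiding and the comultiplication of the
  (unique) graded braided bialgebra structure on \<open>\<T> V\<close> whose braiding extends \<open>c\<close> and for which
  \<open>V\<close> consists of primitive elements.  The braiding of \<open>V \<otimes> V \<subseteq> \<T> V \<otimes> \<T> V\<close> is compared with \<open>c\<close>
  by means of the multiplication \<open>V \<otimes> V \<rightarrow> tpow V 2\<close>.
\<close>

definition tensor_bialgebra :: "('k::field, 'v) module \<Rightarrow> (('k, 'v) T \<Rightarrow> ('k, 'v) T) \<Rightarrow>
    (('k, 'v) TT \<Rightarrow> ('k, 'v) TT) \<Rightarrow> (('k, 'v) T \<Rightarrow> ('k, 'v) TT) \<Rightarrow> bool" where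
  "tensor_bialgebra V c cT \<Delta> \<longleftrightarrow>
     (\<exists>\<epsilon>. braided_bialgebra (\<T> V) cT \<Delta> \<epsilon> \<and> (\<forall>n\<ge>1. \<forall>x\<in>tpow V n. \<epsilon> x = 0)) \<and>
     (\<forall>a b. cT ` pair_tensor (\<T> V) (tpow V a) (tpow V b)
              \<subseteq> pair_tensor (\<T> V) (tpow V b) (tpow V a)) \<and>
     (\<forall>n. \<Delta> ` tpow V n
            \<subseteq> lspan (\<T> (\<T> V)) (\<Union>a\<in>{..n}. pair_tensor (\<T> V) (tpow V a) (tpow V (n - a)))) \<and>
     (let m = pair_ext (\<T> V) (\<T> V) (carrier (\<T> V)) (carrier (\<T> V)) (\<lambda>x y. x \<otimes>\<^bsub>\<T> V\<^esub> y)
      in \<forall>t\<in>pair_tensor (\<T> V) (tpow V 1) (tpow V 1). m (cT t) = c (m t)) \<and>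
     (\<forall>x\<in>tpow V 1. \<Delta> x = tens (\<T> V) [x, \<one>\<^bsub>\<T> V\<^esub>] \<oplus>\<^bsub>\<T> (\<T> V)\<^esub> tens (\<T> V) [\<one>\<^bsub>\<T> V\<^esub>, x])"


section \<open>Brackets, enveloping algebras, Lie algebras\<close>

definition deg_proj :: "('k::field, 'v) module \<Rightarrow> nat \<Rightarrow> ('k, 'v) T \<Rightarrow> ('k, 'v) T" where
  "deg_proj V n = lin_ext (\<T> V) (\<T> V) (lists (carrier V)) (tens V)
     (\<lambda>w. if length w = n then tens V w else \<zero>\<^bsub>\<T> V\<^esub>)"

definition comult_comp :: "('k::field, 'v) module \<Rightarrow> (('k, 'v) T \<Rightarrow> ('k, 'v) TT) \<Rightarrow>
    nat \<Rightarrow> nat \<Rightarrow> ('k, 'v) T \<Rightarrow> ('k, 'v) TT" where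
  "comult_comp V \<Delta> a b x =
     pair_ext (\<T> V) (\<T> (\<T> V)) (carrier (\<T> V)) (carrier (\<T> V))
       (\<lambda>y z. tens (\<T> V) [deg_proj V a y, deg_proj V b z]) (\<Delta> x)"

definition E_deg ::
    "('k::field, 'v) module \<Rightarrow> (('k, 'v) T \<Rightarrow> ('k, 'v) TT) \<Rightarrow> nat \<Rightarrow> ('k, 'v) T set" where
  "E_deg V \<Delta> n =
     (if n < 2 then {\<zero>\<^bsub>\<T> V\<^esub>}
      else {x \<in> tpow V n. \<forall>a\<ge>1. \<forall>b\<ge>1. a + b = n \<longrightarrow> comult_comp V \<Delta> a b x = \<zero>\<^bsub>\<T> (\<T> V)\<^esub>})"

definition E_all ::
    "('k::field, 'v) module \<Rightarrow> (('k, 'v) T \<Rightarrow> ('k, 'v) TT) \<Rightarrow> ('k, 'v) T set" where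
  "E_all V \<Delta> = lspan (\<T> V) (\<Union>n. E_deg V \<Delta> n)"

text \<open>
  \<open>bracket_on V c cT S b\<close> expresses that the linear map \<open>b\<close> from the subspace \<open>S\<close> of \<open>\<T> V\<close> to \<open>V\<close>
  satisfies \<open>c (b \<otimes> V) = (V \<otimes> b) c\<^sub>S\<^sub>,\<^sub>V\<close> and \<open>c (V \<otimes> b) = (b \<otimes> V) c\<^sub>V\<^sub>,\<^sub>S\<close>, where \<open>c\<^sub>S\<^sub>,\<^sub>V\<close> and \<open>c\<^sub>V\<^sub>,\<^sub>S\<close>
  are restrictions of \<open>cT\<close>.  Taking \<open>S = E_all V \<Delta>\<close> gives brackets and \<open>S = E_deg V \<Delta> 2\<close> gives
  Qbrackets.
\<close>

definition bracket_on :: "('k::field, 'v) module \<Rightarrow> (('k, 'v) T \<Rightarrow> ('k, 'v) T) \<Rightarrow>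
    (('k, 'v) TT \<Rightarrow> ('k, 'v) TT) \<Rightarrow> ('k, 'v) T set \<Rightarrow> (('k, 'v) T \<Rightarrow> 'v) \<Rightarrow> bool" where
  "bracket_on V c cT S b \<longleftrightarrow>
     linear_on (\<T> V) S V b \<and>
     (let bV = pair_ext (\<T> V) (\<T> V) S (tpow V 1) (\<lambda>x v. incl V (b x) \<otimes>\<^bsub>\<T> V\<^esub> v);
          Vb = pair_ext (\<T> V) (\<T> V) (tpow V 1) S (\<lambda>v x. v \<otimes>\<^bsub>\<T> V\<^esub> incl V (b x))
      in (\<forall>t\<in>pair_tensor (\<T> V) S (tpow V 1). c (bV t) = Vb (cT t)) \<and>
         (\<forall>t\<in>pair_tensor (\<T> V) (tpow V 1) S. c (Vb t) = bV (cT t)))"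

text \<open>
  Mirrors the quotient ring \<open>A Quot I\<close> of HOL-Algebra, with the scalar action on cosets added.
\<close>

definition quot_algebra :: "('k, 'a) module \<Rightarrow> 'a set \<Rightarrow> ('k, 'a set) module" where
  "quot_algebra A I =
     ring.extend (A Quot I) (module.fields (\<lambda>k X. \<Union>x\<in>X. I +>\<^bsub>A\<^esub> (k \<odot>\<^bsub>A\<^esub> x)))"

definition env_ideal ::
    "('k::field, 'v) module \<Rightarrow> ('k, 'v) T set \<Rightarrow> (('k, 'v) T \<Rightarrow> 'v) \<Rightarrow> ('k, 'v) T set" where
  "env_ideal V S b = Idl\<^bsub>\<T> V\<^esub> {x \<ominus>\<^bsub>\<T> V\<^esub> incl V (b x) | x. x \<in> S}"

definition U_alg :: "('k::field, 'v) module \<Rightarrow> (('k, 'v) T \<Rightarrow> ('k, 'v) TT) \<Rightarrow>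
    (('k, 'v) T \<Rightarrow> 'v) \<Rightarrow> ('k, ('k, 'v) T set) module" where
  "U_alg V \<Delta> b = quot_algebra (\<T> V) (env_ideal V (E_all V \<Delta>) b)"

definition UQ_alg :: "('k::field, 'v) module \<Rightarrow> (('k, 'v) T \<Rightarrow> ('k, 'v) TT) \<Rightarrow>
    (('k, 'v) T \<Rightarrow> 'v) \<Rightarrow> ('k, ('k, 'v) T set) module" where
  "UQ_alg V \<Delta> \<beta> = quot_algebra (\<T> V) (env_ideal V (E_deg V \<Delta> 2) \<beta>)"

definition braided_Lie_algebra :: "('k::field, 'v) module \<Rightarrow> (('k, 'v) T \<Rightarrow> ('k, 'v) T) \<Rightarrow>
    (('k, 'v) TT \<Rightarrow> ('k, 'v) TT) \<Rightarrow> (('k, 'v) T \<Rightarrow> ('k, 'v) TT) \<Rightarrow> (('k, 'v) T \<Rightarrow> 'v) \<Rightarrow> bool" where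
  "braided_Lie_algebra V c cT \<Delta> b \<longleftrightarrow>
     braided_vector_space V c \<and>
     bracket_on V c cT (E_all V \<Delta>) b \<and>
     inj_on (\<lambda>v. env_ideal V (E_all V \<Delta>) b +>\<^bsub>\<T> V\<^esub> incl V v) (carrier V)"

definition QLie_algebra :: "('k::field, 'v) module \<Rightarrow> (('k, 'v) T \<Rightarrow> ('k, 'v) T) \<Rightarrow>
    (('k, 'v) TT \<Rightarrow> ('k, 'v) TT) \<Rightarrow> (('k, 'v) T \<Rightarrow> ('k, 'v) TT) \<Rightarrow> (('k, 'v) T \<Rightarrow> 'v) \<Rightarrow> bool" where
  "QLie_algebra V c cT \<Delta> \<beta> \<longleftrightarrow>
     braided_vector_space V c \<and>
     bracket_on V c cT (E_deg V \<Delta> 2) \<beta> \<and>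
     (let E2 = E_deg V \<Delta> 2; V1 = tpow V 1;
          \<beta>1 = tensor_map (\<T> V) E2 V1 (\<lambda>x. incl V (\<beta> x)) id;
          \<beta>2 = tensor_map (\<T> V) V1 E2 id (\<lambda>x. incl V (\<beta> x))
      in \<forall>z \<in> sub_prod (\<T> V) E2 V1 \<inter> sub_prod (\<T> V) V1 E2.
           \<beta> (\<beta>1 z \<ominus>\<^bsub>\<T> V\<^esub> \<beta>2 z) = \<zero>\<^bsub>V\<^esub>)"


section \<open>Nichols algebras and quadratic algebras\<close>

text \<open>The operator \<open>c\<close> in positions \<open>i\<close>, \<open>i + 1\<close> of \<open>tpow V n\<close>, positions counted from \<open>0\<close>.\<close>

definition braid_at :: "('k::field, 'v) module \<Rightarrow> (('k, 'v) T \<Rightarrow> ('k, 'v) T) \<Rightarrow>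
    nat \<Rightarrow> nat \<Rightarrow> ('k, 'v) T \<Rightarrow> ('k, 'v) T" where
  "braid_at V c n i =
     tensor_map (\<T> V) (tpow V i) (tpow V (n - i)) id
       (tensor_map (\<T> V) (tpow V 2) (tpow V (n - i - 2)) c id)"

definition word_perm :: "nat list \<Rightarrow> nat \<Rightarrow> nat" where
  "word_perm is = foldr (\<lambda>i \<tau>. Transposition.transpose i (Suc i) \<circ> \<tau>) is id"

definition reduced_word :: "nat \<Rightarrow> (nat \<Rightarrow> nat) \<Rightarrow> nat list" where
  "reduced_word n \<sigma> = (ARG_MIN length is. set is \<subseteq> {i. Suc i < n} \<and> word_perm is = \<sigma>)"

definition braid_perm :: "('k::field, 'v) module \<Rightarrow> (('k, 'v) T \<Rightarrow> ('k, 'v) T) \<Rightarrow>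
    nat \<Rightarrow> (nat \<Rightarrow> nat) \<Rightarrow> ('k, 'v) T \<Rightarrow> ('k, 'v) T" where
  "braid_perm V c n \<sigma> = foldr (\<lambda>i f. braid_at V c n i \<circ> f) (reduced_word n \<sigma>) id"

definition quantum_symmetrizer :: "('k::field, 'v) module \<Rightarrow> (('k, 'v) T \<Rightarrow> ('k, 'v) T) \<Rightarrow>
    nat \<Rightarrow> ('k, 'v) T \<Rightarrow> ('k, 'v) T" where
  "quantum_symmetrizer V c n x = (\<Oplus>\<^bsub>\<T> V\<^esub>\<sigma>\<in>{\<sigma>. \<sigma> permutes {..<n}}. braid_perm V c n \<sigma> x)"

definition Gamma_map ::
    "('k::field, 'v) module \<Rightarrow> (('k, 'v) T \<Rightarrow> ('k, 'v) T) \<Rightarrow> ('k, 'v) T \<Rightarrow> ('k, 'v) T" where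
  "Gamma_map V c = lin_ext (\<T> V) (\<T> V) (lists (carrier V)) (tens V)
     (\<lambda>w. quantum_symmetrizer V c (length w) (tens V w))"

definition Nichols_ideal ::
    "('k::field, 'v) module \<Rightarrow> (('k, 'v) T \<Rightarrow> ('k, 'v) T) \<Rightarrow> ('k, 'v) T set" where
  "Nichols_ideal V c = {t \<in> carrier (\<T> V). Gamma_map V c t = \<zero>\<^bsub>\<T> V\<^esub>}"

definition Nichols_algebra :: "('k::field, 'v) module \<Rightarrow> (('k, 'v) T \<Rightarrow> ('k, 'v) T) \<Rightarrow>
    ('k, ('k, 'v) T set) module" where
  "Nichols_algebra V c = quot_algebra (\<T> V) (Nichols_ideal V c)"

definition Nichols_deg :: "('k::field, 'v) module \<Rightarrow> (('k, 'v) T \<Rightarrow> ('k, 'v) T) \<Rightarrow>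
    nat \<Rightarrow> ('k, 'v) T set set" where
  "Nichols_deg V c n = (\<lambda>x. Nichols_ideal V c +>\<^bsub>\<T> V\<^esub> x) ` tpow V n"

text \<open>
  \<open>quadratic_algebra A An\<close> is a condition on a graded algebra \<open>A\<close> with homogeneous components
  \<open>An n\<close>.  Here \<open>\<T> (A\<lparr>carrier := An 1\<rparr>)\<close> is the tensor algebra of the vector space \<open>An 1\<close>, and
  \<open>\<pi>\<close> is its canonical algebra map to \<open>A\<close>.
\<close>

definition word_prod :: "('k, 'a) module \<Rightarrow> 'a list \<Rightarrow> 'a" where
  "word_prod A ws = foldr (\<lambda>x y. x \<otimes>\<^bsub>A\<^esub> y) ws \<one>\<^bsub>A\<^esub>"

definition quadratic_algebra :: "('k::field, 'a) module \<Rightarrow> (nat \<Rightarrow> 'a set) \<Rightarrow> bool" where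
  "quadratic_algebra A An \<longleftrightarrow>
     bij_betw (\<lambda>k. k \<odot>\<^bsub>A\<^esub> \<one>\<^bsub>A\<^esub>) UNIV (An 0) \<and>
     lspan A (word_prod A ` lists (An 1)) = carrier A \<and>
     (let A1 = A\<lparr>carrier := An 1\<rparr>;
          \<pi> = lin_ext (\<T> A1) A (lists (An 1)) (tens A1) (word_prod A);
          J = {t \<in> carrier (\<T> A1). \<pi> t = \<zero>\<^bsub>A\<^esub>}
      in J = Idl\<^bsub>\<T> A1\<^esub> (J \<inter> tpow A1 2))"

end

theory Submission imports Defs "HOL-Library.Function_Algebras" begin

text \<open>
  Let \<open>J\<close> be the kernel of \<open>\<Gamma>\<close> and \<open>I\<close> the ideal defining \<open>U(V, c, b)\<close>.  In degree \<open>n \<ge> 2\<close> the space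
  \<open>E\<^sub>n\<close> consists of the primitive elements, so the compatibility of \<open>b\<close> with the braiding makes \<open>I\<close> a
  coideal, and \<open>I \<inter> (K + V) = 0\<close> since \<open>V\<close> embeds into \<open>U(V, c, b)\<close>.  Let \<open>f\<close> be a linear form that
  vanishes on \<open>I\<close> and on \<open>1\<close>.  Then \<open>(id \<otimes> f) \<Delta>\<close> maps \<open>I\<close> to itself and lowers the filtration
  degree; on leading terms of degree \<open>m + 1\<close> it is the contraction with \<open>f\<close> of
  \<open>\<Sum>\<^sub>j c\<^bsub>m-1\<^esub> \<dots> c\<^sub>j\<close>, through which the quantum symmetrizer of degree \<open>m + 1\<close> factors with the
  symmetrizer of degree \<open>m\<close> as the other factor.  By induction the leading term of every element of
  \<open>I\<close> lies in \<open>J\<close>.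

  If \<open>J\<close> is generated by \<open>J \<inter> (V \<otimes> V) = E\<^sub>2\<close>, such a leading term is a combination of products
  \<open>u e w\<close> with \<open>e \<in> E\<^sub>2\<close>.  Subtracting the products \<open>u (e - b e) w\<close> lowers the degree, hence \<open>I\<close>
  is generated by \<open>(id - b) E\<^sub>2\<close>.  For the QLie identity, \<open>c\<close> exchanges the images of
  \<open>z \<in> (E\<^sub>2 \<otimes> V) \<inter> (V \<otimes> E\<^sub>2)\<close> under \<open>b \<otimes> V\<close> and \<open>V \<otimes> b\<close>, so their difference \<open>y\<close> lies in
  \<open>E\<^sub>2 \<inter> I\<close> and \<open>b y \<in> I \<inter> V = 0\<close>.
\<close>

section \<open>Linear algebra of functionals\<close>

text \<open>\<open>I\<close> is filtered and not graded, which is why leading terms are studied. The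
  map \<open>(id \<otimes> f) \<Delta>\<close> preserves the coideal \<open>I\<close> when
  \<open>f\<close> vanishes on \<open>I\<close>; to recover every coefficient of a coset sum, such
  forms must also take prescribed values on an independent subset of \<open>V\<close>. They exist
  because \<open>1\<close> and this subset stay independent modulo \<open>I\<close>, and this is how
  the injectivity of \<open>V\<close> into the enveloping algebra controls all degrees. The
  comultiplication is known through the bialgebra axioms only, so its component in degrees
  \<open>(m, 1)\<close> is found by induction on \<open>m\<close> and matched with a recursion for
  the coset sums. The symmetrizer is defined through chosen words of minimal length; splitting it
  along cosets of the symmetric group rests on Matsumoto's theorem for operators that satisfy the
  braid relations. The given maps are total functions that are controlled on a subspace only. They
  are replaced by linear maps of the whole type, obtained by composing with linear
  projections.\<close>

definition fscale :: "'k::field \<Rightarrow> ('b \<Rightarrow> 'k) \<Rightarrow> 'b \<Rightarrow> 'k" where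
  "fscale k x = (\<lambda>\<phi>. k * x \<phi>)"

text \<open>Elements of tensor algebras are functions, to be treated as vectors and not unfolded pointwise.\<close>
declare plus_fun_apply [simp del] zero_fun_apply [simp del]
  minus_apply [simp del] uminus_apply [simp del]

lemma fscale_apply: "fscale k x \<phi> = k * x \<phi>"
  by (simp add: fscale_def)

lemmas fun_applies = plus_fun_apply zero_fun_apply minus_apply uminus_apply fscale_apply

global_interpretation fs: vector_space "fscale :: 'k::field \<Rightarrow> ('b \<Rightarrow> 'k) \<Rightarrow> 'b \<Rightarrow> 'k"
  by unfold_locales (auto simp: fun_eq_iff fun_applies algebra_simps)

global_interpretation fs2: vector_space_pair
  "fscale :: 'k::field \<Rightarrow> ('b \<Rightarrow> 'k) \<Rightarrow> 'b \<Rightarrow> 'k" "fscale :: 'k \<Rightarrow> ('c \<Rightarrow> 'k) \<Rightarrow> 'c \<Rightarrow> 'k" ..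

global_interpretation sc: vector_space "(*) :: 'k::field \<Rightarrow> 'k \<Rightarrow> 'k"
  by unfold_locales (auto simp: algebra_simps)

global_interpretation fsk: vector_space_pair
  "fscale :: 'k::field \<Rightarrow> ('b \<Rightarrow> 'k) \<Rightarrow> 'b \<Rightarrow> 'k" "(*) :: 'k \<Rightarrow> 'k \<Rightarrow> 'k" ..

abbreviation lin :: "(('b \<Rightarrow> 'k::field) \<Rightarrow> 'c \<Rightarrow> 'k) \<Rightarrow> bool" where
  "lin \<equiv> Vector_Spaces.linear fscale fscale"

abbreviation lfun :: "(('b \<Rightarrow> 'k::field) \<Rightarrow> 'k) \<Rightarrow> bool" where
  "lfun \<equiv> Vector_Spaces.linear fscale (*)"

lemma linI:
  assumes "\<And>x y. f (x + y) = f x + f y" "\<And>k x. f (fscale k x) = fscale k (f x)"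
  shows "lin f"
  using assms by (simp add: Vector_Spaces.linear_iff fs.vector_space_axioms)

lemma lfunI:
  assumes "\<And>x y. f (x + y) = f x + f y" "\<And>k x. f (fscale k x) = k * f x"
  shows "lfun f"
  using assms by (simp add: Vector_Spaces.linear_iff fs.vector_space_axioms sc.vector_space_axioms)

lemmas lin_add = fs2.linear_add
lemmas lin_scale = fs2.linear_scale
lemmas lin_diff = fs2.linear_diff
lemmas lin_0 = fs2.linear_0
lemmas lin_sum = fs2.linear_sum
lemmas lin_rules = lin_add lin_scale lin_diff lin_0 lin_sum

lemma lin_comp:
  assumes f: "lin f" and g: "lin g"
  shows "lin (\<lambda>x. f (g x))"
  by (rule linI) (simp_all add: lin_rules[OF f] lin_rules[OF g])

lemma lin_id [simp]: "lin (\<lambda>x. x)" "lin id"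
  by (auto intro: linI)

lemma lin_minus:
  assumes f: "lin f" and g: "lin g"
  shows "lin (\<lambda>x. f x - g x)"
  by (rule linI) (simp_all add: lin_rules[OF f] lin_rules[OF g] fs.scale_right_diff_distrib)

lemma lin_sum_fun:
  assumes "\<And>i. i \<in> A \<Longrightarrow> lin (f i)"
  shows "lin (\<lambda>x. \<Sum>i\<in>A. f i x)"
proof (rule linI)
  show "(\<Sum>i\<in>A. f i (x + y)) = (\<Sum>i\<in>A. f i x) + (\<Sum>i\<in>A. f i y)" for x y
    unfolding sum.distrib[symmetric] by (intro sum.cong refl lin_add assms)
  show "(\<Sum>i\<in>A. f i (fscale k x)) = fscale k (\<Sum>i\<in>A. f i x)" for k x
    unfolding fs.scale_sum_right by (intro sum.cong refl lin_scale assms)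
qed

lemma lin_zero: "lin (\<lambda>x. 0)"
  by (rule linI) auto

lemma lin_span_eq:
  assumes "lin f" "lin g" "\<And>x. x \<in> S \<Longrightarrow> f x = g x" "t \<in> fs.span S"
  shows "f t = g t"
  using fs2.linear_eq_on[OF assms(1,2,4)] assms(3) by blast

lemma lin_span_in:
  assumes f: "lin f" and S: "\<And>x. x \<in> S \<Longrightarrow> f x \<in> U" and U: "fs.subspace U" and t: "t \<in> fs.span S"
  shows "f t \<in> U"
  using t
proof (induction rule: fs.span_induct_alt)
  case base
  then show ?case using U by (simp add: lin_0[OF f] fs.subspace_0)
next
  case (step c x y)
  then show ?case using U S by (simp add: lin_add[OF f] lin_scale[OF f] fs.subspace_add fs.subspace_scale)
qed

text \<open>A left inverse of the inclusion is such a projection. Composing with it turns a map that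
  is linear on a subspace into a linear map of the whole type.\<close>

lemma projection_exists:
  assumes "fs.subspace X"
  obtains p :: "('b \<Rightarrow> 'k::field) \<Rightarrow> 'b \<Rightarrow> 'k" where "lin p" "\<And>x. p x \<in> X" "\<And>x. x \<in> X \<Longrightarrow> p x = x"
proof -
  obtain p :: "('b \<Rightarrow> 'k) \<Rightarrow> 'b \<Rightarrow> 'k" where "p ` UNIV \<subseteq> X" "lin p" "\<forall>x\<in>X. p x = x"
    using fs2.linear_exists_left_inverse_on[of "\<lambda>x. x" X] assms by (auto simp: inj_on_def)
  then show thesis using that[of p] by blast
qed

text \<open>The complementary projection. It rewrites membership in a subspace as an equation, so
  that principles for the equality of linear maps also prove membership.\<close>

lemma kernel_exists:
  assumes "fs.subspace X"
  obtains q :: "('b \<Rightarrow> 'k::field) \<Rightarrow> 'b \<Rightarrow> 'k" where "lin q" "\<And>x. q x = 0 \<longleftrightarrow> x \<in> X"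
proof -
  obtain p :: "('b \<Rightarrow> 'k) \<Rightarrow> 'b \<Rightarrow> 'k" where p: "lin p" "\<And>x. p x \<in> X" "\<And>x. x \<in> X \<Longrightarrow> p x = x"
    using projection_exists[OF assms] by blast
  show thesis
  proof (rule that[of "\<lambda>x. x - p x"])
    show "lin (\<lambda>x. x - p x)" using p by (intro lin_minus) auto
    show "x - p x = 0 \<longleftrightarrow> x \<in> X" for x using p by (metis eq_iff_diff_eq_0)
  qed
qed

section \<open>Linear and bilinear maps on subspaces\<close>

definition lin_on :: "('b \<Rightarrow> 'k::field) set \<Rightarrow> (('b \<Rightarrow> 'k) \<Rightarrow> 'c \<Rightarrow> 'k) \<Rightarrow> bool" where
  "lin_on X f \<longleftrightarrow> (\<forall>x\<in>X. \<forall>y\<in>X. f (x + y) = f x + f y) \<and> (\<forall>k. \<forall>x\<in>X. f (fscale k x) = fscale k (f x))"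

lemma lin_on_lin:
  assumes "lin f"
  shows "lin_on X f"
  by (simp add: lin_on_def lin_rules[OF assms])

lemma lin_on_cong: "lin_on X f \<Longrightarrow> fs.subspace X \<Longrightarrow> (\<And>x. x \<in> X \<Longrightarrow> f x = g x) \<Longrightarrow> lin_on X g"
  by (simp add: lin_on_def fs.subspace_add fs.subspace_scale)

text \<open>Braiding, comultiplication and bracket arrive as total functions with unspecified values
  outside their domains. Precomposing with a projection onto \<open>X\<close> makes them linear
  everywhere and keeps the values on \<open>X\<close>.\<close>

lemma lin_on_extend:
  assumes "lin_on X f" "fs.subspace X"
  obtains g where "lin g" "\<And>x. x \<in> X \<Longrightarrow> g x = f x"
proof -
  obtain p where p: "lin p" "\<And>x. p x \<in> X" "\<And>x. x \<in> X \<Longrightarrow> p x = x"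
    using projection_exists[OF assms(2)] by blast
  have "lin (\<lambda>x. f (p x))"
    using assms(1) p by (intro linI) (simp_all add: lin_on_def lin_rules[OF p(1)])
  then show thesis using p that[of "\<lambda>x. f (p x)"] by simp
qed

definition bil :: "('b \<Rightarrow> 'k::field) set \<Rightarrow> ('c \<Rightarrow> 'k) set \<Rightarrow> (('b \<Rightarrow> 'k) \<Rightarrow> ('c \<Rightarrow> 'k) \<Rightarrow> 'd \<Rightarrow> 'k) \<Rightarrow> bool" where
  "bil X Y h \<longleftrightarrow> (\<forall>x\<in>X. lin_on Y (h x)) \<and> (\<forall>y\<in>Y. lin_on X (\<lambda>x. h x y))"

lemma bil_subset: "bil X Y h \<Longrightarrow> X' \<subseteq> X \<Longrightarrow> Y' \<subseteq> Y \<Longrightarrow> bil X' Y' h"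
  unfolding bil_def lin_on_def by blast

lemma bil_flip: "bil X Y h \<Longrightarrow> bil Y X (\<lambda>y x. h x y)"
  unfolding bil_def by blast

lemma bil_comp:
  assumes "bil X Y h" and f: "lin f" and g: "lin g" and "f ` X' \<subseteq> X" "g ` Y' \<subseteq> Y"
  shows "bil X' Y' (\<lambda>x y. h (f x) (g y))"
  using assms(1,4,5) unfolding bil_def lin_on_def
  by (simp add: lin_rules[OF f] lin_rules[OF g] image_subset_iff)

lemma bil_lin: assumes "bil X Y h" and f: "lin f"
  shows "bil X Y (\<lambda>x y. f (h x y))"
  using assms(1) unfolding bil_def lin_on_def by (simp add: lin_rules[OF f])

text \<open>One variable at a time: with the other one fixed, both maps are replaced by linear
  extensions, which are then compared on a spanning set.\<close>

lemma bil_eq: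
  assumes bil: "bil X Y h" "bil X Y h'" and S: "S \<subseteq> X" "R \<subseteq> Y" "fs.subspace X" "fs.subspace Y"
    and eq: "\<And>x y. x \<in> S \<Longrightarrow> y \<in> R \<Longrightarrow> h x y = h' x y"
    and xy: "x \<in> fs.span S" "y \<in> fs.span R"
  shows "h x y = h' x y"
proof -
  have X: "fs.span S \<subseteq> X" and Y: "fs.span R \<subseteq> Y" using S by (simp_all add: fs.span_minimal)
  have *: "h x y = h' x y" if "x \<in> S" for x
  proof -
    have x: "x \<in> X" using that S by auto
    obtain g where g: "lin g" "\<And>y. y \<in> Y \<Longrightarrow> g y = h x y"
      using lin_on_extend[of Y "h x"] bil S x unfolding bil_def by blast
    obtain g' where g': "lin g'" "\<And>y. y \<in> Y \<Longrightarrow> g' y = h' x y"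
      using lin_on_extend[of Y "h' x"] bil S x unfolding bil_def by blast
    show ?thesis using lin_span_eq[OF g(1) g'(1) _ xy(2)] g g' eq that S xy Y by (metis subsetD)
  qed
  have y: "y \<in> Y" using xy Y by auto
  obtain g where g: "lin g" "\<And>x. x \<in> X \<Longrightarrow> g x = h x y"
    using lin_on_extend[of X "\<lambda>x. h x y"] bil S y unfolding bil_def by blast
  obtain g' where g': "lin g'" "\<And>x. x \<in> X \<Longrightarrow> g' x = h' x y"
    using lin_on_extend[of X "\<lambda>x. h' x y"] bil S y unfolding bil_def by blast
  show ?thesis using lin_span_eq[OF g(1) g'(1) _ xy(1)] g g' * S xy X by (metis subsetD)
qed

lemma bil_span_in:
  assumes bil: "bil X Y h" and S: "S \<subseteq> X" "R \<subseteq> Y" "fs.subspace X" "fs.subspace Y"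
    and U: "fs.subspace U" and mem: "\<And>x y. x \<in> S \<Longrightarrow> y \<in> R \<Longrightarrow> h x y \<in> U"
    and xy: "x \<in> fs.span S" "y \<in> fs.span R"
  shows "h x y \<in> U"
proof -
  have X: "fs.span S \<subseteq> X" and Y: "fs.span R \<subseteq> Y" using S by (simp_all add: fs.span_minimal)
  have *: "h x y \<in> U" if "x \<in> S" for x
  proof -
    have x: "x \<in> X" using that S by auto
    obtain g where g: "lin g" "\<And>y. y \<in> Y \<Longrightarrow> g y = h x y"
      using lin_on_extend[of Y "h x"] bil S x unfolding bil_def by blast
    show ?thesis using lin_span_in[OF g(1) _ U xy(2)] g mem that S xy Y by (metis subsetD)
  qed
  have y: "y \<in> Y" using xy Y by auto
  obtain g where g: "lin g" "\<And>x. x \<in> X \<Longrightarrow> g x = h x y"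
    using lin_on_extend[of X "\<lambda>x. h x y"] bil S y unfolding bil_def by blast
  show ?thesis using lin_span_in[OF g(1) _ U xy(1)] g * S xy X by (metis subsetD)
qed

text \<open>Every left factor is expanded in a basis of \<open>X\<close>, and the terms with the
  same basis vector are collected. Independence of \<open>F\<close> makes it possible to read off
  each \<open>y e\<close> later with a linear form dual to \<open>e\<close>.\<close>

lemma bil_decomp:
  assumes bil: "bil X Y \<mu>" and X: "fs.subspace X" and Y: "fs.subspace Y"
    and t: "t \<in> fs.span {\<mu> x y | x y. x \<in> X \<and> y \<in> Y}"
  obtains F y where "finite F" "F \<subseteq> X" "fs.independent F" "y ` F \<subseteq> Y" "t = (\<Sum>e\<in>F. \<mu> e (y e))"
proof -
  obtain B where B: "B \<subseteq> X" "fs.independent B" "X \<subseteq> fs.span B"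
    using fs.maximal_independent_subset[of X] by blast
  have mx: "\<mu> (\<Sum>e\<in>F. fscale (r e) e) y = (\<Sum>e\<in>F. \<mu> e (fscale (r e) y))"
    if "finite F" "F \<subseteq> X" "y \<in> Y" for F r y
    using that
  proof (induction rule: finite_induct)
    case empty
    have "\<mu> (fscale 0 0) y = fscale 0 (\<mu> 0 y)"
      using bil X empty unfolding bil_def lin_on_def by (metis fs.subspace_0)
    then have "\<mu> 0 y = 0" unfolding fs.scale_zero_left .
    then show ?case by simp
  next
    case (insert a F)
    then have "(\<Sum>e\<in>F. fscale (r e) e) \<in> X" "fscale (r a) a \<in> X"
      using X by (auto intro!: fs.subspace_sum fs.subspace_scale)
    then have "\<mu> (fscale (r a) a + (\<Sum>e\<in>F. fscale (r e) e)) y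
        = \<mu> a (fscale (r a) y) + \<mu> (\<Sum>e\<in>F. fscale (r e) e) y"
      using bil insert unfolding bil_def lin_on_def by auto
    then show ?case using insert by simp
  qed
  have "\<exists>F y. finite F \<and> F \<subseteq> B \<and> y ` F \<subseteq> Y \<and> t = (\<Sum>e\<in>F. \<mu> e (y e))"
    using t
  proof (induction rule: fs.span_induct_alt)
    case base
    then show ?case by (intro exI[of _ "{}"]) auto
  next
    case (step c z t)
    obtain x y where z: "z = \<mu> x y" "x \<in> X" "y \<in> Y" using step by blast
    obtain F y' where F: "finite F" "F \<subseteq> B" "y' ` F \<subseteq> Y" "t = (\<Sum>e\<in>F. \<mu> e (y' e))"
      using step by blast
    have "x \<in> fs.span B" using B z by auto
    then obtain G r where G: "finite G" "G \<subseteq> B" "x = (\<Sum>e\<in>G. fscale (r e) e)"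
      unfolding fs.span_explicit by blast
    \<comment> \<open>The new right factor of a basis vector: its old one plus the contribution of
      the added term, with zero where the vector is missing from one of the two expansions.\<close>
    define y2 where "y2 e = (if e \<in> F then y' e else 0) + (if e \<in> G then fscale (c * r e) y else 0)"
        for e
    have \<mu>0: "\<mu> e 0 = 0" if "e \<in> X" for e
      using bil that Y unfolding bil_def lin_on_def
      by (metis fs.subspace_0 fs.scale_zero_left)
    have FG: "F \<subseteq> X" "G \<subseteq> X" using F G B by auto
    have y2Y: "y2 ` (F \<union> G) \<subseteq> Y"
      using F z Y by (auto simp: y2_def image_subset_iff intro!: fs.subspace_add fs.subspace_scale fs.subspace_0)
    have "fscale c z = fscale c (\<Sum>e\<in>G. \<mu> e (fscale (r e) y))"
      using mx[OF G(1) FG(2) z(3)] G z by simp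
    also have "\<dots> = (\<Sum>e\<in>G. \<mu> e (fscale (c * r e) y))"
      unfolding fs.scale_sum_right
    proof (rule sum.cong[OF refl])
      fix e assume "e \<in> G"
      then have "fscale c (\<mu> e (fscale (r e) y)) = \<mu> e (fscale c (fscale (r e) y))"
        using bil z FG Y unfolding bil_def lin_on_def by (metis fs.subspace_scale subsetD)
      then show "fscale c (\<mu> e (fscale (r e) y)) = \<mu> e (fscale (c * r e) y)" by simp
    qed
    also have "\<dots> = (\<Sum>e\<in>F \<union> G. \<mu> e (if e \<in> G then fscale (c * r e) y else 0))"
      using \<mu>0 F G FG by (intro sum.mono_neutral_cong_left) auto
    finally have 1: "fscale c z = (\<Sum>e\<in>F \<union> G. \<mu> e (if e \<in> G then fscale (c * r e) y else 0))" .
    have 2: "t = (\<Sum>e\<in>F \<union> G. \<mu> e (if e \<in> F then y' e else 0))"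
      unfolding F(4) using \<mu>0 F G FG by (intro sum.mono_neutral_cong_left) auto
    have "fscale c z + t = (\<Sum>e\<in>F \<union> G. \<mu> e (y2 e))"
      unfolding 1 2 sum.distrib[symmetric]
    proof (rule sum.cong[OF refl])
      fix e assume e: "e \<in> F \<union> G"
      then have "(if e \<in> G then fscale (c * r e) y else 0) \<in> Y" "(if e \<in> F then y' e else 0) \<in> Y" "e \<in> X"
        using F z Y FG by (auto intro!: fs.subspace_scale fs.subspace_0)
      then show "\<mu> e (if e \<in> G then fscale (c * r e) y else 0) + \<mu> e (if e \<in> F then y' e else 0)
          = \<mu> e (y2 e)"
        using bil unfolding bil_def lin_on_def y2_def by (simp add: add.commute)
    qed
    then show ?case using F G y2Y by (intro exI[of _ "F \<union> G"] exI[of _ y2]) auto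
  qed
  then obtain F y where F: "finite F" "F \<subseteq> B" "y ` F \<subseteq> Y" "t = (\<Sum>e\<in>F. \<mu> e (y e))" by blast
  show thesis by (rule that[OF F(1) _ _ F(3,4)]) (use F B fs.independent_mono in blast)+
qed

lemma dual_exists:
  assumes "fs.independent F"
  obtains f where "\<And>e. lfun (f e)" "\<And>e d. e \<in> F \<Longrightarrow> d \<in> F \<Longrightarrow> f e d = (if d = e then 1 else 0)"
proof -
  have "\<exists>g. lfun g \<and> (\<forall>d\<in>F. g d = (if d = e then 1 else 0))" for e
    using fsk.linear_independent_extend[OF assms, of "\<lambda>d. if d = e then 1 else 0"] by blast
  then show thesis using that by metis
qed

section \<open>Records with pointwise operations, spans and linear extensions\<close>

definition fsp :: "('k::field, 'b \<Rightarrow> 'k, 'm) module_scheme \<Rightarrow> bool" where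
  "fsp M \<longleftrightarrow> \<zero>\<^bsub>M\<^esub> = 0 \<and> add M = (+) \<and> smult M = fscale"

lemma fsp_T: "fsp (\<T> M)"
  by (auto simp: fsp_def tensor_algebra_def fun_eq_iff fun_applies)

lemma T_simps [simp]:
  "\<zero>\<^bsub>\<T> M\<^esub> = 0" "x \<oplus>\<^bsub>\<T> M\<^esub> y = x + y" "k \<odot>\<^bsub>\<T> M\<^esub> x = fscale k x" "\<one>\<^bsub>\<T> M\<^esub> = tens M []"
  by (auto simp: tensor_algebra_def fun_eq_iff fun_applies)

lemma lincomb_fsp: "fsp M \<Longrightarrow> lincomb M ps = (\<Sum>(k, x)\<leftarrow>ps. fscale k x)"
  by (induction ps) (auto simp: lincomb_def fsp_def)

lemma lincomb_T [simp]: "lincomb (\<T> M) ps = (\<Sum>(k, x)\<leftarrow>ps. fscale k x)"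
  by (simp add: lincomb_fsp fsp_T)

lemma span_lists: "fs.span S = {\<Sum>(k, x)\<leftarrow>ps. fscale k x | ps. snd ` set ps \<subseteq> S}"
proof (rule equalityI; rule subsetI)
  fix t assume "t \<in> fs.span S"
  then show "t \<in> {\<Sum>(k, x)\<leftarrow>ps. fscale k x | ps. snd ` set ps \<subseteq> S}"
  proof (induction rule: fs.span_induct_alt)
    case base
    show ?case by (intro CollectI exI[of _ "[]"]) auto
  next
    case (step c x y)
    then obtain ps where "y = (\<Sum>(k, x)\<leftarrow>ps. fscale k x)" "snd ` set ps \<subseteq> S" by blast
    with step show ?case by (intro CollectI exI[of _ "(c,x)#ps"]) auto
  qed
next
  fix t assume "t \<in> {\<Sum>(k, x)\<leftarrow>ps. fscale k x | ps. snd ` set ps \<subseteq> S}"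
  then obtain ps where t: "t = (\<Sum>(k, x)\<leftarrow>ps. fscale k x)" "snd ` set ps \<subseteq> S" by blast
  have "snd ` set ps \<subseteq> S \<Longrightarrow> (\<Sum>(k, x)\<leftarrow>ps. fscale k x) \<in> fs.span S"
    by (induction ps) (auto intro!: fs.span_zero fs.span_add fs.span_scale intro: fs.span_base)
  then show "t \<in> fs.span S" using t by simp
qed

lemma lspan_T [simp]: "lspan (\<T> M) S = fs.span S"
  by (simp add: lspan_def span_lists)

text \<open>\<open>lin_ext\<close> is a definite description, so its value has to be shown unique:
  every presentation of \<open>t\<close> by a list yields \<open>g t\<close>, which depends on
  \<open>t\<close> alone. The target record is arbitrary, because the canonical map onto the Nichols
  algebra takes its values in cosets.\<close>

lemma lin_ext_eqI:
  assumes M: "fsp M" and t: "t \<in> fs.span (p ` I)"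
    and *: "\<And>ps. snd ` set ps \<subseteq> I \<Longrightarrow> lincomb N (map (apsnd h) ps) = g (lincomb M (map (apsnd p) ps))"
  shows "lin_ext M N I p h t = g t"
proof -
  obtain qs where qs: "t = (\<Sum>(k, x)\<leftarrow>qs. fscale k x)" "snd ` set qs \<subseteq> p ` I"
    using t unfolding span_lists by blast
  have "\<exists>ps. snd ` set ps \<subseteq> I \<and> qs = map (apsnd p) ps"
    using qs(2)
  proof (induction qs)
    case (Cons a qs)
    then obtain ps where "snd ` set ps \<subseteq> I" "qs = map (apsnd p) ps" by auto
    moreover obtain k i where "a = (k, p i)" "i \<in> I" using Cons by (cases a) auto
    ultimately show ?case by (intro exI[of _ "(k,i)#ps"]) auto
  qed auto
  then obtain ps where ps: "snd ` set ps \<subseteq> I" "qs = map (apsnd p) ps" by blast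
  have t: "t = lincomb M (map (apsnd p) ps)" using qs ps M by (simp add: lincomb_fsp)
  show ?thesis unfolding lin_ext_def
  proof (rule the_equality)
    show "\<exists>ps. snd ` set ps \<subseteq> I \<and> t = lincomb M (map (apsnd p) ps) \<and> g t = lincomb N (map (apsnd h) ps)"
      using ps t * by metis
  qed (use * in metis)
qed

lemma lin_ext_eq:
  assumes "fsp M" "fsp N" "lin g" "\<And>i. i \<in> I \<Longrightarrow> g (p i) = h i" "t \<in> fs.span (p ` I)"
  shows "lin_ext M N I p h t = g t"
proof (rule lin_ext_eqI[OF assms(1,5)])
  show "lincomb N (map (apsnd h) ps) = g (lincomb M (map (apsnd p) ps))" if "snd ` set ps \<subseteq> I" for ps
    using that assms(1-4) by (induction ps) (auto simp: lincomb_fsp lin_rules)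
qed

lemmas lin_ext_T = lin_ext_eq[OF fsp_T fsp_T]

section \<open>Tensor algebras\<close>

lemma ml_curry:
  assumes "multilinear_form M \<phi>" "u \<in> lists (carrier M)"
  shows "multilinear_form M (\<lambda>w. \<phi> (u @ w))" "multilinear_form M (\<lambda>w. \<phi> (w @ u))"
proof -
  show "multilinear_form M (\<lambda>w. \<phi> (u @ w))"
    unfolding multilinear_form_def
  proof (intro ballI allI)
    fix us ws x y k assume "us \<in> lists (carrier M)" "ws \<in> lists (carrier M)" "x \<in> carrier M"
        "y \<in> carrier M"
    then show "\<phi> (u @ us @ [x \<oplus>\<^bsub>M\<^esub> y] @ ws) = \<phi> (u @ us @ [x] @ ws) + \<phi> (u @ us @ [y] @ ws) \<and>
       \<phi> (u @ us @ [k \<odot>\<^bsub>M\<^esub> x] @ ws) = k * \<phi> (u @ us @ [x] @ ws)"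
      using assms(1)[unfolded multilinear_form_def, rule_format, of "u @ us" ws x y k] assms(2) by simp
  qed
  show "multilinear_form M (\<lambda>w. \<phi> (w @ u))"
    unfolding multilinear_form_def
  proof (intro ballI allI)
    fix us ws x y k assume "us \<in> lists (carrier M)" "ws \<in> lists (carrier M)" "x \<in> carrier M"
        "y \<in> carrier M"
    then show "\<phi> ((us @ [x \<oplus>\<^bsub>M\<^esub> y] @ ws) @ u) = \<phi> ((us @ [x] @ ws) @ u) + \<phi> ((us @ [y] @ ws) @ u) \<and>
       \<phi> ((us @ [k \<odot>\<^bsub>M\<^esub> x] @ ws) @ u) = k * \<phi> ((us @ [x] @ ws) @ u)"
      using assms(1)[unfolded multilinear_form_def, rule_format, of us "ws @ u" x y k] assms(2) by simp
  qed
qed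

lemma ml_add: "multilinear_form M \<phi> \<Longrightarrow> multilinear_form M \<psi> \<Longrightarrow> multilinear_form M (\<lambda>w. \<phi> w + \<psi> w)"
  unfolding multilinear_form_def by (simp add: distrib_left add.assoc add.left_commute)

lemma ml_scale: "multilinear_form M \<phi> \<Longrightarrow> multilinear_form M (\<lambda>w. k * \<phi> w)"
  unfolding multilinear_form_def by (simp add: distrib_left mult.left_commute)

lemma carrier_T: "carrier (\<T> M) = fs.span (tens M ` lists (carrier M))"
proof -
  have *: "(\<lambda>\<phi>. \<Sum>(k, w)\<leftarrow>ps. k * tens M w \<phi>) = (\<Sum>(k, x)\<leftarrow>map (apsnd (tens M)) ps. fscale k x)" for ps
    by (induction ps) (auto simp: fun_eq_iff fun_applies)
  show ?thesis
  proof (rule equalityI; rule subsetI)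
    fix x assume "x \<in> carrier (\<T> M)"
    then obtain ps where "x = (\<Sum>(k, x)\<leftarrow>map (apsnd (tens M)) ps. fscale k x)"
        "snd ` set ps \<subseteq> lists (carrier M)"
      unfolding tensor_algebra_def partial_object.select_convs * by blast
    then show "x \<in> fs.span (tens M ` lists (carrier M))"
      unfolding span_lists by (intro CollectI exI[of _ "map (apsnd (tens M)) ps"]) force
  next
    fix x assume "x \<in> fs.span (tens M ` lists (carrier M))"
    then show "x \<in> carrier (\<T> M)"
    proof (induction rule: fs.span_induct_alt)
      case base
      show ?case unfolding tensor_algebra_def partial_object.select_convs *
        by (intro CollectI exI[of _ "[]"]) auto
    next
      case (step c x y)
      then obtain ps w where "y = (\<Sum>(k, x)\<leftarrow>map (apsnd (tens M)) ps. fscale k x)"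
          "snd ` set ps \<subseteq> lists (carrier M)"
        "x = tens M w" "w \<in> lists (carrier M)"
        unfolding tensor_algebra_def partial_object.select_convs * by blast
      then show ?case unfolding tensor_algebra_def partial_object.select_convs *
        by (intro CollectI exI[of _ "(c, w) # ps"]) auto
    qed
  qed
qed

lemma subspace_T [simp]: "fs.subspace (carrier (\<T> M))"
  by (simp add: carrier_T)

lemma tens_in_T: "w \<in> lists (carrier M) \<Longrightarrow> tens M w \<in> carrier (\<T> M)"
  by (simp add: carrier_T fs.span_base)

lemma T_add: "x \<in> carrier (\<T> M) \<Longrightarrow> \<phi> = (\<lambda>w. \<phi>1 w + \<phi>2 w) \<Longrightarrow> multilinear_form M \<phi>1 \<Longrightarrow>
    multilinear_form M \<phi>2 \<Longrightarrow> x \<phi> = x \<phi>1 + x \<phi>2"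
  unfolding carrier_T by (induction rule: fs.span_induct_alt) (auto simp: fun_applies tens_def ml_add algebra_simps)

lemma T_scale: "x \<in> carrier (\<T> M) \<Longrightarrow> multilinear_form M \<phi> \<Longrightarrow> x (\<lambda>w. k * \<phi> w) = k * x \<phi>"
  unfolding carrier_T by (induction rule: fs.span_induct_alt) (auto simp: fun_applies tens_def
      ml_scale distrib_left mult.left_commute)

lemma T_not_ml: "x \<in> carrier (\<T> M) \<Longrightarrow> \<not> multilinear_form M \<phi> \<Longrightarrow> x \<phi> = 0"
  unfolding carrier_T by (induction rule: fs.span_induct_alt) (auto simp: fun_applies tens_def)

text \<open>Elements of the tensor algebra are combinations of evaluations at words over the
  carrier, so the values of a form at other words do not count. This matters for records whose
  carrier is smaller than the type.\<close>

lemma T_cong_words: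
  "x \<in> carrier (\<T> M) \<Longrightarrow> multilinear_form M \<phi> \<Longrightarrow> multilinear_form M \<psi> \<Longrightarrow>
    (\<And>w. w \<in> lists (carrier M) \<Longrightarrow> \<phi> w = \<psi> w) \<Longrightarrow> x \<phi> = x \<psi>"
  unfolding carrier_T by (induction rule: fs.span_induct_alt) (auto simp: fun_applies tens_def, metis in_listsI)

text \<open>In the test of multilinearity a letter is replaced by a sum or a multiple of letters;
  closure keeps the new word over the carrier, where forms are controlled.\<close>

definition mclosed :: "('k, 'a) module \<Rightarrow> bool" where
  "mclosed M \<longleftrightarrow> (\<forall>x\<in>carrier M. \<forall>y\<in>carrier M. x \<oplus>\<^bsub>M\<^esub> y \<in> carrier M) \<and> (\<forall>k. \<forall>x\<in>carrier M. k \<odot>\<^bsub>M\<^esub> x \<in> carrier M)"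

lemma mclosed_T [simp]: "mclosed (\<T> M)"
  by (auto simp: mclosed_def intro: fs.subspace_add fs.subspace_scale)

text \<open>Evaluating \<open>y\<close> on the tail of a word leaves a multilinear form in its head,
  to which another tensor can be applied. The product in the record is built from exactly this
  double evaluation.\<close>

lemma ml_partial:
  assumes M: "mclosed M" and y: "y \<in> carrier (\<T> M)" and \<phi>: "multilinear_form M \<phi>"
  shows "multilinear_form M (\<lambda>u. y (\<lambda>w. \<phi> (u @ w)))"
  unfolding multilinear_form_def
proof (intro ballI allI conjI)
  fix us ws x y' k assume *: "us \<in> lists (carrier M)" "ws \<in> lists (carrier M)" "x \<in> carrier M"
      "y' \<in> carrier M"
  have cl: "x \<oplus>\<^bsub>M\<^esub> y' \<in> carrier M" "k \<odot>\<^bsub>M\<^esub> x \<in> carrier M" using M * by (auto simp: mclosed_def)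
  have m: "\<phi> ((us @ [x \<oplus>\<^bsub>M\<^esub> y'] @ ws) @ w) = \<phi> ((us @ [x] @ ws) @ w) + \<phi> ((us @ [y'] @ ws) @ w)
     \<and> \<phi> ((us @ [k \<odot>\<^bsub>M\<^esub> x] @ ws) @ w) = k * \<phi> ((us @ [x] @ ws) @ w)" if "w \<in> lists (carrier M)" for w
    using \<phi>[unfolded multilinear_form_def, rule_format, of us "ws @ w" x y' k] * that by simp
  have "y (\<lambda>w. \<phi> ((us @ [x \<oplus>\<^bsub>M\<^esub> y'] @ ws) @ w))
      = y (\<lambda>w. \<phi> ((us @ [x] @ ws) @ w) + \<phi> ((us @ [y'] @ ws) @ w))"
    using * cl m by (intro T_cong_words[OF y] ml_add ml_curry \<phi>) auto
  also have "\<dots> = y (\<lambda>w. \<phi> ((us @ [x] @ ws) @ w)) + y (\<lambda>w. \<phi> ((us @ [y'] @ ws) @ w))"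
    using * by (intro T_add[OF y refl] ml_curry \<phi>) auto
  finally show "y (\<lambda>w. \<phi> ((us @ [x \<oplus>\<^bsub>M\<^esub> y'] @ ws) @ w))
      = y (\<lambda>w. \<phi> ((us @ [x] @ ws) @ w)) + y (\<lambda>w. \<phi> ((us @ [y'] @ ws) @ w))" .
  have "y (\<lambda>w. \<phi> ((us @ [k \<odot>\<^bsub>M\<^esub> x] @ ws) @ w)) = y (\<lambda>w. k * \<phi> ((us @ [x] @ ws) @ w))"
    using * cl m by (intro T_cong_words[OF y] ml_scale ml_curry \<phi>) auto
  also have "\<dots> = k * y (\<lambda>w. \<phi> ((us @ [x] @ ws) @ w))"
    using * by (intro T_scale[OF y] ml_curry \<phi>) auto
  finally show "y (\<lambda>w. \<phi> ((us @ [k \<odot>\<^bsub>M\<^esub> x] @ ws) @ w)) = k * y (\<lambda>w. \<phi> ((us @ [x] @ ws) @ w))" .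
qed

lemma mult_T_apply:
  "(x \<otimes>\<^bsub>\<T> M\<^esub> y) \<phi> = (if multilinear_form M \<phi> then x (\<lambda>u. y (\<lambda>w. \<phi> (u @ w))) else 0)"
  by (simp add: tensor_algebra_def)

lemma mult_T_left: "(x + x') \<otimes>\<^bsub>\<T> M\<^esub> y = x \<otimes>\<^bsub>\<T> M\<^esub> y + x' \<otimes>\<^bsub>\<T> M\<^esub> y" "fscale k x \<otimes>\<^bsub>\<T> M\<^esub> y
    = fscale k (x \<otimes>\<^bsub>\<T> M\<^esub> y)"
  "0 \<otimes>\<^bsub>\<T> M\<^esub> y = 0"
  by (auto simp: fun_eq_iff mult_T_apply fun_applies)

lemma tens_mult_T:
  assumes "mclosed M" "u \<in> lists (carrier M)" "y \<in> carrier (\<T> M)"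
  shows "tens M u \<otimes>\<^bsub>\<T> M\<^esub> y = (\<lambda>\<phi>. if multilinear_form M \<phi> then y (\<lambda>w. \<phi> (u @ w)) else 0)"
  using ml_partial[OF assms(1,3)] by (simp add: fun_eq_iff mult_T_apply tens_def)

text \<open>The product evaluates \<open>x\<close> outermost, so linearity in \<open>x\<close> is
  pointwise. Linearity in \<open>y\<close> instead uses that \<open>x\<close> is a combination of
  pure tensors, for which the product is a plain evaluation of \<open>y\<close>.\<close>

lemma mult_T_right:
  assumes M: "mclosed M" and x: "x \<in> carrier (\<T> M)" and y: "y \<in> carrier (\<T> M)" "y' \<in> carrier (\<T> M)"
  shows "x \<otimes>\<^bsub>\<T> M\<^esub> (y + y') = x \<otimes>\<^bsub>\<T> M\<^esub> y + x \<otimes>\<^bsub>\<T> M\<^esub> y'"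
    and "x \<otimes>\<^bsub>\<T> M\<^esub> fscale k y = fscale k (x \<otimes>\<^bsub>\<T> M\<^esub> y)"
proof -
  have [simp]: "y + y' \<in> carrier (\<T> M)" "fscale k y \<in> carrier (\<T> M)"
    using y by (simp_all add: fs.subspace_add fs.subspace_scale)
  note [simp] = tens_mult_T[OF M] y
  show "x \<otimes>\<^bsub>\<T> M\<^esub> (y + y') = x \<otimes>\<^bsub>\<T> M\<^esub> y + x \<otimes>\<^bsub>\<T> M\<^esub> y'"
    using x unfolding carrier_T
  proof (induction rule: fs.span_induct_alt)
    case base show ?case by (simp add: mult_T_left)
  next
    case (step c w x)
    then obtain u where u: "u \<in> lists (carrier M)" "w = tens M u" by auto
    have "w \<otimes>\<^bsub>\<T> M\<^esub> (y + y') = w \<otimes>\<^bsub>\<T> M\<^esub> y + w \<otimes>\<^bsub>\<T> M\<^esub> y'" using u(1) unfolding u(2)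
        by (simp add: fun_eq_iff fun_applies)
    then show ?case using step by (simp add: mult_T_left fs.scale_right_distrib)
  qed
  show "x \<otimes>\<^bsub>\<T> M\<^esub> fscale k y = fscale k (x \<otimes>\<^bsub>\<T> M\<^esub> y)"
    using x unfolding carrier_T
  proof (induction rule: fs.span_induct_alt)
    case base show ?case by (simp add: mult_T_left)
  next
    case (step c w x)
    then obtain u where u: "u \<in> lists (carrier M)" "w = tens M u" by auto
    have "w \<otimes>\<^bsub>\<T> M\<^esub> fscale k y = fscale k (w \<otimes>\<^bsub>\<T> M\<^esub> y)" using u(1) unfolding u(2)
        by (simp add: fun_eq_iff fun_applies)
    then show ?case using step by (simp add: mult_T_left fs.scale_right_distrib fs.scale_left_commute mult.commute)
  qed
qed

lemma mult_T_scale: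
  "mclosed M \<Longrightarrow> x \<in> carrier (\<T> M) \<Longrightarrow> y \<in> carrier (\<T> M) \<Longrightarrow>
    x \<otimes>\<^bsub>\<T> M\<^esub> fscale k y = fscale k (x \<otimes>\<^bsub>\<T> M\<^esub> y)"
  by (rule mult_T_right(2))

lemma mult_T_bil: "mclosed M \<Longrightarrow> bil (carrier (\<T> M)) (carrier (\<T> M)) (\<lambda>x y. x \<otimes>\<^bsub>\<T> M\<^esub> y)"
  by (simp add: bil_def lin_on_def mult_T_left mult_T_right(1) mult_T_scale)

lemma tens_append:
  assumes "mclosed M" "u \<in> lists (carrier M)" "w \<in> lists (carrier M)"
  shows "tens M u \<otimes>\<^bsub>\<T> M\<^esub> tens M w = tens M (u @ w)"
  using ml_curry(1)[OF _ assms(2)] by (simp add: tens_mult_T assms tens_in_T) (auto simp: tens_def)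

lemma tens_append_set [simp]:
  "mclosed M \<Longrightarrow> \<forall>x\<in>set u. x \<in> carrier M \<Longrightarrow> \<forall>x\<in>set w. x \<in> carrier M \<Longrightarrow>
    tens M u \<otimes>\<^bsub>\<T> M\<^esub> tens M w = tens M (u @ w)"
  by (rule tens_append) auto

lemma span_mult_in:
  assumes M: "mclosed M" and S: "S \<subseteq> carrier (\<T> M)" "R \<subseteq> carrier (\<T> M)"
    and U: "fs.subspace U" and m: "\<And>x y. x \<in> S \<Longrightarrow> y \<in> R \<Longrightarrow> x \<otimes>\<^bsub>\<T> M\<^esub> y \<in> U"
    and xy: "x \<in> fs.span S" "y \<in> fs.span R"
  shows "x \<otimes>\<^bsub>\<T> M\<^esub> y \<in> U"
  by (rule bil_span_in[OF mult_T_bil[OF M] S _ _ U m xy]) auto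

lemma mult_T_closed:
  assumes M: "mclosed M" and "x \<in> carrier (\<T> M)" "y \<in> carrier (\<T> M)"
  shows "x \<otimes>\<^bsub>\<T> M\<^esub> y \<in> carrier (\<T> M)"
  by (rule span_mult_in[OF M, of "tens M ` lists (carrier M)" "tens M ` lists (carrier M)"])
    (use assms in \<open>auto simp: carrier_T intro!: fs.span_base imageI\<close>)

lemma mult_T_assoc:
  assumes M: "mclosed M" and x: "x \<in> carrier (\<T> M)" and y: "y \<in> carrier (\<T> M)" and z: "z \<in> carrier (\<T> M)"
  shows "(x \<otimes>\<^bsub>\<T> M\<^esub> y) \<otimes>\<^bsub>\<T> M\<^esub> z = x \<otimes>\<^bsub>\<T> M\<^esub> (y \<otimes>\<^bsub>\<T> M\<^esub> z)"
proof
  fix \<phi>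
  show "((x \<otimes>\<^bsub>\<T> M\<^esub> y) \<otimes>\<^bsub>\<T> M\<^esub> z) \<phi> = (x \<otimes>\<^bsub>\<T> M\<^esub> (y \<otimes>\<^bsub>\<T> M\<^esub> z)) \<phi>"
  proof (cases "multilinear_form M \<phi>")
    case True
    note mz = ml_partial[OF M z True]
    have "x (\<lambda>u. y (\<lambda>w. z (\<lambda>w'. \<phi> ((u @ w) @ w')))) = x (\<lambda>u. (y \<otimes>\<^bsub>\<T> M\<^esub> z) (\<lambda>w. \<phi> (u @ w)))"
    proof (rule T_cong_words[OF x])
      show "multilinear_form M (\<lambda>u. y (\<lambda>w. z (\<lambda>w'. \<phi> ((u @ w) @ w'))))"
        by (rule ml_partial[OF M y mz])
      show "multilinear_form M (\<lambda>u. (y \<otimes>\<^bsub>\<T> M\<^esub> z) (\<lambda>w. \<phi> (u @ w)))"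
        by (rule ml_partial[OF M mult_T_closed[OF M y z] True])
    next
      fix u assume "u \<in> lists (carrier M)"
      then show "y (\<lambda>w. z (\<lambda>w'. \<phi> ((u @ w) @ w'))) = (y \<otimes>\<^bsub>\<T> M\<^esub> z) (\<lambda>w. \<phi> (u @ w))"
        using ml_curry(1)[OF True] by (simp add: mult_T_apply)
    qed
    then show ?thesis using True mz by (simp add: mult_T_apply)
  qed (simp add: mult_T_apply)
qed

lemma mult_T_one:
  assumes M: "mclosed M" and x: "x \<in> carrier (\<T> M)"
  shows "tens M [] \<otimes>\<^bsub>\<T> M\<^esub> x = x" "x \<otimes>\<^bsub>\<T> M\<^esub> tens M [] = x"
proof -
  show "tens M [] \<otimes>\<^bsub>\<T> M\<^esub> x = x"
    using T_not_ml[OF x] by (simp add: tens_mult_T[OF M _ x] fun_eq_iff)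
  have e: "multilinear_form M \<phi> \<Longrightarrow> multilinear_form M (\<lambda>w. \<phi> (u @ w)) \<or> u \<notin> lists (carrier M)" for \<phi> u
    using ml_curry by blast
  show "x \<otimes>\<^bsub>\<T> M\<^esub> tens M [] = x"
    using x unfolding carrier_T
    by (induction rule: fs.span_induct_alt) (auto simp: mult_T_left M)
qed

lemma ring_T:
  assumes M: "mclosed M"
  shows "ring (\<T> M)"
proof (rule ringI)
  show "abelian_group (\<T> M)"
    by (rule abelian_groupI)
      (auto simp: fs.subspace_add fs.subspace_0 add.assoc add.commute intro!: bexI[of _
          "- _"] fs.subspace_neg)
  show "Group.monoid (\<T> M)"
    by (rule monoidI) (auto simp: mult_T_closed mult_T_assoc mult_T_one M tens_in_T)
qed (auto simp: mult_T_left mult_T_right(1) M)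

lemma minus_T: "mclosed M \<Longrightarrow> x \<in> carrier (\<T> M) \<Longrightarrow> y \<in> carrier (\<T> M) \<Longrightarrow> x \<ominus>\<^bsub>\<T> M\<^esub> y = x - y"
proof -
  assume M: "mclosed M" and x: "x \<in> carrier (\<T> M)" and y: "y \<in> carrier (\<T> M)"
  interpret ring "\<T> M" by (rule ring_T[OF M])
  have "\<ominus>\<^bsub>\<T> M\<^esub> y = - y" by (rule minus_equality) (use y in \<open>auto simp: fs.subspace_neg\<close>)
  then show ?thesis by (simp add: a_minus_def)
qed

section \<open>Extension of multilinear maps\<close>

text \<open>The values are functionals, so multilinearity is asked of each component separately and
  \<open>multilinear_form\<close> can be reused.\<close>

definition mlin :: "('k::field, 'a) module \<Rightarrow> ('a list \<Rightarrow> 'c \<Rightarrow> 'k) \<Rightarrow> bool" where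
  "mlin M f \<longleftrightarrow> (\<forall>\<phi>. multilinear_form M (\<lambda>w. f w \<phi>))"

text \<open>A tensor is a functional on multilinear forms, so it can be evaluated at each component of \<open>f\<close>.\<close>
definition univ :: "('a list \<Rightarrow> 'c \<Rightarrow> 'k::field) \<Rightarrow> (('a list \<Rightarrow> 'k) \<Rightarrow> 'k) \<Rightarrow> 'c \<Rightarrow> 'k" where
  "univ f x = (\<lambda>\<phi>. x (\<lambda>w. f w \<phi>))"

lemma lin_univ: "lin (univ f)"
  by (rule linI) (auto simp: univ_def fun_applies fun_eq_iff)

lemma univ_tens: "mlin M f \<Longrightarrow> univ f (tens M w) = f w"
  by (auto simp: univ_def mlin_def tens_def)

lemma mlinI:
  assumes "\<And>us ws x y. us \<in> lists (carrier M) \<Longrightarrow> ws \<in> lists (carrier M) \<Longrightarrow> x \<in> carrier M \<Longrightarrow> y \<in> carrier M \<Longrightarrow>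
      f (us @ [x \<oplus>\<^bsub>M\<^esub> y] @ ws) = f (us @ [x] @ ws) + f (us @ [y] @ ws)"
    and "\<And>us ws x k. us \<in> lists (carrier M) \<Longrightarrow> ws \<in> lists (carrier M) \<Longrightarrow> x \<in> carrier M \<Longrightarrow>
      f (us @ [k \<odot>\<^bsub>M\<^esub> x] @ ws) = fscale k (f (us @ [x] @ ws))"
  shows "mlin M f"
  unfolding mlin_def multilinear_form_def
proof (intro allI ballI)
  fix \<phi> us ws x y k
  assume *: "us \<in> lists (carrier M)" "ws \<in> lists (carrier M)" "x \<in> carrier M" "y \<in> carrier M"
  show "f (us @ [x \<oplus>\<^bsub>M\<^esub> y] @ ws) \<phi> = f (us @ [x] @ ws) \<phi> + f (us @ [y] @ ws) \<phi> \<and>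
      f (us @ [k \<odot>\<^bsub>M\<^esub> x] @ ws) \<phi> = k * f (us @ [x] @ ws) \<phi>"
    unfolding assms(1)[OF *] assms(2)[OF *(1-3)] by (simp add: fun_applies)
qed

lemma tens_add:
  "us \<in> lists (carrier M) \<Longrightarrow> ws \<in> lists (carrier M) \<Longrightarrow> x \<in> carrier M \<Longrightarrow> y \<in> carrier M \<Longrightarrow>
    tens M (us @ [x \<oplus>\<^bsub>M\<^esub> y] @ ws) = tens M (us @ [x] @ ws) + tens M (us @ [y] @ ws)"
  by (simp add: fun_eq_iff fun_applies tens_def multilinear_form_def)

lemma tens_smult:
  "us \<in> lists (carrier M) \<Longrightarrow> ws \<in> lists (carrier M) \<Longrightarrow> x \<in> carrier M \<Longrightarrow>
    tens M (us @ [k \<odot>\<^bsub>M\<^esub> x] @ ws) = fscale k (tens M (us @ [x] @ ws))"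
  by (simp add: fun_eq_iff fun_applies tens_def multilinear_form_def)

text \<open>The replacements made in the test of multilinearity keep the length of the word, so the
  map may be cut off by zero according to the length.\<close>

lemma mlin_length:
  assumes "\<And>us ws x y. us \<in> lists (carrier M) \<Longrightarrow> ws \<in> lists (carrier M) \<Longrightarrow> x \<in> carrier M \<Longrightarrow> y \<in> carrier M \<Longrightarrow>
      P (Suc (length us + length ws)) \<Longrightarrow> f (us @ [x \<oplus>\<^bsub>M\<^esub> y] @ ws) = f (us @ [x] @ ws) + f (us @ [y] @ ws)"
    and "\<And>us ws x k. us \<in> lists (carrier M) \<Longrightarrow> ws \<in> lists (carrier M) \<Longrightarrow> x \<in> carrier M \<Longrightarrow>
      P (Suc (length us + length ws)) \<Longrightarrow> f (us @ [k \<odot>\<^bsub>M\<^esub> x] @ ws) = fscale k (f (us @ [x] @ ws))"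
  shows "mlin M (\<lambda>w. if P (length w) then f w else 0)"
  using assms by (intro mlinI) auto

section \<open>Tensor powers and maps on products of their subspaces\<close>

definition words :: "('k, 'a) module \<Rightarrow> nat \<Rightarrow> 'a list set" where
  "words M n = {w \<in> lists (carrier M). length w = n}"

lemma tpow_eq: "tpow M n = fs.span (tens M ` words M n)"
  by (simp add: tpow_def words_def)

lemma subspace_tpow [simp]: "fs.subspace (tpow M n)"
  by (simp add: tpow_eq)

lemma words_append: "u \<in> words M m \<Longrightarrow> w \<in> words M n \<Longrightarrow> u @ w \<in> words M (m + n)"
  by (auto simp: words_def)

lemma words_lists: "w \<in> words M n \<Longrightarrow> w \<in> lists (carrier M)"
  by (auto simp: words_def)

lemma tpow_subset: "tpow M n \<subseteq> carrier (\<T> M)"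
  unfolding tpow_eq carrier_T by (rule fs.span_mono) (auto simp: words_def simp del: in_lists_conv_set)

lemma tpow_in_T: "x \<in> tpow M n \<Longrightarrow> x \<in> carrier (\<T> M)"
  using tpow_subset by blast

lemma tens_tpow: "w \<in> words M n \<Longrightarrow> tens M w \<in> tpow M n"
  by (simp add: tpow_eq fs.span_base)

lemma tens_tpow': "w \<in> lists (carrier M) \<Longrightarrow> length w = n \<Longrightarrow> tens M w \<in> tpow M n"
  by (simp add: tens_tpow words_def)

lemma tpow_mult:
  assumes "mclosed M" "x \<in> tpow M m" "y \<in> tpow M n"
  shows "x \<otimes>\<^bsub>\<T> M\<^esub> y \<in> tpow M (m + n)"
  by (rule span_mult_in[OF assms(1) _ _ subspace_tpow _ assms(2,3)[unfolded tpow_eq]])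
    (use assms(1) in \<open>auto simp: tens_append words_lists tens_in_T words_append simp del:
        in_lists_conv_set intro!: tens_tpow\<close>)

lemma tpow_add_span:
  assumes M: "mclosed M"
  shows "tpow M (m + n) = fs.span {x \<otimes>\<^bsub>\<T> M\<^esub> y | x y. x \<in> tpow M m \<and> y \<in> tpow M n}"
proof (rule antisym)
  show "tpow M (m + n) \<subseteq> fs.span {x \<otimes>\<^bsub>\<T> M\<^esub> y | x y. x \<in> tpow M m \<and> y \<in> tpow M n}"
    unfolding tpow_eq[of M "m+n"]
  proof (rule fs.span_mono, safe)
    fix w assume w: "w \<in> words M (m + n)"
    then have *: "take m w \<in> words M m" "drop m w \<in> words M n"
      by (auto simp: words_def dest: in_set_takeD in_set_dropD)
    have "tens M w = tens M (take m w) \<otimes>\<^bsub>\<T> M\<^esub> tens M (drop m w)"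
      using * by (simp add: tens_append M words_lists)
    then show "\<exists>x y. tens M w = x \<otimes>\<^bsub>\<T> M\<^esub> y \<and> x \<in> tpow M m \<and> y \<in> tpow M n"
      using * tens_tpow by blast
  qed
  show "fs.span {x \<otimes>\<^bsub>\<T> M\<^esub> y | x y. x \<in> tpow M m \<and> y \<in> tpow M n} \<subseteq> tpow M (m + n)"
    by (rule fs.span_minimal) (auto intro: tpow_mult[OF M])
qed

text \<open>A letter of a word of length \<open>m + n\<close> lies among the first \<open>m\<close>
  or among the last \<open>n\<close> letters. Changing it affects one argument of \<open>h\<close>,
  and \<open>h\<close> is linear in that argument.\<close>

lemma mlin_split:
  assumes bil: "bil (tpow M m) (tpow M n) h"
  shows "mlin M (\<lambda>w. if length w = m + n then h (tens M (take m w)) (tens M (drop m w)) else 0)"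
proof -
  note L = bil[unfolded bil_def lin_on_def]
  \<comment> \<open>The pieces that do not contain the letter are fixed before \<open>z\<close> is
    quantified, so one cut serves for the sum and for both summands.\<close>
  have split: "(\<exists>ws1 ws2. ws1 \<in> lists (carrier M) \<and> ws2 \<in> words M n \<and> Suc (length us + length ws1) = m \<and>
        (\<forall>z. take m (us @ [z] @ ws) = us @ [z] @ ws1 \<and> drop m (us @ [z] @ ws) = ws2)) \<or>
      (\<exists>us1 us2. us1 \<in> words M m \<and> us2 \<in> lists (carrier M) \<and> Suc (length us2 + length ws) = n \<and>
        (\<forall>z. take m (us @ [z] @ ws) = us1 \<and> drop m (us @ [z] @ ws) = us2 @ [z] @ ws))"
    if *: "us \<in> lists (carrier M)" "ws \<in> lists (carrier M)" "Suc (length us + length ws) = m + n"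
        for us ws
  proof (cases "length us < m")
    case True
    then obtain d where d: "m = Suc (length us + d)" using less_iff_Suc_add by auto
    show ?thesis
      using * by (intro disjI1 exI[of _ "take d ws"] exI[of _ "drop d ws"])
        (auto simp: d words_def dest: in_set_takeD in_set_dropD)
  next
    case False
    show ?thesis
      using * False by (intro disjI2 exI[of _ "take m us"] exI[of _ "drop m us"])
        (auto simp: words_def Suc_diff_le dest: in_set_takeD in_set_dropD)
  qed
  show ?thesis
  proof (rule mlin_length)
    fix us ws x y assume *: "us \<in> lists (carrier M)" "ws \<in> lists (carrier M)" "x \<in> carrier M"
        "y \<in> carrier M"
      and len: "Suc (length us + length ws) = m + n"
    from split[OF *(1,2) len]
    show "h (tens M (take m (us @ [x \<oplus>\<^bsub>M\<^esub> y] @ ws))) (tens M (drop m (us @ [x \<oplus>\<^bsub>M\<^esub> y] @ ws))) =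
          h (tens M (take m (us @ [x] @ ws))) (tens M (drop m (us @ [x] @ ws))) +
          h (tens M (take m (us @ [y] @ ws))) (tens M (drop m (us @ [y] @ ws)))"
    proof (elim disjE exE conjE)
      fix ws1 ws2 assume a: "ws1 \<in> lists (carrier M)" "ws2 \<in> words M n"
          "Suc (length us + length ws1) = m"
        "\<forall>z. take m (us @ [z] @ ws) = us @ [z] @ ws1 \<and> drop m (us @ [z] @ ws) = ws2"
      have "tens M (us @ [x] @ ws1) \<in> tpow M m" "tens M (us @ [y] @ ws1) \<in> tpow M m"
          "tens M ws2 \<in> tpow M n"
        using a * by (auto intro!: tens_tpow simp: words_def)
      then show ?thesis using L unfolding a(4)[rule_format, THEN conjunct1] a(4)[rule_format, THEN conjunct2]
        tens_add[OF *(1) a(1) *(3,4)] by blast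
    next
      fix us1 us2 assume a: "us1 \<in> words M m" "us2 \<in> lists (carrier M)"
          "Suc (length us2 + length ws) = n"
        "\<forall>z. take m (us @ [z] @ ws) = us1 \<and> drop m (us @ [z] @ ws) = us2 @ [z] @ ws"
      have "tens M us1 \<in> tpow M m" "tens M (us2 @ [x] @ ws) \<in> tpow M n"
          "tens M (us2 @ [y] @ ws) \<in> tpow M n"
        using a * by (auto intro!: tens_tpow simp: words_def)
      then show ?thesis using L unfolding a(4)[rule_format, THEN conjunct1] a(4)[rule_format, THEN conjunct2]
        tens_add[OF a(2) *(2,3,4)] by blast
    qed
  next
    fix us ws x k assume *: "us \<in> lists (carrier M)" "ws \<in> lists (carrier M)" "x \<in> carrier M"
      and len: "Suc (length us + length ws) = m + n"
    from split[OF *(1,2) len]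
    show "h (tens M (take m (us @ [k \<odot>\<^bsub>M\<^esub> x] @ ws))) (tens M (drop m (us @ [k \<odot>\<^bsub>M\<^esub> x] @ ws))) =
          fscale k (h (tens M (take m (us @ [x] @ ws))) (tens M (drop m (us @ [x] @ ws))))"
    proof (elim disjE exE conjE)
      fix ws1 ws2 assume a: "ws1 \<in> lists (carrier M)" "ws2 \<in> words M n"
          "Suc (length us + length ws1) = m"
        "\<forall>z. take m (us @ [z] @ ws) = us @ [z] @ ws1 \<and> drop m (us @ [z] @ ws) = ws2"
      have "tens M (us @ [x] @ ws1) \<in> tpow M m" "tens M ws2 \<in> tpow M n"
        using a * by (auto intro!: tens_tpow simp: words_def)
      then show ?thesis using L unfolding a(4)[rule_format, THEN conjunct1] a(4)[rule_format, THEN conjunct2]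
        tens_smult[OF *(1) a(1) *(3)] by blast
    next
      fix us1 us2 assume a: "us1 \<in> words M m" "us2 \<in> lists (carrier M)"
          "Suc (length us2 + length ws) = n"
        "\<forall>z. take m (us @ [z] @ ws) = us1 \<and> drop m (us @ [z] @ ws) = us2 @ [z] @ ws"
      have "tens M us1 \<in> tpow M m" "tens M (us2 @ [x] @ ws) \<in> tpow M n"
        using a * by (auto intro!: tens_tpow simp: words_def)
      then show ?thesis using L unfolding a(4)[rule_format, THEN conjunct1] a(4)[rule_format, THEN conjunct2]
        tens_smult[OF a(2) *(2,3)] by blast
    qed
  qed
qed

text \<open>The degrees are fixed, so a product is cut after \<open>m\<close> letters to recover its
  two factors; this identifies \<open>X \<otimes> Y\<close> with the span of the products.
  Projections first extend \<open>h\<close> to both full tensor powers.\<close>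

lemma prod_ext:
  assumes M: "mclosed M" and X: "fs.subspace X" "X \<subseteq> tpow M m" and Y: "fs.subspace Y" "Y \<subseteq> tpow M n"
    and bil: "bil X Y h"
  obtains g where "lin g" "\<And>x y. x \<in> X \<Longrightarrow> y \<in> Y \<Longrightarrow> g (x \<otimes>\<^bsub>\<T> M\<^esub> y) = h x y"
proof -
  obtain p :: "(('a list \<Rightarrow> 'b) \<Rightarrow> 'b) \<Rightarrow> ('a list \<Rightarrow> 'b) \<Rightarrow> 'b" where p: "lin p" "\<And>x. p x \<in> X"
      "\<And>x. x \<in> X \<Longrightarrow> p x = x"
    using projection_exists[OF X(1)] by blast
  obtain q :: "(('a list \<Rightarrow> 'b) \<Rightarrow> 'b) \<Rightarrow> ('a list \<Rightarrow> 'b) \<Rightarrow> 'b" where q: "lin q" "\<And>x. q x \<in> Y"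
      "\<And>x. x \<in> Y \<Longrightarrow> q x = x"
    using projection_exists[OF Y(1)] by blast
  define h' where "h' x y = h (p x) (q y)" for x y
  have h': "bil A B h'" for A B unfolding h'_def using bil_comp[OF bil p(1) q(1)] p q by blast
  define g where "g = univ (\<lambda>w. if length w
      = m + n then h' (tens M (take m w)) (tens M (drop m w)) else 0)"
  have g: "g (tens M (u @ w)) = h' (tens M u) (tens M w)" if "length u = m" "length w = n" for u w
    unfolding g_def univ_tens[OF mlin_split[OF h']] using that by simp
  have gb: "bil (carrier (\<T> M)) (carrier (\<T> M)) (\<lambda>x y. g (x \<otimes>\<^bsub>\<T> M\<^esub> y))"
    by (rule bil_lin[OF mult_T_bil[OF M]]) (simp add: g_def lin_univ)
  have "g (x \<otimes>\<^bsub>\<T> M\<^esub> y) = h' x y" if "x \<in> tpow M m" "y \<in> tpow M n" for x y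
    by (rule bil_eq[OF gb h' _ _ _ _ _ that[unfolded tpow_eq]])
      (auto simp: M words_def g intro!: tens_in_T)
  then have "g (x \<otimes>\<^bsub>\<T> M\<^esub> y) = h x y" if "x \<in> X" "y \<in> Y" for x y
    using that p(3) q(3) X Y by (simp add: h'_def subset_iff)
  then show thesis using that[of g] by (simp add: g_def lin_univ)
qed

lemma tensor_map_ex:
  assumes M: "mclosed M" and X: "fs.subspace X" "X \<subseteq> tpow M m" and Y: "fs.subspace Y" "Y \<subseteq> tpow M n"
    and f: "lin_on X f" "f ` X \<subseteq> carrier (\<T> M)" and g: "lin_on Y g" "g ` Y \<subseteq> carrier (\<T> M)"
  obtains L where "lin L" "\<And>x y. x \<in> X \<Longrightarrow> y \<in> Y \<Longrightarrow> L (x \<otimes>\<^bsub>\<T> M\<^esub> y) = f x \<otimes>\<^bsub>\<T> M\<^esub> g y"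
    "\<And>t. t \<in> sub_prod (\<T> M) X Y \<Longrightarrow> tensor_map (\<T> M) X Y f g t = L t"
proof -
  have "bil X Y (\<lambda>x y. f x \<otimes>\<^bsub>\<T> M\<^esub> g y)"
    using f g unfolding bil_def lin_on_def
    by (simp add: image_subset_iff mult_T_left mult_T_right(1)[OF M] mult_T_scale[OF M])
  then obtain L where L: "lin L" "\<And>x y. x \<in> X \<Longrightarrow> y \<in> Y \<Longrightarrow> L (x \<otimes>\<^bsub>\<T> M\<^esub> y) = f x \<otimes>\<^bsub>\<T> M\<^esub> g y"
    using prod_ext[OF M X Y] by blast
  have "tensor_map (\<T> M) X Y f g t = L t" if "t \<in> sub_prod (\<T> M) X Y" for t
    unfolding tensor_map_def
  proof (rule lin_ext_T[OF L(1)])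
    have "{x \<otimes>\<^bsub>\<T> M\<^esub> y |x y. x \<in> X \<and> y \<in> Y} = (\<lambda>(x, y). x \<otimes>\<^bsub>\<T> M\<^esub> y) ` (X \<times> Y)" by auto
    then show "t \<in> fs.span ((\<lambda>(x, y). x \<otimes>\<^bsub>\<T> M\<^esub> y) ` (X \<times> Y))"
      using that by (simp add: sub_prod_def)
  qed (auto simp: L)
  then show thesis using that L by blast
qed

text \<open>Here the vectors are themselves the letters, and the word \<open>[x, y]\<close> plays
  the role of \<open>x \<otimes> y\<close>. Projecting the letters to \<open>X\<close> and
  \<open>Y\<close> before applying \<open>h\<close> makes the map bilinear in arbitrary
  letters.\<close>

lemma bil_ext:
  fixes M :: "('k::field, 'b \<Rightarrow> 'k) module"
  assumes M: "fsp M" and X: "fs.subspace X" and Y: "fs.subspace Y" and bil: "bil X Y h"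
  obtains g where "lin g" "\<And>x y. x \<in> X \<Longrightarrow> y \<in> Y \<Longrightarrow> g (tens M [x, y]) = h x y"
proof -
  obtain p :: "('b \<Rightarrow> 'k) \<Rightarrow> 'b \<Rightarrow> 'k" where p: "lin p" "\<And>x. p x \<in> X" "\<And>x. x \<in> X \<Longrightarrow> p x = x"
    using projection_exists[OF X] by blast
  obtain q :: "('b \<Rightarrow> 'k) \<Rightarrow> 'b \<Rightarrow> 'k" where q: "lin q" "\<And>x. q x \<in> Y" "\<And>x. x \<in> Y \<Longrightarrow> q x = x"
    using projection_exists[OF Y] by blast
  define f where "f w = h (p (w ! 0)) (q (w ! 1))" for w
  have "mlin M (\<lambda>w. if length w = 2 then f w else 0)"
  proof (rule mlin_length)
    fix us ws :: "('b \<Rightarrow> 'k) list" and x y assume len: "Suc (length us + length ws) = 2"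
    consider a where "us = []" "ws = [a]" | a where "us = [a]" "ws = []"
      using len by (cases us; cases ws) auto
    then show "f (us @ [x \<oplus>\<^bsub>M\<^esub> y] @ ws) = f (us @ [x] @ ws) + f (us @ [y] @ ws)"
      using M bil p(2) q(2) by cases (auto simp: f_def fsp_def bil_def lin_on_def lin_add[OF p(1)] lin_add[OF q(1)])
  next
    fix us ws :: "('b \<Rightarrow> 'k) list" and x k assume len: "Suc (length us + length ws) = 2"
    consider a where "us = []" "ws = [a]" | a where "us = [a]" "ws = []"
      using len by (cases us; cases ws) auto
    then show "f (us @ [k \<odot>\<^bsub>M\<^esub> x] @ ws) = fscale k (f (us @ [x] @ ws))"
      using M bil p(2) q(2) by cases (auto simp: f_def fsp_def bil_def lin_on_def lin_scale[OF p(1)] lin_scale[OF q(1)])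
  qed
  from univ_tens[OF this] have "univ (\<lambda>w. if length w = 2 then f w else 0) (tens M [x, y]) = h x y"
      if "x \<in> X" "y \<in> Y" for x y
    using that p(3) q(3) by (simp add: f_def)
  then show thesis using that lin_univ by blast
qed

section \<open>Reduced words in the symmetric group\<close>

abbreviation stp :: "nat \<Rightarrow> nat \<Rightarrow> nat" where "stp i \<equiv> Transposition.transpose i (Suc i)"

text \<open>For a permutation of \<open>{..<n}\<close> their number is the Coxeter length: no word
  is shorter (\<open>word_inv_le\<close>) and some word attains it
  (\<open>reduced_exists\<close>).\<close>

definition inversions :: "(nat \<Rightarrow> nat) \<Rightarrow> (nat \<times> nat) set" where
  "inversions \<sigma> = {(a, b). a < b \<and> \<sigma> b < \<sigma> a}"

abbreviation perms :: "nat \<Rightarrow> (nat \<Rightarrow> nat) set" where "perms n \<equiv> {\<sigma>. \<sigma> permutes {..<n}}"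

definition valid :: "nat \<Rightarrow> nat list \<Rightarrow> bool" where "valid n w \<longleftrightarrow> set w \<subseteq> {i. Suc i < n}"

lemma finite_inversions:
  assumes "\<sigma> permutes {..<n}"
  shows "finite (inversions \<sigma>)"
proof (rule finite_subset)
  show "inversions \<sigma> \<subseteq> {..<n} \<times> {..<n}"
  proof (clarsimp simp: inversions_def)
    fix a b assume ab: "a < b" "\<sigma> b < \<sigma> a"
    show "a < n \<and> b < n"
    proof (rule ccontr)
      assume "\<not> ?thesis"
      then have b: "b \<ge> n" using ab by auto
      then have "\<sigma> b = b" using assms by (simp add: permutes_not_in)
      moreover have "\<sigma> a < n \<or> \<sigma> a = a"
        using assms by (metis lessThan_iff permutes_in_image permutes_not_in)
      ultimately show False using ab b by auto
    qed
  qed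
qed auto

lemma stp_permutes: "Suc i < n \<Longrightarrow> stp i permutes {..<n}"
  by (rule permutes_swap_id) auto

text \<open>The transposition of \<open>i\<close> and \<open>i + 1\<close> preserves the order of
  every pair other than \<open>(i, i + 1)\<close>. It therefore carries the old inversions to
  inversions of the product, and \<open>(i, i + 1)\<close> is the only new one.\<close>

lemma inv_up:
  assumes \<sigma>: "\<sigma> permutes {..<n}" and less: "\<sigma> i < \<sigma> (Suc i)"
  shows "card (inversions (\<sigma> \<circ> stp i)) = Suc (card (inversions \<sigma>))"
proof -
  let ?f = "\<lambda>(a, b). (stp i a, stp i b)"
  have inj: "inj ?f" by (auto intro!: injI) (metis transpose_involutory)+
  have mono: "stp i a < stp i b" if "a < b" "(a, b) \<noteq> (i, Suc i)" for a b
    using that by (auto simp: Transposition.transpose_def)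
  have "inversions (\<sigma> \<circ> stp i) = insert (i, Suc i) (?f ` inversions \<sigma>)"
  proof (rule subset_antisym; rule subsetI)
    fix p assume p: "p \<in> inversions (\<sigma> \<circ> stp i)"
    obtain a b where ab: "p = (a, b)" "a < b" "\<sigma> (stp i b) < \<sigma> (stp i a)" using p
        by (auto simp: inversions_def)
    show "p \<in> insert (i, Suc i) (?f ` inversions \<sigma>)"
    proof (cases "(a, b) = (i, Suc i)")
      case False
      then have "(stp i a, stp i b) \<in> inversions \<sigma>" using mono ab by (auto simp: inversions_def)
      then show ?thesis using ab by (intro insertI2 image_eqI[of _ _ "(stp i a, stp i b)"]) auto
    qed (simp add: ab)
  next
    fix p assume p: "p \<in> insert (i, Suc i) (?f ` inversions \<sigma>)"
    show "p \<in> inversions (\<sigma> \<circ> stp i)"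
    proof (cases "p = (i, Suc i)")
      case True
      then show ?thesis using less by (simp add: inversions_def)
    next
      case False
      then obtain a b where ab: "p = (stp i a, stp i b)" "a < b" "\<sigma> b < \<sigma> a" using p
          by (auto simp: inversions_def)
      moreover have "(a, b) \<noteq> (i, Suc i)" using ab less by auto
      ultimately show ?thesis using mono[of a b] by (simp add: inversions_def)
    qed
  qed
  moreover have "(i, Suc i) \<notin> ?f ` inversions \<sigma>"
  proof
    assume "(i, Suc i) \<in> ?f ` inversions \<sigma>"
    then obtain a b where ab: "stp i a = i" "stp i b = Suc i" "a < b" by (force simp: inversions_def)
    then have "a = Suc i" "b = i" by (metis transpose_apply_first transpose_apply_second transpose_involutory)+
    then show False using ab by simp
  qed
  ultimately show ?thesis
    using finite_inversions[OF \<sigma>] by (simp add: card_image inj_on_subset[OF inj])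
qed

lemma permutes_adjacent_neq: "\<sigma> permutes S \<Longrightarrow> \<sigma> i \<noteq> \<sigma> (Suc i)"
  by (metis n_not_Suc_n permutes_inj inj_eq)

lemma stp_stp [simp]: "\<sigma> \<circ> stp i \<circ> stp i = \<sigma>"
  by (simp add: fun_eq_iff)

lemma inv_down:
  assumes \<sigma>: "\<sigma> permutes {..<n}" and i: "Suc i < n" and less: "\<sigma> (Suc i) < \<sigma> i"
  shows "card (inversions \<sigma>) = Suc (card (inversions (\<sigma> \<circ> stp i)))"
  using inv_up[OF permutes_compose[OF stp_permutes[OF i] \<sigma>], of i] less by simp

lemma inversions_id [simp]: "inversions id = {}" by (auto simp: inversions_def)

lemma word_perm_Nil [simp]: "word_perm [] = id" by (simp add: word_perm_def)
lemma word_perm_Cons [simp]: "word_perm (i # w) = stp i \<circ> word_perm w" by (simp add: word_perm_def)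
lemma word_perm_append [simp]: "word_perm (u @ w) = word_perm u \<circ> word_perm w"
  by (induction u) (auto simp: comp_assoc)

lemma valid_simps [simp]:
  "valid n []" "valid n (i # w) \<longleftrightarrow> Suc i < n \<and> valid n w" "valid n (u @ w) \<longleftrightarrow> valid n u \<and> valid n w"
  by (auto simp: valid_def)

lemma word_perm_permutes: "valid n w \<Longrightarrow> word_perm w permutes {..<n}"
  by (induction w) (auto simp: permutes_id intro: permutes_compose stp_permutes)

text \<open>Each appended letter changes the number of inversions by one, up or down.\<close>

lemma word_inv_le: "valid n w \<Longrightarrow> card (inversions (word_perm w)) \<le> length w"
proof (induction w rule: rev_induct)
  case (snoc i w)
  then have i: "Suc i < n" and p: "word_perm w permutes {..<n}" by (auto intro: word_perm_permutes)
  show ?case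
  proof (cases "word_perm w i < word_perm w (Suc i)")
    case True
    then show ?thesis using inv_up[OF p, of i] snoc by (simp del: o_apply)
  next
    case False
    then have "word_perm w (Suc i) < word_perm w i" using permutes_adjacent_neq[OF p, of i] by linarith
    then show ?thesis using inv_down[OF p i] snoc by (simp del: o_apply)
  qed
qed simp

definition reduced :: "nat \<Rightarrow> nat list \<Rightarrow> bool" where
  "reduced n w \<longleftrightarrow> valid n w \<and> length w = card (inversions (word_perm w))"

text \<open>Without a descent \<open>\<sigma>\<close> increases, so
  \<open>i \<le> \<sigma> i\<close> throughout, and a permutation of an initial segment with this
  property is the identity.\<close>

lemma descent_exists:
  assumes \<sigma>: "\<sigma> permutes {..<n}" and "\<sigma> \<noteq> id"
  obtains i where "Suc i < n" "\<sigma> (Suc i) < \<sigma> i"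
proof (rule ccontr)
  note ex = that
  assume nt: "\<not> thesis"
  have inc: "\<sigma> i < \<sigma> (Suc i)" if "Suc i < n" for i
    using that permutes_adjacent_neq[OF \<sigma>, of i] ex[of i] nt by linarith
  have "i < n \<Longrightarrow> i \<le> \<sigma> i" for i
  proof (induction i)
    case (Suc i)
    then show ?case using inc[of i] by simp
  qed simp
  then have "\<sigma> = id" using permutes_natset_ge[OF \<sigma>] by simp
  then show False using assms by simp
qed

lemma reduced_exists:
  "\<sigma> permutes {..<n} \<Longrightarrow> \<exists>w. reduced n w \<and> word_perm w = \<sigma>"
proof (induction "card (inversions \<sigma>)" arbitrary: \<sigma>)
  case 0
  then have "\<sigma> = id" using descent_exists[of \<sigma> n] inv_down[of \<sigma> n] by (metis nat.distinct(1))
  then show ?case by (intro exI[of _ "[]"]) (simp add: reduced_def)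
next
  case (Suc k)
  then have "\<sigma> \<noteq> id" by auto
  then obtain i where i: "Suc i < n" "\<sigma> (Suc i) < \<sigma> i" using descent_exists Suc by blast
  have "card (inversions \<sigma>) = Suc (card (inversions (\<sigma> \<circ> stp i)))" by (rule inv_down) (use i Suc in auto)
  moreover have "\<sigma> \<circ> stp i permutes {..<n}" using Suc i by (intro permutes_compose stp_permutes) auto
  ultimately obtain w where "reduced n w" "word_perm w = \<sigma> \<circ> stp i" using Suc by (metis diff_Suc_1)
  then show ?case using i Suc \<open>card (inversions \<sigma>) = _\<close>
    by (intro exI[of _ "w @ [i]"]) (auto simp: reduced_def comp_assoc[symmetric])
qed

text \<open>Some word attains the number of inversions and none is shorter, so a word of minimal
  length attains it as well.\<close>

lemma reduced_word_reduced:
  assumes "\<sigma> permutes {..<n}"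
  shows "reduced n (reduced_word n \<sigma>)" "word_perm (reduced_word n \<sigma>) = \<sigma>"
proof -
  let ?P = "\<lambda>w. set w \<subseteq> {i. Suc i < n} \<and> word_perm w = \<sigma>"
  obtain w where w: "reduced n w" "word_perm w = \<sigma>" using reduced_exists[OF assms] by blast
  then have P: "?P w" by (simp add: reduced_def valid_def)
  have *: "?P (reduced_word n \<sigma>)" "length (reduced_word n \<sigma>) \<le> length w"
    using arg_min_nat_lemma[of ?P w length, OF P] P unfolding reduced_word_def by auto
  then show "word_perm (reduced_word n \<sigma>) = \<sigma>" by simp
  then show "reduced n (reduced_word n \<sigma>)"
    using * w word_inv_le[of n "reduced_word n \<sigma>"] by (simp add: reduced_def valid_def)
qed

lemma reduced_snocD:
  assumes "reduced n (w @ [i])"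
  shows "reduced n w" "Suc i < n" "word_perm w i < word_perm w (Suc i)"
proof -
  have v: "valid n w" "Suc i < n" and len: "Suc (length w) = card (inversions (word_perm w \<circ> stp i))"
    using assms by (auto simp: reduced_def)
  have p: "word_perm w permutes {..<n}" by (rule word_perm_permutes[OF v(1)])
  have "card (inversions (word_perm w)) \<le> length w" by (rule word_inv_le[OF v(1)])
  then have "\<not> word_perm w (Suc i) < word_perm w i" using inv_down[OF p v(2)] len by auto
  then show less: "word_perm w i < word_perm w (Suc i)" using permutes_adjacent_neq[OF p, of i]
      by linarith
  show "reduced n w" "Suc i < n" using v len inv_up[OF p less] by (auto simp: reduced_def)
qed

lemma reduced_snocI:
  "reduced n w \<Longrightarrow> Suc i < n \<Longrightarrow> word_perm w i < word_perm w (Suc i) \<Longrightarrow> reduced n (w @ [i])"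
  using inv_up[OF word_perm_permutes[of n w], of i] by (simp add: reduced_def)

lemma reduced_mono: "reduced n w \<Longrightarrow> n \<le> m \<Longrightarrow> reduced m w"
  by (auto simp: reduced_def valid_def)

section \<open>Words acting through operators, and Matsumoto's theorem\<close>

definition opw :: "(nat \<Rightarrow> 'a \<Rightarrow> 'a) \<Rightarrow> nat list \<Rightarrow> 'a \<Rightarrow> 'a" where
  "opw C w = foldr (\<lambda>i f. C i \<circ> f) w id"

lemma opw_simps [simp]: "opw C [] x = x" "opw C (i # w) x = C i (opw C w x)"
  by (simp_all add: opw_def)

lemma opw_append [simp]: "opw C (u @ w) x = opw C u (opw C w x)"
  by (induction u) auto

text \<open>The relations are asked on \<open>X\<close> only, because the braiding operators of
  degree \<open>n\<close> are controlled on a single tensor power.\<close>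

locale braid_ops =
  fixes C :: "nat \<Rightarrow> 'a \<Rightarrow> 'a" and X :: "'a set" and n :: nat
  assumes closed: "\<And>i x. Suc i < n \<Longrightarrow> x \<in> X \<Longrightarrow> C i x \<in> X"
    and braid: "\<And>i x. Suc (Suc i) < n \<Longrightarrow> x \<in> X \<Longrightarrow> C i (C (Suc i) (C i x)) = C (Suc i) (C i (C (Suc i) x))"
    and far: "\<And>i j x. Suc i < j \<Longrightarrow> Suc j < n \<Longrightarrow> x \<in> X \<Longrightarrow> C i (C j x) = C j (C i x)"
begin

lemma opw_closed: "valid n w \<Longrightarrow> x \<in> X \<Longrightarrow> opw C w x \<in> X"
  by (induction w) (auto intro: closed)

text \<open>Induction on the length, comparing last letters; equal last letters cancel. If they are
  different letters \<open>i\<close> and \<open>j\<close>, the permutation has descents at both,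
  hence a reduced word that ends in the longest word in these two letters. The two forms of this
  ending are exchanged by one relation, and each form shares its last letter with one of the given
  words.\<close>

lemma matsumoto:
  "reduced n u \<Longrightarrow> reduced n w \<Longrightarrow> word_perm u = word_perm w \<Longrightarrow> x \<in> X \<Longrightarrow> opw C u x = opw C w x"
proof (induction "length u" arbitrary: u w x rule: less_induct)
  case less
  have len: "length u = length w" using less.prems by (simp add: reduced_def)
  have same: "opw C (u' @ [i]) y = opw C (w' @ [i]) y"
    if "length (u' @ [i]) = length u" "reduced n (u' @ [i])" "reduced n (w' @ [i])"
      "word_perm (u' @ [i]) = word_perm (w' @ [i])" "y \<in> X" for u' w' i y
  proof -
    have "word_perm u' = word_perm w'"
      using arg_cong[OF that(4), of "\<lambda>f. f \<circ> stp i"] by simp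
    moreover have "C i y \<in> X" using that reduced_snocD(2) closed by blast
    ultimately show ?thesis
      using less.hyps[of u' w' "C i y"] that reduced_snocD(1) by auto
  qed
  have diff: "opw C (u' @ [i]) y = opw C (w' @ [j]) y"
    if "i < j" "length (u' @ [i]) = length u" "reduced n (u' @ [i])" "reduced n (w' @ [j])"
      "word_perm (u' @ [i]) = word_perm (w' @ [j])" "y \<in> X" for u' w' i j y
  proof -
    define \<sigma> where "\<sigma> = word_perm (u' @ [i])"
    have v: "Suc i < n" "Suc j < n" using that reduced_snocD by blast+
    have \<sigma>: "\<sigma> permutes {..<n}" unfolding \<sigma>_def using that(3)
        by (intro word_perm_permutes) (simp add: reduced_def)
    have di: "\<sigma> (Suc i) < \<sigma> i" unfolding \<sigma>_def using reduced_snocD(3)[OF that(3)] by simp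
    have dj: "\<sigma> (Suc j) < \<sigma> j" unfolding \<sigma>_def that(5) using reduced_snocD(3)[OF that(4)] by simp
    have len: "length u = card (inversions \<sigma>)" using that(2,3) by (simp add: reduced_def \<sigma>_def)
    have p1: "\<sigma> \<circ> stp i permutes {..<n}" by (intro permutes_compose stp_permutes v \<sigma>)
    have i1: "card (inversions \<sigma>) = Suc (card (inversions (\<sigma> \<circ> stp i)))" by (rule inv_down[OF \<sigma> v(1) di])
    have p2: "\<sigma> \<circ> stp i \<circ> stp j permutes {..<n}" by (intro permutes_compose stp_permutes v \<sigma>)
    have len2: "length w' + 1 = length u" using that(4,5) len by (simp add: reduced_def \<sigma>_def)
    show ?thesis
    proof (cases "j = Suc i")
      case False
      then have ij: "Suc i < j" using that by auto
      then have "stp i (Suc j) = Suc j" "stp i j = j" by (auto simp: Transposition.transpose_def)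
      then have i2: "card (inversions (\<sigma> \<circ> stp i)) = Suc (card (inversions (\<sigma> \<circ> stp i \<circ> stp j)))"
        using dj by (intro inv_down[OF p1 v(2)]) simp
      \<comment> \<open>What remains of \<open>\<sigma>\<close> after both descents are removed;
        \<open>r\<close> followed by \<open>i\<close> and \<open>j\<close> in either order is a
        reduced word of \<open>\<sigma>\<close>.\<close>
      obtain r where r: "reduced n r" "word_perm r = \<sigma> \<circ> stp i \<circ> stp j" using reduced_exists[OF p2]
          by blast
      have lr: "Suc (Suc (length r)) = length u" using r i1 i2 len by (simp add: reduced_def)
      have comm: "stp i \<circ> stp j = stp j \<circ> stp i" using ij
          by (auto simp: fun_eq_iff Transposition.transpose_def)
      have e1: "word_perm ((r @ [j]) @ [i]) = \<sigma>" by (simp add: r comp_assoc[symmetric])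
      have "word_perm ((r @ [i]) @ [j]) = word_perm r \<circ> (stp i \<circ> stp j)" by (simp add: comp_assoc)
      also have "\<dots> = \<sigma>" using e1 by (simp add: comm comp_assoc)
      finally have e2: "word_perm ((r @ [i]) @ [j]) = \<sigma>" .
      have r1: "reduced n ((r @ [j]) @ [i])" "reduced n ((r @ [i]) @ [j])"
        unfolding reduced_def e1 e2 using r v i1 i2 by (auto simp: reduced_def)
      have "opw C (u' @ [i]) y = opw C ((r @ [j]) @ [i]) y"
        by (rule same) (use that r1 e1 in \<open>auto simp: \<sigma>_def\<close>)
      also have "\<dots> = opw C ((r @ [i]) @ [j]) y" using far[OF ij v(2) that(6)] by simp
      also have "\<dots> = opw C (w' @ [j]) y"
        by (rule same) (use that r1 e2 lr in \<open>auto simp: \<sigma>_def\<close>)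
      finally show ?thesis .
    next
      case True
      \<comment> \<open>With \<open>j = i + 1\<close> the values of \<open>\<sigma>\<close> at
        \<open>i\<close>, \<open>i + 1\<close>, \<open>i + 2\<close> decrease, so three letters can
        be removed in turn, each lowering the number of inversions by one.\<close>
      have i2: "card (inversions (\<sigma> \<circ> stp i)) = Suc (card (inversions (\<sigma> \<circ> stp i \<circ> stp j)))"
        using dj di True by (intro inv_down[OF p1 v(2)]) (simp add: Transposition.transpose_def)
      have i3: "card (inversions (\<sigma> \<circ> stp i \<circ> stp j))
          = Suc (card (inversions (\<sigma> \<circ> stp i \<circ> stp j \<circ> stp i)))"
        using dj di True by (intro inv_down[OF p2 v(1)]) (simp add: Transposition.transpose_def)
      have p3: "\<sigma> \<circ> stp i \<circ> stp j \<circ> stp i permutes {..<n}" by (intro permutes_compose stp_permutes v \<sigma>)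
      obtain r where r: "reduced n r" "word_perm r = \<sigma> \<circ> stp i \<circ> stp j \<circ> stp i"
          using reduced_exists[OF p3] by blast
      have comm: "stp i \<circ> stp j \<circ> stp i = stp j \<circ> stp i \<circ> stp j"
        using True by (auto simp: fun_eq_iff Transposition.transpose_def)
      have e1: "word_perm ((r @ [i, j]) @ [i]) = \<sigma>" by (simp add: r comp_assoc[symmetric])
      have "word_perm ((r @ [j, i]) @ [j]) = word_perm r \<circ> (stp j \<circ> stp i \<circ> stp j)"
          by (simp add: comp_assoc)
      also have "\<dots> = \<sigma>" unfolding comm[symmetric] r by (simp add: comp_assoc[symmetric])
      finally have e2: "word_perm ((r @ [j, i]) @ [j]) = \<sigma>" .
      have r1: "reduced n ((r @ [i, j]) @ [i])" "reduced n ((r @ [j, i]) @ [j])"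
        unfolding reduced_def e1 e2 using r v i1 i2 i3 by (auto simp: reduced_def)
      have "opw C (u' @ [i]) y = opw C ((r @ [i, j]) @ [i]) y"
        by (rule same) (use that r1 e1 in \<open>auto simp: \<sigma>_def\<close>)
      also have "\<dots> = opw C ((r @ [j, i]) @ [j]) y" using braid[of i y] v that(6) True by simp
      also have "\<dots> = opw C (w' @ [j]) y"
        by (rule same) (use that r1 e2 len i1 i2 i3 r in \<open>auto simp: \<sigma>_def reduced_def\<close>)
      finally show ?thesis .
    qed
  qed
  show ?case
  proof (cases u rule: rev_cases)
    case Nil
    then show ?thesis using len by simp
  next
    case (snoc u' i)
    then obtain w' j where w: "w = w' @ [j]" using len by (cases w rule: rev_cases) auto
    consider "i = j" | "i < j" | "j < i" by linarith
    then show ?thesis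
    proof cases
      case 1 then show ?thesis using same[of u' i w' x] less.prems snoc w by simp
    next
      case 2 then show ?thesis using diff[of i j u' w' x] less.prems snoc w by simp
    next
      case 3 then show ?thesis using diff[of j i w' u' x] less.prems snoc w len by simp
    qed
  qed
qed

end

section \<open>Coset decompositions of the symmetric group\<close>

lemma word_perm_upt: "j \<le> n \<Longrightarrow> word_perm [j..<n] x
    = (if x < j then x else if x < n then Suc x else if x = n then j else x)"
proof (induction "n - j" arbitrary: j)
  case (Suc k)
  then have "[j..<n] = j # [Suc j..<n]" by (simp add: upt_conv_Cons)
  moreover have "word_perm [Suc j..<n] x = (if x < Suc j then x else if x < n then Suc x else if x
      = n then Suc j else x)"
    using Suc by (intro Suc(1)) auto
  ultimately show ?case using Suc by (auto simp: Transposition.transpose_def)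
qed auto

lemma word_perm_rev_upt: "j \<le> n \<Longrightarrow> word_perm (rev [j..<n]) x = (if x < j then x else if x
    = j then n else if x \<le> n then x - 1 else x)"
proof (induction n)
  case (Suc n)
  show ?case
  proof (cases "j = Suc n")
    case False
    then have "j \<le> n" using Suc by simp
    then show ?thesis using Suc by (auto simp: Transposition.transpose_def)
  qed auto
qed auto

lemma reduced_upt: "j \<le> n \<Longrightarrow> reduced (Suc n) [j..<n]"
proof (induction n)
  case (Suc n)
  show ?case
  proof (cases "j = Suc n")
    case False
    then have "j \<le> n" using Suc by simp
    then show ?thesis using Suc
      by (auto intro!: reduced_snocI intro: reduced_mono simp: word_perm_upt)
  qed (simp add: reduced_def)
qed (simp add: reduced_def)

text \<open>Before the letter \<open>j\<close> is appended, position \<open>j + 1\<close> carries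
  the value \<open>n\<close> and position \<open>j\<close> a smaller one, so every letter adds an
  inversion.\<close>

lemma reduced_rev_upt:
  assumes u: "reduced n u"
  shows "j \<le> n \<Longrightarrow> reduced (Suc n) (u @ rev [j..<n])"
proof (induction "n - j" arbitrary: j)
  case 0
  then show ?case using u by (auto intro: reduced_mono)
next
  case (Suc k)
  then have j: "j < n" by simp
  then have e: "u @ rev [j..<n] = (u @ rev [Suc j..<n]) @ [j]" by (simp add: upt_conv_Cons)
  have p: "word_perm u permutes {..<n}" using u by (simp add: reduced_def word_perm_permutes)
  have "word_perm u j < n" using p j by (metis lessThan_iff permutes_in_image)
  moreover have "word_perm u n = n" using p by (simp add: permutes_not_in)
  ultimately show ?case unfolding e using Suc j
    by (intro reduced_snocI) (auto simp: word_perm_rev_upt)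
qed

lemma word_perm_shift: "word_perm (map (\<lambda>i. i + a) w) (x + a) = word_perm w x + a"
proof (induction w arbitrary: x)
  case (Cons i w)
  then show ?case by (auto simp: Transposition.transpose_def)
qed simp

text \<open>Being increasing on the block \<open>{a..<a + n}\<close>, \<open>u\<close> represents
  the shortest element of its coset modulo the permutations of the block. It keeps the order of the
  values in the block, so a letter that adds an inversion to \<open>w\<close> also adds one to the
  combined word.\<close>

lemma reduced_shift_append:
  assumes u: "reduced N u" and N: "a + n \<le> N" and inc: "strict_mono_on {a..<a + n} (word_perm u)"
  shows "reduced n w \<Longrightarrow> reduced N (u @ map (\<lambda>i. i + a) w)"
proof (induction w rule: rev_induct)
  case (snoc i w)
  note w = reduced_snocD[OF snoc.prems]
  have p: "word_perm w permutes {..<n}" using w by (simp add: reduced_def word_perm_permutes)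
  have "word_perm w i < n" "word_perm w (Suc i) < n"
    using p w by (metis lessThan_iff permutes_in_image Suc_lessD)+
  then have "word_perm u (word_perm w i + a) < word_perm u (word_perm w (Suc i) + a)"
    using inc w by (auto simp: strict_mono_on_def)
  moreover have "word_perm (map (\<lambda>i. i + a) w) (i + a) = word_perm w i + a"
    "word_perm (map (\<lambda>i. i + a) w) (Suc (i + a)) = word_perm w (Suc i) + a"
    using word_perm_shift[of a w i] word_perm_shift[of a w "Suc i"] by simp_all
  ultimately have "reduced N ((u @ map (\<lambda>i. i + a) w) @ [i + a])"
    using snoc.IH[OF w(1)] w N by (intro reduced_snocI) auto
  then show ?case by simp
qed (simp add: u)

lemma card_perms: "card (perms n) = fact n"
  using card_permutations[of "{..<n}"] by simp

text \<open>By counting: there are \<open>(n + 1) n!\<close> pairs and equally many permutations, so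
  injectivity suffices.\<close>

lemma coset_bij:
  assumes into: "\<And>j \<sigma>. j \<le> n \<Longrightarrow> \<sigma> \<in> perms n \<Longrightarrow> F (j, \<sigma>) \<in> perms (Suc n)"
    and inj: "inj_on F ({..n} \<times> perms n)"
  shows "bij_betw F ({..n} \<times> perms n) (perms (Suc n))"
proof -
  have "F ` ({..n} \<times> perms n) = perms (Suc n)"
  proof (rule card_subset_eq)
    show "finite (perms (Suc n))" by (simp add: finite_permutations)
    show "F ` ({..n} \<times> perms n) \<subseteq> perms (Suc n)" using into by auto
    show "card (F ` ({..n} \<times> perms n)) = card (perms (Suc n))"
      using inj by (simp add: card_image card_cartesian_product card_perms)
  qed
  then show ?thesis using inj by (simp add: bij_betw_def)
qed

context braid_ops
begin

text \<open>By \<open>matsumoto\<close> the words chosen by \<open>reduced_word\<close> may be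
  exchanged for any other reduced words, here for those adapted to a coset decomposition.\<close>

lemma opw_sum_cosets:
  fixes G :: "nat \<Rightarrow> (nat \<Rightarrow> nat) \<Rightarrow> nat list"
  assumes n: "n = Suc m"
    and red: "\<And>j \<sigma>. j \<le> m \<Longrightarrow> \<sigma> \<in> perms m \<Longrightarrow> reduced n (G j \<sigma>)"
    and inj: "inj_on (\<lambda>(j, \<sigma>). word_perm (G j \<sigma>)) ({..m} \<times> perms m)"
    and x: "x \<in> X"
  shows "(\<Sum>\<sigma>\<in>perms n. f (opw C (reduced_word n \<sigma>) x)) = (\<Sum>j\<le>m. \<Sum>\<sigma>\<in>perms m. f (opw C (G j \<sigma>) x))"
proof -
  let ?F = "\<lambda>(j, \<sigma>). word_perm (G j \<sigma>)"
  have into: "word_perm (G j \<sigma>) \<in> perms (Suc m)" if "j \<le> m" "\<sigma> \<in> perms m" for j \<sigma>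
    using red[OF that] n by (simp add: reduced_def word_perm_permutes)
  have bij: "bij_betw ?F ({..m} \<times> perms m) (perms (Suc m))"
    by (rule coset_bij[OF _ inj]) (use into in auto)
  have "(\<Sum>\<sigma>\<in>perms n. f (opw C (reduced_word n \<sigma>) x)) =
      (\<Sum>p\<in>{..m} \<times> perms m. f (opw C (reduced_word n (?F p)) x))"
    unfolding n by (rule sum.reindex_bij_betw[OF bij, symmetric])
  also have "\<dots> = (\<Sum>(j, \<sigma>)\<in>{..m} \<times> perms m. f (opw C (G j \<sigma>) x))"
  proof (rule sum.cong[OF refl])
    fix q assume "q \<in> {..m} \<times> perms m"
    then obtain j \<sigma> where q: "q = (j, \<sigma>)" and *: "j \<in> {..m}" "\<sigma> permutes {..<m}" by auto
    then have p: "word_perm (G j \<sigma>) permutes {..<n}" and r: "reduced n (G j \<sigma>)"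
      using into red n by auto
    have "opw C (reduced_word n (word_perm (G j \<sigma>))) x = opw C (G j \<sigma>) x"
      using matsumoto[OF reduced_word_reduced(1)[OF p] r reduced_word_reduced(2)[OF p] x] .
    then show "f (opw C (reduced_word n (?F q)) x) = (case q of (j, \<sigma>) \<Rightarrow> f (opw C (G j \<sigma>) x))"
        by (simp add: q)
  qed
  also have "\<dots> = (\<Sum>j\<le>m. \<Sum>\<sigma>\<in>perms m. f (opw C (G j \<sigma>) x))"
    by (simp add: sum.cartesian_product)
  finally show ?thesis .
qed

lemma inj_coset:
  assumes wp: "\<And>j \<sigma>. j \<le> m \<Longrightarrow> \<sigma> \<in> perms m \<Longrightarrow> word_perm (G j \<sigma>) = H j \<sigma>"
    and eq: "\<And>j k \<sigma> \<tau>. j \<le> m \<Longrightarrow> k \<le> m \<Longrightarrow> \<sigma> \<in> perms m \<Longrightarrow> \<tau> \<in> perms m \<Longrightarrow> H j \<sigma> = H k \<tau> \<Longrightarrow> j = k"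
    and eq2: "\<And>j \<sigma> \<tau>. j \<le> m \<Longrightarrow> \<sigma> \<in> perms m \<Longrightarrow> \<tau> \<in> perms m \<Longrightarrow> H j \<sigma> = H j \<tau> \<Longrightarrow> \<sigma> = \<tau>"
  shows "inj_on (\<lambda>(j, \<sigma>). word_perm (G j \<sigma>)) ({..m} \<times> perms m)"
proof (rule inj_onI, clarsimp)
  fix j \<sigma> k \<tau> assume *: "j \<le> m" "\<sigma> permutes {..<m}" "k \<le> m" "\<tau> permutes {..<m}"
    "word_perm (G j \<sigma>) = word_perm (G k \<tau>)"
  then have H: "H j \<sigma> = H k \<tau>" using wp by simp
  then have "j = k" using eq[of j k \<sigma> \<tau>] * by simp
  then show "j = k \<and> \<sigma> = \<tau>" using eq2[of j \<sigma> \<tau>] * H by simp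
qed

text \<open>The permutations of the first \<open>m\<close> positions act last, and the index
  \<open>j\<close> is recovered as the position that is sent to \<open>m\<close>. This form reduces
  degree \<open>m + 1\<close> to degree \<open>m\<close> in the study of leading terms.\<close>

lemma opw_sum_right:
  assumes n: "n = Suc m" and x: "x \<in> X"
  shows "(\<Sum>\<sigma>\<in>perms n. f (opw C (reduced_word n \<sigma>) x)) =
    (\<Sum>j\<le>m. \<Sum>\<sigma>\<in>perms m. f (opw C (reduced_word m \<sigma>) (opw C (rev [j..<m]) x)))"
proof -
  have "(\<Sum>\<sigma>\<in>perms n. f (opw C (reduced_word n \<sigma>) x)) =
      (\<Sum>j\<le>m. \<Sum>\<sigma>\<in>perms m. f (opw C (reduced_word m \<sigma> @ rev [j..<m]) x))"
  proof (rule opw_sum_cosets[OF n _ _ x])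
    show "reduced n (reduced_word m \<sigma> @ rev [j..<m])" if "j \<le> m" "\<sigma> \<in> perms m" for j \<sigma>
      unfolding n using that by (intro reduced_rev_upt reduced_word_reduced) auto
    show "inj_on (\<lambda>(j, \<sigma>). word_perm (reduced_word m \<sigma> @ rev [j..<m])) ({..m} \<times> perms m)"
    proof (rule inj_coset[where H = "\<lambda>j \<sigma>. \<sigma> \<circ> word_perm (rev [j..<m])"])
      fix j k \<sigma> \<tau> assume *: "j \<le> m" "k \<le> m" "\<sigma> \<in> perms m" "\<tau> \<in> perms m"
        "\<sigma> \<circ> word_perm (rev [j..<m]) = \<tau> \<circ> word_perm (rev [k..<m])"
      have fix_m: "\<rho> m = m" if "\<rho> \<in> perms m" for \<rho> using that by (auto intro: permutes_not_in)
      have "word_perm (rev [j..<m]) j = m" using *(1) by (simp add: word_perm_rev_upt)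
      then have "\<tau> (word_perm (rev [k..<m]) j) = m"
        using fun_cong[OF *(5), of j] fix_m[OF *(3)] by simp
      then have "word_perm (rev [k..<m]) j = m"
        using fix_m[OF *(4)] permutes_inj[of \<tau> "{..<m}"] *(4) by (metis injD mem_Collect_eq)
      then show "j = k" using *(1,2) by (auto simp: word_perm_rev_upt split: if_splits)
    next
      fix j \<sigma> \<tau> assume *: "j \<le> m" "\<sigma> \<in> perms m" "\<tau> \<in> perms m"
        "\<sigma> \<circ> word_perm (rev [j..<m]) = \<tau> \<circ> word_perm (rev [j..<m])"
      have "valid n (rev [j..<m])" using n by (auto simp: valid_def)
      then have "surj (word_perm (rev [j..<m]))" using word_perm_permutes permutes_surj by blast
      then show "\<sigma> = \<tau>" using *(4) by (metis surj_fun_eq comp_apply UNIV_I ext surjD)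
    qed (simp add: reduced_word_reduced)
  qed
  then show ?thesis by simp
qed

text \<open>The subgroup acts first, and \<open>j\<close> is the image of \<open>m\<close>. This
  form is behind the closure of the Nichols ideal under right multiplication by vectors.\<close>

lemma opw_sum_left:
  assumes n: "n = Suc m" and x: "x \<in> X"
  shows "(\<Sum>\<sigma>\<in>perms n. f (opw C (reduced_word n \<sigma>) x)) =
    (\<Sum>j\<le>m. \<Sum>\<sigma>\<in>perms m. f (opw C [j..<m] (opw C (reduced_word m \<sigma>) x)))"
proof -
  have "(\<Sum>\<sigma>\<in>perms n. f (opw C (reduced_word n \<sigma>) x)) =
      (\<Sum>j\<le>m. \<Sum>\<sigma>\<in>perms m. f (opw C ([j..<m] @ reduced_word m \<sigma>) x))"
  proof (rule opw_sum_cosets[OF n _ _ x])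
    show "reduced n ([j..<m] @ reduced_word m \<sigma>)" if "j \<le> m" "\<sigma> \<in> perms m" for j \<sigma>
    proof -
      have "reduced n ([j..<m] @ map (\<lambda>i. i + 0) (reduced_word m \<sigma>))"
        by (rule reduced_shift_append[where n
        = m]) (use that n in \<open>auto intro: reduced_upt reduced_word_reduced simp: strict_mono_on_def word_perm_upt\<close>)
      then show ?thesis by simp
    qed
    show "inj_on (\<lambda>(j, \<sigma>). word_perm ([j..<m] @ reduced_word m \<sigma>)) ({..m} \<times> perms m)"
    proof (rule inj_coset[where H = "\<lambda>j \<sigma>. word_perm [j..<m] \<circ> \<sigma>"])
      fix j k \<sigma> \<tau> assume *: "j \<le> m" "k \<le> m" "\<sigma> \<in> perms m" "\<tau> \<in> perms m"
        "word_perm [j..<m] \<circ> \<sigma> = word_perm [k..<m] \<circ> \<tau>"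
      have "\<sigma> m = m" "\<tau> m = m" using * by (auto intro: permutes_not_in)
      then show "j = k" using fun_cong[OF *(5), of m] *(1,2) by (simp add: word_perm_upt)
    next
      fix j \<sigma> \<tau> assume *: "j \<le> m" "\<sigma> \<in> perms m" "\<tau> \<in> perms m"
        "word_perm [j..<m] \<circ> \<sigma> = word_perm [j..<m] \<circ> \<tau>"
      have "valid n [j..<m]" using n by (auto simp: valid_def)
      then have "inj (word_perm [j..<m])" using word_perm_permutes permutes_inj by blast
      then show "\<sigma> = \<tau>" using *(4) by (simp add: inj_compose fun.inj_map_strong fun_eq_iff inj_eq)
    qed (simp add: reduced_word_reduced)
  qed
  then show ?thesis by simp
qed

text \<open>\<open>S_m\<close> is embedded as the stabiliser of \<open>0\<close>, through words
  shifted by one, and \<open>j\<close> is the image of \<open>0\<close>. This form serves left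
  multiplication by vectors.\<close>

lemma opw_sum_left_shift:
  assumes n: "n = Suc m" and x: "x \<in> X"
  shows "(\<Sum>\<sigma>\<in>perms n. f (opw C (reduced_word n \<sigma>) x)) =
    (\<Sum>j\<le>m. \<Sum>\<sigma>\<in>perms m. f (opw C (rev [0..<j]) (opw C (map Suc (reduced_word m \<sigma>)) x)))"
proof -
  have "(\<Sum>\<sigma>\<in>perms n. f (opw C (reduced_word n \<sigma>) x)) =
      (\<Sum>j\<le>m. \<Sum>\<sigma>\<in>perms m. f (opw C (rev [0..<j] @ map Suc (reduced_word m \<sigma>)) x))"
  proof (rule opw_sum_cosets[OF n _ _ x])
    show "reduced n (rev [0..<j] @ map Suc (reduced_word m \<sigma>))" if "j \<le> m" "\<sigma> \<in> perms m" for j \<sigma>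
    proof -
      have "reduced (Suc j) ([] @ rev [0..<j])" by (rule reduced_rev_upt) (auto simp: reduced_def)
      then have "reduced n (rev [0..<j] @ map (\<lambda>i. i + 1) (reduced_word m \<sigma>))"
        by (intro reduced_shift_append[where n = m])
         (use that n in \<open>auto intro: reduced_mono reduced_word_reduced simp: strict_mono_on_def word_perm_rev_upt\<close>)
      moreover have "(\<lambda>i. i + 1) = Suc" by auto
      ultimately show ?thesis by simp
    qed
    have shift: "word_perm (map Suc w) (Suc x) = Suc (word_perm w x)" for w x
    proof -
      have "(\<lambda>i. i + 1) = Suc" by auto
      then show ?thesis using word_perm_shift[of 1 w x] by simp
    qed
    have shift0: "word_perm (map Suc w) 0 = 0" for w
      by (induction w) (auto simp: Transposition.transpose_def)
    show "inj_on (\<lambda>(j, \<sigma>). word_perm (rev [0..<j] @ map Suc (reduced_word m \<sigma>))) ({..m} \<times> perms m)"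
    proof (rule inj_coset[where H =
        "\<lambda>j \<sigma>. word_perm (rev [0..<j]) \<circ> (\<lambda>x. case x of 0 \<Rightarrow> 0 | Suc x \<Rightarrow> Suc (\<sigma> x))"])
      fix j k \<sigma> \<tau> assume *: "j \<le> m" "k \<le> m" "\<sigma> \<in> perms m" "\<tau> \<in> perms m"
        "word_perm (rev [0..<j]) \<circ> (\<lambda>x. case x of 0 \<Rightarrow> 0 | Suc x \<Rightarrow> Suc (\<sigma> x)) =
         word_perm (rev [0..<k]) \<circ> (\<lambda>x. case x of 0 \<Rightarrow> 0 | Suc x \<Rightarrow> Suc (\<tau> x))"
      show "j = k" using fun_cong[OF *(5), of 0] by (simp add: word_perm_rev_upt)
    next
      fix j \<sigma> \<tau> assume *: "j \<le> m" "\<sigma> \<in> perms m" "\<tau> \<in> perms m"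
        "word_perm (rev [0..<j]) \<circ> (\<lambda>x. case x of 0 \<Rightarrow> 0 | Suc x \<Rightarrow> Suc (\<sigma> x)) =
         word_perm (rev [0..<j]) \<circ> (\<lambda>x. case x of 0 \<Rightarrow> 0 | Suc x \<Rightarrow> Suc (\<tau> x))"
      have "valid (Suc j) (rev [0..<j])" by (auto simp: valid_def)
      then have i: "inj (word_perm (rev [0..<j]))" using word_perm_permutes permutes_inj by blast
      show "\<sigma> = \<tau>"
      proof
        fix x show "\<sigma> x = \<tau> x" using fun_cong[OF *(4), of "Suc x"] i by (simp add: inj_eq)
      qed
    next
      fix j \<sigma> assume "j \<le> m" "\<sigma> \<in> perms m"
      then show "word_perm (rev [0..<j] @ map Suc (reduced_word m \<sigma>)) =
          word_perm (rev [0..<j]) \<circ> (\<lambda>x. case x of 0 \<Rightarrow> 0 | Suc x \<Rightarrow> Suc (\<sigma> x))"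
        by (auto simp: fun_eq_iff shift shift0 reduced_word_reduced split: nat.splits)
    qed
  qed
  then show ?thesis by simp
qed

end

lemma lin_on_id: "lin_on X (\<lambda>x. x)"
  by (simp add: lin_on_def)

lemma lin_on_comp: "lin f \<Longrightarrow> lin_on X g \<Longrightarrow> lin_on X (\<lambda>x. f (g x))"
proof -
  assume f: "lin f" and "lin_on X g"
  then show ?thesis by (simp add: lin_on_def lin_rules[OF f])
qed

lemma lin_on_mulL:
  "mclosed M \<Longrightarrow> lin_on X g \<Longrightarrow> (\<And>x. x \<in> X \<Longrightarrow> g x \<in> carrier (\<T> M)) \<Longrightarrow> u \<in> carrier (\<T> M) \<Longrightarrow>
    lin_on X (\<lambda>x. u \<otimes>\<^bsub>\<T> M\<^esub> g x)"
  by (simp add: lin_on_def mult_T_right(1) mult_T_scale)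

lemma lin_on_mulR: "lin_on X g \<Longrightarrow> lin_on X (\<lambda>x. g x \<otimes>\<^bsub>\<T> M\<^esub> u)"
  by (simp add: lin_on_def mult_T_left)

lemma lin_on_span_eq:
  assumes "lin_on X f" "lin_on X g" "fs.subspace X" "S \<subseteq> X" "\<And>x. x \<in> S \<Longrightarrow> f x = g x" "t \<in> fs.span S"
  shows "f t = g t"
proof -
  have tX: "t \<in> X" using assms fs.span_minimal by blast
  obtain f' where f': "lin f'" "\<And>x. x \<in> X \<Longrightarrow> f' x = f x" using lin_on_extend[OF assms(1,3)] by blast
  obtain g' where g': "lin g'" "\<And>x. x \<in> X \<Longrightarrow> g' x = g x" using lin_on_extend[OF assms(2,3)] by blast
  have "f' t = g' t" by (rule lin_span_eq[OF f'(1) g'(1) _ assms(6)]) (use assms f' g' in auto)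
  then show ?thesis using f' g' tX by simp
qed

lemma tpow_prod_eqI:
  assumes M: "mclosed M" and "lin_on (tpow M N) f" "lin_on (tpow M N) g" and N: "N = m + n"
    and "\<And>x y. x \<in> tpow M m \<Longrightarrow> y \<in> tpow M n \<Longrightarrow> f (x \<otimes>\<^bsub>\<T> M\<^esub> y) = g (x \<otimes>\<^bsub>\<T> M\<^esub> y)"
    and "z \<in> tpow M N"
  shows "f z = g z"
proof (rule lin_on_span_eq[OF assms(2,3) subspace_tpow])
  show "z \<in> fs.span {x \<otimes>\<^bsub>\<T> M\<^esub> y | x y. x \<in> tpow M m \<and> y \<in> tpow M n}"
    using assms(6) unfolding N tpow_add_span[OF M] .
qed (use assms tpow_mult[OF M] in auto)

section \<open>Projections to homogeneous components and the degree filtration\<close>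

definition Pd :: "('k::field, 'a) module \<Rightarrow> nat \<Rightarrow> (('a list \<Rightarrow> 'k) \<Rightarrow> 'k) \<Rightarrow> ('a list \<Rightarrow> 'k) \<Rightarrow> 'k" where
  "Pd M n = univ (\<lambda>w. if length w = n then tens M w else 0)"

lemma lin_Pd: "lin (Pd M n)"
  by (simp add: Pd_def lin_univ)

lemma Pd_tens: "Pd M n (tens M w) = (if length w = n then tens M w else 0)"
proof -
  have "mlin M (\<lambda>w. if length w = n then tens M w else 0)"
    by (rule mlin_length) (simp_all only: tens_add tens_smult)
  then show ?thesis unfolding Pd_def by (rule univ_tens)
qed

lemma Pd_tpow: "x \<in> tpow M m \<Longrightarrow> Pd M n x = (if m = n then x else 0)"
proof -
  assume x: "x \<in> tpow M m"
  have l: "lin (\<lambda>x. if m = n then x else 0)" by (auto intro: linI)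
  show ?thesis
  proof (rule lin_span_eq[OF lin_Pd l _ x[unfolded tpow_eq]])
    show "Pd M n x = (if m = n then x else 0)" if "x \<in> tens M ` words M m" for x
      using that by (auto simp: Pd_tens words_def)
  qed
qed

lemma Pd_in: "x \<in> carrier (\<T> M) \<Longrightarrow> Pd M n x \<in> tpow M n"
  unfolding carrier_T
  by (rule lin_span_in[OF lin_Pd _ subspace_tpow, of "tens M ` lists (carrier M)"])
    (auto simp: Pd_tens fs.subspace_0 intro!: tens_tpow')

lemma deg_proj_Pd: "x \<in> carrier (\<T> M) \<Longrightarrow> deg_proj M n x = Pd M n x"
  unfolding deg_proj_def by (rule lin_ext_T[OF lin_Pd]) (auto simp: Pd_tens carrier_T)

definition filt :: "('k::field, 'a) module \<Rightarrow> nat \<Rightarrow> (('a list \<Rightarrow> 'k) \<Rightarrow> 'k) set" where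
  "filt M n = fs.span (\<Union>k\<le>n. tpow M k)"

lemma filt_Pd: "x \<in> filt M n \<Longrightarrow> x = (\<Sum>k\<le>n. Pd M k x)"
proof -
  assume x: "x \<in> filt M n"
  have "lin (\<lambda>x. \<Sum>k\<le>n. Pd M k x)" by (intro lin_sum_fun lin_Pd)
  then show ?thesis
  proof (rule lin_span_eq[OF lin_id(1) _ _ x[unfolded filt_def]])
    fix x assume "x \<in> (\<Union>k\<le>n. tpow M k)"
    then obtain m where "m \<le> n" "x \<in> tpow M m" by blast
    then show "x = (\<Sum>k\<le>n. Pd M k x)" by (simp add: Pd_tpow sum.delta)
  qed
qed

lemma filt_subset: "filt M n \<subseteq> carrier (\<T> M)"
  unfolding filt_def by (rule fs.span_minimal) (auto intro: tpow_in_T)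

lemma subspace_filt [simp]: "fs.subspace (filt M n)" by (simp add: filt_def)

lemma tpow_filt: "k \<le> n \<Longrightarrow> tpow M k \<subseteq> filt M n"
  unfolding filt_def by (auto intro!: fs.span_base)

lemma filt_mono: "m \<le> n \<Longrightarrow> filt M m \<subseteq> filt M n"
  unfolding filt_def by (rule fs.span_mono) (force intro: order_trans)

lemma filt_exists: "x \<in> carrier (\<T> M) \<Longrightarrow> \<exists>n. x \<in> filt M n"
  unfolding carrier_T
proof (induction rule: fs.span_induct_alt)
  case base then show ?case using fs.subspace_0[OF subspace_filt] by blast
next
  case (step k x y)
  then obtain n w where "y \<in> filt M n" "w \<in> lists (carrier M)" "x = tens M w" by blast
  then have "y \<in> filt M (max n (length w))" "x \<in> filt M (max n (length w))"
    using filt_mono[of n "max n (length w)"] tpow_filt[of "length w" "max n (length w)"]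
      tens_tpow'[of w M "length w"] by auto
  then show ?case by (blast intro: fs.subspace_add fs.subspace_scale subspace_filt)
qed

lemma filt_Suc_diff: "x \<in> filt M (Suc n) \<Longrightarrow> x - Pd M (Suc n) x \<in> filt M n"
proof -
  assume x: "x \<in> filt M (Suc n)"
  then have "x - Pd M (Suc n) x = (\<Sum>k\<le>n. Pd M k x)" using filt_Pd[OF x] by (simp add: algebra_simps)
  moreover have "(\<Sum>k\<le>n. Pd M k x) \<in> filt M n"
    using x filt_subset tpow_filt[of _ n M] Pd_in
    by (intro fs.subspace_sum) (auto, blast)
  ultimately show ?thesis by simp
qed

section \<open>Quantum symmetrizers and the Nichols ideal\<close>

locale braided_space =
  fixes s :: "'k::field \<Rightarrow> 'v::ab_group_add \<Rightarrow> 'v" and V :: "('k, 'v) module" and c ::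
      "('k, 'v) T \<Rightarrow> ('k, 'v) T"
  assumes V_def: "V = space_of s" and vs: "vector_space s" and bvs: "braided_vector_space V c"
begin

abbreviation mul (infixl "\<star>" 70) where "x \<star> y \<equiv> x \<otimes>\<^bsub>\<T> V\<^esub> y"
abbreviation tp where "tp n \<equiv> tpow V n"
abbreviation Tc where "Tc \<equiv> carrier (\<T> V)"

lemma carrier_V [simp]: "carrier V = UNIV" by (simp add: V_def space_of_def)

lemma V_simps [simp]: "x \<oplus>\<^bsub>V\<^esub> y = x + y" "\<zero>\<^bsub>V\<^esub> = 0" "k \<odot>\<^bsub>V\<^esub> x = s k x"
  by (simp_all add: V_def space_of_def)

lemma mclosed_V [simp]: "mclosed V" by (simp add: mclosed_def)

lemmas mul_closed = mult_T_closed[OF mclosed_V]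
lemmas mul_assoc = mult_T_assoc[OF mclosed_V]
lemmas mul_tp = tpow_mult[OF mclosed_V]
lemmas mul_left = mult_T_left[where M = V]
lemmas mul_right = mult_T_right(1)[OF mclosed_V] mult_T_scale[OF mclosed_V]
lemmas one_mul = mult_T_one[OF mclosed_V]
lemmas tp_T = tpow_in_T[where M = V]

lemma tp_mul3: "u \<in> tp i \<Longrightarrow> t \<in> tp j \<Longrightarrow> w \<in> tp k \<Longrightarrow> u \<star> (t \<star> w) \<in> tp (i + (j + k))"
  by (intro mul_tp)

lemmas lin_on_intros = lin_on_id lin_on_mulR lin_on_mulL[OF mclosed_V]

lemma tp_eqI:
  assumes "lin_on (tp N) f" "lin_on (tp N) g" "N = m + n"
    and "\<And>x y. x \<in> tp m \<Longrightarrow> y \<in> tp n \<Longrightarrow> f (x \<star> y) = g (x \<star> y)" "z \<in> tp N"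
  shows "f z = g z"
  using tpow_prod_eqI[OF mclosed_V assms] .

lemma c_lin: "lin_on (tp 2) c" and c_tp: "t \<in> tp 2 \<Longrightarrow> c t \<in> tp 2"
proof -
  have *: "linear_on (\<T> V) (tp 2) (\<T> V) c" "c ` tp 2 \<subseteq> tp 2"
    using bvs unfolding braided_vector_space_def by auto
  show "lin_on (tp 2) c" using *(1) unfolding linear_on_def lin_on_def by simp
  show "t \<in> tp 2 \<Longrightarrow> c t \<in> tp 2" using * by auto
qed

lemma sub_prod_tp: "sub_prod (\<T> V) (tp m) (tp n) = tp (m + n)"
  by (simp add: sub_prod_def tpow_add_span)

text \<open>Two nested uses of \<open>tensor_map_ex\<close>. The inner map has to be shown to stay
  in \<open>tp (n - i)\<close> before the outer one can be formed. The formula on products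
  \<open>u t w\<close> determines the operator on \<open>tp n\<close>.\<close>

lemma braid_at_lin:
  assumes "Suc i < n"
  shows "\<exists>L. lin L \<and> (\<forall>x\<in>tp n. braid_at V c n i x = L x) \<and>
    (\<forall>u\<in>tp i. \<forall>t\<in>tp 2. \<forall>w\<in>tp (n - i - 2). L (u \<star> (t \<star> w)) = u \<star> (c t \<star> w))"
proof -
  have n: "n - i = 2 + (n - i - 2)" "n = i + (n - i)" using assms by auto
  let ?I = "tensor_map (\<T> V) (tp 2) (tp (n - i - 2)) c id"
  obtain I where I: "lin I" "\<And>x y. x \<in> tp 2 \<Longrightarrow> y \<in> tp (n - i - 2) \<Longrightarrow> I (x \<star> y) = c x \<star> id y"
    "\<And>t. t \<in> sub_prod (\<T> V) (tp 2) (tp (n - i - 2)) \<Longrightarrow> ?I t = I t"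
    by (rule tensor_map_ex[OF mclosed_V, of "tp 2" 2 "tp (n - i - 2)" "n - i - 2" c id])
      (auto simp: c_lin lin_on_lin intro!: tp_T c_tp)
  have II: "?I t = I t" if "t \<in> tp (n - i)" for t using I(3) that n(1) by (simp add: sub_prod_tp)
  have It: "I t \<in> tp (n - i)" if "t \<in> tp (n - i)" for t
  proof -
    have "t \<in> fs.span {x \<star> y |x y. x \<in> tp 2 \<and> y \<in> tp (n - i - 2)}"
      using that tpow_add_span[OF mclosed_V, of 2 "n - i - 2"] n(1) by simp
    then have "I t \<in> tp (2 + (n - i - 2))"
    proof (rule lin_span_in[OF I(1) _ subspace_tpow, rotated])
      fix z assume "z \<in> {x \<star> y |x y. x \<in> tp 2 \<and> y \<in> tp (n - i - 2)}"
      then obtain x y where xy: "z = x \<star> y" "x \<in> tp 2" "y \<in> tp (n - i - 2)" by blast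
      show "I z \<in> tp (2 + (n - i - 2))" unfolding xy(1) I(2)[OF xy(2,3)] id_apply
          by (intro mul_tp c_tp xy)
    qed
    then show ?thesis using n(1) by simp
  qed
  have lI: "lin_on (tp (n - i)) ?I" using lin_on_cong[OF lin_on_lin[OF I(1)] subspace_tpow] II by metis
  have idT: "id ` tp i \<subseteq> Tc" and IT: "?I ` tp (n - i) \<subseteq> Tc"
    using II It tp_T by (auto simp: image_subset_iff)
  obtain L where L: "lin L" "\<And>x y. x \<in> tp i \<Longrightarrow> y \<in> tp (n - i) \<Longrightarrow> L (x \<star> y) = id x \<star> ?I y"
    "\<And>t. t \<in> sub_prod (\<T> V) (tp i) (tp (n - i)) \<Longrightarrow> tensor_map (\<T> V) (tp i) (tp (n - i)) id ?I t = L t"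
    using tensor_map_ex[OF mclosed_V subspace_tpow order_refl subspace_tpow order_refl lin_on_lin[OF lin_id(2)] idT lI IT]
    by metis
  have "L (u \<star> (t \<star> w)) = u \<star> (c t \<star> w)" if "u \<in> tp i" "t \<in> tp 2" "w \<in> tp (n - i - 2)" for u t w
  proof -
    have "t \<star> w \<in> tp (n - i)" using mul_tp[OF that(2,3)] n(1) by simp
    then show ?thesis using that L(2) II I(2) by simp
  qed
  moreover have "braid_at V c n i x = L x" if "x \<in> tp n" for x
    unfolding braid_at_def using L(3)[of x] that n(2) by (simp add: sub_prod_tp)
  ultimately show ?thesis using L(1) by blast
qed

text \<open>\<open>braid_at\<close> is meaningful on \<open>tp n\<close> only; \<open>braid_op n i\<close> is a linear extension of it to the whole type.\<close>
definition braid_op where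
  "braid_op n i = (SOME L. lin L \<and> (\<forall>x\<in>tp n. braid_at V c n i x = L x) \<and>
    (\<forall>u\<in>tp i. \<forall>t\<in>tp 2. \<forall>w\<in>tp (n - i - 2). L (u \<star> (t \<star> w)) = u \<star> (c t \<star> w)))"

lemma braid_op:
  assumes "Suc i < n"
  shows "lin (braid_op n i)" "x \<in> tp n \<Longrightarrow> braid_at V c n i x = braid_op n i x"
    "u \<in> tp i \<Longrightarrow> t \<in> tp 2 \<Longrightarrow> w \<in> tp k \<Longrightarrow> n = i + 2 + k \<Longrightarrow> braid_op n i (u \<star> (t \<star> w)) = u \<star> (c t \<star> w)"
  using someI_ex[OF braid_at_lin[OF assms]] unfolding braid_op_def[symmetric] by auto

lemma braid_op_on: "Suc i < n \<Longrightarrow> lin_on X g \<Longrightarrow> lin_on X (\<lambda>x. braid_op n i (g x))"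
  by (rule lin_on_comp[OF braid_op(1)])

lemma tp_3eqI:
  assumes f: "lin_on (tp N) f" and g: "lin_on (tp N) g" and N: "N = i + (j + k)"
    and eq: "\<And>u t w. u \<in> tp i \<Longrightarrow> t \<in> tp j \<Longrightarrow> w \<in> tp k \<Longrightarrow>
        f (u \<star> (t \<star> w)) = g (u \<star> (t \<star> w))" and z: "z \<in> tp N"
  shows "f z = g z"
proof (rule tp_eqI[OF f g N _ z])
  fix u y assume u: "u \<in> tp i" and y: "y \<in> tp (j + k)"
  have comp: "lin_on (tp (j + k)) (\<lambda>y. h (u \<star> y))" if h: "lin_on (tp N) h" for h
  proof -
    obtain h' where h': "lin h'" "\<And>x. x \<in> tp N \<Longrightarrow> h' x = h x" using lin_on_extend[OF h subspace_tpow]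
        by blast
    show ?thesis
      by (rule lin_on_cong[of _ "\<lambda>y. h' (u \<star> y)"])
        (use u h' N mul_tp in \<open>auto intro!: lin_on_comp[OF h'(1)] lin_on_intros tp_T\<close>)
  qed
  show "f (u \<star> y) = g (u \<star> y)"
    by (rule tp_eqI[OF comp[OF f] comp[OF g] refl _ y]) (use eq u in auto)
qed

lemma braid_op_tp: "Suc i < n \<Longrightarrow> x \<in> tp n \<Longrightarrow> braid_op n i x \<in> tp n"
proof -
  assume i: "Suc i < n" and x: "x \<in> tp n"
  have n: "n = i + (2 + (n - i - 2))" using i by simp
  \<comment> \<open>Membership in \<open>tp n\<close> is the equation \<open>q x = 0\<close>, so it
    suffices to check it on products \<open>u t w\<close>.\<close>
  obtain q :: "('k, 'v) T \<Rightarrow> ('k, 'v) T" where q: "lin q" "\<And>x. q x = 0 \<longleftrightarrow> x \<in> tp n"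
    using kernel_exists[OF subspace_tpow[of V n]] by metis
  have "q (braid_op n i x) = (\<lambda>_. 0) x"
  proof (rule tp_3eqI[OF lin_on_comp[OF q(1) braid_op_on[OF i lin_on_id]] lin_on_lin[OF lin_zero] n _ x])
    fix u t w assume *: "u \<in> tp i" "t \<in> tp 2" "w \<in> tp (n - i - 2)"
    have "u \<star> (c t \<star> w) \<in> tp n" using tp_mul3[OF *(1) c_tp[OF *(2)] *(3)] by (subst n)
    then show "q (braid_op n i (u \<star> (t \<star> w))) = 0" using braid_op(3)[OF i *] i q by simp
  qed
  then show ?thesis using q by simp
qed

lemma braid_op_right:
  assumes i: "Suc i < n" and x: "x \<in> tp n" and v: "v \<in> tp 1"
  shows "braid_op (Suc n) i (x \<star> v) = braid_op n i x \<star> v"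
proof (rule tp_3eqI[of n "\<lambda>x. braid_op (Suc n) i (x \<star> v)" "\<lambda>x. braid_op n i x \<star> v" i 2 "n - i - 2" x])
  fix u t w assume *: "u \<in> tp i" "t \<in> tp 2" "w \<in> tp (n - i - 2)"
  have T: "u \<in> Tc" "t \<in> Tc" "w \<in> Tc" "v \<in> Tc" "c t \<in> Tc" using * v c_tp tp_T by blast+
  have "braid_op (Suc n) i (u \<star> (t \<star> (w \<star> v))) = u \<star> (c t \<star> (w \<star> v))"
    by (rule braid_op(3)[OF _ *(1,2) mul_tp[OF *(3) v]]) (use i in auto)
  then show "braid_op (Suc n) i (u \<star> (t \<star> w) \<star> v) = braid_op n i (u \<star> (t \<star> w)) \<star> v"
    using braid_op(3)[OF i *] T i by (simp add: mul_assoc mul_closed)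
qed (use i x in \<open>auto intro!: braid_op_on lin_on_intros\<close>)

lemma braid_op_left:
  assumes i: "Suc i < n" and x: "x \<in> tp n" and v: "v \<in> tp 1"
  shows "braid_op (Suc n) (Suc i) (v \<star> x) = v \<star> braid_op n i x"
proof (rule tp_3eqI[of n "\<lambda>x. braid_op (Suc n) (Suc i) (v \<star> x)" "\<lambda>x. v \<star> braid_op n i x" i 2
    "n - i - 2" x])
  fix u t w assume *: "u \<in> tp i" "t \<in> tp 2" "w \<in> tp (n - i - 2)"
  have T: "u \<in> Tc" "t \<in> Tc" "w \<in> Tc" "v \<in> Tc" "c t \<in> Tc" using * v c_tp tp_T by blast+
  have vu: "v \<star> u \<in> tp (Suc i)" using mul_tp[OF v *(1)] by simp
  have "braid_op (Suc n) (Suc i) ((v \<star> u) \<star> (t \<star> w)) = (v \<star> u) \<star> (c t \<star> w)"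
    by (rule braid_op(3)[OF _ vu *(2,3)]) (use i in auto)
  then show "braid_op (Suc n) (Suc i) (v \<star> (u \<star> (t \<star> w))) = v \<star> braid_op n i (u \<star> (t \<star> w))"
    using braid_op(3)[OF i *] T i by (simp add: mul_assoc mul_closed)
qed (use i x v braid_op_tp tp_T[OF braid_op_tp] in \<open>auto intro!: braid_op_on lin_on_intros tp_T\<close>)

text \<open>On a product \<open>u t m t' w\<close> with \<open>t\<close> and \<open>t'\<close> of
  degree two, the operators act on different factors. The two nested reductions lead to such
  products.\<close>

lemma braid_op_far:
  assumes ij: "Suc i < j" "Suc j < n" and x: "x \<in> tp n"
  shows "braid_op n i (braid_op n j x) = braid_op n j (braid_op n i x)"
proof (rule tp_3eqI[of n "\<lambda>x. braid_op n i (braid_op n j x)" "\<lambda>x. braid_op n j (braid_op n i x)" i 2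
    "n - i - 2" x])
  fix u t w0 assume u: "u \<in> tp i" and t: "t \<in> tp 2" and w0: "w0 \<in> tp (n - i - 2)"
  have i: "Suc i < n" using ij by simp
  show "braid_op n i (braid_op n j (u \<star> (t \<star> w0))) = braid_op n j (braid_op n i (u \<star> (t \<star> w0)))"
  proof (rule tp_3eqI[of "n - i - 2" "\<lambda>y. braid_op n i (braid_op n j (u \<star> (t \<star> y)))"
      "\<lambda>y. braid_op n j (braid_op n i (u \<star> (t \<star> y)))"
        "j - i - 2" 2 "n - j - 2", OF _ _ _ _ w0])
    fix m t' w assume *: "m \<in> tp (j - i - 2)" "t' \<in> tp 2" "w \<in> tp (n - j - 2)"
    have T: "u \<in> Tc" "t \<in> Tc" "w \<in> Tc" "m \<in> Tc" "t' \<in> Tc" "c t \<in> Tc" "c t' \<in> Tc"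
      using * u t c_tp tp_T by blast+
    have ct: "c t \<in> tp 2" "c t' \<in> tp 2" using t * c_tp by auto
    have m: "m \<star> (y \<star> w) \<in> tp (n - i - 2)" if "y \<in> tp 2" for y
    proof -
      have "n - i - 2 = (j - i - 2) + (2 + (n - j - 2))" using ij by simp
      then show ?thesis using tp_mul3[OF *(1) that *(3)] by metis
    qed
    have u2: "u \<star> (y \<star> m) \<in> tp j" if "y \<in> tp 2" for y
    proof -
      have "j = i + (2 + (j - i - 2))" using ij by simp
      then show ?thesis using tp_mul3[OF u that *(1)] by metis
    qed
    have Ci: "braid_op n i (u \<star> (t \<star> (m \<star> (y \<star> w)))) = u \<star> (c t \<star> (m \<star> (y \<star> w)))" if "y \<in> tp 2" for y
      by (rule braid_op(3)[OF i u t m[OF that]]) (use ij in auto)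
    have Cj: "braid_op n j (u \<star> (y \<star> (m \<star> (t' \<star> w)))) = u \<star> (y \<star> (m \<star> (c t' \<star> w)))" if "y \<in> tp 2" for y
    proof -
      have "braid_op n j ((u \<star> (y \<star> m)) \<star> (t' \<star> w)) = (u \<star> (y \<star> m)) \<star> (c t' \<star> w)"
        by (rule braid_op(3)[OF _ u2[OF that] *(2,3)]) (use ij in auto)
      then show ?thesis using T tp_T[OF that] by (simp add: mul_assoc mul_closed)
    qed
    show "braid_op n i (braid_op n j (u \<star> (t \<star> (m \<star> (t' \<star> w)))))
        = braid_op n j (braid_op n i (u \<star> (t \<star> (m \<star> (t' \<star> w)))))"
      by (simp add: Ci Cj t * ct)
  qed (use ij i u t tp_T in \<open>auto intro!: braid_op_on lin_on_intros mul_closed\<close>)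
qed (use ij x in \<open>auto intro!: braid_op_on lin_on_intros\<close>)

text \<open>Both operators act within the middle factor of degree three of a product
  \<open>u t w\<close>, as \<open>L1\<close> and \<open>L2\<close>. There the relation is the
  Yang-Baxter equation from \<open>braided_vector_space\<close>.\<close>

lemma braid_op_braid:
  assumes i: "Suc (Suc i) < n" and x: "x \<in> tp n"
  shows "braid_op n i (braid_op n (Suc i) (braid_op n i x))
      = braid_op n (Suc i) (braid_op n i (braid_op n (Suc i) x))"
proof -
  obtain L1 where L1: "lin L1" "\<And>x y. x \<in> tp 2 \<Longrightarrow> y \<in> tp 1 \<Longrightarrow> L1 (x \<star> y) = c x \<star> id y"
    "\<And>t. t \<in> sub_prod (\<T> V) (tp 2) (tp 1) \<Longrightarrow> tensor_map (\<T> V) (tp 2) (tp 1) c id t = L1 t"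
    by (rule tensor_map_ex[OF mclosed_V, of "tp 2" 2
    "tp 1" 1 c id]) (auto simp: c_lin lin_on_lin intro!: tp_T c_tp)
  obtain L2 where L2: "lin L2" "\<And>x y. x \<in> tp 1 \<Longrightarrow> y \<in> tp 2 \<Longrightarrow> L2 (x \<star> y) = id x \<star> c y"
    "\<And>t. t \<in> sub_prod (\<T> V) (tp 1) (tp 2) \<Longrightarrow> tensor_map (\<T> V) (tp 1) (tp 2) id c t = L2 t"
    by (rule tensor_map_ex[OF mclosed_V, of "tp 1" 1
    "tp 2" 2 id c]) (auto simp: c_lin lin_on_lin intro!: tp_T c_tp)
  have sp: "sub_prod (\<T> V) (tp 1) (tp 2) = tp 3" "sub_prod (\<T> V) (tp 2) (tp 1) = tp 3"
    using sub_prod_tp[of 1 2] sub_prod_tp[of 2 1] by (auto simp: numeral_3_eq_3 numeral_2_eq_2)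
  have L1t: "L1 t \<in> tp 3" if t: "t \<in> tp 3" for t
    using t unfolding sp(2)[symmetric] sub_prod_def lspan_T
  proof (rule lin_span_in[OF L1(1), rotated -1])
    fix z assume "z \<in> {x \<star> y |x y. x \<in> tp 2 \<and> y \<in> tp 1}"
    then obtain x y where xy: "z = x \<star> y" "x \<in> tp 2" "y \<in> tp 1" by blast
    have "L1 z = c x \<star> y" unfolding xy(1) L1(2)[OF xy(2,3)] id_apply ..
    then show "L1 z \<in> fs.span {x \<star> y |x y. x \<in> tp 2 \<and> y \<in> tp 1}"
      using c_tp xy by (intro fs.span_base) blast
  qed simp
  have L2t: "L2 t \<in> tp 3" if t: "t \<in> tp 3" for t
    using t unfolding sp(1)[symmetric] sub_prod_def lspan_T
  proof (rule lin_span_in[OF L2(1), rotated -1])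
    fix z assume "z \<in> {x \<star> y |x y. x \<in> tp 1 \<and> y \<in> tp 2}"
    then obtain x y where xy: "z = x \<star> y" "x \<in> tp 1" "y \<in> tp 2" by blast
    have "L2 z = x \<star> c y" unfolding xy(1) L2(2)[OF xy(2,3)] id_apply ..
    then show "L2 z \<in> fs.span {x \<star> y |x y. x \<in> tp 1 \<and> y \<in> tp 2}"
      using c_tp xy by (intro fs.span_base) blast
  qed simp
  have yb: "L1 (L2 (L1 t)) = L2 (L1 (L2 t))" if "t \<in> tp 3" for t
    using bvs that L1t L2t L1(3) L2(3) unfolding braided_vector_space_def sp Let_def by simp
  let ?k = "n - i - 3"
  have n: "n = i + (3 + ?k)" using i by simp
  have C1: "braid_op n i (u \<star> (t \<star> w)) = u \<star> (L1 t \<star> w)" if "u \<in> tp i" "t \<in> tp 3" "w \<in> tp ?k" for u t w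
  proof (rule tp_eqI[of 3 "\<lambda>t. braid_op n i (u \<star> (t \<star> w))" "\<lambda>t. u \<star> (L1 t \<star> w)" 2 1 t])
    fix p q assume p: "p \<in> tp 2" and q: "q \<in> tp 1"
    have T: "u \<in> Tc" "w \<in> Tc" "p \<in> Tc" "q \<in> Tc" "c p \<in> Tc" using that p q c_tp tp_T by blast+
    have "braid_op n i (u \<star> (p \<star> (q \<star> w))) = u \<star> (c p \<star> (q \<star> w))"
      by (rule braid_op(3)[OF _ that(1) p mul_tp[OF q that(3)]]) (use n in auto)
    then show "braid_op n i (u \<star> ((p \<star> q) \<star> w)) = u \<star> (L1 (p \<star> q) \<star> w)"
      using L1(2)[OF p q] T by (simp add: mul_assoc)
  qed (use that i L1t tp_T in \<open>auto intro!: braid_op_on lin_on_intros lin_on_comp[OF L1(1)] mul_closed\<close>)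
  have C2: "braid_op n (Suc i) (u \<star> (t \<star> w)) = u \<star> (L2 t \<star> w)" if "u \<in> tp i" "t \<in> tp 3" "w \<in> tp ?k"
      for u t w
  proof (rule tp_eqI[of 3 "\<lambda>t. braid_op n (Suc i) (u \<star> (t \<star> w))" "\<lambda>t. u \<star> (L2 t \<star> w)" 1 2 t])
    fix q p assume q: "q \<in> tp 1" and p: "p \<in> tp 2"
    have T: "u \<in> Tc" "w \<in> Tc" "p \<in> Tc" "q \<in> Tc" "c p \<in> Tc" using that p q c_tp tp_T by blast+
    have uq: "u \<star> q \<in> tp (Suc i)" using mul_tp[OF that(1) q] by simp
    have "braid_op n (Suc i) ((u \<star> q) \<star> (p \<star> w)) = (u \<star> q) \<star> (c p \<star> w)"
      by (rule braid_op(3)[OF _ uq p that(3)]) (use n i in auto)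
    then show "braid_op n (Suc i) (u \<star> ((q \<star> p) \<star> w)) = u \<star> (L2 (q \<star> p) \<star> w)"
      using L2(2)[OF q p] T by (simp add: mul_assoc mul_closed)
  qed (use that i L2t tp_T in \<open>auto intro!: braid_op_on lin_on_intros lin_on_comp[OF L2(1)] mul_closed\<close>)
  show ?thesis
    by (rule tp_3eqI[of n "\<lambda>x. braid_op n i (braid_op n (Suc i) (braid_op n i x))"
    "\<lambda>x. braid_op n (Suc i) (braid_op n i (braid_op n (Suc i) x))" i 3 ?k x])
      (use n x i in \<open>auto simp: C1 C2 L1t L2t yb intro!: braid_op_on lin_on_intros\<close>)
qed

sublocale br: braid_ops "braid_op n" "tp n" n for n
  by unfold_locales (auto intro: braid_op_tp braid_op_braid braid_op_far)

lemma opw_lin: "valid n w \<Longrightarrow> lin (opw (braid_op n) w)"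
proof (induction w)
  case Nil
  have "opw (braid_op n) [] = (\<lambda>x. x)" by auto
  then show ?case by (simp only: lin_id)
next
  case (Cons i w)
  have "opw (braid_op n) (i # w) = (\<lambda>x. braid_op n i (opw (braid_op n) w x))" by auto
  moreover have "lin (\<lambda>x. braid_op n i (opw (braid_op n) w x))" using Cons
      by (intro lin_comp[OF braid_op(1)]) auto
  ultimately show ?case by (simp only:)
qed

lemma opw_right: "valid n w \<Longrightarrow> x \<in> tp n \<Longrightarrow> v \<in> tp 1 \<Longrightarrow>
    opw (braid_op (Suc n)) w (x \<star> v) = opw (braid_op n) w x \<star> v"
  by (induction w) (auto simp: braid_op_right br.opw_closed)

lemma opw_left: "valid n w \<Longrightarrow> x \<in> tp n \<Longrightarrow> v \<in> tp 1 \<Longrightarrow>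
    opw (braid_op (Suc n)) (map Suc w) (v \<star> x) = v \<star> opw (braid_op n) w x"
  by (induction w) (auto simp: braid_op_left br.opw_closed)

section \<open>Quantum symmetrizers and their recursions\<close>

lemma valid_red: "\<sigma> \<in> perms n \<Longrightarrow> valid n (reduced_word n \<sigma>)"
  using reduced_word_reduced(1)[of \<sigma> n] by (simp add: reduced_def)

definition qsym where "qsym n x = (\<Sum>\<sigma>\<in>perms n. opw (braid_op n) (reduced_word n \<sigma>) x)"

lemma lin_qsym: "lin (qsym n)"
proof -
  have "lin (\<lambda>x. \<Sum>\<sigma>\<in>perms n. opw (braid_op n) (reduced_word n \<sigma>) x)"
    by (intro lin_sum_fun) (metis opw_lin valid_red eta_contract_eq)
  then show ?thesis by (simp add: qsym_def[abs_def])
qed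

lemma qsym_tp: "x \<in> tp n \<Longrightarrow> qsym n x \<in> tp n"
  unfolding qsym_def by (intro fs.subspace_sum subspace_tpow br.opw_closed valid_red)

lemma qsym_small:
  shows "qsym 0 x = x" "qsym 1 x = x"
proof -
  have *: "perms 0 = {id}" "perms 1 = {id}" by (auto simp: lessThan_Suc)
  have "reduced_word n id = []" for n
    using reduced_word_reduced[of id n] by (simp add: reduced_def permutes_id)
  then show "qsym 0 x = x" "qsym 1 x = x" unfolding qsym_def * by simp_all
qed

text \<open>
  The words \<open>[m-1, \<dots>, j]\<close> are reduced words of the shortest representatives of the cosets of
  \<open>S\<^sub>m\<close> in \<open>S\<^bsub>m+1\<^esub>\<close>.
\<close>
definition coset_sum where "coset_sum m x = (\<Sum>j\<le>m. opw (braid_op (Suc m)) (rev [j..<m]) x)"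

lemma lin_coset_sum: "lin (coset_sum m)"
proof -
  have "lin (\<lambda>x. \<Sum>j\<le>m. opw (braid_op (Suc m)) (rev [j..<m]) x)"
  proof (rule lin_sum_fun)
    fix j
    have "lin (opw (braid_op (Suc m)) (rev [j..<m]))" by (rule opw_lin) (auto simp: valid_def)
    then show "lin (\<lambda>x. opw (braid_op (Suc m)) (rev [j..<m]) x)" by (simp only: eta_contract_eq)
  qed
  then show ?thesis by (simp add: coset_sum_def[abs_def])
qed

lemma coset_sum_tp: "x \<in> tp (Suc m) \<Longrightarrow> coset_sum m x \<in> tp (Suc m)"
  unfolding coset_sum_def by (intro fs.subspace_sum subspace_tpow br.opw_closed) (auto simp: valid_def)

lemma coset_sum_0: "coset_sum 0 x = x" by (simp add: coset_sum_def)

text \<open>The summand \<open>j = m + 1\<close> is the empty word. Every other word starts with the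
  letter \<open>m\<close>, and its remaining letters act on \<open>x\<close> alone. The
  comultiplication will be seen to follow the same recursion.\<close>

lemma coset_sum_Suc:
  assumes x: "x \<in> tp (Suc m)" and v: "v \<in> tp 1"
  shows "coset_sum (Suc m) (x \<star> v) = x \<star> v + braid_op (Suc (Suc m)) m (coset_sum m x \<star> v)"
proof -
  have val: "valid (Suc m) (rev [j..<m])" for j by (auto simp: valid_def)
  have "opw (braid_op (Suc (Suc m))) (rev [j..<Suc m]) (x \<star> v) =
      braid_op (Suc (Suc m)) m (opw (braid_op (Suc m)) (rev [j..<m]) x \<star> v)" if "j \<le> m" for j
    using opw_right[OF val x v] that by simp
  then have "coset_sum (Suc m) (x \<star> v)
      = x \<star> v + (\<Sum>j\<le>m. braid_op (Suc (Suc m)) m (opw (braid_op (Suc m)) (rev [j..<m]) x \<star> v))"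
    unfolding coset_sum_def by (simp add: add.commute)
  also have "(\<Sum>j\<le>m. braid_op (Suc (Suc m)) m (opw (braid_op (Suc m)) (rev [j..<m]) x \<star> v))
      = braid_op (Suc (Suc m)) m (coset_sum m x \<star> v)"
  proof -
    have "(\<Sum>j\<in>A. g j) \<star> v = (\<Sum>j\<in>A. g j \<star> v)" if "finite A" for g :: "nat \<Rightarrow> ('k, 'v) T" and A
      using that by (induction rule: finite_induct) (auto simp: mul_left)
    then show ?thesis unfolding coset_sum_def by (simp add: lin_sum[OF braid_op(1)])
  qed
  finally show ?thesis .
qed

text \<open>The coset representatives act first and add up to \<open>coset_sum\<close>; what is left
  are the permutations of the first \<open>m\<close> positions.\<close>

lemma qsym_right: "x \<in> tp (Suc m) \<Longrightarrow>
    qsym (Suc m) x = (\<Sum>\<sigma>\<in>perms m. opw (braid_op (Suc m)) (reduced_word m \<sigma>) (coset_sum m x))"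
proof -
  assume x: "x \<in> tp (Suc m)"
  have "qsym (Suc m) x = (\<Sum>j\<le>m. \<Sum>\<sigma>\<in>perms m. opw (braid_op (Suc m)) (reduced_word m \<sigma>) (opw (braid_op
      (Suc m)) (rev [j..<m]) x))"
    unfolding qsym_def by (rule br.opw_sum_right[OF refl x, where f = "\<lambda>x. x"])
  also have "\<dots> = (\<Sum>\<sigma>\<in>perms m. \<Sum>j\<le>m. opw (braid_op (Suc m)) (reduced_word m \<sigma>) (opw (braid_op (Suc m)) (rev [j..<m]) x))"
    by (rule sum.swap)
  also have "\<dots> = (\<Sum>\<sigma>\<in>perms m. opw (braid_op (Suc m)) (reduced_word m \<sigma>) (coset_sum m x))"
  proof (rule sum.cong[OF refl])
    fix \<sigma> assume "\<sigma> \<in> perms m"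
    then have "valid (Suc m) (reduced_word m \<sigma>)" using valid_red[of \<sigma> m] by (auto simp: valid_def)
    from lin_sum[OF opw_lin[OF this], of "\<lambda>j. opw (braid_op (Suc m)) (rev [j..<m]) x" "{..m}"]
    show "(\<Sum>j\<le>m. opw (braid_op (Suc m)) (reduced_word m \<sigma>) (opw (braid_op (Suc m)) (rev [j..<m]) x)) =
      opw (braid_op (Suc m)) (reduced_word m \<sigma>) (coset_sum m x)" by (simp add: coset_sum_def)
  qed
  finally show ?thesis .
qed

lemma mul_sum_left: "(\<Sum>j\<in>A. g j) \<star> v = (\<Sum>j\<in>A. g j \<star> v)"
  by (induction A rule: infinite_finite_induct) (auto simp: mul_left)

lemma mul_sum_right: "u \<in> Tc \<Longrightarrow> (\<And>j. j \<in> A \<Longrightarrow> g j \<in> Tc) \<Longrightarrow> u \<star> (\<Sum>j\<in>A. g j) = (\<Sum>j\<in>A. u \<star> g j)"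
proof (induction A rule: infinite_finite_induct)
  case (insert a A)
  then show ?case by (simp add: mul_right fs.subspace_sum)
qed (use mul_right(2)[of u 0 0] in \<open>auto simp: fs.subspace_0\<close>)

text \<open>Once the coset sum is written with last letters \<open>e\<close>, the permutations of
  the first \<open>m\<close> positions act on the factors \<open>z e\<close> only and add up to the
  symmetrizer of degree \<open>m\<close>.\<close>

lemma qsym_eq_0_right:
  assumes x: "x \<in> tp (Suc m)" and Y: "coset_sum m x = (\<Sum>e\<in>F. z e \<star> e)" and F: "F \<subseteq> tp 1"
    and z: "\<And>e. e \<in> F \<Longrightarrow> z e \<in> tp m \<and> qsym m (z e) = 0"
  shows "qsym (Suc m) x = 0"
proof -
  have "qsym (Suc m) x = (\<Sum>\<sigma>\<in>perms m. \<Sum>e\<in>F. opw (braid_op m) (reduced_word m \<sigma>) (z e) \<star> e)"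
    unfolding qsym_right[OF x] Y
  proof (rule sum.cong[OF refl])
    fix \<sigma> assume s: "\<sigma> \<in> perms m"
    then have "valid (Suc m) (reduced_word m \<sigma>)" using valid_red[of \<sigma> m] by (auto simp: valid_def)
    from lin_sum[OF opw_lin[OF this], of "\<lambda>e. z e \<star> e" F]
    show "opw (braid_op (Suc m)) (reduced_word m \<sigma>) (\<Sum>e\<in>F. z e \<star> e)
        = (\<Sum>e\<in>F. opw (braid_op m) (reduced_word m \<sigma>) (z e) \<star> e)"
      using opw_right[OF valid_red[OF s]] z F by (auto intro!: sum.cong)
  qed
  also have "\<dots> = (\<Sum>e\<in>F. qsym m (z e) \<star> e)"
    unfolding sum.swap[of _ F] by (simp add: qsym_def mul_sum_left)
  finally show ?thesis using z by (simp add: mul_left)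
qed

lemma qsym_left:
  assumes x: "x \<in> tp m" and v: "v \<in> tp 1"
  shows "qsym (Suc m) (x \<star> v) = (\<Sum>j\<le>m. opw (braid_op (Suc m)) [j..<m] (qsym m x \<star> v))"
proof -
  have xv: "x \<star> v \<in> tp (Suc m)" using mul_tp[OF x v] by simp
  have "qsym (Suc m) (x \<star> v) = (\<Sum>j\<le>m. \<Sum>\<sigma>\<in>perms m. opw (braid_op (Suc m)) [j..<m] (opw (braid_op (Suc
      m)) (reduced_word m \<sigma>) (x \<star> v)))"
    unfolding qsym_def by (rule br.opw_sum_left[OF refl xv, where f = "\<lambda>x. x"])
  also have "\<dots> = (\<Sum>j\<le>m. opw (braid_op (Suc m)) [j..<m] (qsym m x \<star> v))"
  proof (rule sum.cong[OF refl])
    fix j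
    have "lin (opw (braid_op (Suc m)) [j..<m])" by (rule opw_lin) (auto simp: valid_def)
    from lin_sum[OF this, of "\<lambda>\<sigma>. opw (braid_op m) (reduced_word m \<sigma>) x \<star> v" "perms m"]
    show "(\<Sum>\<sigma>\<in>perms m. opw (braid_op (Suc m)) [j..<m] (opw (braid_op (Suc m)) (reduced_word m \<sigma>) (x \<star> v))) =
        opw (braid_op (Suc m)) [j..<m] (qsym m x \<star> v)"
      using opw_right[OF valid_red x v] by (simp add: qsym_def mul_sum_left)
  qed
  finally show ?thesis .
qed

lemma qsym_left_shift:
  assumes x: "x \<in> tp m" and v: "v \<in> tp 1"
  shows "qsym (Suc m) (v \<star> x) = (\<Sum>j\<le>m. opw (braid_op (Suc m)) (rev [0..<j]) (v \<star> qsym m x))"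
proof -
  have xv: "v \<star> x \<in> tp (Suc m)" using mul_tp[OF v x] by simp
  have "qsym (Suc m) (v \<star> x) = (\<Sum>j\<le>m. \<Sum>\<sigma>\<in>perms m. opw (braid_op (Suc m)) (rev [0..<j]) (opw
      (braid_op (Suc m)) (map Suc (reduced_word m \<sigma>)) (v \<star> x)))"
    unfolding qsym_def by (rule br.opw_sum_left_shift[OF refl xv, where f = "\<lambda>x. x"])
  also have "\<dots> = (\<Sum>j\<le>m. opw (braid_op (Suc m)) (rev [0..<j]) (v \<star> qsym m x))"
  proof (rule sum.cong[OF refl])
    fix j assume "j \<in> {..m}"
    then have "lin (opw (braid_op (Suc m)) (rev [0..<j]))" by (intro opw_lin) (auto simp: valid_def)
    from lin_sum[OF this, of "\<lambda>\<sigma>. v \<star> opw (braid_op m) (reduced_word m \<sigma>) x" "perms m"]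
    show "(\<Sum>\<sigma>\<in>perms m. opw (braid_op (Suc m)) (rev [0..<j]) (opw (braid_op (Suc m)) (map Suc (reduced_word m \<sigma>)) (v \<star> x))) =
        opw (braid_op (Suc m)) (rev [0..<j]) (v \<star> qsym m x)"
      using opw_left[OF valid_red x v] mul_sum_right[OF tp_T[OF v], of "perms m"
      "\<lambda>\<sigma>. opw (braid_op m) (reduced_word m \<sigma>) x"]
        tp_T[OF br.opw_closed[OF valid_red x]]
      by (simp add: qsym_def)
  qed
  finally show ?thesis .
qed

section \<open>The Nichols ideal as the kernel of a linear map of the whole type\<close>

definition qshuffle where "qshuffle = univ (\<lambda>w. qsym (length w) (tens V w))"

lemma lin_qshuffle: "lin qshuffle" by (simp add: qshuffle_def lin_univ)

lemma mlin_lin: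
  assumes "\<And>n. lin (f n)"
  shows "mlin V (\<lambda>w. f (length w) (tens V w))"
proof (rule mlinI)
  fix us ws x y assume *: "us \<in> lists (carrier V)" "ws \<in> lists (carrier V)" "x \<in> carrier V"
      "y \<in> carrier V"
  show "f (length (us @ [x \<oplus>\<^bsub>V\<^esub> y] @ ws)) (tens V (us @ [x \<oplus>\<^bsub>V\<^esub> y] @ ws)) =
    f (length (us @ [x] @ ws)) (tens V (us @ [x] @ ws)) + f (length (us @ [y] @ ws)) (tens V (us @ [y] @ ws))"
    unfolding tens_add[OF *] lin_add[OF assms] by simp
next
  fix us ws x k assume *: "us \<in> lists (carrier V)" "ws \<in> lists (carrier V)" "x \<in> carrier V"
  show "f (length (us @ [k \<odot>\<^bsub>V\<^esub> x] @ ws)) (tens V (us @ [k \<odot>\<^bsub>V\<^esub> x] @ ws)) =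
    fscale k (f (length (us @ [x] @ ws)) (tens V (us @ [x] @ ws)))"
    unfolding tens_smult[OF *] lin_scale[OF assms] by simp
qed

lemma qshuffle_tens: "qshuffle (tens V w) = qsym (length w) (tens V w)"
  unfolding qshuffle_def by (rule univ_tens) (rule mlin_lin[OF lin_qsym])

lemma words_V: "words V n = {w. length w = n}" by (simp add: words_def)

lemma qshuffle_tp: "x \<in> tp n \<Longrightarrow> qshuffle x = qsym n x"
  unfolding tpow_eq by (erule lin_span_eq[OF lin_qshuffle lin_qsym, rotated]) (auto simp: qshuffle_tens words_V)

lemma Tc_eq: "Tc = fs.span (range (tens V))" by (simp add: carrier_T)

lemma finsum_T: "finite A \<Longrightarrow> (\<And>a. a \<in> A \<Longrightarrow> f a \<in> Tc) \<Longrightarrow> finsum (\<T> V) f A = sum f A"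
proof (induction A rule: finite_induct)
  case empty
  interpret ring "\<T> V" by (rule ring_T) simp
  show ?case by simp
next
  case (insert a A)
  interpret ring "\<T> V" by (rule ring_T) simp
  show ?case using insert by (subst finsum_insert) auto
qed

lemma quantum_symmetrizer_eq: "x \<in> tp n \<Longrightarrow> quantum_symmetrizer V c n x = qsym n x"
proof -
  assume x: "x \<in> tp n"
  have eq: "valid n w \<Longrightarrow> foldr (\<lambda>i f. braid_at V c n i \<circ> f) w id x = opw (braid_op n) w x" for w
    by (induction w) (auto simp: braid_op(2) br.opw_closed[OF _ x])
  have bp: "braid_perm V c n \<sigma> x = opw (braid_op n) (reduced_word n \<sigma>) x" if "\<sigma> \<in> perms n" for \<sigma>
    unfolding braid_perm_def using eq[OF valid_red[OF that]] .
  have "quantum_symmetrizer V c n x = (\<Sum>\<sigma>\<in>perms n. braid_perm V c n \<sigma> x)"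
    unfolding quantum_symmetrizer_def
    by (rule finsum_T) (auto simp: finite_permutations bp intro!: tp_T br.opw_closed valid_red x)
  then show ?thesis using bp by (simp add: qsym_def)
qed

lemma Gamma_map_eq: "x \<in> Tc \<Longrightarrow> Gamma_map V c x = qshuffle x"
  unfolding Gamma_map_def
  by (rule lin_ext_T[OF lin_qshuffle]) (auto simp: qshuffle_tens Tc_eq quantum_symmetrizer_eq tens_tpow' words_V)

definition J where "J = {x \<in> Tc. qshuffle x = 0}"

lemma Nichols_ideal_eq: "Nichols_ideal V c = J"
  by (auto simp: Nichols_ideal_def J_def Gamma_map_eq)

lemma subspace_J: "fs.subspace J"
  unfolding J_def by (intro fs.subspaceI) (auto simp: lin_rules[OF lin_qshuffle] fs.subspace_add
      fs.subspace_scale fs.subspace_0)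

lemma tens_Tc [simp]: "tens V w \<in> Tc"
  by (rule tens_in_T) simp

text \<open>By \<open>qsym_left\<close>, the image of \<open>x v\<close> arises from the product of
  \<open>qshuffle x\<close> and \<open>v\<close> by a fixed linear operator, so it vanishes together
  with \<open>qshuffle x\<close>. Elements of \<open>J\<close> need not be homogeneous; therefore
  the operators of the single degrees are glued to one linear map \<open>A\<close>.\<close>

lemma J_mul_right:
  assumes x: "x \<in> J" and v: "v \<in> tp 1"
  shows "x \<star> v \<in> J"
proof -
  \<comment> \<open>\<open>n\<close> is the degree after multiplication by \<open>v\<close>, so the
    coset index runs up to \<open>n - 1\<close>. In degree zero the truncated difference leaves the
    empty word, which does no harm.\<close>
  define f where "f n = (\<lambda>x. \<Sum>j\<le>n-1. opw (braid_op n) [j..<n-1] x)" for n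
  have "lin (f n)" for n unfolding f_def
  proof (rule lin_sum_fun)
    fix j
    have "lin (opw (braid_op n) [j..<n-1])" by (rule opw_lin) (auto simp: valid_def)
    then show "lin (\<lambda>x. opw (braid_op n) [j..<n-1] x)" by (simp only: eta_contract_eq)
  qed
  note fl = this
  define A where "A = univ (\<lambda>w. f (length w) (tens V w))"
  have A: "lin A" "A (tens V w) = f (length w) (tens V w)" for w
    unfolding A_def by (rule lin_univ, rule univ_tens[OF mlin_lin[OF fl]])
  have At: "A x = f n x" if "x \<in> tp n" for x n
    using that unfolding tpow_eq by (rule lin_span_eq[OF A(1) fl, rotated]) (auto simp: A words_V)
  have "qshuffle (x \<star> v) = A (qshuffle x \<star> v)" if "x \<in> Tc" for x
  proof (rule lin_on_span_eq[where X = Tc and f = "\<lambda>x. qshuffle (x \<star> v)" and g =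
      "\<lambda>x. A (qshuffle x \<star> v)" and S = "range (tens V)" and t = x])
    show "x \<in> fs.span (range (tens V))" using that by (simp add: Tc_eq)
    fix x assume "x \<in> range (tens V)"
    then obtain w where w: "x = tens V w" by blast
    have x: "x \<in> tp (length w)" unfolding w by (rule tens_tpow') auto
    have xv: "x \<star> v \<in> tp (Suc (length w))" "qshuffle x \<star> v \<in> tp (Suc (length w))"
      using mul_tp[OF x v] mul_tp[OF qsym_tp[OF x] v] by (simp_all add: qshuffle_tp[OF x])
    show "qshuffle (x \<star> v) = A (qshuffle x \<star> v)"
      unfolding qshuffle_tp[OF xv(1)] At[OF xv(2)] qsym_left[OF x v] f_def
          by (simp add: qshuffle_tp[OF x])
  qed (auto intro!: lin_on_comp[OF lin_qshuffle] lin_on_comp[OF A(1)] lin_on_intros lin_on_lin[OF lin_qshuffle] tens_in_T)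
  then show ?thesis using x v by (auto simp: J_def mul_left lin_0[OF A(1)] intro!: mul_closed tp_T[OF v])
qed

text \<open>The same argument with \<open>qsym_left_shift\<close>: the new letter stands in position
  \<open>0\<close>, and the words for \<open>x\<close> are shifted by one.\<close>

lemma J_mul_left:
  assumes x: "x \<in> J" and v: "v \<in> tp 1"
  shows "v \<star> x \<in> J"
proof -
  define f where "f n = (\<lambda>x. \<Sum>j\<in>{..n-1}\<inter>{..<n}. opw (braid_op n) (rev [0..<j]) x)" for n
  have "lin (f n)" for n unfolding f_def
  proof (rule lin_sum_fun)
    fix j assume "j \<in> {..n-1} \<inter> {..<n}"
    then have "lin (opw (braid_op n) (rev [0..<j]))" by (intro opw_lin) (auto simp: valid_def)
    then show "lin (\<lambda>x. opw (braid_op n) (rev [0..<j]) x)" by (simp only: eta_contract_eq)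
  qed
  note fl = this
  define A where "A = univ (\<lambda>w. f (length w) (tens V w))"
  have A: "lin A" "A (tens V w) = f (length w) (tens V w)" for w
    unfolding A_def by (rule lin_univ, rule univ_tens[OF mlin_lin[OF fl]])
  have At: "A x = f n x" if "x \<in> tp n" for x n
    using that unfolding tpow_eq by (rule lin_span_eq[OF A(1) fl, rotated]) (auto simp: A words_V)
  have GT: "qshuffle x \<in> Tc" if "x \<in> Tc" for x
    using that unfolding Tc_eq
    by (rule lin_span_in[OF lin_qshuffle, rotated -1]) (auto simp: qshuffle_tens Tc_eq[symmetric]
    intro!: tp_T[OF qsym_tp[OF tens_tpow'[OF _ refl]]])
  have "qshuffle (v \<star> x) = A (v \<star> qshuffle x)" if "x \<in> Tc" for x
  proof (rule lin_on_span_eq[where X = Tc and f = "\<lambda>x. qshuffle (v \<star> x)" and g =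
      "\<lambda>x. A (v \<star> qshuffle x)" and S = "range (tens V)" and t = x])
    show "x \<in> fs.span (range (tens V))" using that by (simp add: Tc_eq)
    fix x assume "x \<in> range (tens V)"
    then obtain w where w: "x = tens V w" by blast
    have x: "x \<in> tp (length w)" unfolding w by (rule tens_tpow') auto
    have xv: "v \<star> x \<in> tp (Suc (length w))" "v \<star> qshuffle x \<in> tp (Suc (length w))"
      using mul_tp[OF v x] mul_tp[OF v qsym_tp[OF x]] by (simp_all add: qshuffle_tp[OF x])
    have "{..length w} \<inter> {..<Suc (length w)} = {..length w}" by auto
    then show "qshuffle (v \<star> x) = A (v \<star> qshuffle x)"
      unfolding qshuffle_tp[OF xv(1)] At[OF xv(2)] qsym_left_shift[OF x v] f_def
          by (simp add: qshuffle_tp[OF x])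
  qed (auto intro!: lin_on_comp[OF lin_qshuffle] lin_on_comp[OF A(1)] lin_on_intros lin_on_lin[OF
      lin_qshuffle] tens_in_T GT tp_T[OF v])
  moreover have "v \<star> 0 = 0" using mul_right(2)[of v 0 0] tp_T[OF v] by (simp add: fs.subspace_0)
  ultimately show ?thesis using x v by (auto simp: J_def lin_0[OF A(1)] intro!: mul_closed tp_T[OF v])
qed

lemma tens_Cons: "tens V (x # w) = tens V [x] \<star> tens V w"
  by simp

lemma tens1_tp: "tens V [x] \<in> tp 1"
  by (rule tens_tpow') auto

text \<open>The tensor algebra is generated by its degree-one part, so absorption has to be checked
  for vectors only; products with words follow by induction on the word.\<close>

lemma ideal_from_generators:
  assumes I: "fs.subspace I" "I \<subseteq> Tc"
    and l: "\<And>x v. x \<in> I \<Longrightarrow> v \<in> tp 1 \<Longrightarrow> v \<star> x \<in> I" and r: "\<And>x v. x \<in> I \<Longrightarrow> v \<in> tp 1 \<Longrightarrow> x \<star> v \<in> I"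
  shows "ideal I (\<T> V)"
proof -
  interpret ring "\<T> V" by (rule ring_T) simp
  have l': "tens V w \<star> x \<in> I" if "x \<in> I" for x w
  proof (induction w)
    case Nil then show ?case using one_mul(1) that I by auto
  next
    case (Cons a w)
    have "tens V (a # w) \<star> x = tens V [a] \<star> (tens V w \<star> x)"
      unfolding tens_Cons[of a w] using that I by (intro mul_assoc tens_in_T) auto
    then show ?case using l[OF Cons tens1_tp] by simp
  qed
  have r': "x \<star> tens V w \<in> I" if "x \<in> I" for x w
    using that
  proof (induction w arbitrary: x)
    case Nil then show ?case using one_mul(2) I by auto
  next
    case (Cons a w)
    have "x \<star> tens V (a # w) = (x \<star> tens V [a]) \<star> tens V w"
      unfolding tens_Cons[of a w] using Cons.prems I by (intro mul_assoc[symmetric] tens_in_T) auto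
    then show ?case using Cons.IH[OF r[OF Cons.prems tens1_tp]] by simp
  qed
  show ?thesis
  proof (rule idealI)
    show "ring (\<T> V)" by (rule ring_T) simp
    have inv: "\<ominus>\<^bsub>\<T> V\<^esub> x = - x" if "x \<in> I" for x
      by (rule minus_equality) (use that I fs.subspace_neg in auto)
    show "subgroup I (add_monoid (\<T> V))"
    proof (rule group.subgroupI[OF a_group])
      show "I \<subseteq> carrier (add_monoid (\<T> V))" using I by simp
      show "I \<noteq> {}" using fs.subspace_0[OF I(1)] by blast
      show "inv\<^bsub>add_monoid (\<T> V)\<^esub> a \<in> I" if "a \<in> I" for a
        using inv[OF that] fs.subspace_neg[OF I(1) that] unfolding a_inv_def by simp
      show "a \<otimes>\<^bsub>add_monoid (\<T> V)\<^esub> b \<in> I" if "a \<in> I" "b \<in> I" for a b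
        using fs.subspace_add[OF I(1) that] by simp
    qed
  next
    fix a x assume a: "a \<in> I" and x: "x \<in> Tc"
    show "x \<star> a \<in> I"
      using x unfolding Tc_eq
    proof (induction rule: fs.span_induct_alt)
      case base then show ?case using I by (simp add: mul_left fs.subspace_0)
    next
      case (step k y z) then show ?case using l' a I
          by (auto simp: mul_left intro!: fs.subspace_add fs.subspace_scale)
    qed
    obtain h where h: "lin h" "\<And>x. x \<in> Tc \<Longrightarrow> h x = a \<star> x"
      using lin_on_extend[of Tc "\<lambda>x. a \<star> x"] lin_on_mulL[OF mclosed_V lin_on_id, of Tc a] a I by auto
    have "h x \<in> I" using x unfolding Tc_eq
      by (rule lin_span_in[OF h(1) _ I(1), rotated]) (use h(2) r' a in auto)
    then show "a \<star> x \<in> I" using h(2) x by simp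
  qed
qed

lemma ideal_J: "ideal J (\<T> V)"
  by (rule ideal_from_generators[OF subspace_J _ J_mul_left J_mul_right]) (auto simp: J_def)

lemma J_tp: "x \<in> tp n \<Longrightarrow> x \<in> J \<longleftrightarrow> qsym n x = 0"
  using tp_T by (auto simp: J_def qshuffle_tp)

lemma J_tp_small: "x \<in> tp 0 \<union> tp 1 \<Longrightarrow> x \<in> J \<Longrightarrow> x = 0"
  using J_tp[of x 0] J_tp[of x 1] qsym_small by auto

lemma braid_op_2: "x \<in> tp 2 \<Longrightarrow> braid_op 2 0 x = c x"
proof -
  assume x: "x \<in> tp 2"
  have e: "tens V [] \<in> tp 0" by (rule tens_tpow') auto
  have "braid_op 2 0 (tens V [] \<star> (x \<star> tens V [])) = tens V [] \<star> (c x \<star> tens V [])"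
    by (rule braid_op(3)[OF _ e x e]) auto
  then show ?thesis using one_mul x c_tp tp_T by (metis (no_types))
qed

text \<open>In degree two the symmetrizer is \<open>c + Id\<close>. With \<open>E2_iff\<close> this
  identifies the quadratic part of the Nichols ideal with \<open>E2\<close>.\<close>

lemma J_tp2: "x \<in> tp 2 \<Longrightarrow> x \<in> J \<longleftrightarrow> c x = - x"
proof -
  assume x: "x \<in> tp 2"
  have p: "perms 1 = {id}" by (auto simp: lessThan_Suc)
  have r: "reduced_word 1 id = []"
    using reduced_word_reduced[of id 1] by (simp add: reduced_def permutes_id)
  have x': "x \<in> tp (Suc 1)" using x by (simp add: numeral_2_eq_2)
  have "qsym (Suc 1) x = coset_sum 1 x" unfolding qsym_right[OF x'] p using r by simp
  also have "\<dots> = braid_op 2 0 x + x" by (simp add: coset_sum_def numeral_2_eq_2)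
  finally have "qsym 2 x = c x + x" using braid_op_2[OF x] by (simp add: numeral_2_eq_2)
  then show ?thesis using J_tp[OF x] by (simp add: eq_neg_iff_add_eq_0)
qed

end

section \<open>The braided bialgebra on the tensor algebra\<close>

text \<open>Keeps the simplifier from rewriting \<open>tpow V 1\<close> to \<open>tpow V (Suc 0)\<close>.\<close>
declare One_nat_def [simp del]

section \<open>Linear extensions of tensor products of maps\<close>

definition TM where
  "TM M i j f g = (SOME L. lin L \<and> (\<forall>x\<in>tpow M i. \<forall>y\<in>tpow M j. L (x \<otimes>\<^bsub>\<T> M\<^esub> y) = f x \<otimes>\<^bsub>\<T> M\<^esub> g y) \<and>
    (\<forall>t\<in>tpow M (i + j). tensor_map (\<T> M) (tpow M i) (tpow M j) f g t = L t))"

text \<open>\<open>tensor_map\<close> is meaningful on the span of the products only.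
  \<open>TM\<close> selects a linear map of the whole type that agrees with it there, so that it can
  be moved through sums and composed freely.\<close>

lemma TM:
  assumes M: "mclosed M" and f: "lin_on (tpow M i) f" "f ` tpow M i \<subseteq> carrier (\<T> M)"
    and g: "lin_on (tpow M j) g" "g ` tpow M j \<subseteq> carrier (\<T> M)"
  shows "lin (TM M i j f g)" "\<And>x y. x \<in> tpow M i \<Longrightarrow> y \<in> tpow M j \<Longrightarrow>
      TM M i j f g (x \<otimes>\<^bsub>\<T> M\<^esub> y) = f x \<otimes>\<^bsub>\<T> M\<^esub> g y"
    "\<And>t. t \<in> tpow M (i + j) \<Longrightarrow> tensor_map (\<T> M) (tpow M i) (tpow M j) f g t = TM M i j f g t"
proof -
  obtain L where L: "lin L" "\<And>x y. x \<in> tpow M i \<Longrightarrow> y \<in> tpow M j \<Longrightarrow> L (x \<otimes>\<^bsub>\<T> M\<^esub> y) = f x \<otimes>\<^bsub>\<T> M\<^esub> g y"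
    "\<And>t. t \<in> sub_prod (\<T> M) (tpow M i) (tpow M j) \<Longrightarrow> tensor_map (\<T> M) (tpow M i) (tpow M j) f g t = L t"
    using tensor_map_ex[OF M subspace_tpow order_refl subspace_tpow order_refl f g] by metis
  have "sub_prod (\<T> M) (tpow M i) (tpow M j) = tpow M (i + j)"
    by (simp add: sub_prod_def tpow_add_span[OF M])
  then have "\<exists>L. lin L \<and> (\<forall>x\<in>tpow M i. \<forall>y\<in>tpow M j. L (x \<otimes>\<^bsub>\<T> M\<^esub> y) = f x \<otimes>\<^bsub>\<T> M\<^esub> g y) \<and>
    (\<forall>t\<in>tpow M (i + j). tensor_map (\<T> M) (tpow M i) (tpow M j) f g t = L t)"
    using L by (intro exI[of _ L]) simp
  from someI_ex[OF this, folded TM_def]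
  show "lin (TM M i j f g)" "\<And>x y. x \<in> tpow M i \<Longrightarrow> y \<in> tpow M j \<Longrightarrow>
      TM M i j f g (x \<otimes>\<^bsub>\<T> M\<^esub> y) = f x \<otimes>\<^bsub>\<T> M\<^esub> g y"
    "\<And>t. t \<in> tpow M (i + j) \<Longrightarrow> tensor_map (\<T> M) (tpow M i) (tpow M j) f g t = TM M i j f g t"
    by auto
qed

lemma tensor_map_eq:
  assumes L: "lin L" "\<And>x y. x \<in> X \<Longrightarrow> y \<in> Y \<Longrightarrow>
      L (x \<otimes>\<^bsub>\<T> M\<^esub> y) = f x \<otimes>\<^bsub>\<T> M\<^esub> g y" and t: "t \<in> sub_prod (\<T> M) X Y"
  shows "tensor_map (\<T> M) X Y f g t = L t"
  unfolding tensor_map_def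
proof (rule lin_ext_T[OF L(1)])
  have "{x \<otimes>\<^bsub>\<T> M\<^esub> y |x y. x \<in> X \<and> y \<in> Y} = (\<lambda>(x, y). x \<otimes>\<^bsub>\<T> M\<^esub> y) ` (X \<times> Y)" by auto
  then show "t \<in> fs.span ((\<lambda>(x, y). x \<otimes>\<^bsub>\<T> M\<^esub> y) ` (X \<times> Y))" using t by (simp add: sub_prod_def)
qed (auto simp: L)

lemma pair_ext_eq:
  assumes N: "fsp N" and L: "lin L" "\<And>x y. x \<in> X \<Longrightarrow> y \<in> Y \<Longrightarrow> L (tens M [x, y]) = h x y"
    and t: "t \<in> pair_tensor M X Y"
  shows "pair_ext M N X Y h t = L t"
  unfolding pair_ext_def
proof (rule lin_ext_eq[OF fsp_T N L(1)])
  have "{tens M [x, y] |x y. x \<in> X \<and> y \<in> Y} = (\<lambda>(x, y). tens M [x, y]) ` (X \<times> Y)" by auto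
  then show "t \<in> fs.span ((\<lambda>(x, y). tens M [x, y]) ` (X \<times> Y))" using t by (simp add: pair_tensor_def)
qed (auto simp: L)

lemma pair_tensor_eq: "pair_tensor M X Y = fs.span {tens M [x, y] | x y. x \<in> X \<and> y \<in> Y}"
  by (simp add: pair_tensor_def)

lemma subspace_pair [simp]: "fs.subspace (pair_tensor M X Y)"
  by (simp add: pair_tensor_eq)

lemma pair_tensor_mono: "X \<subseteq> X' \<Longrightarrow> Y \<subseteq> Y' \<Longrightarrow> pair_tensor M X Y \<subseteq> pair_tensor M X' Y'"
  unfolding pair_tensor_eq by (rule fs.span_mono) blast

lemma pair_tensor_base: "x \<in> X \<Longrightarrow> y \<in> Y \<Longrightarrow> tens M [x, y] \<in> pair_tensor M X Y"
  unfolding pair_tensor_eq by (rule fs.span_base) blast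

lemma pair_tensor_tpow: "X \<subseteq> carrier M \<Longrightarrow> Y \<subseteq> carrier M \<Longrightarrow> pair_tensor M X Y \<subseteq> tpow M 2"
  unfolding pair_tensor_eq by (rule fs.span_minimal) (auto intro!: tens_tpow')

lemma tpow2_pair: "tpow M 2 = pair_tensor M (carrier M) (carrier M)"
proof (rule antisym)
  show "tpow M 2 \<subseteq> pair_tensor M (carrier M) (carrier M)"
    unfolding tpow_eq pair_tensor_eq
  proof (rule fs.span_mono, clarify)
    fix w assume "w \<in> words M 2"
    then show "\<exists>x y. tens M w = tens M [x, y] \<and> x \<in> carrier M \<and> y \<in> carrier M"
      by (cases w; cases "tl w") (auto simp: words_def)
  qed
qed (rule pair_tensor_tpow, auto)

lemma pair_in:
  assumes "lin_on (tpow M 2) f" "X \<subseteq> carrier M" "Y \<subseteq> carrier M" "fs.subspace U"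
    and "\<And>x y. x \<in> X \<Longrightarrow> y \<in> Y \<Longrightarrow> f (tens M [x, y]) \<in> U" and t: "t \<in> pair_tensor M X Y"
  shows "f t \<in> U"
proof -
  have s: "pair_tensor M X Y \<subseteq> tpow M 2" by (rule pair_tensor_tpow[OF assms(2,3)])
  obtain g where g: "lin g" "\<And>x. x \<in> tpow M 2 \<Longrightarrow> g x = f x"
      using lin_on_extend[OF assms(1) subspace_tpow] by blast
  have "g t \<in> U"
  proof (rule lin_span_in[OF g(1) _ assms(4) t[unfolded pair_tensor_eq]])
    fix z assume "z \<in> {tens M [x, y] |x y. x \<in> X \<and> y \<in> Y}"
    then show "g z \<in> U" using assms(5) g(2) pair_tensor_base[of _ X _ Y M] s by force
  qed
  then show ?thesis using g s t by auto
qed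

lemma pair_eq:
  assumes "lin_on (tpow M 2) f" "lin_on (tpow M 2) g" "X \<subseteq> carrier M" "Y \<subseteq> carrier M"
    and "\<And>x y. x \<in> X \<Longrightarrow> y \<in> Y \<Longrightarrow> f (tens M [x, y]) = g (tens M [x, y])" and t: "t \<in> pair_tensor M X Y"
  shows "f t = g t"
proof -
  have "(\<lambda>t. f t - g t) t \<in> {0}"
  proof (rule pair_in[OF _ assms(3,4) _ _ t])
    show "lin_on (tpow M 2) (\<lambda>t. f t - g t)"
      using assms(1,2) by (simp add: lin_on_def fs.scale_right_diff_distrib)
  qed (use assms in auto)
  then show ?thesis by simp
qed

lemma pair_bil: "fsp M \<Longrightarrow> bil (carrier M) (carrier M) (\<lambda>x y. tens M [x, y])"
proof -
  assume M: "fsp M"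
  have *: "tens M [x + x', y] = tens M [x, y] + tens M [x', y]" "tens M [y, x + x']
      = tens M [y, x] + tens M [y, x']"
      "tens M [fscale k x, y] = fscale k (tens M [x, y])" "tens M [y, fscale k x]
          = fscale k (tens M [y, x])"
    if "x \<in> carrier M" "x' \<in> carrier M" "y \<in> carrier M" for x x' y k
    using tens_add[of "[]" M "[y]" x x'] tens_add[of "[y]" M "[]" x x'] tens_smult[of "[]" M "[y]" x k]
      tens_smult[of "[y]" M "[]" x k] M that by (simp_all add: fsp_def)
  show ?thesis unfolding bil_def lin_on_def using * by blast
qed

text \<open>The counit is a parameter, because \<open>tensor_bialgebra\<close> only asserts that one
  exists.\<close>

locale tensor_bialg = braided_space s V c
  for s :: "'k::field \<Rightarrow> 'v::ab_group_add \<Rightarrow> 'v" and V :: "('k, 'v) module" and c ::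
      "('k, 'v) T \<Rightarrow> ('k, 'v) T" +
  fixes cT :: "('k, 'v) TT \<Rightarrow> ('k, 'v) TT" and \<Delta> :: "('k, 'v) T \<Rightarrow> ('k, 'v) TT" and \<epsilon> :: "('k, 'v) T \<Rightarrow> 'k"
  assumes tb: "tensor_bialgebra V c cT \<Delta>"
    and bb: "braided_bialgebra (\<T> V) cT \<Delta> \<epsilon>" and eps_pos: "\<And>n x. n \<ge> 1 \<Longrightarrow> x \<in> tpow V n \<Longrightarrow> \<epsilon> x = 0"
begin

abbreviation A where "A \<equiv> \<T> V"
abbreviation T2 where "T2 \<equiv> tpow (\<T> V) 2"
abbreviation pt where "pt \<equiv> pair_tensor (\<T> V)"
abbreviation tmul (infixl "\<diamond>" 70) where "x \<diamond> y \<equiv> x \<otimes>\<^bsub>\<T> (\<T> V)\<^esub> y"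
abbreviation t1 where "t1 x \<equiv> tens (\<T> V) [x]"
abbreviation t2 where "t2 x y \<equiv> tens (\<T> V) [x, y]"
abbreviation t3 where "t3 x y z \<equiv> tens (\<T> V) [x, y, z]"
abbreviation one1 where "one1 \<equiv> tens V []"

lemma t_in: "a \<in> Tc \<Longrightarrow> t1 a \<in> tpow A 1" "a \<in> Tc \<Longrightarrow> b \<in> Tc \<Longrightarrow> t2 a b \<in> T2"
  "a \<in> Tc \<Longrightarrow> b \<in> Tc \<Longrightarrow> d \<in> Tc \<Longrightarrow> t3 a b d \<in> tpow A 3"
  by (rule tens_tpow'; simp)+

lemmas TT_T = tpow_in_T[where M = "\<T> V"]

lemma t2_bil: "bil Tc Tc t2" by (rule pair_bil[OF fsp_T])

lemma t2_add: "a \<in> Tc \<Longrightarrow> a' \<in> Tc \<Longrightarrow> b \<in> Tc \<Longrightarrow> t2 (a + a') b = t2 a b + t2 a' b"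
  "a \<in> Tc \<Longrightarrow> a' \<in> Tc \<Longrightarrow> b \<in> Tc \<Longrightarrow> t2 b (a + a') = t2 b a + t2 b a'"
  "a \<in> Tc \<Longrightarrow> b \<in> Tc \<Longrightarrow> t2 (fscale k a) b = fscale k (t2 a b)"
  "a \<in> Tc \<Longrightarrow> b \<in> Tc \<Longrightarrow> t2 b (fscale k a) = fscale k (t2 b a)"
  using t2_bil unfolding bil_def lin_on_def by blast+

lemma t1_add: "a \<in> Tc \<Longrightarrow> a' \<in> Tc \<Longrightarrow> t1 (a + a') = t1 a + t1 a'" "a \<in> Tc \<Longrightarrow>
    t1 (fscale k a) = fscale k (t1 a)"
  using tens_add[of "[]" A "[]" a a'] tens_smult[of "[]" A "[]" a k] by auto

lemma cT_lin: "lin_on T2 cT" and cT_T2: "z \<in> T2 \<Longrightarrow> cT z \<in> T2"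
proof -
  have "braided_vector_space A cT" using bb unfolding braided_bialgebra_def braided_algebra_def by blast
  then have *: "linear_on (\<T> A) T2 (\<T> A) cT" "cT ` T2 \<subseteq> T2" unfolding braided_vector_space_def by auto
  show "lin_on T2 cT" using *(1) unfolding linear_on_def lin_on_def by simp
  show "z \<in> T2 \<Longrightarrow> cT z \<in> T2" using * by auto
qed

lemma D_lin: "lin_on Tc \<Delta>" and D_T2: "x \<in> Tc \<Longrightarrow> \<Delta> x \<in> T2"
proof -
  have "linear_on A Tc (\<T> A) \<Delta>" "\<Delta> ` Tc \<subseteq> T2"
    using bb unfolding braided_bialgebra_def braided_coalgebra_def by auto
  then show "lin_on Tc \<Delta>" "x \<in> Tc \<Longrightarrow> \<Delta> x \<in> T2" unfolding linear_on_def lin_on_def by auto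
qed

definition mA where "mA = (SOME L. lin L \<and> (\<forall>x\<in>Tc. \<forall>y\<in>Tc. L (t2 x y) = t1 (x \<star> y)))"

lemma mA: "lin mA" "x \<in> Tc \<Longrightarrow> y \<in> Tc \<Longrightarrow> mA (t2 x y) = t1 (x \<star> y)"
proof -
  have "bil Tc Tc (\<lambda>x y. t1 (x \<star> y))"
    using mult_T_bil[OF mclosed_V] unfolding bil_def lin_on_def by (auto simp: t1_add mul_closed)
  from bil_ext[OF fsp_T subspace_T subspace_T this]
  have "\<exists>L. lin L \<and> (\<forall>x\<in>Tc. \<forall>y\<in>Tc. L (t2 x y) = t1 (x \<star> y))" by metis
  from someI_ex[OF this] show "lin mA" "x \<in> Tc \<Longrightarrow> y \<in> Tc \<Longrightarrow> mA (t2 x y) = t1 (x \<star> y)"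
    unfolding mA_def[symmetric] by auto
qed

lemma T2_in:
  assumes "lin_on T2 f" "fs.subspace U" "\<And>x y. x \<in> Tc \<Longrightarrow> y \<in> Tc \<Longrightarrow> f (t2 x y) \<in> U" "t \<in> T2"
  shows "f t \<in> U"
  by (rule pair_in[OF assms(1) _ _ assms(2,3) assms(4)[unfolded tpow2_pair]]) auto

lemma T2_eq:
  assumes "lin_on T2 f" "lin_on T2 g" "\<And>x y. x \<in> Tc \<Longrightarrow> y \<in> Tc \<Longrightarrow> f (t2 x y) = g (t2 x y)" "t \<in> T2"
  shows "f t = g t"
  by (rule pair_eq[OF assms(1,2) _ _ assms(3) assms(4)[unfolded tpow2_pair]]) auto

lemma mA_in: "z \<in> T2 \<Longrightarrow> mA z \<in> tpow A 1"
  by (rule T2_in[OF lin_on_lin[OF mA(1)] subspace_tpow]) (auto simp: mA mul_closed t_in)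

lemma mult_map_eq: "z \<in> T2 \<Longrightarrow> mult_map A z = mA z"
  unfolding mult_map_def tpow2_pair by (rule pair_ext_eq[OF fsp_T mA(1)]) (auto simp: mA incl_def)

definition dA where "dA = (SOME L. lin L \<and> (\<forall>x\<in>Tc. L (t1 x) = \<Delta> x))"

lemma dA: "lin dA" "x \<in> Tc \<Longrightarrow> dA (t1 x) = \<Delta> x"
proof -
  obtain d where d: "lin d" "\<And>x. x \<in> Tc \<Longrightarrow> d x = \<Delta> x" using lin_on_extend[OF D_lin subspace_T] by blast
  have "mlin A (\<lambda>w. if length w = 1 then d (hd w) else 0)"
    by (rule mlin_length) (auto simp: lin_rules[OF d(1)])
  from univ_tens[OF this] have "\<exists>L. lin L \<and> (\<forall>x\<in>Tc. L (t1 x) = \<Delta> x)"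
    using lin_univ d(2) by (intro exI[of _ "univ (\<lambda>w. if length w = 1 then d (hd w) else 0)"]) simp
  from someI_ex[OF this] show "lin dA" "x \<in> Tc \<Longrightarrow> dA (t1 x) = \<Delta> x" unfolding dA_def[symmetric] by auto
qed

lemma tpow1: "tpow A 1 = t1 ` Tc"
proof -
  have "words A 1 = (\<lambda>x. [x]) ` Tc" by (auto simp: words_def length_Suc_conv One_nat_def)
  then have *: "tpow A 1 = fs.span (t1 ` Tc)" unfolding tpow_eq by (simp add: image_image)
  have "fs.subspace (t1 ` Tc)"
  proof (rule fs.subspaceI)
    show "0 \<in> t1 ` Tc" using t1_add(2)[of 0 0] by (intro image_eqI[of _ _ 0]) (auto simp: fs.subspace_0)
  qed (auto simp: t1_add[symmetric] fs.subspace_add fs.subspace_scale)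
  then show ?thesis unfolding * by simp
qed

lemma comult_map_eq: "z \<in> tpow A 1 \<Longrightarrow> comult_map A \<Delta> z = dA z"
  unfolding comult_map_def
  by (rule lin_ext_T[OF dA(1)]) (use tpow1 in \<open>auto simp: dA incl_def intro: fs.span_base\<close>)

lemma mult_map_on: "lin_on T2 (mult_map A)" "mult_map A ` T2 \<subseteq> carrier (\<T> A)"
proof -
  show "lin_on T2 (mult_map A)"
    by (rule lin_on_cong[OF lin_on_lin[OF mA(1)] subspace_tpow]) (simp add: mult_map_eq)
  show "mult_map A ` T2 \<subseteq> carrier (\<T> A)" using TT_T[OF mA_in] by (auto simp: mult_map_eq)
qed

lemma comult_map_on: "lin_on (tpow A 1) (comult_map A \<Delta>)" "comult_map A \<Delta> ` tpow A 1 \<subseteq> carrier (\<T> A)"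
proof -
  show "lin_on (tpow A 1) (comult_map A \<Delta>)"
    by (rule lin_on_cong[OF lin_on_lin[OF dA(1)] subspace_tpow]) (simp add: comult_map_eq)
  show "comult_map A \<Delta> ` tpow A 1 \<subseteq> carrier (\<T> A)" using TT_T[OF D_T2]
      by (auto simp: comult_map_eq tpow1 dA)
qed

lemma id_on: "lin_on (tpow A n) id" "id ` tpow A n \<subseteq> carrier (\<T> A)"
  using TT_T by (auto simp: lin_on_def)

lemma cT_on: "cT ` T2 \<subseteq> carrier (\<T> A)"
  using cT_T2 TT_T by auto

lemma lin_on_compon: "lin_on Z f \<Longrightarrow> lin_on Q g \<Longrightarrow> (\<And>x. x \<in> Q \<Longrightarrow> g x \<in> Z) \<Longrightarrow> lin_on Q (\<lambda>x. f (g x))"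
  by (simp add: lin_on_def)

text \<open>In the usual notation these six maps are \<open>m \<otimes> T\<close>,
  \<open>T \<otimes> m\<close>, \<open>c_T \<otimes> T\<close>, \<open>T \<otimes> c_T\<close>,
  \<open>\<Delta> \<otimes> T\<close> and \<open>T \<otimes> \<Delta>\<close>; so \<open>M21\<close>
  multiplies the last two of three factors.\<close>

definition "M12 = TM A 2 1 (mult_map A) id"
definition "M21 = TM A 1 2 id (mult_map A)"
definition "F12 = TM A 2 1 cT id"
definition "F23 = TM A 1 2 id cT"
definition "D1 = TM A 1 1 (comult_map A \<Delta>) id"
definition "D2 = TM A 1 1 id (comult_map A \<Delta>)"

lemmas M12 = TM[OF mclosed_T mult_map_on id_on[of 1], folded M12_def]
lemmas M21 = TM[OF mclosed_T id_on[of 1] mult_map_on, folded M21_def]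
lemmas F12 = TM[OF mclosed_T cT_lin cT_on id_on[of 1], folded F12_def]
lemmas F23 = TM[OF mclosed_T id_on[of 1] cT_lin cT_on, folded F23_def]
lemmas D1 = TM[OF mclosed_T comult_map_on id_on[of 1], folded D1_def]
lemmas D2 = TM[OF mclosed_T id_on[of 1] comult_map_on, folded D2_def]

lemma M12_t: "a \<in> Tc \<Longrightarrow> b \<in> Tc \<Longrightarrow> d \<in> Tc \<Longrightarrow> M12 (t3 a b d) = t2 (a \<star> b) d"
  using M12(2)[of "t2 a b" "t1 d"] by (simp add: t_in mult_map_eq mA mul_closed)

lemma M21_t: "a \<in> Tc \<Longrightarrow> b \<in> Tc \<Longrightarrow> d \<in> Tc \<Longrightarrow> M21 (t3 a b d) = t2 a (b \<star> d)"
  using M21(2)[of "t1 a" "t2 b d"] by (simp add: t_in mult_map_eq mA mul_closed)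

lemma F12_t: "u \<in> T2 \<Longrightarrow> d \<in> Tc \<Longrightarrow> F12 (u \<diamond> t1 d) = cT u \<diamond> t1 d"
  using F12(2)[of u "t1 d"] by (simp add: t_in)

lemma F23_t: "u \<in> T2 \<Longrightarrow> a \<in> Tc \<Longrightarrow> F23 (t1 a \<diamond> u) = t1 a \<diamond> cT u"
  using F23(2)[of "t1 a" u] by (simp add: t_in)

lemma e3: "(2::nat) + 1 = 3" "(1::nat) + 2 = 3" "(1::nat) + 3 = 4" "(2::nat) + 2 = 4" by auto

lemma tp_TT3: "u \<in> T2 \<Longrightarrow> a \<in> Tc \<Longrightarrow> t1 a \<diamond> u \<in> tpow A 3" "u \<in> T2 \<Longrightarrow> a \<in> Tc \<Longrightarrow> u \<diamond> t1 a \<in> tpow A 3"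
proof -
  assume u: "u \<in> T2" and a: "a \<in> Tc"
  have "t1 a \<diamond> u \<in> tpow A (1 + 2)" "u \<diamond> t1 a \<in> tpow A (2 + 1)"
    by (intro tpow_mult mclosed_T t_in(1) u a)+
  then show "t1 a \<diamond> u \<in> tpow A 3" "u \<diamond> t1 a \<in> tpow A 3" by (simp_all only: e3)
qed

lemma F12_in: "z \<in> tpow A 3 \<Longrightarrow> F12 z \<in> tpow A 3"
  unfolding e3(1)[symmetric] tpow_add_span[OF mclosed_T]
proof (erule lin_span_in[OF F12(1), rotated 2])
  fix z assume "z \<in> {x \<diamond> y |x y. x \<in> T2 \<and> y \<in> tpow A 1}"
  then obtain x y where z: "z = x \<diamond> y" "x \<in> T2" "y \<in> tpow A 1" by blast
  then have "F12 z = cT x \<diamond> y" using F12(2) by simp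
  then show "F12 z \<in> fs.span {x \<diamond> y |x y. x \<in> T2 \<and> y \<in> tpow A 1}"
    using cT_T2 z by (intro fs.span_base) blast
qed simp

lemma F23_in: "z \<in> tpow A 3 \<Longrightarrow> F23 z \<in> tpow A 3"
  unfolding e3(2)[symmetric] tpow_add_span[OF mclosed_T]
proof (erule lin_span_in[OF F23(1), rotated 2])
  fix z assume "z \<in> {x \<diamond> y |x y. x \<in> tpow A 1 \<and> y \<in> T2}"
  then obtain x y where z: "z = x \<diamond> y" "x \<in> tpow A 1" "y \<in> T2" by blast
  then have "F23 z = x \<diamond> cT y" using F23(2) by simp
  then show "F23 z \<in> fs.span {x \<diamond> y |x y. x \<in> tpow A 1 \<and> y \<in> T2}"
    using cT_T2 z by (intro fs.span_base) blast
qed simp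

text \<open>
  \<open>LA a\<close> and \<open>RA d\<close> multiply the outer sides of \<open>x \<otimes> y\<close>, giving \<open>a x \<otimes> y\<close> and \<open>x \<otimes> y d\<close>; \<open>KL x\<close> and
  \<open>KR y\<close> first braid the new factor past the adjacent one and multiply on the inner side.
\<close>
definition "LA a u = M12 (t1 a \<diamond> u)"
definition "RA d u = M21 (u \<diamond> t1 d)"
definition "KL x u = M21 (F12 (t1 x \<diamond> u))"
definition "KR y u = M12 (F23 (u \<diamond> t1 y))"

lemma tmul_on: "a \<in> Tc \<Longrightarrow> lin_on T2 (\<lambda>u. t1 a \<diamond> u)" "lin_on T2 (\<lambda>u. u \<diamond> t1 a)"
  using lin_on_mulL[OF mclosed_T lin_on_id, of T2 V
  "t1 a"] TT_T[OF t_in(1)] TT_T lin_on_mulR[OF lin_on_id] by auto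

lemma LA_on: "a \<in> Tc \<Longrightarrow> lin_on T2 (LA a)" and RA_on: "lin_on T2 (RA a)"
  and KL_on: "a \<in> Tc \<Longrightarrow> lin_on T2 (KL a)" and KR_on: "lin_on T2 (KR a)"
  unfolding LA_def[abs_def] RA_def[abs_def] KL_def[abs_def] KR_def[abs_def]
  by (intro lin_on_comp[OF M12(1)] lin_on_comp[OF M21(1)] lin_on_comp[OF F12(1)] lin_on_comp[OF
  F23(1)] tmul_on; assumption?)+

lemma LA_t: "a \<in> Tc \<Longrightarrow> b \<in> Tc \<Longrightarrow> d \<in> Tc \<Longrightarrow> LA a (t2 b d) = t2 (a \<star> b) d"
  by (simp add: LA_def M12_t)

lemma RA_t: "a \<in> Tc \<Longrightarrow> b \<in> Tc \<Longrightarrow> d \<in> Tc \<Longrightarrow> RA d (t2 a b) = t2 a (b \<star> d)"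
  by (simp add: RA_def M21_t)

lemma KL_t: "x \<in> Tc \<Longrightarrow> v \<in> Tc \<Longrightarrow> y \<in> Tc \<Longrightarrow> KL x (t2 v y) = RA y (cT (t2 x v))"
  using F12_t[of "t2 x v" y] by (simp add: KL_def RA_def t_in)

lemma KR_t: "x \<in> Tc \<Longrightarrow> v \<in> Tc \<Longrightarrow> y \<in> Tc \<Longrightarrow> KR y (t2 x v) = LA x (cT (t2 v y))"
  using F23_t[of "t2 v y" x] by (simp add: KR_def LA_def t_in)

lemma RA_in: "a \<in> Tc \<Longrightarrow> u \<in> T2 \<Longrightarrow> RA a u \<in> T2"
  by (rule T2_in[OF RA_on subspace_tpow]) (auto simp: RA_t t_in mul_closed)

lemma ba: "z \<in> tpow A 3 \<Longrightarrow> cT (tensor_map (\<T> A) T2 (tpow A 1) (mult_map A) id z) =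
        tensor_map (\<T> A) (tpow A 1) T2 id (mult_map A) (tensor_map (\<T> A) T2 (tpow A 1) cT id
            (tensor_map (\<T> A) (tpow A 1) T2 id cT z))"
    "z \<in> tpow A 3 \<Longrightarrow> cT (tensor_map (\<T> A) (tpow A 1) T2 id (mult_map A) z) =
        tensor_map (\<T> A) T2 (tpow A 1) (mult_map A) id (tensor_map (\<T> A) (tpow A 1) T2 id cT
            (tensor_map (\<T> A) T2 (tpow A 1) cT id z))"
  using bb unfolding braided_bialgebra_def braided_algebra_def by blast+

lemma tmap3: assumes "z \<in> tpow A 3"
  shows "tensor_map (\<T> A) T2 (tpow A 1) (mult_map A) id z = M12 z"
      "tensor_map (\<T> A) (tpow A 1) T2 id (mult_map A) z = M21 z"
    "tensor_map (\<T> A) T2 (tpow A 1) cT id z = F12 z" "tensor_map (\<T> A) (tpow A 1) T2 id cT z = F23 z"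
  using M12(3)[unfolded e3, OF assms] M21(3)[unfolded e3, OF assms] F12(3)[unfolded e3, OF assms]
  F23(3)[unfolded e3, OF assms]
  by auto

text \<open>The axiom on \<open>c_T\<close> and the multiplication, evaluated at
  \<open>x \<otimes> y \<otimes> v\<close>: \<open>v\<close> passes \<open>y\<close> first and
  \<open>x\<close> second, and the product is formed at the end.\<close>

lemma cT_mul_left:
  assumes "x \<in> Tc" "y \<in> Tc" "v \<in> Tc"
  shows "cT (t2 (x \<star> y) v) = KL x (cT (t2 y v))"
proof -
  have z: "t3 x y v \<in> tpow A 3" using assms by (simp add: t_in)
  have "F23 (t3 x y v) = t1 x \<diamond> cT (t2 y v)" using F23_t[of "t2 y v" x] assms by (simp add: t_in)
  then show ?thesis
    using ba(1)[OF z] M12_t assms by (simp add: tmap3 z F23_in F12_in KL_def tp_TT3 cT_T2 t_in)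
qed

lemma cT_mul_right:
  assumes "x \<in> Tc" "y \<in> Tc" "v \<in> Tc"
  shows "cT (t2 v (x \<star> y)) = KR y (cT (t2 v x))"
proof -
  have z: "t3 v x y \<in> tpow A 3" using assms by (simp add: t_in)
  have "F12 (t3 v x y) = cT (t2 v x) \<diamond> t1 y" using F12_t[of "t2 v x" y] assms by (simp add: t_in)
  then show ?thesis
    using ba(2)[OF z] M21_t assms by (simp add: tmap3 z F23_in F12_in KR_def tp_TT3 cT_T2 t_in)
qed

lemma cT_one: "x \<in> Tc \<Longrightarrow> cT (t2 one1 x) = t2 x one1" "x \<in> Tc \<Longrightarrow> cT (t2 x one1) = t2 one1 x"
  using bb unfolding braided_bialgebra_def braided_algebra_def by auto

section \<open>Comultiplication of a product\<close>

definition "MM = TM A 2 2 (mult_map A) (mult_map A)"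
definition "Fm = TM A 1 3 id (tensor_map (\<T> A) T2 (tpow A 1) cT id)"

lemmas MM = TM[OF mclosed_T mult_map_on mult_map_on, folded MM_def]

lemma F12m: "lin_on (tpow A 3) (tensor_map (\<T> A) T2 (tpow A 1) cT id)"
    "tensor_map (\<T> A) T2 (tpow A 1) cT id ` tpow A 3 \<subseteq> carrier (\<T> A)"
proof -
  show "lin_on (tpow A 3) (tensor_map (\<T> A) T2 (tpow A 1) cT id)"
    by (rule lin_on_cong[OF lin_on_lin[OF F12(1)] subspace_tpow]) (simp add: tmap3)
  show "tensor_map (\<T> A) T2 (tpow A 1) cT id ` tpow A 3 \<subseteq> carrier (\<T> A)" using TT_T[OF F12_in]
      by (auto simp: tmap3)
qed

lemmas Fm = TM[OF mclosed_T id_on[of 1] F12m, folded Fm_def]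

lemma Fm_t: "a \<in> Tc \<Longrightarrow> z \<in> tpow A 3 \<Longrightarrow> Fm (t1 a \<diamond> z) = t1 a \<diamond> F12 z"
  using Fm(2)[of "t1 a" z] by (simp add: t_in tmap3)

lemma Fm_in: "z \<in> tpow A 4 \<Longrightarrow> Fm z \<in> tpow A 4"
  unfolding e3(3)[symmetric] tpow_add_span[OF mclosed_T]
proof (erule lin_span_in[OF Fm(1), rotated 2])
  fix z assume "z \<in> {x \<diamond> y |x y. x \<in> tpow A 1 \<and> y \<in> tpow A 3}"
  then obtain x y where z: "z = x \<diamond> y" "x \<in> tpow A 1" "y \<in> tpow A 3" by blast
  then have "Fm z = x \<diamond> F12 y" using Fm(2) by (simp add: tmap3)
  then show "Fm z \<in> fs.span {x \<diamond> y |x y. x \<in> tpow A 1 \<and> y \<in> tpow A 3}"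
    using F12_in z by (intro fs.span_base) blast
qed simp

lemma D_mul:
  assumes "x \<in> Tc" "y \<in> Tc"
  shows "\<Delta> (x \<star> y) = MM (Fm (\<Delta> x \<diamond> \<Delta> y))"
proof -
  have "\<Delta> (x \<star> y) = tensor_map (\<T> A) T2 T2 (mult_map A) (mult_map A)
          (tensor_map (\<T> A) (tpow A 1) (tpow A 3) id (tensor_map (\<T> A) T2 (tpow A 1) cT id) (\<Delta> x \<diamond> \<Delta> y))"
    using bb assms unfolding braided_bialgebra_def by blast
  moreover have "\<Delta> x \<diamond> \<Delta> y \<in> tpow A 4"
      using tpow_mult[OF mclosed_T D_T2[OF assms(1)] D_T2[OF assms(2)]] by simp
  ultimately show ?thesis using Fm(3)[unfolded e3] MM(3)[unfolded e3] Fm_in by simp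
qed

lemma MM_LR:
  assumes "a \<in> Tc" "q \<in> Tc" "u \<in> T2"
  shows "MM (t1 a \<diamond> (u \<diamond> t1 q)) = LA a (RA q u)"
proof (rule T2_eq[OF _ _ _ assms(3)])
  show "lin_on T2 (\<lambda>u. MM (t1 a \<diamond> (u \<diamond> t1 q)))"
    using assms by (intro lin_on_comp[OF MM(1)] lin_on_mulL[OF mclosed_T] tmul_on) (auto intro!:
    TT_T[OF t_in(1)] TT_T[OF tp_TT3(2)])
  show "lin_on T2 (\<lambda>u. LA a (RA q u))"
    by (rule lin_on_compon[OF LA_on RA_on]) (use assms RA_in in auto)
  fix x y assume xy: "x \<in> Tc" "y \<in> Tc"
  have 1: "t1 a \<diamond> (t2 x y \<diamond> t1 q) = t2 a x \<diamond> t2 y q" using xy assms by simp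
  have 2: "MM (t2 a x \<diamond> t2 y q) = mult_map A (t2 a x) \<diamond> mult_map A (t2 y q)"
    by (rule MM(2)) (use xy assms in \<open>simp_all add: t_in\<close>)
  have 3: "mult_map A (t2 a x) \<diamond> mult_map A (t2 y q) = t2 (a \<star> x) (y \<star> q)"
    using xy assms by (simp add: t_in mult_map_eq mA mul_closed)
  show "MM (t1 a \<diamond> (t2 x y \<diamond> t1 q)) = LA a (RA q (t2 x y))"
    unfolding 1 2 3 using xy assms by (simp add: LA_t RA_t mul_closed)
qed

lemma MMFm:
  assumes "a \<in> Tc" "b \<in> Tc" "p \<in> Tc" "q \<in> Tc"
  shows "MM (Fm (t2 a b \<diamond> t2 p q)) = LA a (RA q (cT (t2 b p)))"
proof -
  have e: "t2 a b \<diamond> t2 p q = t1 a \<diamond> (t2 b p \<diamond> t1 q)" using assms by simp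
  have u: "t2 b p \<in> T2" using assms by (simp add: t_in)
  have "Fm (t1 a \<diamond> (t2 b p \<diamond> t1 q)) = t1 a \<diamond> (cT (t2 b p) \<diamond> t1 q)"
    unfolding Fm_t[OF assms(1) tp_TT3(2)[OF u assms(4)]] F12_t[OF u assms(4)] ..
  then show ?thesis unfolding e using MM_LR[OF assms(1,4) cT_T2[OF u]] by simp
qed

lemma one_T [simp]: "one1 \<in> Tc" by (rule tens_Tc)

lemma D_prim: "v \<in> tp 1 \<Longrightarrow> \<Delta> v = t2 v one1 + t2 one1 v"
  using tb unfolding tensor_bialgebra_def by auto

lemma RA_one: "u \<in> T2 \<Longrightarrow> RA one1 u = u"
  using T2_eq[OF RA_on lin_on_id, of one1 u] by (auto simp: RA_t one_mul)

lemma LA_one: "u \<in> T2 \<Longrightarrow> LA one1 u = u"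
  using T2_eq[OF LA_on lin_on_id, of one1 u] by (auto simp: LA_t one_mul)

text \<open>Multiplication by \<open>\<Delta> v\<close> in the braided tensor square of the tensor algebra.\<close>
definition "Psi v z = MM (Fm (z \<diamond> \<Delta> v))"
definition "Psi' v z = MM (Fm (\<Delta> v \<diamond> z))"

lemma Psi_on: "lin_on T2 (Psi v)" and Psi'_on: "v \<in> Tc \<Longrightarrow> lin_on T2 (Psi' v)"
  unfolding Psi_def[abs_def] Psi'_def[abs_def]
  by (intro lin_on_comp[OF MM(1)] lin_on_comp[OF Fm(1)] lin_on_mulR lin_on_id)
    (intro lin_on_comp[OF MM(1)] lin_on_comp[OF Fm(1)] lin_on_mulL[OF mclosed_T lin_on_id]; auto intro: TT_T[OF D_T2] TT_T)

text \<open>For the summand \<open>v \<otimes> 1\<close> of \<open>\<Delta> v\<close> the factor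
  \<open>b\<close> is braided with \<open>v\<close>; for \<open>1 \<otimes> v\<close> it is braided
  with the unit, which is the flip.\<close>

lemma Psi_t:
  assumes "a \<in> Tc" "b \<in> Tc" "v \<in> tp 1"
  shows "Psi v (t2 a b) = LA a (cT (t2 b v)) + t2 a (b \<star> v)"
proof -
  have v: "v \<in> Tc" using assms tp_T by blast
  have "t2 a b \<diamond> \<Delta> v = t2 a b \<diamond> t2 v one1 + t2 a b \<diamond> t2 one1 v"
    unfolding D_prim[OF assms(3)] using v assms
    by (intro mult_T_right(1)[OF mclosed_T]) (auto intro!: TT_T[OF t_in(2)])
  then have "Psi v (t2 a b) = LA a (RA one1 (cT (t2 b v))) + LA a (RA v (cT (t2 b one1)))"
    using MMFm[OF assms(1,2) v one_T] MMFm[OF assms(1,2) one_T v]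
    by (simp only: Psi_def lin_add[OF MM(1)] lin_add[OF Fm(1)])
  then show ?thesis using v assms by (simp add: RA_one cT_T2 t_in cT_one RA_t LA_t one_mul mul_closed)
qed

lemma Psi'_t:
  assumes "a \<in> Tc" "b \<in> Tc" "v \<in> tp 1"
  shows "Psi' v (t2 a b) = t2 (v \<star> a) b + RA b (cT (t2 v a))"
proof -
  have v: "v \<in> Tc" using assms tp_T by blast
  have "\<Delta> v \<diamond> t2 a b = t2 v one1 \<diamond> t2 a b + t2 one1 v \<diamond> t2 a b"
    unfolding D_prim[OF assms(3)] by (rule mult_T_left(1))
  then have "Psi' v (t2 a b) = LA v (RA b (cT (t2 one1 a))) + LA one1 (RA b (cT (t2 v a)))"
    using MMFm[OF v one_T assms(1,2)] MMFm[OF one_T v assms(1,2)]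
    by (simp only: Psi'_def lin_add[OF MM(1)] lin_add[OF Fm(1)])
  then show ?thesis using v assms by (simp add: LA_one RA_in cT_T2 t_in cT_one RA_t LA_t one_mul mul_closed)
qed

lemma D_mul_right: "x \<in> Tc \<Longrightarrow> v \<in> Tc \<Longrightarrow> \<Delta> (x \<star> v) = Psi v (\<Delta> x)"
  and D_mul_left: "x \<in> Tc \<Longrightarrow> v \<in> Tc \<Longrightarrow> \<Delta> (v \<star> x) = Psi' v (\<Delta> x)"
  by (simp_all add: D_mul Psi_def Psi'_def)

lemma eps_add: "x \<in> Tc \<Longrightarrow> y \<in> Tc \<Longrightarrow> \<epsilon> (x + y) = \<epsilon> x + \<epsilon> y"
  and eps_scale: "x \<in> Tc \<Longrightarrow> \<epsilon> (fscale k x) = k * \<epsilon> x"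
  using bb unfolding braided_bialgebra_def braided_coalgebra_def by auto

lemma eps_mul: "x \<in> Tc \<Longrightarrow> y \<in> Tc \<Longrightarrow> \<epsilon> (x \<star> y) = \<epsilon> x * \<epsilon> y" and eps_one: "\<epsilon> one1 = 1"
  using bb unfolding braided_bialgebra_def by auto

lemma eps_0: "\<epsilon> 0 = 0" using eps_scale[of 0 0] by (simp add: fs.subspace_0)

lemma fsp_A: "fsp A" by (rule fsp_T)

section \<open>The counit, and comultiplication against braiding\<close>

definition eR where "eR = (SOME L. lin L \<and> (\<forall>x\<in>Tc. \<forall>y\<in>Tc. L (t2 x y) = fscale (\<epsilon> y) x))"
definition eL where "eL = (SOME L. lin L \<and> (\<forall>x\<in>Tc. \<forall>y\<in>Tc. L (t2 x y) = fscale (\<epsilon> x) y))"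

lemma eR: "lin eR" "x \<in> Tc \<Longrightarrow> y \<in> Tc \<Longrightarrow> eR (t2 x y) = fscale (\<epsilon> y) x"
proof -
  have "bil Tc Tc (\<lambda>x y. fscale (\<epsilon> y) x)"
    unfolding bil_def lin_on_def by (simp add: eps_add eps_scale fs.scale_left_distrib fs.scale_right_distrib mult.commute)
  from bil_ext[OF fsp_A subspace_T subspace_T this]
  have "\<exists>L. lin L \<and> (\<forall>x\<in>Tc. \<forall>y\<in>Tc. L (t2 x y) = fscale (\<epsilon> y) x)" by metis
  from someI_ex[OF this] show "lin eR" "x \<in> Tc \<Longrightarrow> y \<in> Tc \<Longrightarrow> eR (t2 x y) = fscale (\<epsilon> y) x"
    unfolding eR_def[symmetric] by auto
qed

lemma eL: "lin eL" "x \<in> Tc \<Longrightarrow> y \<in> Tc \<Longrightarrow> eL (t2 x y) = fscale (\<epsilon> x) y"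
proof -
  have "bil Tc Tc (\<lambda>x y. fscale (\<epsilon> x) y)"
    unfolding bil_def lin_on_def by (simp add: eps_add eps_scale fs.scale_left_distrib fs.scale_right_distrib mult.commute)
  from bil_ext[OF fsp_A subspace_T subspace_T this]
  have "\<exists>L. lin L \<and> (\<forall>x\<in>Tc. \<forall>y\<in>Tc. L (t2 x y) = fscale (\<epsilon> x) y)" by metis
  from someI_ex[OF this] show "lin eL" "x \<in> Tc \<Longrightarrow> y \<in> Tc \<Longrightarrow> eL (t2 x y) = fscale (\<epsilon> x) y"
    unfolding eL_def[symmetric] by auto
qed

lemma counit:
  assumes x: "x \<in> Tc"
  shows "eL (\<Delta> x) = x" "eR (\<Delta> x) = x"
proof -
  have *: "pair_ext A A Tc Tc (\<lambda>x y. \<epsilon> x \<odot>\<^bsub>A\<^esub> y) (\<Delta> x) = x"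
      "pair_ext A A Tc Tc (\<lambda>x y. \<epsilon> y \<odot>\<^bsub>A\<^esub> x) (\<Delta> x) = x"
    using bb x unfolding braided_bialgebra_def braided_coalgebra_def Let_def by blast+
  have D: "\<Delta> x \<in> pt Tc Tc" using D_T2[OF x] by (simp add: tpow2_pair)
  show "eL (\<Delta> x) = x" using *(1) pair_ext_eq[OF fsp_A eL(1) _ D, of "\<lambda>x y. \<epsilon> x \<odot>\<^bsub>A\<^esub> y"] eL(2) by simp
  show "eR (\<Delta> x) = x" using *(2) pair_ext_eq[OF fsp_A eR(1) _ D, of "\<lambda>x y. \<epsilon> y \<odot>\<^bsub>A\<^esub> x"] eR(2) by simp
qed

lemma D1_t: "x \<in> Tc \<Longrightarrow> v \<in> Tc \<Longrightarrow> D1 (t2 x v) = \<Delta> x \<diamond> t1 v"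
  using D1(2)[of "t1 x" "t1 v"] by (simp add: t_in comult_map_eq dA)

lemma D2_t: "x \<in> Tc \<Longrightarrow> v \<in> Tc \<Longrightarrow> D2 (t2 v x) = t1 v \<diamond> \<Delta> x"
  using D2(2)[of "t1 v" "t1 x"] by (simp add: t_in comult_map_eq dA)

lemma D12_in: "z \<in> T2 \<Longrightarrow> D1 z \<in> tpow A 3" "z \<in> T2 \<Longrightarrow> D2 z \<in> tpow A 3"
  by (rule T2_in[OF lin_on_lin[OF D1(1)] subspace_tpow], auto simp: D1_t intro!: tp_TT3 D_T2)
    (rule T2_in[OF lin_on_lin[OF D2(1)] subspace_tpow], auto simp: D2_t intro!: tp_TT3 D_T2)

lemma D_braid: assumes z: "z \<in> T2"
  shows "D2 (cT z) = F12 (F23 (D1 z))" "D1 (cT z) = F23 (F12 (D2 z))"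
proof -
  have e2: "1 + (1::nat) = 2" by simp
  have *: "tensor_map (\<T> A) (tpow A 1) (tpow A 1) id (comult_map A \<Delta>) (cT z) =
            tensor_map (\<T> A) T2 (tpow A 1) cT id (tensor_map (\<T> A) (tpow A 1) T2 id cT (tensor_map
                (\<T> A) (tpow A 1) (tpow A 1) (comult_map A \<Delta>) id z))"
    "tensor_map (\<T> A) (tpow A 1) (tpow A 1) (comult_map A \<Delta>) id (cT z) =
            tensor_map (\<T> A) (tpow A 1) T2 id cT (tensor_map (\<T> A) T2 (tpow A 1) cT id (tensor_map
                (\<T> A) (tpow A 1) (tpow A 1) id (comult_map A \<Delta>) z))"
    using bb z unfolding braided_bialgebra_def braided_coalgebra_def Let_def by blast+
  note D = D1(3)[unfolded e2] D2(3)[unfolded e2]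
  show "D2 (cT z) = F12 (F23 (D1 z))" "D1 (cT z) = F23 (F12 (D2 z))"
    using * by (simp_all add: D cT_T2 z tmap3 D12_in F12_in F23_in)
qed

lemma tp_sub: "tp n \<subseteq> Tc" by (rule tpow_subset)

lemma cT_gr: "t \<in> pt (tp a) (tp b) \<Longrightarrow> cT t \<in> pt (tp b) (tp a)"
  using tb unfolding tensor_bialgebra_def by blast

lemma D_gr: "x \<in> tp n \<Longrightarrow> \<Delta> x \<in> fs.span (\<Union>a\<in>{..n}. pt (tp a) (tp (n - a)))"
  using tb unfolding tensor_bialgebra_def lspan_T by blast

definition mult_pair where "mult_pair = (SOME L. lin L \<and> (\<forall>x\<in>Tc. \<forall>y\<in>Tc. L (t2 x y) = x \<star> y))"

lemma mult_pair: "lin mult_pair" "x \<in> Tc \<Longrightarrow> y \<in> Tc \<Longrightarrow> mult_pair (t2 x y) = x \<star> y"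
proof -
  from bil_ext[OF fsp_A subspace_T subspace_T mult_T_bil[OF mclosed_V]]
  have "\<exists>L. lin L \<and> (\<forall>x\<in>Tc. \<forall>y\<in>Tc. L (t2 x y) = x \<star> y)" by metis
  from someI_ex[OF this] show "lin mult_pair" "x \<in> Tc \<Longrightarrow> y \<in> Tc \<Longrightarrow> mult_pair (t2 x y) = x \<star> y"
    unfolding mult_pair_def[symmetric] by auto
qed

lemma cT_c: "t \<in> pt (tp 1) (tp 1) \<Longrightarrow> mult_pair (cT t) = c (mult_pair t)"
proof -
  assume t: "t \<in> pt (tp 1) (tp 1)"
  have s: "pt (tp 1) (tp 1) \<subseteq> pt Tc Tc" by (intro pair_tensor_mono tp_sub)
  have *: "pair_ext A A Tc Tc (\<lambda>x y. x \<star> y) (cT t) = c (pair_ext A A Tc Tc (\<lambda>x y. x \<star> y) t)"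
    using tb t unfolding tensor_bialgebra_def Let_def by blast
  have e: "pair_ext A A Tc Tc (\<lambda>x y. x \<star> y) u = mult_pair u" if "u \<in> pt (tp 1) (tp 1)" for u
    by (rule pair_ext_eq[OF fsp_A mult_pair(1)]) (use that s mult_pair in auto)
  show ?thesis using * e t cT_gr[OF t] by simp
qed

text \<open>\<open>V \<otimes> V\<close> occurs twice: as words of length two over \<open>V\<close>,
  and as words of length two whose letters are elements of \<open>tp 1\<close>. \<open>iota\<close>
  and \<open>mult_pair\<close> are the inverse identifications between them.\<close>

definition iota where "iota = (SOME L. lin L \<and> (\<forall>x\<in>tp 1. \<forall>y\<in>tp 1. L (x \<star> y) = t2 x y))"

lemma iota: "lin iota" "x \<in> tp 1 \<Longrightarrow> y \<in> tp 1 \<Longrightarrow> iota (x \<star> y) = t2 x y"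
proof -
  from prod_ext[OF mclosed_V subspace_tpow order_refl subspace_tpow order_refl bil_subset[OF t2_bil tp_sub tp_sub], of 1 1]
  have "\<exists>L. lin L \<and> (\<forall>x\<in>tp 1. \<forall>y\<in>tp 1. L (x \<star> y) = t2 x y)" by metis
  from someI_ex[OF this] show "lin iota" "x \<in> tp 1 \<Longrightarrow> y \<in> tp 1 \<Longrightarrow> iota (x \<star> y) = t2 x y"
    unfolding iota_def[symmetric] by auto
qed

lemma iota_mult_pair: "t \<in> pt (tp 1) (tp 1) \<Longrightarrow> iota (mult_pair t) = t"
  by (rule pair_eq[OF lin_on_comp[OF iota(1) lin_on_lin[OF mult_pair(1)]] lin_on_id tp_sub tp_sub])
    (use tp_T in \<open>auto simp: mult_pair iota\<close>)

lemma mult_pair_iota: "t \<in> tp 2 \<Longrightarrow> mult_pair (iota t) = t"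
  by (rule tp_eqI[of 2 "\<lambda>t. mult_pair (iota t)" "\<lambda>t. t" 1 1])
    (use tp_T in \<open>auto simp: mult_pair iota intro!: lin_on_comp[OF mult_pair(1)] lin_on_lin[OF iota(1)] lin_on_id\<close>)

lemma cT_iota:
  assumes "v \<in> tp 1" "w \<in> tp 1"
  shows "cT (t2 v w) = iota (c (v \<star> w))"
proof -
  have t: "t2 v w \<in> pt (tp 1) (tp 1)" using assms by (rule pair_tensor_base)
  have "iota (mult_pair (cT (t2 v w))) = iota (c (v \<star> w))"
    unfolding cT_c[OF t] using mult_pair(2)[of v w] assms tp_T by auto
  then show ?thesis using iota_mult_pair[OF cT_gr[OF t]] by simp
qed

text \<open>For a product \<open>v w\<close> the mixed terms are \<open>v \<otimes> w\<close> and
  \<open>c_T (v \<otimes> w)\<close>. Hence the component in degrees \<open>(1, 1)\<close> is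
  \<open>Id + c\<close>, and \<open>E2\<close> is the kernel of \<open>Id + c\<close>.\<close>

lemma D_tp2:
  assumes "x \<in> tp 2"
  shows "\<Delta> x = t2 x one1 + t2 one1 x + iota (x + c x)"
proof (rule tp_eqI[of 2 \<Delta> "\<lambda>x. t2 x one1 + t2 one1 x + iota (x + c x)" 1 1])
  show "lin_on (tp 2) \<Delta>" using D_lin tp_sub[of 2] unfolding lin_on_def by blast
  show "lin_on (tp 2) (\<lambda>x. t2 x one1 + t2 one1 x + iota (x + c x))"
    using c_lin tp_T[of _ 2] unfolding lin_on_def
    by (simp add: t2_add lin_add[OF iota(1)] lin_scale[OF iota(1)] fs.scale_right_distrib)
next
  fix v w assume vw: "v \<in> tp 1" "w \<in> tp 1"
  then have T: "v \<in> Tc" "w \<in> Tc" using tp_T by auto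
  have "\<Delta> (v \<star> w) = Psi w (t2 v one1 + t2 one1 v)" using D_mul_right[OF T] D_prim[OF vw(1)] by simp
  also have "\<dots> = Psi w (t2 v one1) + Psi w (t2 one1 v)"
    using Psi_on[of w] T unfolding lin_on_def by (simp add: t_in)
  also have "\<dots> = t2 (v \<star> w) one1 + t2 v w + (cT (t2 v w) + t2 one1 (v \<star> w))"
    using T vw by (simp add: Psi_t cT_one LA_t LA_one one_mul cT_T2 t_in)
  finally show "\<Delta> (v \<star> w) = t2 (v \<star> w) one1 + t2 one1 (v \<star> w) + iota (v \<star> w + c (v \<star> w))"
    using iota(2)[OF vw] cT_iota[OF vw] by (simp add: lin_add[OF iota(1)])
qed (use assms in auto)

section \<open>Primitive elements\<close>

definition P2 where "P2 i j = (SOME L. lin L \<and> (\<forall>x\<in>Tc. \<forall>y\<in>Tc. L (t2 x y) = t2 (Pd V i x) (Pd V j y)))"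

lemma Pd_T [simp]: "x \<in> Tc \<Longrightarrow> Pd V n x \<in> Tc"
  using Pd_in tp_T by blast

lemma P2: "lin (P2 i j)" "x \<in> Tc \<Longrightarrow> y \<in> Tc \<Longrightarrow> P2 i j (t2 x y) = t2 (Pd V i x) (Pd V j y)"
proof -
  have "bil Tc Tc (\<lambda>x y. t2 (Pd V i x) (Pd V j y))"
    by (rule bil_comp[OF t2_bil lin_Pd lin_Pd]) auto
  from bil_ext[OF fsp_A subspace_T subspace_T this]
  have "\<exists>L. lin L \<and> (\<forall>x\<in>Tc. \<forall>y\<in>Tc. L (t2 x y) = t2 (Pd V i x) (Pd V j y))" by metis
  from someI_ex[OF this] show "lin (P2 i j)" "x \<in> Tc \<Longrightarrow> y \<in> Tc \<Longrightarrow>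
      P2 i j (t2 x y) = t2 (Pd V i x) (Pd V j y)"
    unfolding P2_def[symmetric] by auto
qed

lemma t2_zero [simp]: "a \<in> Tc \<Longrightarrow> t2 a 0 = 0" "a \<in> Tc \<Longrightarrow> t2 0 a = 0"
  using t2_add(3)[of 0 a 0] t2_add(4)[of 0 a 0] by (simp_all add: fs.subspace_0)

lemma P2_pt: "t \<in> pt (tp i) (tp j) \<Longrightarrow> P2 p q t = (if i = p \<and> j = q then t else 0)"
proof -
  assume t: "t \<in> pt (tp i) (tp j)"
  have l: "lin (\<lambda>t. if i = p \<and> j = q then t else 0)" by (auto intro: linI)
  show ?thesis
    by (rule pair_eq[OF lin_on_lin[OF P2(1)] lin_on_lin[OF l] tp_sub tp_sub _ t])
      (use tp_T in \<open>auto simp: P2 Pd_tpow fs.subspace_0\<close>)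
qed

lemma P2_in: "t \<in> T2 \<Longrightarrow> P2 p q t \<in> pt (tp p) (tp q)"
  by (rule T2_in[OF lin_on_lin[OF P2(1)] subspace_pair]) (auto simp: P2 intro!: pair_tensor_base Pd_in)

lemma pt_T2: "Q \<subseteq> Tc \<Longrightarrow> R \<subseteq> Tc \<Longrightarrow> pt Q R \<subseteq> T2"
  by (rule pair_tensor_tpow)

lemma D_sum: "x \<in> tp n \<Longrightarrow> \<Delta> x = (\<Sum>i\<le>n. P2 i (n - i) (\<Delta> x))"
proof -
  assume x: "x \<in> tp n"
  have l: "lin (\<lambda>t. \<Sum>i\<le>n. P2 i (n - i) t)" by (intro lin_sum_fun P2)
  show ?thesis
  proof (rule lin_span_eq[OF lin_id(1) l _ D_gr[OF x]])
    fix t assume "t \<in> (\<Union>a\<in>{..n}. pt (tp a) (tp (n - a)))"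
    then obtain a where a: "a \<le> n" "t \<in> pt (tp a) (tp (n - a))" by auto
    have "(\<Sum>i\<le>n. P2 i (n - i) t) = (\<Sum>i\<le>n. if a = i then t else 0)"
      by (rule sum.cong[OF refl]) (auto simp: P2_pt[OF a(2)])
    then show "t = (\<Sum>i\<le>n. P2 i (n - i) t)" using a by simp
  qed
qed

lemma comult_comp_eq: "x \<in> Tc \<Longrightarrow> comult_comp V \<Delta> i j x = P2 i j (\<Delta> x)"
  unfolding comult_comp_def
  by (rule pair_ext_eq[OF fsp_T P2(1)]) (auto simp: P2 deg_proj_Pd D_T2 tpow2_pair[symmetric])

lemma tp0: "x \<in> tp 0 \<Longrightarrow> \<exists>k. x = fscale k one1"
proof -
  have "words V 0 = {[]}" by (auto simp: words_V)
  then show "x \<in> tp 0 \<Longrightarrow> \<exists>k. x = fscale k one1" by (auto simp: tpow_eq fs.span_singleton)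
qed

lemma one_tp0 [simp]: "one1 \<in> tp 0" by (rule tens_tpow') auto

text \<open>\<open>tp 0\<close> consists of the multiples of the unit, and scalars move into the
  left factor.\<close>

lemma pt_one_right: "t \<in> pt Q (tp 0) \<Longrightarrow> fs.subspace Q \<Longrightarrow> Q \<subseteq> Tc \<Longrightarrow> \<exists>x\<in>Q. t = t2 x one1"
proof -
  assume t: "t \<in> pt Q (tp 0)" and Q: "fs.subspace Q" "Q \<subseteq> Tc"
  have "(\<lambda>t. t) t \<in> (\<lambda>x. t2 x one1) ` Q"
  proof (rule pair_in[OF lin_on_id Q(2) tp_sub _ _ t])
    show "fs.subspace ((\<lambda>x. t2 x one1) ` Q)"
    proof (rule fs.subspaceI)
      show "0 \<in> (\<lambda>x. t2 x one1) ` Q" using fs.subspace_0[OF Q(1)] by (intro image_eqI[of _ _ 0]) auto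
      fix x y assume "x \<in> (\<lambda>x. t2 x one1) ` Q" "y \<in> (\<lambda>x. t2 x one1) ` Q"
      then obtain p q where "p \<in> Q" "q \<in> Q" "x = t2 p one1" "y = t2 q one1" by blast
      then show "x + y \<in> (\<lambda>x. t2 x one1) ` Q"
        using Q by (intro image_eqI[of _ _ "p + q"]) (auto simp: t2_add subset_iff fs.subspace_add)
    next
      fix k x assume "x \<in> (\<lambda>x. t2 x one1) ` Q"
      then obtain p where "p \<in> Q" "x = t2 p one1" by blast
      then show "fscale k x \<in> (\<lambda>x. t2 x one1) ` Q"
        using Q by (intro image_eqI[of _ _
        "fscale k p"]) (auto simp: t2_add subset_iff fs.subspace_scale)
    qed
    fix x y assume xy: "x \<in> Q" "y \<in> tp 0"
    then obtain k where "y = fscale k one1" using tp0 by blast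
    then have "t2 x y = t2 (fscale k x) one1" using xy Q by (simp add: t2_add subset_iff)
    then show "t2 x y \<in> (\<lambda>x. t2 x one1) ` Q" using xy Q fs.subspace_scale by blast
  qed
  then show ?thesis by blast
qed

lemma pt_one_left: "t \<in> pt (tp 0) Q \<Longrightarrow> fs.subspace Q \<Longrightarrow> Q \<subseteq> Tc \<Longrightarrow> \<exists>x\<in>Q. t = t2 one1 x"
proof -
  assume t: "t \<in> pt (tp 0) Q" and Q: "fs.subspace Q" "Q \<subseteq> Tc"
  have "(\<lambda>t. t) t \<in> (\<lambda>x. t2 one1 x) ` Q"
  proof (rule pair_in[OF lin_on_id tp_sub Q(2) _ _ t])
    show "fs.subspace ((\<lambda>x. t2 one1 x) ` Q)"
    proof (rule fs.subspaceI)
      show "0 \<in> (\<lambda>x. t2 one1 x) ` Q" using fs.subspace_0[OF Q(1)] by (intro image_eqI[of _ _ 0]) auto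
      fix x y assume "x \<in> (\<lambda>x. t2 one1 x) ` Q" "y \<in> (\<lambda>x. t2 one1 x) ` Q"
      then obtain p q where "p \<in> Q" "q \<in> Q" "x = t2 one1 p" "y = t2 one1 q" by blast
      then show "x + y \<in> (\<lambda>x. t2 one1 x) ` Q"
        using Q by (intro image_eqI[of _ _ "p + q"]) (auto simp: t2_add subset_iff fs.subspace_add)
    next
      fix k x assume "x \<in> (\<lambda>x. t2 one1 x) ` Q"
      then obtain p where "p \<in> Q" "x = t2 one1 p" by blast
      then show "fscale k x \<in> (\<lambda>x. t2 one1 x) ` Q"
        using Q by (intro image_eqI[of _ _
        "fscale k p"]) (auto simp: t2_add subset_iff fs.subspace_scale)
    qed
    fix y x assume xy: "x \<in> Q" "y \<in> tp 0"
    then obtain k where "y = fscale k one1" using tp0 by blast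
    then have "t2 y x = t2 one1 (fscale k x)" using xy Q by (simp add: t2_add subset_iff)
    then show "t2 y x \<in> (\<lambda>x. t2 one1 x) ` Q" using xy Q fs.subspace_scale by blast
  qed
  then show ?thesis by blast
qed

definition prim where "prim = {x \<in> Tc. \<Delta> x = t2 x one1 + t2 one1 x}"

lemma subspace_prim: "fs.subspace prim"
proof (rule fs.subspaceI)
  note D = D_lin[unfolded lin_on_def]
  have "\<Delta> 0 = 0" using D fs.subspace_0[OF subspace_T[of V]] by (metis fs.scale_zero_left)
  then show "0 \<in> prim" by (simp add: prim_def fs.subspace_0)
  show "x + y \<in> prim" if "x \<in> prim" "y \<in> prim" for x y
    using that D by (simp add: prim_def t2_add fs.subspace_add)
  show "fscale k x \<in> prim" if "x \<in> prim" for k x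
    using that D by (simp add: prim_def t2_add fs.subspace_scale fs.scale_right_distrib)
qed

lemma tp1_prim: "tp 1 \<subseteq> prim"
  using D_prim tp_T by (auto simp: prim_def)

text \<open>If the mixed components vanish, only
  \<open>\<Delta> x = q \<otimes> 1 + 1 \<otimes> p\<close> is left, with \<open>p\<close> and
  \<open>q\<close> of degree \<open>n\<close>. The two counit axioms then give \<open>x = q\<close>
  and \<open>x = p\<close>.\<close>

lemma E_deg_eq: "n \<ge> 2 \<Longrightarrow> E_deg V \<Delta> n = tp n \<inter> prim"
proof -
  assume n: "n \<ge> 2"
  have "(\<forall>i\<ge>1. \<forall>j\<ge>1. i + j = n \<longrightarrow> P2 i j (\<Delta> x) = 0) \<longleftrightarrow> x \<in> prim" if x: "x \<in> tp n" for x
  proof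
    assume z: "\<forall>i\<ge>1. \<forall>j\<ge>1. i + j = n \<longrightarrow> P2 i j (\<Delta> x) = 0"
    have "\<Delta> x = (\<Sum>i\<le>n. P2 i (n - i) (\<Delta> x))" by (rule D_sum[OF x])
    also have "\<dots> = (\<Sum>i\<in>{0, n}. P2 i (n - i) (\<Delta> x))"
      by (rule sum.mono_neutral_right) (use z in \<open>auto simp: One_nat_def Suc_le_eq\<close>)
    also have "\<dots> = P2 0 n (\<Delta> x) + P2 n 0 (\<Delta> x)" using n by simp
    finally have D: "\<Delta> x = P2 0 n (\<Delta> x) + P2 n 0 (\<Delta> x)" .
    have "\<Delta> x \<in> T2" using D_T2 tp_T x by blast
    then obtain p q where p: "p \<in> tp n" "P2 0 n (\<Delta> x) = t2 one1 p" and q: "q \<in> tp n" "P2 n 0 (\<Delta> x)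
        = t2 q one1"
      using pt_one_left[OF P2_in[of _ 0 n]] pt_one_right[OF P2_in[of _ n 0]] tp_sub subspace_tpow
      by metis
    have D': "\<Delta> x = t2 one1 p + t2 q one1" using D unfolding p(2) q(2) .
    \<comment> \<open>\<open>n\<close> is positive, so the counit kills \<open>p\<close> and
      \<open>q\<close>, and each counit axiom retains a single summand.\<close>
    have e: "\<epsilon> p = 0" "\<epsilon> q = 0" using eps_pos[of n] n p q by auto
    have T: "p \<in> Tc" "q \<in> Tc" "x \<in> Tc" using p q x tp_T by auto
    have "x = q" using counit(2)[OF T(3)] unfolding D' using T
        by (simp add: lin_add[OF eR(1)] eR e eps_one)
    moreover have "x = p" using counit(1)[OF T(3)] unfolding D' using T
        by (simp add: lin_add[OF eL(1)] eL e eps_one)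
    ultimately show "x \<in> prim" using D' T by (simp add: prim_def add.commute)
  next
    assume "x \<in> prim"
    then show "\<forall>i\<ge>1. \<forall>j\<ge>1. i + j = n \<longrightarrow> P2 i j (\<Delta> x) = 0"
      by (auto simp: prim_def lin_add[OF P2(1)] P2 Pd_tpow[OF one_tp0])
  qed
  moreover have "x \<in> E_deg V \<Delta> n \<longleftrightarrow> x \<in> tp n \<and> (\<forall>i\<ge>1. \<forall>j\<ge>1. i + j = n \<longrightarrow> P2 i j (\<Delta> x) = 0)" for x
    using n comult_comp_eq[OF tp_T, of x n] by (auto simp: E_deg_def)
  ultimately show ?thesis by blast
qed

lemma E_deg_small: "n < 2 \<Longrightarrow> E_deg V \<Delta> n = {0}"
  by (simp add: E_deg_def)

lemma E_deg_sub: "E_deg V \<Delta> n \<subseteq> tp n" "E_deg V \<Delta> n \<subseteq> prim" "fs.subspace (E_deg V \<Delta> n)"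
  using E_deg_eq[of n] E_deg_small[of n] subspace_prim
  by (cases "n < 2"; auto simp: fs.subspace_0 fs.subspace_inter)+

lemma E2_iff: "x \<in> E_deg V \<Delta> 2 \<longleftrightarrow> x \<in> tp 2 \<and> c x = - x"
proof -
  have "x \<in> prim \<longleftrightarrow> c x = - x" if x: "x \<in> tp 2" for x
  proof -
    have xc: "x + c x \<in> tp 2" using x c_tp fs.subspace_add[OF subspace_tpow] by blast
    have "x \<in> prim \<longleftrightarrow> iota (x + c x) = 0" using D_tp2[OF x] x tp_T by (auto simp: prim_def)
    also have "\<dots> \<longleftrightarrow> x + c x = 0" using mult_pair_iota[OF xc] lin_0[OF mult_pair(1)] lin_0[OF iota(1)]
        by metis
    finally show ?thesis by (simp add: eq_neg_iff_add_eq_0 add.commute)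
  qed
  then show ?thesis by (auto simp: E_deg_eq)
qed

abbreviation E where "E \<equiv> E_all V \<Delta>"

lemma E_eq: "E = fs.span (\<Union>n. E_deg V \<Delta> n)" by (simp add: E_all_def)

lemma E_sub: "E \<subseteq> prim" "E \<subseteq> Tc" "fs.subspace E" "E_deg V \<Delta> n \<subseteq> E"
proof -
  show "E \<subseteq> prim" unfolding E_eq by (rule fs.span_minimal) (use E_deg_sub subspace_prim in auto)
  then show "E \<subseteq> Tc" by (auto simp: prim_def)
  show "fs.subspace E" by (simp add: E_eq)
  show "E_deg V \<Delta> n \<subseteq> E" unfolding E_eq by (rule subsetI, rule fs.span_base) auto
qed

section \<open>Stability of primitive elements under braiding with vectors\<close>

lemma lf_tens_ex:
  assumes f: "lfun f"
  obtains f' where "\<And>x y. f' (x + y) = f' x + f' y" "\<And>k x. f' (fscale k x) = k * f' x"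
      "\<And>a. f' (t1 a) = f a"
\<comment> \<open>A tensor is a functional on multilinear forms; here it is evaluated at the form
  that is \<open>f\<close> on words of one letter and zero on all others.\<close>
proof (rule that[of "\<lambda>z. z (\<lambda>w. if length w = 1 then f (hd w) else 0)"])
  have "multilinear_form A (\<lambda>w. if length w = 1 then f (hd w) else 0)"
    unfolding multilinear_form_def
    by (auto simp: fsk.linear_add[OF f] fsk.linear_scale[OF f] One_nat_def)
  then show "t1 a (\<lambda>w. if length w = 1 then f (hd w) else 0) = f a" for a by (simp add: tens_def)
qed (auto simp: fun_applies)

lemma Kf_ex:
  assumes f: "lfun f"
  shows "\<exists>L. lin L \<and> (\<forall>a\<in>Tc. \<forall>u\<in>T2. L (t1 a \<diamond> u) = fscale (f a) u)"
    and "\<exists>L. lin L \<and> (\<forall>a\<in>Tc. \<forall>u\<in>T2. L (u \<diamond> t1 a) = fscale (f a) u)"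
proof -
  obtain f' where f': "\<And>x y. f' (x + y) = f' x + f' y" "\<And>k x. f' (fscale k x) = k * f' x"
      "\<And>a. f' (t1 a) = f a"
    using lf_tens_ex[OF f] by metis
  have b: "bil (tpow A 1) T2 (\<lambda>z u. fscale (f' z) u)" "bil T2 (tpow A 1) (\<lambda>u z. fscale (f' z) u)"
    unfolding bil_def lin_on_def by (simp_all add: f' fs.scale_left_distrib fs.scale_right_distrib mult.commute)
  obtain L where L: "lin L" "\<And>x y. x \<in> tpow A 1 \<Longrightarrow> y \<in> T2 \<Longrightarrow> L (x \<diamond> y) = fscale (f' x) y"
    using prod_ext[OF mclosed_T subspace_tpow order_refl subspace_tpow order_refl b(1)] by metis
  obtain L' where L': "lin L'" "\<And>x y. x \<in> T2 \<Longrightarrow> y \<in> tpow A 1 \<Longrightarrow> L' (x \<diamond> y) = fscale (f' y) x"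
    using prod_ext[OF mclosed_T subspace_tpow order_refl subspace_tpow order_refl b(2)] by metis
  show "\<exists>L. lin L \<and> (\<forall>a\<in>Tc. \<forall>u\<in>T2. L (t1 a \<diamond> u) = fscale (f a) u)"
    by (rule exI[of _ L]) (use L in \<open>auto simp: t_in f'(3) simp del: tens_append_set\<close>)
  show "\<exists>L. lin L \<and> (\<forall>a\<in>Tc. \<forall>u\<in>T2. L (u \<diamond> t1 a) = fscale (f a) u)"
    by (rule exI[of _ L']) (use L' in \<open>auto simp: t_in f'(3) simp del: tens_append_set\<close>)
qed

lemma tmul_sum_right: "(\<And>e. e \<in> F \<Longrightarrow> u e \<in> T2) \<Longrightarrow> a \<in> Tc \<Longrightarrow> t1 a \<diamond> (\<Sum>e\<in>F. u e) = (\<Sum>e\<in>F. t1 a \<diamond> u e)"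
proof (induction F rule: infinite_finite_induct)
  case (insert x F)
  then show ?case using TT_T[of _ 2] by (simp add: mult_T_right(1) TT_T[OF t_in(1)] fs.subspace_sum)
qed (use tmul_on(1)[of a] in \<open>auto simp: lin_on_def, (metis fs.scale_zero_left fs.subspace_0 subspace_tpow)+\<close>)

lemma tmul_sum_left: "(\<Sum>e\<in>F. u e) \<diamond> t1 a = (\<Sum>e\<in>F. u e \<diamond> t1 a)"
  by (induction F rule: infinite_finite_induct) (auto simp: mult_T_left)

lemma lin_on_sum:
  assumes f: "lin_on Q f" and Q: "fs.subspace Q" and u: "\<And>e. e \<in> F \<Longrightarrow> u e \<in> Q"
  shows "f (\<Sum>e\<in>F. u e) = (\<Sum>e\<in>F. f (u e))"
proof -
  obtain g where g: "lin g" "\<And>x. x \<in> Q \<Longrightarrow> g x = f x" using lin_on_extend[OF f Q] by blast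
  have "g (\<Sum>e\<in>F. u e) = (\<Sum>e\<in>F. g (u e))" by (rule lin_sum[OF g(1)])
  then show ?thesis using g u Q by (simp add: fs.subspace_sum)
qed

text \<open>\<open>c_T (x \<otimes> v)\<close> is written as a sum of terms
  \<open>e \<otimes> y e\<close> with independent vectors \<open>e\<close>. Since \<open>c_T\<close>
  is compatible with \<open>\<Delta>\<close> and \<open>x\<close> is primitive, the sum of the
  \<open>e \<otimes> \<Delta> (y e)\<close> has the value it would have with primitive
  \<open>y e\<close>. A form dual to \<open>e\<close> then isolates each single term.\<close>

lemma cT_E_left:
  assumes x: "x \<in> E_deg V \<Delta> n" and v: "v \<in> tp 1"
  shows "cT (t2 x v) \<in> pt (tp 1) (E_deg V \<Delta> n)"
proof (cases "n < 2")
  case True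
  then have "x = 0" using x E_deg_small by simp
  moreover have "cT 0 = 0" using cT_lin unfolding lin_on_def
      by (metis fs.scale_zero_left fs.subspace_0 subspace_tpow)
  ultimately show ?thesis using v tp_T by (simp add: fs.subspace_0)
next
  case False
  then have xn: "x \<in> tp n" "x \<in> prim" and En: "E_deg V \<Delta> n = tp n \<inter> prim" using x E_deg_eq by auto
  have T: "x \<in> Tc" "v \<in> Tc" using xn v tp_T by auto
  define t where "t = cT (t2 x v)"
  have t: "t \<in> pt (tp 1) (tp n)" unfolding t_def by (intro cT_gr pair_tensor_base xn v)
  have tT: "t \<in> T2" using t pt_T2[OF tp_sub tp_sub] by blast
  obtain F y where F: "finite F" "F \<subseteq> tp 1" "fs.independent F" "y ` F \<subseteq> tp n" "t = (\<Sum>e\<in>F. t2 e (y e))"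
    by (rule bil_decomp[OF bil_subset[OF t2_bil tp_sub tp_sub] subspace_tpow subspace_tpow t[unfolded pair_tensor_eq]])
  have FT: "e \<in> Tc" "y e \<in> Tc" if "e \<in> F" for e using F that tp_T by blast+
  \<comment> \<open>\<open>A1\<close> to \<open>A5\<close> evaluate
    \<open>F12 (F23 (D1 (t2 x v)))\<close>; braiding with the unit is the flip throughout.\<close>
  have A1: "D1 (t2 x v) = t3 x one1 v + t3 one1 x v"
    using T xn(2) by (simp add: D1_t prim_def mult_T_left)
  have A2: "F23 (t3 x one1 v + t3 one1 x v) = t1 x \<diamond> cT (t2 one1 v) + t1 one1 \<diamond> t"
    using F23_t[of "t2 one1 v" x] F23_t[of "t2 x v" one1] T by (simp add: t_in lin_add[OF F23(1)] t_def)
  have A3: "t1 x \<diamond> cT (t2 one1 v) + t1 one1 \<diamond> t = t2 x v \<diamond> t1 one1 + (\<Sum>e\<in>F. t2 one1 e \<diamond> t1 (y e))"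
    using T FT unfolding F(5) by (simp add: cT_one tmul_sum_right t_in)
  have A4: "F12 (t2 x v \<diamond> t1 one1 + (\<Sum>e\<in>F. t2 one1 e \<diamond> t1 (y e))) =
      t \<diamond> t1 one1 + (\<Sum>e\<in>F. cT (t2 one1 e) \<diamond> t1 (y e))"
    using T FT by (simp only: lin_add[OF F12(1)] lin_sum[OF F12(1)])
      (auto simp: F12_t t_in t_def[symmetric] simp del: tens_append_set intro!: arg_cong2[of _ _ _ _
          "(+)"] sum.cong)
  have A5: "t \<diamond> t1 one1 + (\<Sum>e\<in>F. cT (t2 one1 e) \<diamond> t1 (y e))
      = (\<Sum>e\<in>F. t1 e \<diamond> (t2 (y e) one1 + t2 one1 (y e)))"
    using FT unfolding F(5) tmul_sum_left
    by (simp add: sum.distrib[symmetric] cT_one mult_T_right(1) TT_T[OF t_in(1)] TT_T[OF t_in(2)])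
  have R: "F12 (F23 (D1 (t2 x v))) = (\<Sum>e\<in>F. t1 e \<diamond> (t2 (y e) one1 + t2 one1 (y e)))"
    by (simp only: A1 A2 A3 A4 A5)
  have "D2 t = (\<Sum>e\<in>F. t1 e \<diamond> \<Delta> (y e))" using FT unfolding F(5) by (simp add: lin_sum[OF D2(1)] D2_t)
  with R D_braid(1)[of "t2 x v"] T have eq: "(\<Sum>e\<in>F. t1 e \<diamond> \<Delta> (y e))
      = (\<Sum>e\<in>F. t1 e \<diamond> (t2 (y e) one1 + t2 one1 (y e)))"
    by (simp add: t_in t_def)
  obtain f where f: "\<And>e. lfun (f e)" "\<And>e d. e \<in> F \<Longrightarrow> d \<in> F \<Longrightarrow> f e d = (if d = e then 1 else (0::'k))"
    using dual_exists[OF F(3)] by metis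
  have "y e0 \<in> prim" if e0: "e0 \<in> F" for e0
  proof -
    obtain L where L: "lin L" "\<And>a u. a \<in> Tc \<Longrightarrow> u \<in> T2 \<Longrightarrow> L (t1 a \<diamond> u) = fscale (f e0 a) u"
      using Kf_ex(1)[OF f(1)[of e0]] by blast
    have pick: "L (\<Sum>e\<in>F. t1 e \<diamond> u e) = u e0" if "\<And>e. e \<in> F \<Longrightarrow> u e \<in> T2" for u
    proof -
      have "L (\<Sum>e\<in>F. t1 e \<diamond> u e) = (\<Sum>e\<in>F. fscale (f e0 e) (u e))"
        using that FT by (simp add: lin_sum[OF L(1)] L(2))
      also have "\<dots> = (\<Sum>e\<in>F. if e = e0 then u e0 else 0)"
          by (rule sum.cong[OF refl]) (use f(2)[OF e0] in auto)
      finally show ?thesis using F(1) e0 by simp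
    qed
    have "\<Delta> (y e0) = t2 (y e0) one1 + t2 one1 (y e0)"
      using arg_cong[OF eq, of L] FT
      by (subst (asm) (1 2) pick) (auto intro!: D_T2 fs.subspace_add t_in)
    then show ?thesis using FT[OF e0] by (simp add: prim_def)
  qed
  then have "t2 e (y e) \<in> pt (tp 1) (E_deg V \<Delta> n)" if "e \<in> F" for e
    using F that unfolding En by (intro pair_tensor_base) auto
  then show ?thesis unfolding t_def[symmetric] F(5) by (intro fs.subspace_sum subspace_pair)
qed

text \<open>The mirror image: the independent vectors stand on the right, and the other
  compatibility of \<open>c_T\<close> with \<open>\<Delta>\<close> is used.\<close>

lemma cT_E_right:
  assumes x: "x \<in> E_deg V \<Delta> n" and v: "v \<in> tp 1"
  shows "cT (t2 v x) \<in> pt (E_deg V \<Delta> n) (tp 1)"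
proof (cases "n < 2")
  case True
  then have "x = 0" using x E_deg_small by simp
  moreover have "cT 0 = 0" using cT_lin unfolding lin_on_def
      by (metis fs.scale_zero_left fs.subspace_0 subspace_tpow)
  ultimately show ?thesis using v tp_T by (simp add: fs.subspace_0)
next
  case False
  then have xn: "x \<in> tp n" "x \<in> prim" and En: "E_deg V \<Delta> n = tp n \<inter> prim" using x E_deg_eq by auto
  have T: "x \<in> Tc" "v \<in> Tc" using xn v tp_T by auto
  define t where "t = cT (t2 v x)"
  have t: "t \<in> pt (tp n) (tp 1)" unfolding t_def by (intro cT_gr pair_tensor_base xn v)
  have tT: "t \<in> T2" using t pt_T2[OF tp_sub tp_sub] by blast
  have t': "t \<in> fs.span {t2 y e | e y. e \<in> tp 1 \<and> y \<in> tp n}"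
    by (rule subsetD[OF fs.span_mono t[unfolded pair_tensor_eq]]) blast
  obtain F y where F: "finite F" "F \<subseteq> tp 1" "fs.independent F" "y ` F \<subseteq> tp n" "t = (\<Sum>e\<in>F. t2 (y e) e)"
    by (rule bil_decomp[OF bil_flip[OF bil_subset[OF t2_bil tp_sub tp_sub]] subspace_tpow subspace_tpow t'])
  have FT: "e \<in> Tc" "y e \<in> Tc" if "e \<in> F" for e using F that tp_T by blast+
  have A1: "D2 (t2 v x) = t3 v x one1 + t3 v one1 x"
    using T xn(2) by (simp add: D2_t prim_def mult_T_right(1) TT_T[OF t_in(1)] TT_T[OF t_in(2)])
  have A2: "F12 (t3 v x one1 + t3 v one1 x) = t \<diamond> t1 one1 + cT (t2 v one1) \<diamond> t1 x"
    using F12_t[of "t2 v x" one1] F12_t[of "t2 v one1" x] T by (simp add: t_in lin_add[OF F12(1)] t_def)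
  have A3: "t \<diamond> t1 one1 + cT (t2 v one1) \<diamond> t1 x = (\<Sum>e\<in>F. t1 (y e) \<diamond> t2 e one1) + t1 one1 \<diamond> t2 v x"
    using T FT unfolding F(5) by (simp add: cT_one tmul_sum_left)
  have A4: "F23 ((\<Sum>e\<in>F. t1 (y e) \<diamond> t2 e one1) + t1 one1 \<diamond> t2 v x) =
      (\<Sum>e\<in>F. t1 (y e) \<diamond> cT (t2 e one1)) + t1 one1 \<diamond> t"
    using T FT by (simp only: lin_add[OF F23(1)] lin_sum[OF F23(1)])
      (auto simp: F23_t t_in t_def[symmetric] simp del: tens_append_set intro!: arg_cong2[of _ _ _ _
          "(+)"] sum.cong)
  have A5: "(\<Sum>e\<in>F. t1 (y e) \<diamond> cT (t2 e one1)) + t1 one1 \<diamond> t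
      = (\<Sum>e\<in>F. (t2 (y e) one1 + t2 one1 (y e)) \<diamond> t1 e)"
    using FT unfolding F(5) by (simp add: sum.distrib[symmetric] cT_one mult_T_left tmul_sum_right t_in add.commute)
  have R: "F23 (F12 (D2 (t2 v x))) = (\<Sum>e\<in>F. (t2 (y e) one1 + t2 one1 (y e)) \<diamond> t1 e)"
    by (simp only: A1 A2 A3 A4 A5)
  have "D1 t = (\<Sum>e\<in>F. \<Delta> (y e) \<diamond> t1 e)" using FT unfolding F(5) by (simp add: lin_sum[OF D1(1)] D1_t)
  with R D_braid(2)[of "t2 v x"] T have eq: "(\<Sum>e\<in>F. \<Delta> (y e) \<diamond> t1 e)
      = (\<Sum>e\<in>F. (t2 (y e) one1 + t2 one1 (y e)) \<diamond> t1 e)"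
    by (simp add: t_in t_def)
  obtain f where f: "\<And>e. lfun (f e)" "\<And>e d. e \<in> F \<Longrightarrow> d \<in> F \<Longrightarrow> f e d = (if d = e then 1 else (0::'k))"
    using dual_exists[OF F(3)] by metis
  have "y e0 \<in> prim" if e0: "e0 \<in> F" for e0
  proof -
    obtain L where L: "lin L" "\<And>a u. a \<in> Tc \<Longrightarrow> u \<in> T2 \<Longrightarrow> L (u \<diamond> t1 a) = fscale (f e0 a) u"
      using Kf_ex(2)[OF f(1)[of e0]] by blast
    have pick: "L (\<Sum>e\<in>F. u e \<diamond> t1 e) = u e0" if "\<And>e. e \<in> F \<Longrightarrow> u e \<in> T2" for u
    proof -
      have "L (\<Sum>e\<in>F. u e \<diamond> t1 e) = (\<Sum>e\<in>F. fscale (f e0 e) (u e))"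
        using that FT by (simp add: lin_sum[OF L(1)] L(2))
      also have "\<dots> = (\<Sum>e\<in>F. if e = e0 then u e0 else 0)"
          by (rule sum.cong[OF refl]) (use f(2)[OF e0] in auto)
      finally show ?thesis using F(1) e0 by simp
    qed
    have "\<Delta> (y e0) = t2 (y e0) one1 + t2 one1 (y e0)"
      using arg_cong[OF eq, of L] FT
      by (subst (asm) (1 2) pick) (auto intro!: D_T2 fs.subspace_add t_in)
    then show ?thesis using FT[OF e0] by (simp add: prim_def)
  qed
  then have "t2 (y e) e \<in> pt (E_deg V \<Delta> n) (tp 1)" if "e \<in> F" for e
    using F that unfolding En by (intro pair_tensor_base) auto
  then show ?thesis unfolding t_def[symmetric] F(5) by (intro fs.subspace_sum subspace_pair)
qed

lemma cT_E_all:
  assumes x: "x \<in> E" and v: "v \<in> tp 1"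
  shows "cT (t2 x v) \<in> pt (tp 1) E" "cT (t2 v x) \<in> pt E (tp 1)"
proof -
  have T: "v \<in> Tc" using v tp_T by blast
  have l: "lin_on Tc (\<lambda>x. cT (t2 x v))" "lin_on Tc (\<lambda>x. cT (t2 v x))"
    using cT_lin T unfolding lin_on_def by (auto simp: t2_add t_in)
  obtain g where g: "lin g" "\<And>x. x \<in> Tc \<Longrightarrow> g x = cT (t2 x v)"
    using lin_on_extend[OF l(1) subspace_T] by blast
  obtain g' where g': "lin g'" "\<And>x. x \<in> Tc \<Longrightarrow> g' x = cT (t2 v x)"
    using lin_on_extend[OF l(2) subspace_T] by blast
  have xT: "x \<in> Tc" using x E_sub by blast
  have "g x \<in> pt (tp 1) E"
  proof (rule lin_span_in[OF g(1) _ subspace_pair x[unfolded E_eq]])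
    fix x assume "x \<in> (\<Union>n. E_deg V \<Delta> n)"
    then obtain n where n: "x \<in> E_deg V \<Delta> n" by blast
    then have "x \<in> Tc" using E_sub by blast
    then show "g x \<in> pt (tp 1) E" using cT_E_left[OF n v] g pair_tensor_mono[OF order_refl E_sub(4)[of n]] by auto
  qed
  then show "cT (t2 x v) \<in> pt (tp 1) E" using g xT by simp
  have "g' x \<in> pt E (tp 1)"
  proof (rule lin_span_in[OF g'(1) _ subspace_pair x[unfolded E_eq]])
    fix x assume "x \<in> (\<Union>n. E_deg V \<Delta> n)"
    then obtain n where n: "x \<in> E_deg V \<Delta> n" by blast
    then have "x \<in> Tc" using E_sub by blast
    then show "g' x \<in> pt E (tp 1)" using cT_E_right[OF n v] g' pair_tensor_mono[OF E_sub(4)[of n] order_refl] by auto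
  qed
  then show "cT (t2 v x) \<in> pt E (tp 1)" using g' xT by simp
qed

section \<open>Ideals as subspaces, and contractions of the comultiplication\<close>

lemma ideal_sub: "ideal I A \<Longrightarrow> fs.subspace I" "ideal I A \<Longrightarrow> I \<subseteq> Tc"
  "ideal I A \<Longrightarrow> x \<in> I \<Longrightarrow> y \<in> Tc \<Longrightarrow> y \<star> x \<in> I" "ideal I A \<Longrightarrow> x \<in> I \<Longrightarrow> y \<in> Tc \<Longrightarrow> x \<star> y \<in> I"
proof -
  assume I: "ideal I A"
  interpret ideal I A by (rule I)
  show sub: "I \<subseteq> Tc" using Icarr by auto
  show l: "x \<in> I \<Longrightarrow> y \<in> Tc \<Longrightarrow> y \<star> x \<in> I" for x y by (rule I_l_closed)
  show "x \<in> I \<Longrightarrow> y \<in> Tc \<Longrightarrow> x \<star> y \<in> I" by (rule I_r_closed)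
  show "fs.subspace I"
  proof (rule fs.subspaceI)
    show "0 \<in> I" using additive_subgroup.zero_closed[OF additive_subgroup_axioms] by simp
    show "x + y \<in> I" if "x \<in> I" "y \<in> I" for x y
      using additive_subgroup.a_closed[OF additive_subgroup_axioms that] by simp
    \<comment> \<open>An ideal of the ring comes without closure under scalars; \<open>k x\<close>
      is the product of \<open>k 1\<close> and \<open>x\<close>.\<close>
    show "fscale k x \<in> I" if "x \<in> I" for k x
    proof -
      have "fscale k one1 \<star> x \<in> I" by (rule l[OF that]) (simp add: fs.subspace_scale)
      then show ?thesis using that sub one_mul(1)[of x] by (auto simp: mul_left)
    qed
  qed
qed

text \<open>\<open>contract f\<close> is \<open>id \<otimes> f\<close>.\<close>
definition contract where "contract f = (SOME L. lin L \<and> (\<forall>x\<in>Tc. \<forall>y\<in>Tc. L (t2 x y) = fscale (f y) x))"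

lemma contract:
  assumes f: "lfun f"
  shows "lin (contract f)" "x \<in> Tc \<Longrightarrow> y \<in> Tc \<Longrightarrow> contract f (t2 x y) = fscale (f y) x"
proof -
  have "bil Tc Tc (\<lambda>x y. fscale (f y) x)"
    unfolding bil_def lin_on_def
    by (simp add: fsk.linear_add[OF f] fsk.linear_scale[OF f] fs.scale_left_distrib fs.scale_right_distrib mult.commute)
  from bil_ext[OF fsp_A subspace_T subspace_T this]
  have "\<exists>L. lin L \<and> (\<forall>x\<in>Tc. \<forall>y\<in>Tc. L (t2 x y) = fscale (f y) x)" by metis
  from someI_ex[OF this] show "lin (contract f)" "x \<in> Tc \<Longrightarrow> y \<in> Tc \<Longrightarrow> contract f (t2 x y) = fscale (f y) x"
    unfolding contract_def[symmetric] by auto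
qed

text \<open>Multiplies the part with right factor in \<open>V\<close> back into the tensor algebra.
  For \<open>z\<close> of degree \<open>m + 1\<close>, the value at \<open>\<Delta> z\<close> is the
  component of \<open>\<Delta> z\<close> in degrees \<open>(m, 1)\<close>, seen in
  \<open>tp (m + 1)\<close>.\<close>

definition mult_last where "mult_last = (SOME L. lin L \<and> (\<forall>x\<in>Tc. \<forall>y\<in>Tc. L (t2 x y) = x \<star> Pd V 1 y))"

lemma mult_last: "lin mult_last" "x \<in> Tc \<Longrightarrow> y \<in> Tc \<Longrightarrow> mult_last (t2 x y) = x \<star> Pd V 1 y"
proof -
  have "bil Tc Tc (\<lambda>x y. x \<star> Pd V 1 y)"
    by (rule bil_comp[OF mult_T_bil[OF mclosed_V] lin_id(1) lin_Pd]) auto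
  from bil_ext[OF fsp_A subspace_T subspace_T this]
  have "\<exists>L. lin L \<and> (\<forall>x\<in>Tc. \<forall>y\<in>Tc. L (t2 x y) = x \<star> Pd V 1 y)" by metis
  from someI_ex[OF this] show "lin mult_last" "x \<in> Tc \<Longrightarrow> y \<in> Tc \<Longrightarrow> mult_last (t2 x y) = x \<star> Pd V 1 y"
    unfolding mult_last_def[symmetric] by auto
qed

lemma mul_zero [simp]: "u \<in> Tc \<Longrightarrow> u \<star> 0 = 0" "0 \<star> u = 0"
  using mul_right(2)[of u 0 0] mul_left by (simp_all add: fs.subspace_0)

lemma mult_last_pt_0:
  assumes u: "u \<in> pt (tp i) (tp j)" and j: "j \<noteq> 1"
  shows "mult_last u = 0"
  by (rule pair_eq[OF lin_on_lin[OF mult_last(1)] lin_on_lin[OF lin_zero] tp_sub tp_sub _ u])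
    (use j tp_T in \<open>auto simp: mult_last Pd_tpow\<close>)

lemma mult_last_LA:
  assumes a: "a \<in> Tc" and w: "w \<in> tp 2"
  shows "mult_last (LA a (iota w)) = a \<star> w"
proof (rule tp_eqI[of 2 "\<lambda>w. mult_last (LA a (iota w))" "\<lambda>w. a \<star> w" 1 1 w])
  have iT: "iota w \<in> T2" if "w \<in> tp 2" for w
  proof -
    have "w \<in> tp (1 + 1)" using that by simp
    then have w: "w \<in> fs.span {x \<star> y |x y. x \<in> tp 1 \<and> y \<in> tp 1}" unfolding tpow_add_span[OF mclosed_V] .
    show ?thesis
      by (rule lin_span_in[OF iota(1) _ subspace_tpow w]) (use tp_T in \<open>auto simp: iota intro!: t_in\<close>)
  qed
  show "lin_on (tp 2) (\<lambda>w. mult_last (LA a (iota w)))"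
    by (rule lin_on_comp[OF mult_last(1)], rule lin_on_compon[OF LA_on[OF a] lin_on_lin[OF iota(1)] iT])
  show "lin_on (tp 2) (\<lambda>w. a \<star> w)" by (rule lin_on_mulL[OF mclosed_V lin_on_id tp_T a])
  fix x y assume xy: "x \<in> tp 1" "y \<in> tp 1"
  then have T: "x \<in> Tc" "y \<in> Tc" using tp_T by auto
  show "mult_last (LA a (iota (x \<star> y))) = a \<star> (x \<star> y)"
    using xy T a by (simp add: iota LA_t mult_last mul_closed Pd_tpow mul_assoc)
qed (use w in auto)

lemma eps_tp0: "b \<in> tp 0 \<Longrightarrow> b = fscale (\<epsilon> b) one1"
  using tp0[of b] by (auto simp: eps_scale eps_one)

text \<open>Of the two terms in \<open>Psi_t\<close>, the one with right factor \<open>b v\<close>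
  survives only for scalar \<open>b\<close>, where it gives the counit term. The other one has its
  right factor in the degree of \<open>b\<close> and survives only in degree one, where
  \<open>c_T\<close> is \<open>c\<close> acting on the last two letters.\<close>

lemma mult_last_Psi:
  assumes u: "u \<in> pt (tp i) (tp j)" and ij: "i + j = Suc m" and v: "v \<in> tp 1"
  shows "mult_last (Psi v u) = eR u \<star> v + braid_op (Suc (Suc m)) m (mult_last u \<star> v)"
proof (rule pair_eq[OF _ _ tp_sub tp_sub _ u])
  have CLl: "lin (braid_op (Suc (Suc m)) m)" by (rule braid_op(1)) simp
  show "lin_on T2 (\<lambda>u. mult_last (Psi v u))" by (rule lin_on_comp[OF mult_last(1) Psi_on])
  have "lin_on T2 (\<lambda>u. eR u \<star> v)" "lin_on T2 (\<lambda>u. braid_op (Suc (Suc m)) m (mult_last u \<star> v))"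
    by (intro lin_on_mulR lin_on_lin eR lin_on_comp[OF CLl] mult_last)+
  then show "lin_on T2 (\<lambda>u. eR u \<star> v + braid_op (Suc (Suc m)) m (mult_last u \<star> v))"
    unfolding lin_on_def by (simp add: fs.scale_right_distrib)
  fix a b assume ab: "a \<in> tp i" "b \<in> tp j"
  have T: "a \<in> Tc" "b \<in> Tc" "v \<in> Tc" using ab v tp_T by auto
  have 1: "mult_last (t2 a (b \<star> v)) = eR (t2 a b) \<star> v"
  proof (cases "j = 0")
    case True
    then have b: "b = fscale (\<epsilon> b) one1" using eps_tp0 ab by simp
    have "b \<star> v = fscale (\<epsilon> b) v" by (subst b) (simp add: mul_left one_mul T)
    then show ?thesis
      using T v by (simp add: mult_last mul_closed fs.subspace_scale lin_scale[OF lin_Pd] Pd_tpow mul_right(2) eR mul_left)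
  next
    case False
    then have "\<epsilon> b = 0" using eps_pos[of j b] ab by (simp add: One_nat_def)
    moreover have "b \<star> v \<in> tp (j + 1)" using mul_tp ab v by blast
    ultimately show ?thesis using T False by (simp add: mult_last mul_closed Pd_tpow eR)
  qed
  have 2: "mult_last (LA a (cT (t2 b v))) = braid_op (Suc (Suc m)) m (mult_last (t2 a b) \<star> v)"
  proof (cases "j = 1")
    case True
    then have i: "i = m" using ij by simp
    have bv: "b \<star> v \<in> tp 2" using mul_tp[of b 1 v 1] ab v True by simp
    have cbv: "c (b \<star> v) \<in> tp 2" using c_tp bv by simp
    have b1: "b \<in> tp 1" using ab True by simp
    have "mult_last (LA a (cT (t2 b v))) = a \<star> c (b \<star> v)"
      unfolding cT_iota[OF b1 v] by (rule mult_last_LA[OF T(1) cbv])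
    also have "\<dots> = braid_op (Suc (Suc m)) m (a \<star> ((b \<star> v) \<star> one1))"
    proof -
      have "braid_op (Suc (Suc m)) m (a \<star> ((b \<star> v) \<star> one1)) = a \<star> (c (b \<star> v) \<star> one1)"
        by (rule braid_op(3)[of m "Suc (Suc m)" a "b \<star> v" one1 0]) (use ab bv i in auto)
      then show ?thesis using cbv tp_T by (simp add: one_mul)
    qed
    also have "a \<star> ((b \<star> v) \<star> one1) = mult_last (t2 a b) \<star> v"
      using T b1 by (simp add: one_mul mul_closed mult_last Pd_tpow mul_assoc)
    finally show ?thesis .
  next
    case False
    have z: "cT (t2 b v) \<in> pt (tp 1) (tp j)" by (intro cT_gr pair_tensor_base ab v)
    have "mult_last (LA a (cT (t2 b v))) = 0"
    proof (rule pair_eq[OF lin_on_comp[OF mult_last(1) LA_on[OF T(1)]] lin_on_lin[OF lin_zero] tp_sub tp_sub _ z])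
      fix x y assume "x \<in> tp 1" "y \<in> tp j"
      then show "mult_last (LA a (t2 x y)) = 0" using T False tp_T[of x 1] tp_T[of y j]
          by (simp add: LA_t mult_last mul_closed Pd_tpow)
    qed
    moreover have "mult_last (t2 a b) = 0" using ab T False by (simp add: mult_last Pd_tpow)
    ultimately show ?thesis by (simp add: lin_0[OF CLl])
  qed
  show "mult_last (Psi v (t2 a b)) = eR (t2 a b) \<star> v + braid_op (Suc (Suc m)) m (mult_last (t2 a b) \<star> v)"
    using T v by (simp only: Psi_t lin_add[OF mult_last(1)] 1 2 add.commute)
qed

text \<open>Both sides obey the same recursion in \<open>m\<close>: \<open>mult_last_Psi\<close> on
  the left, where the counit axiom replaces \<open>eR (\<Delta> x)\<close> by \<open>x\<close>, and
  \<open>coset_sum_Suc\<close> on the right.\<close>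

lemma coset_sum_eq: "z \<in> tp (Suc m) \<Longrightarrow> mult_last (\<Delta> z) = coset_sum m z"
proof (induction m arbitrary: z)
  case 0
  then have z: "z \<in> tp 1" by (simp add: One_nat_def)
  then show ?case using tp_T[OF z] by (simp add: D_prim lin_add[OF mult_last(1)] mult_last
      Pd_tpow[OF one_tp0] Pd_tpow one_mul coset_sum_0)
next
  case (Suc m)
  have Don: "lin_on (tp n) \<Delta>" for n using D_lin tp_sub[of n] unfolding lin_on_def by blast
  show ?case
  proof (rule tp_eqI[of "Suc (Suc m)" "\<lambda>z. mult_last (\<Delta> z)" "coset_sum (Suc m)" "Suc m" 1 z])
    show "lin_on (tp (Suc (Suc m))) (\<lambda>z. mult_last (\<Delta> z))" by (rule lin_on_comp[OF mult_last(1) Don])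
    fix x v assume x: "x \<in> tp (Suc m)" and v: "v \<in> tp 1"
    have T: "x \<in> Tc" "v \<in> Tc" using x v tp_T by auto
    have CLl: "lin (braid_op (Suc (Suc m)) m)" by (rule braid_op(1)) simp
    have l: "lin_on T2 (\<lambda>u. eR u \<star> v + braid_op (Suc (Suc m)) m (mult_last u \<star> v))"
    proof -
      have "lin_on T2 (\<lambda>u. eR u \<star> v)" "lin_on T2 (\<lambda>u. braid_op (Suc (Suc m)) m (mult_last u \<star> v))"
        by (intro lin_on_mulR lin_on_lin eR lin_on_comp[OF CLl] mult_last)+
      then show ?thesis unfolding lin_on_def by (simp add: fs.scale_right_distrib)
    qed
    have "mult_last (\<Delta> (x \<star> v)) = mult_last (Psi v (\<Delta> x))" by (simp add: D_mul_right T)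
    also have "\<dots> = eR (\<Delta> x) \<star> v + braid_op (Suc (Suc m)) m (mult_last (\<Delta> x) \<star> v)"
    proof (rule lin_on_span_eq[OF lin_on_comp[OF mult_last(1) Psi_on] l subspace_tpow _ _ D_gr[OF x]])
      show "(\<Union>i\<in>{..Suc m}. pt (tp i) (tp (Suc m - i))) \<subseteq> T2" using pt_T2[OF tp_sub tp_sub] by blast
      fix u assume "u \<in> (\<Union>i\<in>{..Suc m}. pt (tp i) (tp (Suc m - i)))"
      then obtain i where "i \<le> Suc m" "u \<in> pt (tp i) (tp (Suc m - i))" by auto
      then show "mult_last (Psi v u) = eR u \<star> v + braid_op (Suc (Suc m)) m (mult_last u \<star> v)"
        using mult_last_Psi[of u i "Suc m - i" m v] v by simp
    qed
    also have "\<dots> = coset_sum (Suc m) (x \<star> v)"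
      by (simp only: counit(2)[OF T(1)] Suc.IH[OF x] coset_sum_Suc[OF x v])
    finally show "mult_last (\<Delta> (x \<star> v)) = coset_sum (Suc m) (x \<star> v)" .
  qed (use Suc.prems in \<open>auto intro: lin_on_lin[OF lin_coset_sum]\<close>)
qed

lemma contract_pt:
  assumes f: "lfun f" and u: "u \<in> pt (tp i) (tp j)"
  shows "contract f u \<in> tp i"
  by (rule pair_in[OF lin_on_lin[OF contract(1)[OF f]] tp_sub tp_sub subspace_tpow _ u])
    (use tp_T in \<open>auto simp: contract[OF f] intro!: fs.subspace_scale\<close>)

lemma contract_pt_0:
  assumes f: "lfun f" "f one1 = 0" and u: "u \<in> pt (tp i) (tp 0)"
  shows "contract f u = 0"
proof (rule pair_eq[OF lin_on_lin[OF contract(1)[OF f(1)]] lin_on_lin[OF lin_zero] tp_sub tp_sub _ u])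
  fix x y assume xy: "x \<in> tp i" "y \<in> tp 0"
  have "f y = 0" using tp0[OF xy(2)] f by (auto simp: fsk.linear_scale[OF f(1)])
  then show "contract f (t2 x y) = 0" using xy tp_T[of x i] tp_T[of y 0] by (simp add: contract[OF f(1)])
qed

lemma D0_in: "z \<in> Tc \<Longrightarrow> P2 i j (\<Delta> z) \<in> pt (tp i) (tp j)"
  by (rule P2_in[OF D_T2])

lemma Df_0:
  assumes f: "lfun f" "f one1 = 0" and z: "z \<in> tp 0"
  shows "contract f (\<Delta> z) = 0"
proof -
  have "\<Delta> z = P2 0 0 (\<Delta> z)" using D_sum[OF z] by simp
  then show ?thesis using contract_pt_0[OF f D0_in[OF tp_T[OF z]]] by metis
qed

text \<open>\<open>f\<close> kills the unit and with it the component in degrees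
  \<open>(k + 1, 0)\<close>. Among the remaining components only the one in degrees
  \<open>(k, 1)\<close> has a left factor of degree \<open>k\<close>.\<close>

lemma Df_Suc:
  assumes f: "lfun f" "f one1 = 0" and z: "z \<in> tp (Suc k)"
  shows "contract f (\<Delta> z) \<in> filt V k" "Pd V k (contract f (\<Delta> z)) = contract f (P2 k 1 (\<Delta> z))"
proof -
  have zT: "z \<in> Tc" using z tp_T by blast
  have "contract f (\<Delta> z) = (\<Sum>i\<le>Suc k. contract f (P2 i (Suc k - i) (\<Delta> z)))"
    using D_sum[OF z] lin_sum[OF contract(1)[OF f(1)]] by metis
  also have "\<dots> = (\<Sum>i\<le>k. contract f (P2 i (Suc k - i) (\<Delta> z)))"
    using contract_pt_0[OF f D0_in[OF zT]] by simp
  finally have e: "contract f (\<Delta> z) = (\<Sum>i\<le>k. contract f (P2 i (Suc k - i) (\<Delta> z)))" .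
  have m: "contract f (P2 i (Suc k - i) (\<Delta> z)) \<in> tp i" for i using contract_pt[OF f(1) D0_in[OF zT]] .
  show "contract f (\<Delta> z) \<in> filt V k" unfolding e using m tpow_filt[of _ k V]
      by (intro fs.subspace_sum subspace_filt) auto
  have "Pd V k (contract f (\<Delta> z)) = (\<Sum>i\<le>k. if i = k then contract f (P2 k (Suc k - k) (\<Delta> z)) else 0)"
    unfolding e lin_sum[OF lin_Pd] by (rule sum.cong[OF refl]) (use Pd_tpow[OF m] in auto)
  then show "Pd V k (contract f (\<Delta> z)) = contract f (P2 k 1 (\<Delta> z))" by (simp add: One_nat_def)
qed

lemma contraction_exists:
  assumes f: "lfun f"
  shows "\<exists>R. lin R \<and> (\<forall>x\<in>tp m. \<forall>v\<in>tp 1. R (x \<star> v) = fscale (f v) x)"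
proof -
  have b: "bil (tp m) (tp 1) (\<lambda>x v. fscale (f v) x)"
    unfolding bil_def lin_on_def
    by (simp add: fsk.linear_add[OF f] fsk.linear_scale[OF f] fs.scale_left_distrib fs.scale_right_distrib mult.commute)
  show ?thesis using prod_ext[OF mclosed_V subspace_tpow order_refl subspace_tpow order_refl b] by metis
qed

text \<open>Both sides are the contraction with \<open>f\<close> of the component of
  \<open>\<Delta> z\<close> in degrees \<open>(m, 1)\<close>, once after multiplication into
  \<open>tp (m + 1)\<close> and once before.\<close>

lemma contract_coset_sum:
  assumes f: "lfun f" "f one1 = 0" and z: "z \<in> tp (Suc m)"
    and R: "lin R" "\<And>x v. x \<in> tp m \<Longrightarrow> v \<in> tp 1 \<Longrightarrow> R (x \<star> v) = fscale (f v) x"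
  shows "R (coset_sum m z) = Pd V m (contract f (\<Delta> z))"
proof -
  have zT: "z \<in> Tc" using z tp_T by blast
  have "coset_sum m z = (\<Sum>i\<le>Suc m. mult_last (P2 i (Suc m - i) (\<Delta> z)))"
    using coset_sum_eq[OF z] D_sum[OF z] lin_sum[OF mult_last(1)] by metis
  also have "\<dots> = (\<Sum>i\<le>Suc m. if i = m then mult_last (P2 m 1 (\<Delta> z)) else 0)"
    by (rule sum.cong[OF refl]) (use mult_last_pt_0[OF D0_in[OF zT]] in \<open>auto simp: One_nat_def\<close>)
  also have "\<dots> = mult_last (P2 m 1 (\<Delta> z))" by simp
  finally have Y: "coset_sum m z = mult_last (P2 m 1 (\<Delta> z))" .
  have "R (mult_last u) = contract f u" if u: "u \<in> pt (tp m) (tp 1)" for u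
    by (rule pair_eq[OF lin_on_comp[OF R(1) lin_on_lin[OF mult_last(1)]] lin_on_lin[OF
    contract(1)[OF f(1)]] tp_sub tp_sub _ u])
      (use tp_T in \<open>auto simp: mult_last contract[OF f(1)] Pd_tpow R\<close>)
  then show ?thesis unfolding Y Df_Suc(2)[OF f z] using D0_in[OF zT] by blast
qed

end

section \<open>The enveloping ideal\<close>

locale braided_lie = tensor_bialg s V c cT \<Delta> \<epsilon>
  for s :: "'k::field \<Rightarrow> 'v::ab_group_add \<Rightarrow> 'v" and V :: "('k, 'v) module" and c ::
      "('k, 'v) T \<Rightarrow> ('k, 'v) T"
    and cT :: "('k, 'v) TT \<Rightarrow> ('k, 'v) TT" and \<Delta> :: "('k, 'v) T \<Rightarrow> ('k, 'v) TT" and \<epsilon> ::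
        "('k, 'v) T \<Rightarrow> 'k" +
  fixes b :: "('k, 'v) T \<Rightarrow> 'v"
  assumes bl: "braided_Lie_algebra V c cT \<Delta> b"
begin

definition incl_b where "incl_b x = incl V (b x)"
definition I where "I = env_ideal V E b"

lemma incl_tp1: "incl V v \<in> tp 1"
  unfolding incl_def by (rule tens1_tp)

lemma tp1_incl: "tp 1 = range (incl V)"
proof -
  have "words V 1 = range (\<lambda>x. [x])" by (auto simp: words_V length_Suc_conv One_nat_def)
  then have *: "tp 1 = fs.span (range (incl V))" unfolding tpow_eq incl_def[abs_def]
      by (simp add: image_image)
  have add: "incl V (x + y) = incl V x + incl V y" "incl V (s k x) = fscale k (incl V x)" for x y k
    using tens_add[of "[]" V "[]" x y] tens_smult[of "[]" V "[]" x k] by (simp_all add: incl_def)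
  have "fs.subspace (range (incl V))"
  proof (rule fs.subspaceI)
    show "0 \<in> range (incl V)" using add(2)[of 0 0] by (metis fs.scale_zero_left rangeI)
    show "x + y \<in> range (incl V)" if "x \<in> range (incl V)" "y \<in> range (incl V)" for x y
      using that add(1) by (metis (no_types) rangeE rangeI)
    show "fscale k x \<in> range (incl V)" if "x \<in> range (incl V)" for k x
      using that add(2) by (metis (no_types) rangeE rangeI)
  qed
  then show ?thesis unfolding * by simp
qed

lemma incl_lin: "incl V (x + y) = incl V x + incl V y" "incl V (s k x) = fscale k (incl V x)"
  using tens_add[of "[]" V "[]" x y] tens_smult[of "[]" V "[]" x k] by (simp_all add: incl_def)

lemma incl_0: "incl V 0 = 0"
proof -
  interpret vector_space s by (rule vs)
  have "incl V (s 0 0) = fscale 0 (incl V 0)" by (rule incl_lin)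
  then show ?thesis by simp
qed

lemma incl_b_tp1 [simp]: "incl_b x \<in> tp 1" by (simp add: incl_b_def incl_tp1)
lemma incl_b_Tc [simp]: "incl_b x \<in> Tc" using incl_b_tp1 tp_T by blast

lemma brk: "bracket_on V c cT E b" using bl by (simp add: braided_Lie_algebra_def)

lemma b_lin: "x \<in> E \<Longrightarrow> y \<in> E \<Longrightarrow> b (x + y) = b x + b y" "x \<in> E \<Longrightarrow> b (fscale k x) = s k (b x)"
  using brk unfolding bracket_on_def linear_on_def by auto

lemma incl_b_lin: "lin_on E incl_b"
  unfolding lin_on_def incl_b_def by (simp add: b_lin incl_lin)

definition bV where "bV = (SOME L. lin L \<and> (\<forall>x\<in>E. \<forall>v\<in>tp 1. L (t2 x v) = incl_b x \<star> v))"
definition Vb where "Vb = (SOME L. lin L \<and> (\<forall>v\<in>tp 1. \<forall>x\<in>E. L (t2 v x) = v \<star> incl_b x))"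

lemma bV: "lin bV" "x \<in> E \<Longrightarrow> v \<in> tp 1 \<Longrightarrow> bV (t2 x v) = incl_b x \<star> v"
proof -
  have "bil E (tp 1) (\<lambda>x v. incl_b x \<star> v)"
    using incl_b_lin tp_T unfolding bil_def lin_on_def by (simp add: mul_left mul_right)
  from bil_ext[OF fsp_A E_sub(3) subspace_tpow this]
  have "\<exists>L. lin L \<and> (\<forall>x\<in>E. \<forall>v\<in>tp 1. L (t2 x v) = incl_b x \<star> v)" by metis
  from someI_ex[OF this] show "lin bV" "x \<in> E \<Longrightarrow> v \<in> tp 1 \<Longrightarrow> bV (t2 x v) = incl_b x \<star> v"
    unfolding bV_def[symmetric] by auto
qed

lemma Vb: "lin Vb" "x \<in> E \<Longrightarrow> v \<in> tp 1 \<Longrightarrow> Vb (t2 v x) = v \<star> incl_b x"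
proof -
  have "bil (tp 1) E (\<lambda>v x. v \<star> incl_b x)"
    using incl_b_lin tp_T unfolding bil_def lin_on_def by (simp add: mul_left mul_right)
  from bil_ext[OF fsp_A subspace_tpow E_sub(3) this]
  have "\<exists>L. lin L \<and> (\<forall>v\<in>tp 1. \<forall>x\<in>E. L (t2 v x) = v \<star> incl_b x)" by metis
  from someI_ex[OF this] show "lin Vb" "x \<in> E \<Longrightarrow> v \<in> tp 1 \<Longrightarrow> Vb (t2 v x) = v \<star> incl_b x"
    unfolding Vb_def[symmetric] by auto
qed

lemma bV_eq:
  assumes "E' \<subseteq> E" "\<And>x. x \<in> E' \<Longrightarrow> b' x = b x"
  shows "t \<in> pt E' (tp 1) \<Longrightarrow> pair_ext A A E' (tp 1) (\<lambda>x v. incl V (b' x) \<star> v) t = bV t"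
    "t \<in> pt (tp 1) E' \<Longrightarrow> pair_ext A A (tp 1) E' (\<lambda>v x. v \<star> incl V (b' x)) t = Vb t"
  using assms by (auto intro!: pair_ext_eq[OF fsp_A bV(1)] pair_ext_eq[OF fsp_A Vb(1)] simp: bV Vb incl_b_def subset_iff)

lemma pt_E: "t \<in> pt E (tp 1) \<Longrightarrow> cT t \<in> pt (tp 1) E" "t \<in> pt (tp 1) E \<Longrightarrow> cT t \<in> pt E (tp 1)"
  by (rule pair_in[OF cT_lin E_sub(2) tp_sub subspace_pair cT_E_all(1)]; assumption)
    (rule pair_in[OF cT_lin tp_sub E_sub(2) subspace_pair cT_E_all(2)]; assumption)

lemma bracket: "t \<in> pt E (tp 1) \<Longrightarrow> c (bV t) = Vb (cT t)" "t \<in> pt (tp 1) E \<Longrightarrow> c (Vb t) = bV (cT t)"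
proof -
  have *: "\<forall>t\<in>pt E (tp 1). c (pair_ext A A E (tp 1) (\<lambda>x v. incl V (b x) \<star> v) t)
      = pair_ext A A (tp 1) E (\<lambda>v x. v \<star> incl V (b x)) (cT t)"
    "\<forall>t\<in>pt (tp 1) E. c (pair_ext A A (tp 1) E (\<lambda>v x. v \<star> incl V (b x)) t)
        = pair_ext A A E (tp 1) (\<lambda>x v. incl V (b x) \<star> v) (cT t)"
    using brk unfolding bracket_on_def Let_def by auto
  show "t \<in> pt E (tp 1) \<Longrightarrow> c (bV t) = Vb (cT t)" "t \<in> pt (tp 1) E \<Longrightarrow> c (Vb t) = bV (cT t)"
    using *(1)[rule_format, of t] *(2)[rule_format, of t] bV_eq[OF order_refl refl] pt_E by auto
qed

section \<open>The enveloping ideal: braiding with vectors and coideal property\<close>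

lemma I_ideal: "ideal I A" and I_gen: "x \<in> E \<Longrightarrow> x - incl_b x \<in> I"
  and I_min: "ideal K A \<Longrightarrow> (\<And>x. x \<in> E \<Longrightarrow> x - incl_b x \<in> K) \<Longrightarrow> I \<subseteq> K"
proof -
  interpret ring A by (rule ring_T) simp
  have g: "{x \<ominus>\<^bsub>A\<^esub> incl V (b x) |x. x \<in> E} = {x - incl_b x | x. x \<in> E}"
    unfolding Setcompr_eq_image
    by (rule image_cong[OF refl]) (use E_sub(2) in \<open>auto simp: incl_b_def minus_T tp_T[OF incl_tp1]\<close>)
  have sub: "{x - incl_b x | x. x \<in> E} \<subseteq> Tc" using E_sub(2)
      by (auto intro!: fs.subspace_diff[OF subspace_T])
  show "ideal I A" unfolding I_def env_ideal_def g by (rule genideal_ideal[OF sub])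
  show "x \<in> E \<Longrightarrow> x - incl_b x \<in> I" unfolding I_def env_ideal_def g using genideal_self[OF sub] by blast
  show "ideal K A \<Longrightarrow> (\<And>x. x \<in> E \<Longrightarrow> x - incl_b x \<in> K) \<Longrightarrow> I \<subseteq> K"
    unfolding I_def env_ideal_def g by (rule genideal_minimal) auto
qed

lemmas I_sub = ideal_sub[OF I_ideal]

text \<open>By the bracket axiom, \<open>c_T (b x \<otimes> v)\<close> is the image under
  \<open>V \<otimes> b\<close> of \<open>c_T (x \<otimes> v)\<close>, which lies in
  \<open>V \<otimes> E\<close>. The difference of the two thus has factors \<open>y - b y\<close>
  with \<open>y\<close> in \<open>E\<close>, and these lie in \<open>I\<close>.\<close>

lemma cT_I_gen:
  assumes x: "x \<in> E" and v: "v \<in> tp 1"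
  shows "cT (t2 (x - incl_b x) v) \<in> pt (tp 1) I" "cT (t2 v (x - incl_b x)) \<in> pt I (tp 1)"
proof -
  have T: "x \<in> Tc" "v \<in> Tc" using x v E_sub tp_T by auto
  have ITc: "I \<subseteq> Tc" by (rule I_sub(2))
  note c = cT_lin[unfolded lin_on_def]
  have dif: "t2 (p - q) w = t2 p w - t2 q w" "t2 w (p - q) = t2 w p - t2 w q"
    "cT (t2 p w - t2 q w) = cT (t2 p w) - cT (t2 q w)" "cT (t2 w p - t2 w q) = cT (t2 w p) - cT (t2 w q)"
    if "p \<in> Tc" "q \<in> Tc" "w \<in> Tc" for p q w
  proof -
    obtain g :: "('k, 'v) TT \<Rightarrow> ('k, 'v) TT" where g: "lin g" "\<And>x. x \<in> T2 \<Longrightarrow> g x = cT x"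
      using lin_on_extend[OF cT_lin subspace_tpow] by blast
    show "t2 (p - q) w = t2 p w - t2 q w" using t2_add(1)[of "p - q" q w] that
        by (simp add: fs.subspace_diff)
    show "t2 w (p - q) = t2 w p - t2 w q" using t2_add(2)[of "p - q" q w] that
        by (simp add: fs.subspace_diff)
    show "cT (t2 p w - t2 q w) = cT (t2 p w) - cT (t2 q w)" "cT (t2 w p - t2 w q)
        = cT (t2 w p) - cT (t2 w q)"
      using lin_diff[OF g(1), of "t2 p w" "t2 q w"] lin_diff[OF g(1), of "t2 w p" "t2 w q"] that
      by (simp_all add: g(2) t_in fs.subspace_diff)
  qed
  have "cT (t2 (incl_b x) v) = iota (Vb (cT (t2 x v)))"
    unfolding cT_iota[OF incl_b_tp1 v] using bracket(1)[OF pair_tensor_base[OF x v]] bV(2)[OF x v]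
        by simp
  then have e1: "cT (t2 (x - incl_b x) v) = (\<lambda>t. t - iota (Vb t)) (cT (t2 x v))"
    using T by (simp add: dif)
  have l1: "lin (\<lambda>t. t - iota (Vb t))" by (intro lin_minus lin_id lin_comp[OF iota(1) Vb(1)])
  have l2: "lin (\<lambda>t. t - iota (bV t))" by (intro lin_minus lin_id lin_comp[OF iota(1) bV(1)])
  show "cT (t2 (x - incl_b x) v) \<in> pt (tp 1) I" unfolding e1
  proof (rule pair_in[OF lin_on_lin[OF l1] tp_sub E_sub(2) subspace_pair _ cT_E_all(1)[OF x v]])
    fix w y assume wy: "w \<in> tp 1" "y \<in> E"
    have "t2 w y - iota (Vb (t2 w y)) = t2 w (y - incl_b y)"
      using wy tp_T[of w 1] E_sub(2) by (auto simp: Vb iota dif subset_iff)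
    then show "t2 w y - iota (Vb (t2 w y)) \<in> pt (tp 1) I"
        using pair_tensor_base[OF wy(1) I_gen[OF wy(2)]] by simp
  qed
  have "cT (t2 v (incl_b x)) = iota (bV (cT (t2 v x)))"
    unfolding cT_iota[OF v incl_b_tp1] using bracket(2)[OF pair_tensor_base[OF v x]] Vb(2)[OF x v]
        by simp
  then have e2: "cT (t2 v (x - incl_b x)) = (\<lambda>t. t - iota (bV t)) (cT (t2 v x))"
    using T by (simp add: dif)
  show "cT (t2 v (x - incl_b x)) \<in> pt I (tp 1)" unfolding e2
  proof (rule pair_in[OF lin_on_lin[OF l2] E_sub(2) tp_sub subspace_pair _ cT_E_all(2)[OF x v]])
    fix y w assume wy: "y \<in> E" "w \<in> tp 1"
    have "t2 y w - iota (bV (t2 y w)) = t2 (y - incl_b y) w"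
      using wy tp_T[of w 1] E_sub(2) by (auto simp: bV iota dif subset_iff)
    then show "t2 y w - iota (bV (t2 y w)) \<in> pt I (tp 1)"
        using pair_tensor_base[OF I_gen[OF wy(1)] wy(2)] by simp
  qed
qed

lemma tp1T: "v \<in> tp 1 \<Longrightarrow> v \<in> Tc" by (rule tp_T)

lemma cT_tp1_T: "z \<in> Tc \<Longrightarrow> v \<in> tp 1 \<Longrightarrow> cT (t2 z v) \<in> pt (tp 1) Tc" "z \<in> Tc \<Longrightarrow> v \<in> tp 1 \<Longrightarrow>
    cT (t2 v z) \<in> pt Tc (tp 1)"
proof -
  assume z: "z \<in> Tc" and v: "v \<in> tp 1"
  have T: "v \<in> Tc" using v tp1T by blast
  have l: "lin_on Tc (\<lambda>x. cT (t2 x v))" "lin_on Tc (\<lambda>x. cT (t2 v x))"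
    using cT_lin T unfolding lin_on_def by (auto simp: t2_add t_in)
  obtain g where g: "lin g" "\<And>x. x \<in> Tc \<Longrightarrow> g x = cT (t2 x v)"
    using lin_on_extend[OF l(1) subspace_T] by blast
  obtain g' where g': "lin g'" "\<And>x. x \<in> Tc \<Longrightarrow> g' x = cT (t2 v x)"
    using lin_on_extend[OF l(2) subspace_T] by blast
  have "g z \<in> pt (tp 1) Tc"
  proof (rule lin_span_in[OF g(1) _ subspace_pair z[unfolded Tc_eq]])
    fix x assume "x \<in> range (tens V)"
    then obtain w where w: "x = tens V w" by blast
    have "x \<in> tp (length w)" unfolding w by (rule tens_tpow') auto
    then have "cT (t2 x v) \<in> pt (tp 1) (tp (length w))" using v by (intro cT_gr pair_tensor_base)
    then show "g x \<in> pt (tp 1) Tc" using g w subsetD[OF pair_tensor_mono[OF order_refl tp_sub]] by auto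
  qed
  then show "cT (t2 z v) \<in> pt (tp 1) Tc" using g z by simp
  have "g' z \<in> pt Tc (tp 1)"
  proof (rule lin_span_in[OF g'(1) _ subspace_pair z[unfolded Tc_eq]])
    fix x assume "x \<in> range (tens V)"
    then obtain w where w: "x = tens V w" by blast
    have "x \<in> tp (length w)" unfolding w by (rule tens_tpow') auto
    then have "cT (t2 v x) \<in> pt (tp (length w)) (tp 1)" using v by (intro cT_gr pair_tensor_base)
    then show "g' x \<in> pt Tc (tp 1)" using g' w subsetD[OF pair_tensor_mono[OF tp_sub order_refl]] by auto
  qed
  then show "cT (t2 v z) \<in> pt Tc (tp 1)" using g' z by simp
qed

text \<open>The elements of \<open>I\<close> with both properties form an ideal: when
  \<open>v\<close> passes a product, it passes the factors in turn, and the factor in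
  \<open>I\<close> stays in \<open>I\<close>. This ideal contains the generators, hence it is all of
  \<open>I\<close>.\<close>

lemma cT_I: "z \<in> I \<Longrightarrow> v \<in> tp 1 \<Longrightarrow> cT (t2 z v) \<in> pt (tp 1) I \<and> cT (t2 v z) \<in> pt I (tp 1)"
proof -
  define K where "K = {z \<in> I. \<forall>v\<in>tp 1. cT (t2 z v) \<in> pt (tp 1) I \<and> cT (t2 v z) \<in> pt I (tp 1)}"
  have ITc: "x \<in> Tc" if "x \<in> I" for x using I_sub(2) that by blast
  have "ideal K A"
  proof (rule ideal_from_generators)
    show "K \<subseteq> Tc" using ITc by (auto simp: K_def)
    show "fs.subspace K"
    proof (rule fs.subspaceI)
      note c = cT_lin[unfolded lin_on_def]
      have "cT 0 = 0" using c by (metis fs.scale_zero_left fs.subspace_0 subspace_tpow)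
      then show "0 \<in> K" using I_sub(1) tp1T by (auto simp: K_def fs.subspace_0)
      show "x + y \<in> K" if "x \<in> K" "y \<in> K" for x y
        using that c ITc tp1T I_sub(1) by (auto simp: K_def t2_add t_in fs.subspace_add)
      show "fscale k x \<in> K" if "x \<in> K" for k x
        using that c ITc tp1T I_sub(1) by (auto simp: K_def t2_add t_in fs.subspace_scale)
    qed
  next
    fix z w assume z: "z \<in> K" and w: "w \<in> tp 1"
    then have zI: "z \<in> I" and zT: "z \<in> Tc" and wT: "w \<in> Tc" using ITc tp1T by (auto simp: K_def)
    show "w \<star> z \<in> K" unfolding K_def
    proof (intro CollectI conjI ballI)
      show "w \<star> z \<in> I" using I_sub(3)[OF zI wT] .
      fix v assume v: "v \<in> tp 1"
      then have vT: "v \<in> Tc" using tp1T by blast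
      have zv: "cT (t2 z v) \<in> pt (tp 1) I" "cT (t2 v z) \<in> pt I (tp 1)" using z v by (auto simp: K_def)
      show "cT (t2 (w \<star> z) v) \<in> pt (tp 1) I" unfolding cT_mul_left[OF wT zT vT]
      proof (rule pair_in[OF KL_on[OF wT] tp_sub I_sub(2) subspace_pair _ zv(1)])
        fix v' y assume vy: "v' \<in> tp 1" "y \<in> I"
        have yT: "y \<in> Tc" using vy ITc by blast
        show "KL w (t2 v' y) \<in> pt (tp 1) I" unfolding KL_t[OF wT tp1T[OF vy(1)] yT]
        proof (rule pair_in[OF RA_on tp_sub subset_refl subspace_pair _ cT_tp1_T(1)[OF wT vy(1)]])
          fix p q assume "p \<in> tp 1" "q \<in> Tc"
          then show "RA y (t2 p q) \<in> pt (tp 1) I"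
            using RA_t tp1T yT I_sub(3)[OF vy(2)] by (simp add: pair_tensor_base)
        qed
      qed
      show "cT (t2 v (w \<star> z)) \<in> pt I (tp 1)" unfolding cT_mul_right[OF wT zT vT]
      proof (rule pair_in[OF KR_on subset_refl tp_sub subspace_pair _ cT_tp1_T(2)[OF wT v]])
        fix p q assume pq: "p \<in> Tc" "q \<in> tp 1"
        have zq: "cT (t2 q z) \<in> pt I (tp 1)" using z pq by (auto simp: K_def)
        show "KR z (t2 p q) \<in> pt I (tp 1)" unfolding KR_t[OF pq(1) tp1T[OF pq(2)] zT]
        proof (rule pair_in[OF LA_on[OF pq(1)] I_sub(2) tp_sub subspace_pair _ zq])
          fix y r assume "y \<in> I" "r \<in> tp 1"
          then show "LA p (t2 y r) \<in> pt I (tp 1)"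
            using LA_t tp1T ITc pq I_sub(3) by (simp add: pair_tensor_base)
        qed
      qed
    qed
    show "z \<star> w \<in> K" unfolding K_def
    proof (intro CollectI conjI ballI)
      show "z \<star> w \<in> I" using I_sub(4)[OF zI wT] .
      fix v assume v: "v \<in> tp 1"
      then have vT: "v \<in> Tc" using tp1T by blast
      have zv: "cT (t2 z v) \<in> pt (tp 1) I" "cT (t2 v z) \<in> pt I (tp 1)" using z v by (auto simp: K_def)
      show "cT (t2 (z \<star> w) v) \<in> pt (tp 1) I" unfolding cT_mul_left[OF zT wT vT]
      proof (rule pair_in[OF KL_on[OF zT] tp_sub subset_refl subspace_pair _ cT_tp1_T(1)[OF wT v]])
        fix q p assume pq: "q \<in> tp 1" "p \<in> Tc"
        have zq: "cT (t2 z q) \<in> pt (tp 1) I" using z pq by (auto simp: K_def)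
        show "KL z (t2 q p) \<in> pt (tp 1) I" unfolding KL_t[OF zT tp1T[OF pq(1)] pq(2)]
        proof (rule pair_in[OF RA_on tp_sub I_sub(2) subspace_pair _ zq])
          fix r y assume "r \<in> tp 1" "y \<in> I"
          then show "RA p (t2 r y) \<in> pt (tp 1) I"
            using RA_t tp1T ITc pq I_sub(4) by (simp add: pair_tensor_base)
        qed
      qed
      show "cT (t2 v (z \<star> w)) \<in> pt I (tp 1)" unfolding cT_mul_right[OF zT wT vT]
      proof (rule pair_in[OF KR_on I_sub(2) tp_sub subspace_pair _ zv(2)])
        fix y v' assume vy: "y \<in> I" "v' \<in> tp 1"
        have yT: "y \<in> Tc" using vy ITc by blast
        show "KR w (t2 y v') \<in> pt I (tp 1)" unfolding KR_t[OF yT tp1T[OF vy(2)] wT]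
        proof (rule pair_in[OF LA_on[OF yT] subset_refl tp_sub subspace_pair _ cT_tp1_T(2)[OF wT vy(2)]])
          fix p q assume "p \<in> Tc" "q \<in> tp 1"
          then show "LA y (t2 p q) \<in> pt I (tp 1)"
            using LA_t tp1T yT I_sub(4)[OF vy(1)] by (simp add: pair_tensor_base)
        qed
      qed
    qed
  qed
  then have "I \<subseteq> K" by (rule I_min) (auto simp: K_def cT_I_gen I_gen)
  then show "z \<in> I \<Longrightarrow> v \<in> tp 1 \<Longrightarrow> cT (t2 z v) \<in> pt (tp 1) I \<and> cT (t2 v z) \<in> pt I (tp 1)"
    by (auto simp: K_def)
qed

text \<open>The subspace \<open>I \<otimes> T + T \<otimes> I\<close> of the tensor square.\<close>

definition W where "W = fs.span {t2 x y | x y. x \<in> Tc \<and> y \<in> Tc \<and> (x \<in> I \<or> y \<in> I)}"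

lemma subspace_W [simp]: "fs.subspace W" by (simp add: W_def)

lemma W_base: "x \<in> Tc \<Longrightarrow> y \<in> Tc \<Longrightarrow> x \<in> I \<or> y \<in> I \<Longrightarrow> t2 x y \<in> W"
  unfolding W_def by (rule fs.span_base) blast

lemma W_T2: "W \<subseteq> T2"
  unfolding W_def by (rule fs.span_minimal) (auto intro: t_in)

lemma W_in:
  assumes f: "lin_on T2 f" and U: "fs.subspace U" and m: "\<And>x y. x \<in> Tc \<Longrightarrow> y \<in> Tc \<Longrightarrow> x \<in> I \<or> y \<in> I \<Longrightarrow>
      f (t2 x y) \<in> U"
    and t: "t \<in> W"
  shows "f t \<in> U"
proof -
  obtain g where g: "lin g" "\<And>x. x \<in> T2 \<Longrightarrow> g x = f x" using lin_on_extend[OF f subspace_tpow] by blast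
  have "g t \<in> U"
    by (rule lin_span_in[OF g(1) _ U t[unfolded W_def]]) (use g(2) m t_in(2) in auto)
  then show ?thesis using g(2) t W_T2 by auto
qed

lemma I_Tc: "x \<in> I \<Longrightarrow> x \<in> Tc" using I_sub(2) by blast

text \<open>The generators are differences of primitive elements, hence primitive, and
  multiplication by \<open>\<Delta> v\<close> preserves \<open>W\<close>, because a factor in
  \<open>I\<close> stays in \<open>I\<close> when it is braided with \<open>v\<close>. So the
  elements of \<open>I\<close> with the property form an ideal that contains the generators.\<close>

lemma coideal: "z \<in> I \<Longrightarrow> \<Delta> z \<in> W"
proof -
  define K where "K = {z \<in> I. \<Delta> z \<in> W}"
  have "ideal K A"
  proof (rule ideal_from_generators)
    show "K \<subseteq> Tc" using I_Tc by (auto simp: K_def)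
    show "fs.subspace K"
    proof (rule fs.subspaceI)
      note d = D_lin[unfolded lin_on_def]
      have "\<Delta> 0 = 0" using d by (metis fs.scale_zero_left fs.subspace_0 subspace_T)
      then show "0 \<in> K" using I_sub(1) by (auto simp: K_def fs.subspace_0)
      show "x + y \<in> K" if "x \<in> K" "y \<in> K" for x y
        using that d I_Tc I_sub(1) by (auto simp: K_def fs.subspace_add)
      show "fscale k x \<in> K" if "x \<in> K" for k x
        using that d I_Tc I_sub(1) by (auto simp: K_def fs.subspace_scale)
    qed
  next
    fix z v assume z: "z \<in> K" and v: "v \<in> tp 1"
    have zI: "z \<in> I" and zT: "z \<in> Tc" and zW: "\<Delta> z \<in> W" and vT: "v \<in> Tc" using z v I_Tc tp1T
        by (auto simp: K_def)
    have "Psi' v (\<Delta> z) \<in> W"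
    proof (rule W_in[OF Psi'_on[OF vT] subspace_W _ zW])
      fix x y assume xy: "x \<in> Tc" "y \<in> Tc" "x \<in> I \<or> y \<in> I"
      have 1: "t2 (v \<star> x) y \<in> W" using xy vT I_sub(3) by (intro W_base) (auto simp: mul_closed)
      have 2: "RA y (cT (t2 v x)) \<in> W"
      proof (cases "x \<in> I")
        case True
        show ?thesis
          by (rule pair_in[OF RA_on I_sub(2) tp_sub subspace_W _ cT_I[OF True v, THEN conjunct2]])
            (use xy I_Tc tp1T in \<open>auto simp: RA_t mul_closed intro!: W_base\<close>)
      next
        case False
        then have yI: "y \<in> I" using xy by blast
        show ?thesis
          by (rule pair_in[OF RA_on subset_refl tp_sub subspace_W _ cT_tp1_T(2)[OF xy(1) v]])
            (use xy yI I_sub(3) tp1T in \<open>auto simp: RA_t mul_closed intro!: W_base\<close>)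
      qed
      show "Psi' v (t2 x y) \<in> W" unfolding Psi'_t[OF xy(1,2) v] using 1 2
          by (rule fs.subspace_add[OF subspace_W])
    qed
    then show "v \<star> z \<in> K" using I_sub(3)[OF zI vT] D_mul_left[OF zT vT] by (simp add: K_def)
    have "Psi v (\<Delta> z) \<in> W"
    proof (rule W_in[OF Psi_on subspace_W _ zW])
      fix x y assume xy: "x \<in> Tc" "y \<in> Tc" "x \<in> I \<or> y \<in> I"
      have 1: "t2 x (y \<star> v) \<in> W" using xy vT I_sub(4) by (intro W_base) (auto simp: mul_closed)
      have 2: "LA x (cT (t2 y v)) \<in> W"
      proof (cases "y \<in> I")
        case True
        show ?thesis
          by (rule pair_in[OF LA_on[OF xy(1)] tp_sub I_sub(2) subspace_W _ cT_I[OF True v, THEN conjunct1]])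
            (use xy I_Tc tp1T in \<open>auto simp: LA_t mul_closed intro!: W_base\<close>)
      next
        case False
        then have xI: "x \<in> I" using xy by blast
        show ?thesis
          by (rule pair_in[OF LA_on[OF xy(1)] tp_sub subset_refl subspace_W _ cT_tp1_T(1)[OF xy(2) v]])
            (use xy xI I_sub(4) tp1T in \<open>auto simp: LA_t mul_closed intro!: W_base\<close>)
      qed
      show "Psi v (t2 x y) \<in> W" unfolding Psi_t[OF xy(1,2) v] using 1 2
          by (intro fs.subspace_add[OF subspace_W])
    qed
    then show "z \<star> v \<in> K" using I_sub(4)[OF zI vT] D_mul_right[OF zT vT] by (simp add: K_def)
  qed
  then have "I \<subseteq> K"
  proof (rule I_min)
    fix x assume x: "x \<in> E"
    have "x - incl_b x \<in> prim"
      using x E_sub(1) tp1_prim incl_b_tp1 by (intro fs.subspace_diff[OF subspace_prim]) auto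
    then have "x - incl_b x \<in> Tc" "\<Delta> (x - incl_b x)
        = t2 (x - incl_b x) one1 + t2 one1 (x - incl_b x)" by (auto simp: prim_def)
    then show "x - incl_b x \<in> K" using I_gen[OF x] by (auto simp: K_def intro!: fs.subspace_add W_base)
  qed
  then show "z \<in> I \<Longrightarrow> \<Delta> z \<in> W" by (auto simp: K_def)
qed

section \<open>Linear forms that vanish on \<open>I\<close>, and leading terms\<close>

lemma E_deg_eps: "x \<in> E \<Longrightarrow> \<epsilon> x = 0"
proof -
  have "fs.subspace {x \<in> Tc. \<epsilon> x = 0}"
    by (rule fs.subspaceI) (auto simp: eps_0 eps_add eps_scale fs.subspace_0 fs.subspace_add fs.subspace_scale)
  moreover have "(\<Union>n. E_deg V \<Delta> n) \<subseteq> {x \<in> Tc. \<epsilon> x = 0}"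
  proof clarify
    fix x n assume x: "x \<in> E_deg V \<Delta> n"
    show "x \<in> Tc \<and> \<epsilon> x = 0"
      using x E_deg_small[of n] E_deg_sub(1)[of n] eps_pos[of n x] tp_T[of x n]
      by (cases "n < 2") (auto simp: eps_0 fs.subspace_0)
  qed
  ultimately have "E \<subseteq> {x \<in> Tc. \<epsilon> x = 0}" unfolding E_eq by (intro fs.span_minimal)
  then show "x \<in> E \<Longrightarrow> \<epsilon> x = 0" by blast
qed

lemma eps_diff: "x \<in> Tc \<Longrightarrow> y \<in> Tc \<Longrightarrow> \<epsilon> (x - y) = \<epsilon> x - \<epsilon> y"
  using eps_add[of "x - y" y] by (simp add: fs.subspace_diff)

lemma eps_I: "z \<in> I \<Longrightarrow> \<epsilon> z = 0"
proof -
  define K where "K = {z \<in> I. \<epsilon> z = 0}"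
  have "ideal K A"
  proof (rule ideal_from_generators)
    show "K \<subseteq> Tc" using I_Tc by (auto simp: K_def)
    show "fs.subspace K"
      using I_sub(1) I_Tc by (intro fs.subspaceI) (auto simp: K_def eps_0 eps_add eps_scale
      fs.subspace_0 fs.subspace_add fs.subspace_scale)
  qed (use I_Tc tp1T I_sub(3,4) in \<open>auto simp: K_def eps_mul\<close>)
  then have "I \<subseteq> K"
  proof (rule I_min)
    fix x assume x: "x \<in> E"
    have "\<epsilon> (x - incl_b x) = 0" using x E_deg_eps[OF x] E_sub(2) eps_pos[of 1 "incl_b x"]
        by (auto simp: eps_diff)
    then show "x - incl_b x \<in> K" using I_gen[OF x] by (simp add: K_def)
  qed
  then show "z \<in> I \<Longrightarrow> \<epsilon> z = 0" by (auto simp: K_def)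
qed

lemma I_tp1: "x \<in> I \<Longrightarrow> x \<in> tp 1 \<Longrightarrow> x = 0"
proof -
  assume x: "x \<in> I" "x \<in> tp 1"
  interpret ring A by (rule ring_T) simp
  obtain v where v: "x = incl V v" using x tp1_incl by auto
  have inj: "inj_on (\<lambda>v. I +>\<^bsub>A\<^esub> incl V v) UNIV"
    using bl unfolding braided_Lie_algebra_def I_def by simp
  have sg: "subgroup I (add_monoid A)"
    by (rule additive_subgroup.a_subgroup[OF ideal.axioms(1)[OF I_ideal]])
  have "I +>\<^bsub>A\<^esub> incl V v = I"
    using a_coset_join2[OF tp_T[OF incl_tp1] sg] x(1) v by simp
  moreover have "I +>\<^bsub>A\<^esub> incl V 0 = I"
    using a_coset_join2[OF tp_T[OF incl_tp1, of 0] sg] fs.subspace_0[OF I_sub(1)] unfolding incl_0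
    by simp
  ultimately have "v = 0" using injD[OF inj, of v 0] by simp
  then show "x = 0" using v incl_0 by simp
qed

text \<open>The counit vanishes on \<open>I\<close> and on \<open>V\<close>, so it shows that the
  scalar part is zero; what remains is a vector in \<open>I\<close>.\<close>

lemma I_filt1: "x \<in> I \<Longrightarrow> x \<in> filt V 1 \<Longrightarrow> x = 0"
proof -
  assume x: "x \<in> I" "x \<in> filt V 1"
  have xT: "x \<in> Tc" using x I_Tc by blast
  have e: "x = Pd V 0 x + Pd V 1 x" using filt_Pd[OF x(2)] by (simp add: One_nat_def)
  obtain k where k: "Pd V 0 x = fscale k one1" using tp0[OF Pd_in[OF xT]] by blast
  have "\<epsilon> x = k" using eps_pos[of 1 "Pd V 1 x"] Pd_in[OF xT, of 1] xT
    by (subst e) (simp add: k eps_add eps_scale eps_one fs.subspace_scale)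
  then have "k = 0" using eps_I[OF x(1)] by simp
  then have "x = Pd V 1 x" using e k by simp
  then show "x = 0" using I_tp1[OF x(1)] Pd_in[OF xT, of 1] by simp
qed

text \<open>On \<open>I \<otimes> T\<close> the contraction has values in \<open>I\<close>; on
  \<open>T \<otimes> I\<close> it is zero because \<open>f\<close> vanishes on
  \<open>I\<close>.\<close>

lemma Df_I:
  assumes f: "lfun f" "\<And>x. x \<in> I \<Longrightarrow> f x = 0" and z: "z \<in> I"
  shows "contract f (\<Delta> z) \<in> I"
  by (rule W_in[OF lin_on_lin[OF contract(1)[OF f(1)]] I_sub(1) _ coideal[OF z]])
    (use f I_sub(1) in \<open>auto simp: contract[OF f(1)] fs.subspace_scale fs.subspace_0\<close>)

text \<open>\<open>q\<close> has kernel \<open>I\<close> and is injective on the span of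
  \<open>1\<close> and \<open>F\<close>, since \<open>I\<close> contains no nonzero element of
  degree at most one. The images stay independent, so a form with prescribed values on them exists;
  composed with \<open>q\<close> it vanishes on \<open>I\<close>.\<close>

lemma functional_exists:
  assumes F: "F \<subseteq> tp 1" "fs.independent F" and e: "e \<in> F"
  shows "\<exists>f. lfun f \<and> f one1 = 0 \<and> (\<forall>x\<in>I. f x = 0) \<and> (\<forall>d\<in>F. f d = (if d = e then 1 else 0))"
proof -
  obtain q :: "('k, 'v) T \<Rightarrow> ('k, 'v) T" where q: "lin q" "\<And>x. q x = 0 \<longleftrightarrow> x \<in> I"
    using kernel_exists[OF I_sub(1)] by blast
  have one: "one1 \<notin> fs.span F"
  proof
    assume "one1 \<in> fs.span F"
    then have "one1 \<in> tp 1" using fs.span_minimal[OF F(1) subspace_tpow] by blast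
    then have "\<epsilon> one1 = 0" by (intro eps_pos[of 1]) auto
    then show False by (simp add: eps_one)
  qed
  then have ind: "fs.independent (insert one1 F)" using F(2) by (rule fs.independent_insertI)
  have sp: "fs.span (insert one1 F) \<subseteq> filt V 1"
    by (rule fs.span_minimal) (use F tpow_filt[of 0 1 V] tpow_filt[of 1 1 V] one_tp0 in auto)
  have inj: "inj_on q (fs.span (insert one1 F))"
  proof (rule inj_onI)
    fix x y assume xy: "x \<in> fs.span (insert one1 F)" "y \<in> fs.span (insert one1 F)" "q x = q y"
    then have "x - y \<in> I" using q(2)[of "x - y"] lin_diff[OF q(1)] by simp
    moreover have "x - y \<in> filt V 1" using xy sp by (intro fs.subspace_diff subspace_filt) auto
    ultimately show "x = y" using I_filt1 by force
  qed
  have indq: "fs.independent (q ` insert one1 F)"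
    using fs2.linear_independent_injective_image[OF q(1) ind inj] .
  define h where "h y = (if y = q e then 1 else (0::'k))" for y
  obtain g where g: "lfun g" "\<And>y. y \<in> q ` insert one1 F \<Longrightarrow> g y = h y"
    using fsk.linear_independent_extend[OF indq, of h] by blast
  have inj': "inj_on q (insert one1 F)" using inj by (rule inj_on_subset) (auto intro: fs.span_base)
  have "g (q x) = (if x = e then 1 else 0)" if "x \<in> insert one1 F" for x
    using g(2)[of "q x"] that inj_on_eq_iff[OF inj', of x e] e by (auto simp: h_def)
  moreover have "one1 \<noteq> e" using one e fs.span_base by blast
  moreover have "lfun (\<lambda>x. g (q x))"
    by (rule lfunI) (simp_all add: lin_rules[OF q(1)] fsk.linear_add[OF g(1)] fsk.linear_scale[OF g(1)])
  moreover have "g (q x) = 0" if "x \<in> I" for x using q(2)[of x] that fsk.linear_0[OF g(1)] by simp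
  ultimately show ?thesis by (intro exI[of _ "\<lambda>x. g (q x)"]) auto
qed

lemma Pd_filt: "x \<in> filt V n \<Longrightarrow> n < m \<Longrightarrow> Pd V m x = 0"
  unfolding filt_def
  by (erule lin_span_eq[OF lin_Pd lin_zero, rotated]) (auto simp: Pd_tpow)

lemma Df_filt:
  assumes f: "lfun f" "f one1 = 0" and z: "z \<in> filt V (Suc m)"
  shows "contract f (\<Delta> z) \<in> filt V m" "Pd V m (contract f (\<Delta> z))
      = Pd V m (contract f (\<Delta> (Pd V (Suc m) z)))"
proof -
  have zT: "z \<in> Tc" using z filt_subset by blast
  have PT: "Pd V k z \<in> tp k" for k using Pd_in zT by blast
  have "\<Delta> z = \<Delta> (\<Sum>k\<le>Suc m. Pd V k z)" using filt_Pd[OF z] by simp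
  also have "\<dots> = (\<Sum>k\<le>Suc m. \<Delta> (Pd V k z))" by (rule lin_on_sum[OF D_lin subspace_T]) (use zT in auto)
  finally have e: "contract f (\<Delta> z) = (\<Sum>k\<le>Suc m. contract f (\<Delta> (Pd V k z)))"
      by (simp only: lin_sum[OF contract(1)[OF f(1)]])
  \<comment> \<open>For \<open>k = 0\<close> the subtraction truncates to zero, but then the
    contraction itself is zero. Both facts are needed to see that only \<open>k = m + 1\<close>
    contributes in degree \<open>m\<close>.\<close>
  have in_filt: "contract f (\<Delta> (Pd V k z)) \<in> filt V (k - 1)" and z0: "k = 0 \<Longrightarrow>
      contract f (\<Delta> (Pd V k z)) = 0" for k
  proof -
    show z0: "contract f (\<Delta> (Pd V k z)) = 0" if "k = 0" using Df_0[OF f PT[of 0]] that by simp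
    show "contract f (\<Delta> (Pd V k z)) \<in> filt V (k - 1)"
    proof (cases k)
      case 0
      then show ?thesis using z0 by (simp add: fs.subspace_0)
    next
      case (Suc l)
      then show ?thesis using Df_Suc(1)[OF f, of "Pd V k z" l] PT[of k] by simp
    qed
  qed
  have "contract f (\<Delta> (Pd V k z)) \<in> filt V m" if "k \<le> Suc m" for k
  proof -
    have "k - 1 \<le> m" using that by arith
    then show ?thesis using in_filt[of k] filt_mono[of "k - 1" m V] by blast
  qed
  then show "contract f (\<Delta> z) \<in> filt V m" unfolding e by (intro fs.subspace_sum subspace_filt) auto
  have "Pd V m (contract f (\<Delta> z)) = (\<Sum>k\<le>Suc m. Pd V m (contract f (\<Delta> (Pd V k z))))"
    unfolding e by (rule lin_sum[OF lin_Pd])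
  also have "\<dots> = (\<Sum>k\<in>{Suc m}. Pd V m (contract f (\<Delta> (Pd V k z))))"
  proof (rule sum.mono_neutral_right)
    show "\<forall>k\<in>{..Suc m} - {Suc m}. Pd V m (contract f (\<Delta> (Pd V k z))) = 0"
    proof
      fix k assume "k \<in> {..Suc m} - {Suc m}"
      then have k: "k \<le> m" by auto
      show "Pd V m (contract f (\<Delta> (Pd V k z))) = 0"
      proof (cases "k = 0")
        case True then show ?thesis using z0 lin_0[OF lin_Pd] by simp
      next
        case False then show ?thesis using Pd_filt[OF in_filt[of k], of m] k by simp
      qed
    qed
  qed auto
  finally show "Pd V m (contract f (\<Delta> z)) = Pd V m (contract f (\<Delta> (Pd V (Suc m) z)))" by simp
qed

text \<open>The coefficient \<open>\<zeta> e\<close> of the coset sum is extracted by a form dual to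
  \<open>e\<close>. By \<open>contract_coset_sum\<close> and \<open>Df_filt\<close> it is the
  component in degree \<open>m\<close> of \<open>contract f (\<Delta> z)\<close>, an element of
  \<open>I\<close> of degree at most \<open>m\<close>, so the induction hypothesis puts it into
  \<open>J\<close>.\<close>

lemma top_in_J: "z \<in> I \<Longrightarrow> z \<in> filt V n \<Longrightarrow> Pd V n z \<in> J"
proof (induction n arbitrary: z)
  case 0
  then have "z = 0" using I_filt1 filt_mono[of 0 1 V] by auto
  then show ?case using subspace_J by (simp add: lin_0[OF lin_Pd] fs.subspace_0)
next
  case (Suc m)
  define x where "x = Pd V (Suc m) z"
  have zT: "z \<in> Tc" using Suc I_Tc by blast
  have x: "x \<in> tp (Suc m)" unfolding x_def by (rule Pd_in[OF zT])
  have "coset_sum m x \<in> tp (m + 1)" using coset_sum_tp[OF x] by (simp only: Suc_eq_plus1)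
  then have "coset_sum m x \<in> fs.span {y \<star> e | y e. y \<in> tp m \<and> e \<in> tp 1}"
      unfolding tpow_add_span[OF mclosed_V] .
  then have t: "coset_sum m x \<in> fs.span {y \<star> e | e y. e \<in> tp 1 \<and> y \<in> tp m}"
    by (rule subsetD[OF fs.span_mono, rotated]) blast
  \<comment> \<open>The factors are taken in reversed order, so that \<open>bil_decomp\<close> makes
    the last letters independent.\<close>
  have bilm: "bil (tp 1) (tp m) (\<lambda>e y. y \<star> e)"
    by (rule bil_flip[OF bil_subset[OF mult_T_bil[OF mclosed_V] tp_sub tp_sub]])
  obtain F \<zeta> where F: "finite F" "F \<subseteq> tp 1" "fs.independent F" "\<zeta> ` F \<subseteq> tp m" "coset_sum m x
      = (\<Sum>e\<in>F. \<zeta> e \<star> e)"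
    by (rule bil_decomp[OF bilm subspace_tpow subspace_tpow t])
  have "\<zeta> e \<in> tp m \<and> qsym m (\<zeta> e) = 0" if e: "e \<in> F" for e
  proof -
    obtain f where f: "lfun f" "f one1 = 0" "\<And>x. x \<in> I \<Longrightarrow> f x = 0" "\<And>d. d \<in> F \<Longrightarrow>
        f d = (if d = e then 1 else 0)"
      using functional_exists[OF F(2,3) e] by blast
    obtain R :: "('k, 'v) T \<Rightarrow> ('k, 'v) T" where R: "lin R" "\<And>x v. x \<in> tp m \<Longrightarrow> v \<in> tp 1 \<Longrightarrow>
        R (x \<star> v) = fscale (f v) x"
      using contraction_exists[OF f(1)] by blast
    have "R (coset_sum m x) = (\<Sum>d\<in>F. if d = e then \<zeta> e else 0)"
      unfolding F(5) lin_sum[OF R(1)]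
    proof (rule sum.cong[OF refl])
      fix d assume d: "d \<in> F"
      then have "\<zeta> d \<in> tp m" "d \<in> tp 1" using F(2,4) by auto
      then show "R (\<zeta> d \<star> d) = (if d = e then \<zeta> e else 0)" using R(2) f(4)[OF d] by simp
    qed
    also have "\<dots> = \<zeta> e" using F(1) e by simp
    finally have "\<zeta> e = Pd V m (contract f (\<Delta> x))" using contract_coset_sum[OF f(1,2) x R] by simp
    also have "\<dots> = Pd V m (contract f (\<Delta> z))" unfolding x_def
        using Df_filt(2)[OF f(1,2) Suc.prems(2)] by simp
    also have "\<dots> \<in> J" by (intro Suc.IH Df_I f(1) f(3) Suc.prems Df_filt(1)[OF f(1,2)])
    finally have "\<zeta> e \<in> J" .
    moreover have "\<zeta> e \<in> tp m" using F(4) e by blast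
    ultimately show ?thesis using J_tp by blast
  qed
  then have "qsym (Suc m) x = 0" using qsym_eq_0_right[OF x F(5,2)] by blast
  then show ?case using J_tp[OF x] by (simp add: x_def)
qed

section \<open>The quadratic part of the bracket\<close>

lemma incl_eq_0: "incl V v = 0 \<Longrightarrow> v = 0"
proof -
  assume v: "incl V v = 0"
  have "inj_on (\<lambda>v. I +>\<^bsub>A\<^esub> incl V v) UNIV"
    using bl unfolding braided_Lie_algebra_def I_def by simp
  then show "v = 0" using v incl_0 injD[of "\<lambda>v. I +>\<^bsub>A\<^esub> incl V v" v 0] by simp
qed

abbreviation E2 where "E2 \<equiv> E_deg V \<Delta> 2"
text \<open>\<open>restrict\<close> has an undefined default outside \<open>E2\<close>, so
  \<open>\<beta>\<close> is compared with \<open>b\<close> on \<open>E2\<close> only.\<close>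

definition \<beta> where "\<beta> = restrict b E2"

lemma beta_eq: "x \<in> E2 \<Longrightarrow> \<beta> x = b x" by (simp add: \<beta>_def)

lemmas E2_E = E_sub(4)[of 2]
lemmas E2_tp = E_deg_sub(1)[of 2]
lemmas subspace_E2 = E_deg_sub(3)[of 2]

lemma pt_E2: "t \<in> pt E2 (tp 1) \<Longrightarrow> cT t \<in> pt (tp 1) E2" "t \<in> pt (tp 1) E2 \<Longrightarrow> cT t \<in> pt E2 (tp 1)"
proof -
  have E2T: "E2 \<subseteq> Tc" using E2_E E_sub(2) by blast
  show "t \<in> pt E2 (tp 1) \<Longrightarrow> cT t \<in> pt (tp 1) E2"
    by (rule pair_in[OF cT_lin E2T tp_sub subspace_pair cT_E_left])
  show "t \<in> pt (tp 1) E2 \<Longrightarrow> cT t \<in> pt E2 (tp 1)"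
    by (rule pair_in[OF cT_lin tp_sub E2T subspace_pair cT_E_right])
qed

text \<open>The identities for \<open>b\<close> restrict to \<open>E2\<close> because
  \<open>c_T\<close> exchanges \<open>E2 \<otimes> V\<close> and
  \<open>V \<otimes> E2\<close>.\<close>

lemma bracket_beta: "bracket_on V c cT E2 \<beta>"
proof -
  have lin: "linear_on A E2 V \<beta>"
    unfolding linear_on_def using E2_E b_lin subspace_E2
    by (auto simp: beta_eq fs.subspace_add fs.subspace_scale subset_iff)
  note e = bV_eq[OF E2_E beta_eq]
  have "c (bV t) = Vb (cT t)" if "t \<in> pt E2 (tp 1)" for t
    using bracket(1) that pair_tensor_mono[OF E2_E order_refl] by blast
  moreover have "c (Vb t) = bV (cT t)" if "t \<in> pt (tp 1) E2" for t
    using bracket(2) that pair_tensor_mono[OF order_refl E2_E] by blast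
  ultimately show ?thesis
    unfolding bracket_on_def Let_def using lin by (simp add: e pt_E2)
qed

section \<open>The braiding between degrees two and one, computed inside \<open>tp 3\<close>\<close>

lemma iota_T2: "w \<in> tp 2 \<Longrightarrow> iota w \<in> T2"
proof -
  assume "w \<in> tp 2"
  then have "w \<in> tp (1 + 1)" by simp
  then have w: "w \<in> fs.span {x \<star> y |x y. x \<in> tp 1 \<and> y \<in> tp 1}" unfolding tpow_add_span[OF mclosed_V] .
  show ?thesis
    by (rule lin_span_in[OF iota(1) _ subspace_tpow w]) (use tp_T in \<open>auto simp: iota intro!: t_in\<close>)
qed

lemma braid_op_30: "x \<in> tp 2 \<Longrightarrow> z \<in> tp 1 \<Longrightarrow> braid_op 3 0 (x \<star> z) = c x \<star> z"
proof -
  assume xz: "x \<in> tp 2" "z \<in> tp 1"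
  then have T: "x \<in> Tc" "z \<in> Tc" "c x \<in> Tc" using c_tp tp_T by blast+
  have "braid_op 3 0 (one1 \<star> (x \<star> z)) = one1 \<star> (c x \<star> z)"
    by (rule braid_op(3)[OF _ one_tp0 xz]) auto
  then show "braid_op 3 0 (x \<star> z) = c x \<star> z" using T by (simp add: one_mul mul_closed)
qed

lemma braid_op_31: "x \<in> tp 1 \<Longrightarrow> z \<in> tp 2 \<Longrightarrow> braid_op 3 1 (x \<star> z) = x \<star> c z"
proof -
  assume xz: "x \<in> tp 1" "z \<in> tp 2"
  then have T: "x \<in> Tc" "z \<in> Tc" "c z \<in> Tc" using c_tp tp_T by blast+
  have "braid_op 3 1 (x \<star> (z \<star> one1)) = x \<star> (c z \<star> one1)"
    by (rule braid_op(3)[OF _ xz one_tp0]) (auto simp: One_nat_def)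
  then show "braid_op 3 1 (x \<star> z) = x \<star> c z" using T by (simp add: one_mul)
qed

lemma lin_braid_op3: "lin (braid_op 3 0)" "lin (braid_op 3 1)"
  by (auto intro: braid_op(1) simp: One_nat_def)

lemma mul_tp11: "x \<in> tp 1 \<Longrightarrow> y \<in> tp 1 \<Longrightarrow> x \<star> y \<in> tp 2"
  using mul_tp[of x 1 y 1] by simp

lemma mult_pair_RA_iota: "w \<in> tp 2 \<Longrightarrow> q \<in> tp 1 \<Longrightarrow> mult_pair (RA q (iota w)) = w \<star> q"
proof (rule tp_eqI[of 2 "\<lambda>w. mult_pair (RA q (iota w))" "\<lambda>w. w \<star> q" 1 1 w])
  show "lin_on (tp 2) (\<lambda>w. mult_pair (RA q (iota w)))"
    by (rule lin_on_comp[OF mult_pair(1)], rule lin_on_compon[OF RA_on lin_on_lin[OF iota(1)] iota_T2])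
qed (use tp1T in \<open>auto simp: iota RA_t mult_pair mul_closed mul_assoc intro: lin_on_mulR lin_on_id\<close>)

lemma mult_pair_LA_iota: "w \<in> tp 2 \<Longrightarrow> p \<in> tp 1 \<Longrightarrow> mult_pair (LA p (iota w)) = p \<star> w"
proof (rule tp_eqI[of 2 "\<lambda>w. mult_pair (LA p (iota w))" "\<lambda>w. p \<star> w" 1 1 w])
  assume p: "p \<in> tp 1"
  show "lin_on (tp 2) (\<lambda>w. mult_pair (LA p (iota w)))"
    by (rule lin_on_comp[OF mult_pair(1)], rule lin_on_compon[OF LA_on[OF tp1T[OF p]] lin_on_lin[OF iota(1)] iota_T2])
  show "lin_on (tp 2) (\<lambda>w. p \<star> w)" by (rule lin_on_mulL[OF mclosed_V lin_on_id tp_T tp1T[OF p]])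
qed (use tp1T in \<open>auto simp: iota LA_t mult_pair mul_closed mul_assoc\<close>)

text \<open>\<open>KL a\<close> braids \<open>a\<close> with the first of the two letters of
  \<open>w\<close>, which inside \<open>tp 3\<close> is \<open>c\<close> in the first two
  positions.\<close>

lemma mult_pair_KL_iota: "w \<in> tp 2 \<Longrightarrow> a \<in> tp 1 \<Longrightarrow> mult_pair (KL a (iota w)) = braid_op 3 0 (a \<star> w)"
proof (rule tp_eqI[of 2 "\<lambda>w. mult_pair (KL a (iota w))" "\<lambda>w. braid_op 3 0 (a \<star> w)" 1 1 w])
  assume a: "a \<in> tp 1"
  show "lin_on (tp 2) (\<lambda>w. mult_pair (KL a (iota w)))"
    by (rule lin_on_comp[OF mult_pair(1)], rule lin_on_compon[OF KL_on[OF tp1T[OF a]] lin_on_lin[OF iota(1)] iota_T2])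
  show "lin_on (tp 2) (\<lambda>w. braid_op 3 0 (a \<star> w))"
    by (rule lin_on_comp[OF lin_braid_op3(1) lin_on_mulL[OF mclosed_V lin_on_id tp_T tp1T[OF a]]])
  fix p q assume pq: "p \<in> tp 1" "q \<in> tp 1"
  have T: "a \<in> Tc" "p \<in> Tc" "q \<in> Tc" using a pq tp1T by auto
  have "mult_pair (KL a (iota (p \<star> q))) = c (a \<star> p) \<star> q"
    using pq a T by (simp add: iota KL_t cT_iota mult_pair_RA_iota c_tp mul_tp11)
  also have "\<dots> = braid_op 3 0 ((a \<star> p) \<star> q)" using braid_op_30[OF mul_tp11[OF a pq(1)] pq(2)] by simp
  finally show "mult_pair (KL a (iota (p \<star> q))) = braid_op 3 0 (a \<star> (p \<star> q))" using T
      by (simp add: mul_assoc)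
qed auto

lemma mult_pair_KR_iota: "w \<in> tp 2 \<Longrightarrow> q \<in> tp 1 \<Longrightarrow> mult_pair (KR q (iota w)) = braid_op 3 1 (w \<star> q)"
proof (rule tp_eqI[of 2 "\<lambda>w. mult_pair (KR q (iota w))" "\<lambda>w. braid_op 3 1 (w \<star> q)" 1 1 w])
  assume q: "q \<in> tp 1"
  show "lin_on (tp 2) (\<lambda>w. mult_pair (KR q (iota w)))"
    by (rule lin_on_comp[OF mult_pair(1)], rule lin_on_compon[OF KR_on lin_on_lin[OF iota(1)] iota_T2])
  show "lin_on (tp 2) (\<lambda>w. braid_op 3 1 (w \<star> q))"
    by (rule lin_on_comp[OF lin_braid_op3(2) lin_on_mulR[OF lin_on_id]])
  fix p r assume pq: "p \<in> tp 1" "r \<in> tp 1"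
  have T: "r \<in> Tc" "p \<in> Tc" "q \<in> Tc" using q pq tp1T by auto
  have "mult_pair (KR q (iota (p \<star> r))) = p \<star> c (r \<star> q)"
    using pq q T by (simp add: iota KR_t cT_iota mult_pair_LA_iota c_tp mul_tp11)
  also have "\<dots> = braid_op 3 1 (p \<star> (r \<star> q))" using braid_op_31[OF pq(1) mul_tp11[OF pq(2) q]] by simp
  finally show "mult_pair (KR q (iota (p \<star> r))) = braid_op 3 1 ((p \<star> r) \<star> q)" using T
      by (simp add: mul_assoc)
qed auto

lemma cT_on_left: "v \<in> tp 1 \<Longrightarrow> lin_on (tp n) (\<lambda>x. cT (t2 x v))" "v \<in> tp 1 \<Longrightarrow>
    lin_on (tp n) (\<lambda>x. cT (t2 v x))"
proof -
  assume v: "v \<in> tp 1"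
  have T: "v \<in> Tc" "\<And>x. x \<in> tp n \<Longrightarrow> x \<in> Tc" using v tp_T by auto
  show "lin_on (tp n) (\<lambda>x. cT (t2 x v))" "lin_on (tp n) (\<lambda>x. cT (t2 v x))"
    using cT_lin T unfolding lin_on_def by (auto simp: t2_add t_in)
qed

text \<open>The vector on the right passes the two letters of the left factor one after the other,
  the nearer one first, by \<open>cT_mul_left\<close>.\<close>

lemma mult_pair_cT_21:
  assumes t: "t \<in> pt (tp 2) (tp 1)"
  shows "mult_pair (cT t) = braid_op 3 0 (braid_op 3 1 (mult_pair t))"
proof (rule pair_eq[OF lin_on_comp[OF mult_pair(1) cT_lin] lin_on_lin[OF lin_comp[OF
    lin_braid_op3(1) lin_comp[OF lin_braid_op3(2) mult_pair(1)]]] tp_sub tp_sub _ t])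
  fix x v assume x: "x \<in> tp 2" and v: "v \<in> tp 1"
  have "mult_pair (cT (t2 x v)) = braid_op 3 0 (braid_op 3 1 (x \<star> v))"
  proof (rule tp_eqI[of 2 "\<lambda>x. mult_pair (cT (t2 x v))" "\<lambda>x. braid_op 3 0 (braid_op 3 1 (x \<star> v))" 1 1 x])
    show "lin_on (tp 2) (\<lambda>x. mult_pair (cT (t2 x v)))"
        by (rule lin_on_comp[OF mult_pair(1) cT_on_left(1)[OF v]])
    show "lin_on (tp 2) (\<lambda>x. braid_op 3 0 (braid_op 3 1 (x \<star> v)))"
      by (rule lin_on_comp[OF lin_braid_op3(1) lin_on_comp[OF lin_braid_op3(2) lin_on_mulR[OF lin_on_id]]])
    fix a b assume ab: "a \<in> tp 1" "b \<in> tp 1"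
    have T: "a \<in> Tc" "b \<in> Tc" "v \<in> Tc" using ab v tp1T by auto
    have "mult_pair (cT (t2 (a \<star> b) v)) = braid_op 3 0 (a \<star> c (b \<star> v))"
      using ab v T by (simp add: cT_mul_left cT_iota mult_pair_KL_iota c_tp mul_tp11)
    also have "\<dots> = braid_op 3 0 (braid_op 3 1 (a \<star> (b \<star> v)))"
        using braid_op_31[OF ab(1) mul_tp11[OF ab(2) v]] by simp
    finally show "mult_pair (cT (t2 (a \<star> b) v)) = braid_op 3 0 (braid_op 3 1 (a \<star> b \<star> v))" using T
        by (simp add: mul_assoc)
  qed (use x in auto)
  then show "mult_pair (cT (t2 x v)) = braid_op 3 0 (braid_op 3 1 (mult_pair (t2 x v)))"
      using x v tp_T by (simp add: mult_pair)
qed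

text \<open>The same from the other side, by \<open>cT_mul_right\<close>; the nearer letter is now
  the left one, so the operators occur in the opposite order.\<close>

lemma mult_pair_cT_12:
  assumes t: "t \<in> pt (tp 1) (tp 2)"
  shows "mult_pair (cT t) = braid_op 3 1 (braid_op 3 0 (mult_pair t))"
proof (rule pair_eq[OF lin_on_comp[OF mult_pair(1) cT_lin] lin_on_lin[OF lin_comp[OF
    lin_braid_op3(2) lin_comp[OF lin_braid_op3(1) mult_pair(1)]]] tp_sub tp_sub _ t])
  fix v x assume x: "x \<in> tp 2" and v: "v \<in> tp 1"
  have "mult_pair (cT (t2 v x)) = braid_op 3 1 (braid_op 3 0 (v \<star> x))"
  proof (rule tp_eqI[of 2 "\<lambda>x. mult_pair (cT (t2 v x))" "\<lambda>x. braid_op 3 1 (braid_op 3 0 (v \<star> x))" 1 1 x])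
    show "lin_on (tp 2) (\<lambda>x. mult_pair (cT (t2 v x)))"
        by (rule lin_on_comp[OF mult_pair(1) cT_on_left(2)[OF v]])
    show "lin_on (tp 2) (\<lambda>x. braid_op 3 1 (braid_op 3 0 (v \<star> x)))"
      by (rule lin_on_comp[OF lin_braid_op3(2) lin_on_comp[OF lin_braid_op3(1) lin_on_mulL[OF
      mclosed_V lin_on_id tp_T tp1T[OF v]]]])
    fix a b assume ab: "a \<in> tp 1" "b \<in> tp 1"
    have T: "a \<in> Tc" "b \<in> Tc" "v \<in> Tc" using ab v tp1T by auto
    have "mult_pair (cT (t2 v (a \<star> b))) = braid_op 3 1 (c (v \<star> a) \<star> b)"
      using ab v T by (simp add: cT_mul_right cT_iota mult_pair_KR_iota c_tp mul_tp11)
    also have "\<dots> = braid_op 3 1 (braid_op 3 0 ((v \<star> a) \<star> b))"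
        using braid_op_30[OF mul_tp11[OF v ab(1)] ab(2)] by simp
    finally show "mult_pair (cT (t2 v (a \<star> b))) = braid_op 3 1 (braid_op 3 0 (v \<star> (a \<star> b)))" using T
        by (simp add: mul_assoc)
  qed (use x in auto)
  then show "mult_pair (cT (t2 v x)) = braid_op 3 1 (braid_op 3 0 (mult_pair (t2 v x)))"
      using x v tp_T by (simp add: mult_pair)
qed

lemma mult_pair_lift:
  assumes "z \<in> fs.span {x \<star> y | x y. x \<in> P \<and> y \<in> Q}" "P \<subseteq> Tc" "Q \<subseteq> Tc"
  shows "\<exists>t\<in>pt P Q. mult_pair t = z"
  using assms(1)
proof (induction rule: fs.span_induct_alt)
  case base
  then show ?case using lin_0[OF mult_pair(1)] by (intro bexI[of _ 0]) (auto simp: fs.subspace_0)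
next
  case (step k z y)
  then obtain t p q where t: "t \<in> pt P Q" "mult_pair t = y" "z = p \<star> q" "p \<in> P" "q \<in> Q" by blast
  have "mult_pair (fscale k (t2 p q) + t) = fscale k z + y"
    using t assms by (auto simp: lin_add[OF mult_pair(1)] lin_scale[OF mult_pair(1)] mult_pair subset_iff)
  moreover have "fscale k (t2 p q) + t \<in> pt P Q"
    using t by (intro fs.subspace_add fs.subspace_scale subspace_pair pair_tensor_base)
  ultimately show ?case by blast
qed

lemma qlie:
  assumes z: "z \<in> sub_prod A E2 (tp 1)" "z \<in> sub_prod A (tp 1) E2"
  shows "\<beta> (tensor_map A E2 (tp 1) (\<lambda>x. incl V (\<beta> x)) id z \<ominus>\<^bsub>A\<^esub> tensor_map A (tp 1) E2 id (\<lambda>x. incl V (\<beta> x)) z) = 0"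
proof -
  have E2T: "E2 \<subseteq> Tc" using E2_E E_sub(2) by blast
  have E2b: "incl V (\<beta> x) = incl_b x" if "x \<in> E2" for x using that by (simp add: beta_eq incl_b_def)
  have lb: "lin_on E2 incl_b" using incl_b_lin E2_E unfolding lin_on_def by blast
  have bil1: "bil E2 (tp 1) (\<lambda>x v. incl_b x \<star> v)" and bil2: "bil (tp 1) E2 (\<lambda>v x. v \<star> incl_b x)"
    using lb tp1T unfolding bil_def lin_on_def by (simp_all add: mul_left mul_right)
  obtain L1 :: "('k, 'v) T \<Rightarrow> ('k, 'v) T" where L1: "lin L1" "\<And>x v. x \<in> E2 \<Longrightarrow> v \<in> tp 1 \<Longrightarrow>
      L1 (x \<star> v) = incl_b x \<star> v"
    using prod_ext[OF mclosed_V subspace_E2 E2_tp subspace_tpow order_refl bil1] by blast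
  obtain L2 :: "('k, 'v) T \<Rightarrow> ('k, 'v) T" where L2: "lin L2" "\<And>v x. v \<in> tp 1 \<Longrightarrow> x \<in> E2 \<Longrightarrow>
      L2 (v \<star> x) = v \<star> incl_b x"
    using prod_ext[OF mclosed_V subspace_tpow order_refl subspace_E2 E2_tp bil2] by blast
  have T1: "tensor_map A E2 (tp 1) (\<lambda>x. incl V (\<beta> x)) id z = L1 z"
    by (rule tensor_map_eq[OF L1(1) _ z(1)]) (simp add: L1 E2b)
  have T2: "tensor_map A (tp 1) E2 id (\<lambda>x. incl V (\<beta> x)) z = L2 z"
    by (rule tensor_map_eq[OF L2(1) _ z(2)]) (simp add: L2 E2b)
  \<comment> \<open>Two lifts of the same \<open>z\<close>, to \<open>E2 \<otimes> V\<close> and to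
    \<open>V \<otimes> E2\<close>; the bracket identities are stated for these lifts and not for
    \<open>z\<close> itself.\<close>
  obtain t where t: "t \<in> pt E2 (tp 1)" "mult_pair t = z"
      using mult_pair_lift[OF z(1)[unfolded sub_prod_def lspan_T] E2T tp_sub] by blast
  obtain t' where t': "t' \<in> pt (tp 1) E2" "mult_pair t' = z"
      using mult_pair_lift[OF z(2)[unfolded sub_prod_def lspan_T] tp_sub E2T] by blast
  have b1: "bV u = L1 (mult_pair u)" if "u \<in> pt E2 (tp 1)" for u
    by (rule pair_eq[OF lin_on_lin[OF bV(1)] lin_on_lin[OF lin_comp[OF L1(1) mult_pair(1)]] E2T tp_sub _ that])
      (use E2_E E2T tp1T in \<open>auto simp: bV mult_pair L1 subset_iff\<close>)
  have b2: "Vb u = L2 (mult_pair u)" if "u \<in> pt (tp 1) E2" for u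
    by (rule pair_eq[OF lin_on_lin[OF Vb(1)] lin_on_lin[OF lin_comp[OF L2(1) mult_pair(1)]] tp_sub E2T _ that])
      (use E2_E E2T tp1T in \<open>auto simp: Vb mult_pair L2 subset_iff\<close>)
  \<comment> \<open>\<open>c\<close> is \<open>-1\<close> on \<open>E2\<close>. The first
    description of \<open>z\<close> gives the sign in the first two positions, the second
    description the sign in the last two.\<close>
  have neg0: "braid_op 3 0 z = - z"
  proof (rule lin_span_eq[OF lin_braid_op3(1) _ _ z(1)[unfolded sub_prod_def lspan_T]])
    show "lin (uminus :: ('k, 'v) T \<Rightarrow> ('k, 'v) T)" by (rule linI) auto
    fix x assume "x \<in> {x \<star> y |x y. x \<in> E2 \<and> y \<in> tp 1}"
    then obtain p q where pq: "x = p \<star> q" "p \<in> E2" "q \<in> tp 1" by blast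
    have "braid_op 3 0 x = c p \<star> q" unfolding pq(1) using pq E2_tp by (intro braid_op_30) auto
    also have "\<dots> = - x" using pq(2) mul_left(2)[of "-1" p q] unfolding pq(1) E2_iff
        by (simp add: fs.scale_minus_left)
    finally show "braid_op 3 0 x = - x" .
  qed
  have neg1: "braid_op 3 1 z = - z"
  proof (rule lin_span_eq[OF lin_braid_op3(2) _ _ z(2)[unfolded sub_prod_def lspan_T]])
    show "lin (uminus :: ('k, 'v) T \<Rightarrow> ('k, 'v) T)" by (rule linI) auto
    fix x assume "x \<in> {x \<star> y |x y. x \<in> tp 1 \<and> y \<in> E2}"
    then obtain p q where pq: "x = q \<star> p" "p \<in> E2" "q \<in> tp 1" by blast
    have pT: "q \<in> Tc" "p \<in> Tc" using pq E2T tp1T by auto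
    have "braid_op 3 1 x = q \<star> c p" unfolding pq(1) using pq E2_tp by (intro braid_op_31) auto
    also have "q \<star> c p = - x" using pq(2) mul_right(2)[OF pT, of "-1"] unfolding pq(1) E2_iff
        by (simp add: fs.scale_minus_left)
    finally show "braid_op 3 1 x = - x" .
  qed
  have "t \<in> pt (tp 2) (tp 1)" "t' \<in> pt (tp 1) (tp 2)"
    using t(1) t'(1) pair_tensor_mono[OF E2_tp order_refl] pair_tensor_mono[OF order_refl E2_tp]
    by blast+
  \<comment> \<open>\<open>c_T\<close> acts as the composite of both operators, so the two signs
    cancel and \<open>z\<close> is reproduced on the other side.\<close>
  then have mt: "mult_pair (cT t) = z" "mult_pair (cT t') = z"
    using mult_pair_cT_21[of t] mult_pair_cT_12[of t'] t(2) t'(2) neg0 neg1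
      fs2.linear_neg[OF lin_braid_op3(1)] fs2.linear_neg[OF lin_braid_op3(2)] by simp_all
  \<comment> \<open>\<open>cT t\<close> lies in \<open>V \<otimes> E2\<close> and multiplies to
    \<open>z\<close>, so \<open>V \<otimes> b\<close> takes it to \<open>L2 z\<close>.\<close>
  have cL1: "c (L1 z) = L2 z"
    using bracket(1)[of t] b1[OF t(1)] b2[OF pt_E2(1)[OF t(1)]] t mt pair_tensor_mono[OF E2_E order_refl] by auto
  have cL2: "c (L2 z) = L1 z"
    using bracket(2)[of t'] b2[OF t'(1)] b1[OF pt_E2(2)[OF t'(1)]] t' mt pair_tensor_mono[OF order_refl E2_E] by auto
  have L1t: "L1 z \<in> tp 2" and zI1: "z - L1 z \<in> I"
  proof -
    show "L1 z \<in> tp 2"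
      by (rule lin_span_in[OF L1(1) _ subspace_tpow z(1)[unfolded sub_prod_def lspan_T]]) (auto simp: L1 mul_tp11)
    have "lin (\<lambda>z. z - L1 z)" by (intro lin_minus lin_id L1)
    then show "z - L1 z \<in> I"
    proof (rule lin_span_in[OF _ _ I_sub(1) z(1)[unfolded sub_prod_def lspan_T]])
      fix x assume "x \<in> {x \<star> y |x y. x \<in> E2 \<and> y \<in> tp 1}"
      then obtain p q where pq: "x = p \<star> q" "p \<in> E2" "q \<in> tp 1" by blast
      have "p \<star> q - incl_b p \<star> q = (p - incl_b p) \<star> q"
          using mul_left(1)[of "p - incl_b p" "incl_b p" q] by simp
      then show "x - L1 x \<in> I" unfolding pq(1) L1(2)[OF pq(2,3)]
        using I_sub(4)[OF I_gen tp1T[OF pq(3)]] pq(2) E2_E by auto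
    qed
  qed
  have L2t: "L2 z \<in> tp 2" and zI2: "z - L2 z \<in> I"
  proof -
    show "L2 z \<in> tp 2"
      by (rule lin_span_in[OF L2(1) _ subspace_tpow z(2)[unfolded sub_prod_def lspan_T]]) (auto simp: L2 mul_tp11)
    have "lin (\<lambda>z. z - L2 z)" by (intro lin_minus lin_id L2)
    then show "z - L2 z \<in> I"
    proof (rule lin_span_in[OF _ _ I_sub(1) z(2)[unfolded sub_prod_def lspan_T]])
      fix x assume "x \<in> {x \<star> y |x y. x \<in> tp 1 \<and> y \<in> E2}"
      then obtain p q where pq: "x = q \<star> p" "p \<in> E2" "q \<in> tp 1" by blast
      have T: "p \<in> Tc" "q \<in> Tc" using pq E2T tp1T by auto
      have "q \<star> p - q \<star> incl_b p = q \<star> (p - incl_b p)"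
        using mul_right(1)[of q "p - incl_b p" "incl_b p"] T by (simp add: fs.subspace_diff)
      then show "x - L2 x \<in> I" unfolding pq(1) L2(2)[OF pq(3,2)]
        using I_sub(3)[OF I_gen T(2)] pq(2) E2_E by auto
    qed
  qed
  define y where "y = L1 z - L2 z"
  have y2: "y \<in> tp 2" unfolding y_def by (rule fs.subspace_diff[OF subspace_tpow L1t L2t])
  obtain c' :: "('k, 'v) T \<Rightarrow> ('k, 'v) T" where c': "lin c'" "\<And>x. x \<in> tp 2 \<Longrightarrow> c' x = c x"
    using lin_on_extend[OF c_lin subspace_tpow] by blast
  have "c y = - y" using c'(2)[OF y2] lin_diff[OF c'(1), of "L1 z"
      "L2 z"] c'(2)[OF L1t] c'(2)[OF L2t] cL1 cL2
    by (simp add: y_def)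
  then have yE: "y \<in> E2" using y2 E2_iff by blast
  have "y = (z - L2 z) - (z - L1 z)" by (simp add: y_def)
  then have yI: "y \<in> I" using fs.subspace_diff[OF I_sub(1) zI2 zI1] by simp
  have "incl_b y = y - (y - incl_b y)" by simp
  also have "\<dots> \<in> I" by (rule fs.subspace_diff[OF I_sub(1) yI I_gen]) (use yE E2_E in blast)
  finally have "incl_b y = 0" using I_tp1 incl_b_tp1 by blast
  then have "b y = 0" unfolding incl_b_def by (rule incl_eq_0)
  then have "\<beta> y = 0" using yE beta_eq by simp
  then show ?thesis unfolding T1 T2 using minus_T[OF mclosed_V] L1t L2t tp_T by (simp add: y_def)
qed

lemma QLie: "QLie_algebra V c cT \<Delta> \<beta>"
  unfolding QLie_algebra_def Let_def
  using bvs bracket_beta qlie by auto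

text \<open>The assumption says that \<open>J\<close> is generated by its part of degree two,
  phrased through arbitrary ideals \<open>K\<close> so that an explicitly spanned one can be
  inserted.\<close>

lemma main_reduction:
  assumes J: "\<And>K. ideal K A \<Longrightarrow> J \<inter> tp 2 \<subseteq> K \<Longrightarrow> J \<subseteq> K"
  shows "env_ideal V E b = env_ideal V E2 \<beta>"
proof -
  interpret ring A by (rule ring_T) simp
  define IQ where "IQ = env_ideal V E2 \<beta>"
  have E2T: "E2 \<subseteq> Tc" using E2_E E_sub(2) by blast
  have g: "{x \<ominus>\<^bsub>A\<^esub> incl V (\<beta> x) |x. x \<in> E2} = {x - incl_b x | x. x \<in> E2}"
    unfolding Setcompr_eq_image
    by (rule image_cong[OF refl]) (use E2T in \<open>auto simp: incl_b_def beta_eq minus_T tp_T[OF incl_tp1]\<close>)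
  have sub: "{x - incl_b x | x. x \<in> E2} \<subseteq> Tc" using E2T by (auto intro!: fs.subspace_diff[OF subspace_T])
  have IQ: "ideal IQ A" unfolding IQ_def env_ideal_def g by (rule genideal_ideal[OF sub])
  have IQ_gen: "x - incl_b x \<in> IQ" if "x \<in> E2" for x
    using that genideal_self[OF sub] unfolding IQ_def env_ideal_def g by blast
  note IQs = ideal_sub[OF IQ]
  have IQ_I: "IQ \<subseteq> I"
    unfolding IQ_def env_ideal_def g by (rule genideal_minimal[OF I_ideal]) (use I_gen E2_E in auto)
  \<comment> \<open>The ideal generated by \<open>E2\<close>. Its spanning elements are homogeneous,
    so a degree projection keeps or kills each of them.\<close>
  define K where "K = fs.span {tens V u \<star> (e \<star> tens V w) | u e w. e \<in> E2}"
  have KT: "K \<subseteq> Tc" unfolding K_def by (rule fs.span_minimal) (use E2T in \<open>auto intro!: mul_closed\<close>)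
  have "ideal K A"
  proof (rule ideal_from_generators[OF _ KT])
    show "fs.subspace K" by (simp add: K_def)
    fix x v assume x: "x \<in> K" and v: "v \<in> tp 1"
    obtain a where a: "v = tens V [a]" using v tp1_incl by (auto simp: incl_def)
    obtain h :: "('k, 'v) T \<Rightarrow> ('k, 'v) T" where h: "lin h" "\<And>x. x \<in> Tc \<Longrightarrow> h x = v \<star> x"
      using lin_on_extend[OF lin_on_mulL[OF mclosed_V lin_on_id _ tp1T[OF v], of Tc] subspace_T] by blast
    have "h x \<in> K"
    proof (rule lin_span_in[OF h(1) _ _ x[unfolded K_def]])
      fix y assume "y \<in> {tens V u \<star> (e \<star> tens V w) | u e w. e \<in> E2}"
      then obtain u e w where y: "y = tens V u \<star> (e \<star> tens V w)" "e \<in> E2" by blast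
      have eT: "e \<in> Tc" using y E2T by blast
      have "h y = v \<star> (tens V u \<star> (e \<star> tens V w))" unfolding y(1) using eT
          by (intro h(2) mul_closed) auto
      also have "\<dots> = (v \<star> tens V u) \<star> (e \<star> tens V w)" using eT tp1T[OF v]
          by (intro mul_assoc[symmetric] mul_closed) auto
      also have "v \<star> tens V u = tens V (a # u)" unfolding a by simp
      finally show "h y \<in> K" unfolding K_def using y(2) by (intro fs.span_base) blast
    qed (simp add: K_def)
    then show "v \<star> x \<in> K" using h(2) x KT by auto
    have l: "lin (\<lambda>x. x \<star> v)" by (rule linI) (simp_all add: mul_left)
    show "x \<star> v \<in> K"
    proof (rule lin_span_in[OF l _ _ x[unfolded K_def]])
      fix y assume "y \<in> {tens V u \<star> (e \<star> tens V w) | u e w. e \<in> E2}"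
      then obtain u e w where y: "y = tens V u \<star> (e \<star> tens V w)" "e \<in> E2" by blast
      have eT: "e \<in> Tc" using y E2T by blast
      have "y \<star> v = tens V u \<star> (e \<star> (tens V w \<star> v))" unfolding y(1) using eT tp1T[OF v]
          by (simp add: mul_assoc mul_closed)
      also have "tens V w \<star> v = tens V (w @ [a])" unfolding a by simp
      finally show "y \<star> v \<in> K" unfolding K_def using y(2) by (intro fs.span_base) blast
    qed (simp add: K_def)
  qed
  moreover have "J \<inter> tp 2 \<subseteq> K"
  proof
    fix x assume "x \<in> J \<inter> tp 2"
    then have x: "x \<in> E2" using E2_iff J_tp2 by blast
    then have "x = tens V [] \<star> (x \<star> tens V [])" using E2T one_mul by auto
    then show "x \<in> K" unfolding K_def using x by (intro fs.span_base) blast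
  qed
  ultimately have JK: "J \<subseteq> K" by (rule J)
  \<comment> \<open>The elements that agree modulo \<open>IQ\<close> with an element of degree at
    most \<open>n\<close>.\<close>
  define S where "S n = {p + q | p q. p \<in> IQ \<and> q \<in> filt V n}" for n
  have subS: "fs.subspace (S n)" for n unfolding S_def
      by (rule fs.subspace_sums[OF IQs(1) subspace_filt])
  \<comment> \<open>In a spanning element of degree \<open>n + 1\<close>, replacing \<open>e\<close>
    by \<open>b e\<close> changes it by an element of \<open>IQ\<close> and lowers the degree by
    one.\<close>
  have KS: "Pd V (Suc n) x \<in> S n" if "x \<in> K" for x n
  proof (rule lin_span_in[OF lin_Pd _ subS that[unfolded K_def]])
    fix y assume "y \<in> {tens V u \<star> (e \<star> tens V w) | u e w. e \<in> E2}"
    then obtain u e w where y: "y = tens V u \<star> (e \<star> tens V w)" "e \<in> E2" by blast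
    have eT: "e \<in> Tc" "e \<in> tp 2" using y E2T E2_tp by auto
    have uw: "tens V u \<in> tp (length u)" "tens V w \<in> tp (length w)" by (auto intro: tens_tpow')
    have ydeg: "y \<in> tp (length u + (2 + length w))" unfolding y(1) by (intro mul_tp uw eT)
    show "Pd V (Suc n) y \<in> S n"
    proof (cases "length u + (2 + length w) = Suc n")
      case False
      then show ?thesis using Pd_tpow[OF ydeg] fs.subspace_0[OF subS] by simp
    next
      case True
      have "tens V u \<star> (incl_b e \<star> tens V w) \<in> tp (length u + (1 + length w))"
          by (intro mul_tp uw incl_b_tp1)
      then have q: "tens V u \<star> (incl_b e \<star> tens V w) \<in> filt V n"
        using tpow_filt[of "length u + (1 + length w)" n V] True by auto
      have "tens V u \<star> ((e - incl_b e) \<star> tens V w) \<in> IQ"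
        by (intro IQs(3) IQs(4) IQ_gen y(2)) auto
      moreover have "tens V u \<star> ((e - incl_b e) \<star> tens V w) = y - tens V u \<star> (incl_b e \<star> tens V w)"
      proof -
        have d: "(e - incl_b e) \<star> tens V w = e \<star> tens V w - incl_b e \<star> tens V w"
          using mul_left(1)[of "e - incl_b e" "incl_b e" "tens V w"] by simp
        have T: "e \<star> tens V w - incl_b e \<star> tens V w \<in> Tc" "incl_b e \<star> tens V w \<in> Tc"
          using eT by (auto intro!: fs.subspace_diff[OF subspace_T] mul_closed)
        show ?thesis unfolding d y(1) using mul_right(1)[OF tens_Tc T, of u] by simp
      qed
      ultimately have "y - tens V u \<star> (incl_b e \<star> tens V w) \<in> IQ" by simp
      moreover have "y = (y - tens V u \<star> (incl_b e \<star> tens V w)) + tens V u \<star> (incl_b e \<star> tens V w)"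
          by simp
      ultimately have "y \<in> S n" unfolding S_def using q by blast
      then show ?thesis using Pd_tpow[OF ydeg] True by simp
    qed
  qed
  have "z \<in> I \<Longrightarrow> z \<in> filt V n \<Longrightarrow> z \<in> IQ" for z n
  proof (induction n arbitrary: z)
    case 0
    then have "z = 0" using I_filt1 filt_mono[of 0 1 V] by auto
    then show ?case using fs.subspace_0[OF IQs(1)] by simp
  next
    case (Suc n)
    have zT: "z \<in> Tc" using Suc I_Tc by blast
    have "Pd V (Suc n) z \<in> K" using top_in_J[OF Suc.prems] JK by blast
    then have "Pd V (Suc n) (Pd V (Suc n) z) \<in> S n" by (rule KS)
    then have "Pd V (Suc n) z \<in> S n" using Pd_tpow[OF Pd_in[OF zT]] by simp
    then obtain p q where pq: "Pd V (Suc n) z = p + q" "p \<in> IQ" "q \<in> filt V n" unfolding S_def by blast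
    \<comment> \<open>Subtracting \<open>p\<close> removes the leading term of \<open>z\<close> and
      leaves only \<open>q\<close> in its place. As \<open>p\<close> also lies in \<open>I\<close>,
      the induction hypothesis applies to \<open>z - p\<close>.\<close>
    have "z - p = (z - Pd V (Suc n) z) + q" using pq(1) by simp
    then have "z - p \<in> filt V n"
      using fs.subspace_add[OF subspace_filt filt_Suc_diff[OF Suc.prems(2)] pq(3)] by (simp only:)
    moreover have "z - p \<in> I" using Suc.prems(1) pq(2) IQ_I by (intro fs.subspace_diff[OF I_sub(1)]) auto
    ultimately have "z - p \<in> IQ" by (rule Suc.IH[rotated])
    then have "(z - p) + p \<in> IQ" using pq(2) by (rule fs.subspace_add[OF IQs(1)])
    then show ?case by simp
  qed
  then have "I \<subseteq> IQ" using filt_exists I_Tc by blast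
  then show ?thesis using IQ_I unfolding I_def IQ_def by blast
qed

section \<open>Quadratic Nichols algebras\<close>

abbreviation coset where "coset x \<equiv> J +>\<^bsub>A\<^esub> x"

lemma coset_eq: "coset x = (\<lambda>h. h + x) ` J" by (auto simp: a_r_coset_def')

lemma mem_coset: "z \<in> coset x \<longleftrightarrow> z - x \<in> J"
proof
  assume "z - x \<in> J"
  then show "z \<in> coset x" unfolding coset_eq by (intro image_eqI[of _ _ "z - x"]) auto
qed (auto simp: coset_eq)

lemma coset_eqI: "x - y \<in> J \<Longrightarrow> coset x = coset y"
proof (rule Set.set_eqI)
  fix z assume xy: "x - y \<in> J"
  have "z - y = (z - x) + (x - y)" "z - x = (z - y) - (x - y)" by auto
  then show "z \<in> coset x \<longleftrightarrow> z \<in> coset y"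
    using fs.subspace_add[OF subspace_J _ xy, of "z - x"] fs.subspace_diff[OF subspace_J _ xy, of
    "z - y"] unfolding mem_coset by metis
qed

lemma coset_self: "x \<in> coset x" unfolding mem_coset using fs.subspace_0[OF subspace_J] by simp

lemma coset_iff: "coset x = coset y \<longleftrightarrow> x - y \<in> J"
  using coset_eqI coset_self[of x] mem_coset[of x y] by blast

lemma coset_0: "coset 0 = J" using mem_coset[of _ 0] by auto

lemma coset_J: "coset x = J \<longleftrightarrow> x \<in> J" using coset_iff[of x 0] coset_0 by simp

abbreviation B where "B \<equiv> quot_algebra A J"

lemma B_carrier: "carrier B = coset ` Tc" and B_zero: "\<zero>\<^bsub>B\<^esub> = J" and B_one: "\<one>\<^bsub>B\<^esub> = coset one1"
  by (auto simp: quot_algebra_def ring.defs FactRing_def A_RCOSETS_def')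

lemma B_add: "coset x \<oplus>\<^bsub>B\<^esub> coset y = coset (x + y)"
proof -
  have "coset x \<oplus>\<^bsub>B\<^esub> coset y = (\<Union>h\<in>coset x. \<Union>k\<in>coset y. {h + k})"
    by (simp add: quot_algebra_def ring.defs FactRing_def set_add_def')
  also have "\<dots> = coset (x + y)"
  proof (intro Set.set_eqI iffI)
    fix z assume "z \<in> (\<Union>h\<in>coset x. \<Union>k\<in>coset y. {h + k})"
    then obtain h k where hk: "z = h + k" "h - x \<in> J" "k - y \<in> J" unfolding mem_coset[symmetric] by blast
    have "z - (x + y) = (h - x) + (k - y)" by (simp add: hk(1))
    then show "z \<in> coset (x + y)" unfolding mem_coset using fs.subspace_add[OF subspace_J hk(2,3)]
        by (simp only:)
  next
    fix z assume "z \<in> coset (x + y)"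
    then have "z - y \<in> coset x" unfolding mem_coset by (simp add: algebra_simps)
    moreover have "z = (z - y) + y" by simp
    ultimately show "z \<in> (\<Union>h\<in>coset x. \<Union>k\<in>coset y. {h + k})" using coset_self[of y] by blast
  qed
  finally show ?thesis .
qed

lemma B_mult: "x \<in> Tc \<Longrightarrow> y \<in> Tc \<Longrightarrow> coset x \<otimes>\<^bsub>B\<^esub> coset y = coset (x \<star> y)"
  using ideal.rcoset_mult_add[OF ideal_J] by (simp add: quot_algebra_def ring.defs FactRing_def)

text \<open>The definition takes a union over all representatives of the coset; they contribute
  equal cosets, and there is at least one of them.\<close>

lemma B_smult: "k \<odot>\<^bsub>B\<^esub> coset x = coset (fscale k x)"
proof -
  have "k \<odot>\<^bsub>B\<^esub> coset x = (\<Union>z\<in>coset x. coset (fscale k z))"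
    by (simp add: quot_algebra_def ring.defs module.defs)
  also have "\<dots> = (\<Union>z\<in>coset x. coset (fscale k x))"
  proof (rule SUP_cong[OF refl coset_eqI])
    fix z assume "z \<in> coset x"
    then show "fscale k z - fscale k x \<in> J"
      using fs.subspace_scale[OF subspace_J, of "z - x" k]
      by (simp add: mem_coset fs.scale_right_diff_distrib)
  qed
  also have "\<dots> = coset (fscale k x)" using coset_self[of x] by blast
  finally show ?thesis .
qed

text \<open>\<open>q\<close> identifies \<open>V\<close> with the degree-one part of the Nichols algebra \<open>B\<close>.\<close>
definition q where "q v = coset (incl V v)"
abbreviation "B1 \<equiv> B\<lparr>carrier := coset ` tp 1\<rparr>"

lemma B1_carrier: "coset ` tp 1 = range q"
  by (auto simp: q_def[abs_def] tp1_incl image_image)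

lemma q_lin: "q (x + y) = q x \<oplus>\<^bsub>B\<^esub> q y" "q (s k x) = k \<odot>\<^bsub>B\<^esub> q x"
  by (simp_all add: q_def B_add B_smult incl_lin)

text \<open>\<open>J\<close> contains no nonzero vector because the symmetrizer of degree one is the
  identity; hence \<open>q\<close> is injective.\<close>

lemma q_inv: "inv_into UNIV q (q v) = v"
proof -
  have "inj q"
  proof (rule injI)
    fix v w assume "q v = q w"
    then have "incl V v - incl V w \<in> J" by (simp add: q_def coset_iff)
    moreover have d: "incl V v - incl V w = incl V (v - w)" using incl_lin(1)[of "v - w" w] by simp
    ultimately have "incl V (v - w) = 0" using J_tp_small[of "incl V (v - w)"] incl_tp1 by simp
    then show "v = w" using incl_eq_0[of "v - w"] by simp
  qed
  then show ?thesis by simp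
qed

lemma mclosed_B1: "mclosed B1"
  unfolding mclosed_def using q_lin by (auto simp: B1_carrier) (metis rangeI)+

text \<open>\<open>quadratic_algebra\<close> speaks of the tensor algebra over the degree-one part
  of the Nichols algebra, whose letters are cosets. These maps relabel letters by \<open>q\<close>
  and back, which transports ideals to the tensor algebra of \<open>V\<close>.\<close>

definition from_B1 where "from_B1 = univ (\<lambda>w. tens V (map (inv_into UNIV q) w))"
definition to_B1 where "to_B1 = univ (\<lambda>w. tens B1 (map q w))"

lemma lin_from_B1: "lin from_B1" and lin_to_B1: "lin to_B1"
    by (simp_all add: from_B1_def to_B1_def lin_univ)

lemma from_B1_tens: "from_B1 (tens B1 w) = tens V (map (inv_into UNIV q) w)"
  unfolding from_B1_def
proof (rule univ_tens[OF mlinI])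
  fix us ws x y assume "x \<in> carrier B1" "y \<in> carrier B1"
  then obtain v w where [simp]: "x = q v" "y = q w" by (auto simp: B1_carrier)
  show "tens V (map (inv_into UNIV q) (us @ [x \<oplus>\<^bsub>B1\<^esub> y] @ ws))
      = tens V (map (inv_into UNIV q) (us @ [x] @ ws)) + tens V (map (inv_into UNIV q) (us @ [y] @ ws))"
    using tens_add[of "map (inv_into UNIV q) us" V "map (inv_into UNIV q) ws" v w]
    by (simp add: q_lin[symmetric] q_inv)
next
  fix us ws x k assume "x \<in> carrier B1"
  then obtain v where [simp]: "x = q v" by (auto simp: B1_carrier)
  show "tens V (map (inv_into UNIV q) (us @ [k \<odot>\<^bsub>B1\<^esub> x] @ ws))
      = fscale k (tens V (map (inv_into UNIV q) (us @ [x] @ ws)))"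
    using tens_smult[of "map (inv_into UNIV q) us" V "map (inv_into UNIV q) ws" v k]
    by (simp add: q_lin[symmetric] q_inv)
qed

lemma q_lists: "map q w \<in> lists (carrier B1)" by (auto simp: B1_carrier)

lemma to_B1_tens: "to_B1 (tens V w) = tens B1 (map q w)"
  unfolding to_B1_def
proof (rule univ_tens[OF mlinI])
  fix us ws x y
  show "tens B1 (map q (us @ [x \<oplus>\<^bsub>V\<^esub> y] @ ws))
      = tens B1 (map q (us @ [x] @ ws)) + tens B1 (map q (us @ [y] @ ws))"
    using tens_add[of "map q us" B1 "map q ws" "q x" "q y"] q_lists by (auto simp: B1_carrier q_lin)
next
  fix us ws x k
  show "tens B1 (map q (us @ [k \<odot>\<^bsub>V\<^esub> x] @ ws)) = fscale k (tens B1 (map q (us @ [x] @ ws)))"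
    using tens_smult[of "map q us" B1 "map q ws" "q x" k] q_lists by (auto simp: B1_carrier q_lin)
qed

lemma from_B1_to_B1: "x \<in> Tc \<Longrightarrow> from_B1 (to_B1 x) = x"
  unfolding Tc_eq
  by (rule lin_span_eq[OF lin_comp[OF lin_from_B1 lin_to_B1] lin_id(1)]) (auto simp: from_B1_tens to_B1_tens q_inv o_def)

lemma to_B1_in: "x \<in> Tc \<Longrightarrow> to_B1 x \<in> carrier (\<T> B1)"
  unfolding Tc_eq
  by (rule lin_span_in[OF lin_to_B1 _ subspace_T]) (auto simp only: to_B1_tens intro!: tens_in_T q_lists)

lemma from_B1_in: "x \<in> carrier (\<T> B1) \<Longrightarrow> from_B1 x \<in> Tc"
  unfolding carrier_T[of B1]
  by (rule lin_span_in[OF lin_from_B1 _ subspace_T]) (auto simp: from_B1_tens)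

lemma from_B1_tp: "x \<in> tpow B1 n \<Longrightarrow> from_B1 x \<in> tp n"
  unfolding tpow_eq[of B1]
  by (rule lin_span_in[OF lin_from_B1 _ subspace_tpow]) (auto simp: from_B1_tens words_def intro!: tens_tpow')

lemma from_B1_mult:
  assumes "x \<in> carrier (\<T> B1)" "y \<in> carrier (\<T> B1)"
  shows "from_B1 (x \<otimes>\<^bsub>\<T> B1\<^esub> y) = from_B1 x \<star> from_B1 y"
proof (rule bil_eq[where h = "\<lambda>x y. from_B1 (x \<otimes>\<^bsub>\<T> B1\<^esub> y)" and h' = "\<lambda>x y. from_B1 x \<star> from_B1 y"
      and S = "tens B1 ` lists (carrier B1)" and R =
          "tens B1 ` lists (carrier B1)", OF _ _ _ _ subspace_T subspace_T])
  show "bil (carrier (\<T> B1)) (carrier (\<T> B1)) (\<lambda>x y. from_B1 (x \<otimes>\<^bsub>\<T> B1\<^esub> y))"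
    by (rule bil_lin[OF mult_T_bil[OF mclosed_B1] lin_from_B1])
  show "bil (carrier (\<T> B1)) (carrier (\<T> B1)) (\<lambda>x y. from_B1 x \<star> from_B1 y)"
    unfolding bil_def lin_on_def by (simp add: lin_add[OF lin_from_B1] lin_scale[OF lin_from_B1]
        mul_left mul_right from_B1_in)
  show "tens B1 ` lists (carrier B1) \<subseteq> carrier (\<T> B1)" "tens B1 ` lists (carrier B1) \<subseteq> carrier (\<T> B1)"
    by (auto intro: tens_in_T)
  show "x \<in> fs.span (tens B1 ` lists (carrier B1))" "y \<in> fs.span (tens B1 ` lists (carrier B1))"
    using assms by (simp_all add: carrier_T)
  fix x y assume "x \<in> tens B1 ` lists (carrier B1)" "y \<in> tens B1 ` lists (carrier B1)"
  then obtain u w where "u \<in> lists (carrier B1)" "x = tens B1 u" "w \<in> lists (carrier B1)" "y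
      = tens B1 w" by blast
  then show "from_B1 (x \<otimes>\<^bsub>\<T> B1\<^esub> y) = from_B1 x \<star> from_B1 y"
    using tens_append[OF mclosed_B1, of u w] by (simp only:) (simp add: from_B1_tens)
qed

lemma word_prod_B: "w \<in> lists (coset ` tp 1) \<Longrightarrow> word_prod B w = coset (tens V (map (inv_into UNIV q) w))"
proof (induction w)
  case Nil
  show ?case by (simp add: word_prod_def B_one)
next
  case (Cons x w)
  then obtain v where x: "x = q v" by (auto simp: B1_carrier)
  have "word_prod B (x # w) = x \<otimes>\<^bsub>B\<^esub> word_prod B w" by (simp add: word_prod_def)
  also have "word_prod B w = coset (tens V (map (inv_into UNIV q) w))" using Cons by simp
  also have "x \<otimes>\<^bsub>B\<^esub> coset (tens V (map (inv_into UNIV q) w))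
      = coset (tens V [v] \<star> tens V (map (inv_into UNIV q) w))"
    unfolding x q_def incl_def by (rule B_mult) simp_all
  also have "tens V [v] \<star> tens V (map (inv_into UNIV q) w) = tens V (map (inv_into UNIV q) (x # w))"
    by (simp add: x q_inv)
  finally show ?case .
qed

text \<open>The values are cosets and not functionals, so the description in \<open>lin_ext\<close>
  is resolved on lists of pure tensors: a word of cosets multiplies to the coset of the word of
  representatives.\<close>

lemma pi_eq:
  assumes t: "t \<in> carrier (\<T> B1)"
  shows "lin_ext (\<T> B1) B (lists (coset ` tp 1)) (tens B1) (word_prod B) t = coset (from_B1 t)"
proof (rule lin_ext_eqI[OF fsp_T])
  show "t \<in> fs.span (tens B1 ` lists (coset ` tp 1))" using t by (simp add: carrier_T)
  fix ps :: "('k \<times> ('k, 'v) T set list) list"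
  show "snd ` set ps \<subseteq> lists (coset ` tp 1) \<Longrightarrow>
    lincomb B (map (apsnd (word_prod B)) ps)
        = coset (from_B1 (lincomb (\<T> B1) (map (apsnd (tens B1)) ps)))"
  proof (induction ps)
    case Nil
    show ?case by (simp add: lincomb_def B_zero lin_0[OF lin_from_B1] coset_0)
  next
    case (Cons p ps)
    obtain k w where p: "p = (k, w)" by force
    have "lincomb B (map (apsnd (word_prod B)) (p # ps))
        = (k \<odot>\<^bsub>B\<^esub> word_prod B w) \<oplus>\<^bsub>B\<^esub> lincomb B (map (apsnd (word_prod B)) ps)"
      by (simp add: lincomb_def p)
    then show ?case using Cons
      by (simp add: p word_prod_B B_smult B_add lin_add[OF lin_from_B1] lin_scale[OF lin_from_B1] from_B1_tens)
  qed
qed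

text \<open>The hypothesis says that the preimage \<open>J1\<close> of \<open>J\<close> under
  \<open>from_B1\<close> is generated in degree two. \<open>K\<close> is pulled back to an ideal
  \<open>K1\<close>, minimality gives \<open>J1 \<subseteq> K1\<close>, and \<open>to_B1\<close>
  brings the inclusion back to \<open>J\<close> and \<open>K\<close>.\<close>

lemma J_quadratic:
  assumes quad: "quadratic_algebra (Nichols_algebra V c) (Nichols_deg V c)"
    and K: "ideal K A" and JK: "J \<inter> tp 2 \<subseteq> K"
  shows "J \<subseteq> K"
proof
  interpret R: ring "\<T> B1" by (rule ring_T[OF mclosed_B1])
  define J1 where "J1 = {t \<in> carrier (\<T> B1). from_B1 t \<in> J}"
  have "Nichols_deg V c 1 = coset ` tp 1" "Nichols_algebra V c = B"
    by (simp_all add: Nichols_deg_def Nichols_algebra_def Nichols_ideal_eq)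
  moreover have "{t \<in> carrier (\<T> B1). lin_ext (\<T> B1) B (lists (coset ` tp 1)) (tens B1) (word_prod B) t = \<zero>\<^bsub>B\<^esub>} = J1"
    unfolding J1_def by (rule Collect_cong, rule conj_cong[OF refl]) (simp only: pi_eq B_zero coset_J)
  ultimately have J1: "J1 = Idl\<^bsub>\<T> B1\<^esub> (J1 \<inter> tpow B1 2)"
    using quad unfolding quadratic_algebra_def Let_def by simp
  note Ks = ideal_sub[OF K]
  define K1 where "K1 = {t \<in> carrier (\<T> B1). from_B1 t \<in> K}"
  have "ideal K1 (\<T> B1)"
  proof (rule idealI)
    show "ring (\<T> B1)" by (rule R.ring_axioms)
    have inv: "\<ominus>\<^bsub>\<T> B1\<^esub> x = - x" if "x \<in> K1" for x
      by (rule R.minus_equality) (use that fs.subspace_neg[OF subspace_T] in \<open>auto simp: K1_def\<close>)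
    show "subgroup K1 (add_monoid (\<T> B1))"
    proof (rule group.subgroupI[OF R.a_group])
      show "K1 \<subseteq> carrier (add_monoid (\<T> B1))" by (auto simp: K1_def)
      show "K1 \<noteq> {}"
        using fs.subspace_0[OF Ks(1)] fs.subspace_0[OF subspace_T] lin_0[OF lin_from_B1]
        unfolding K1_def by force
      show "inv\<^bsub>add_monoid (\<T> B1)\<^esub> a \<in> K1" if "a \<in> K1" for a
        using inv[OF that] that unfolding a_inv_def K1_def
        by (simp add: fs.subspace_neg[OF subspace_T] fs.subspace_neg[OF Ks(1)] fs2.linear_neg[OF lin_from_B1])
      show "a \<otimes>\<^bsub>add_monoid (\<T> B1)\<^esub> b \<in> K1" if "a \<in> K1" "b \<in> K1" for a b
        using that unfolding K1_def
        by (simp add: fs.subspace_add[OF Ks(1)] fs.subspace_add[OF subspace_T] lin_add[OF lin_from_B1])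
    qed
  next
    fix a x assume "a \<in> K1" "x \<in> carrier (\<T> B1)"
    then show "x \<otimes>\<^bsub>\<T> B1\<^esub> a \<in> K1" "a \<otimes>\<^bsub>\<T> B1\<^esub> x \<in> K1"
      by (simp_all add: K1_def from_B1_mult from_B1_in Ks(3,4) mult_T_closed[OF mclosed_B1])
  qed
  moreover have "J1 \<inter> tpow B1 2 \<subseteq> K1" using JK from_B1_tp by (auto simp: J1_def K1_def)
  ultimately have "J1 \<subseteq> K1" unfolding J1[symmetric] by (subst J1) (rule R.genideal_minimal)
  fix x assume x: "x \<in> J"
  then have xT: "x \<in> Tc" by (simp add: J_def)
  then have "to_B1 x \<in> J1" using x by (simp add: J1_def to_B1_in from_B1_to_B1)
  then show "x \<in> K" using \<open>J1 \<subseteq> K1\<close> xT by (auto simp: K1_def from_B1_to_B1)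
qed

end

theorem theorem3p11:
  fixes s :: "'k::field \<Rightarrow> 'v::ab_group_add \<Rightarrow> 'v"
    and c :: "('k, 'v) T \<Rightarrow> ('k, 'v) T"
    and cT :: "('k, 'v) TT \<Rightarrow> ('k, 'v) TT"
    and \<Delta> :: "('k, 'v) T \<Rightarrow> ('k, 'v) TT"
    and b :: "('k, 'v) T \<Rightarrow> 'v"
  defines "V \<equiv> space_of s"
  assumes "vector_space s"
    and "tensor_bialgebra V c cT \<Delta>"
    and "braided_Lie_algebra V c cT \<Delta> b"
    and "quadratic_algebra (Nichols_algebra V c) (Nichols_deg V c)"
  shows "QLie_algebra V c cT \<Delta> (restrict b (E_deg V \<Delta> 2)) \<and>
         U_alg V \<Delta> b = UQ_alg V \<Delta> (restrict b (E_deg V \<Delta> 2))"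
proof -
  obtain \<epsilon> where \<epsilon>: "braided_bialgebra (\<T> V) cT \<Delta> \<epsilon>" "\<And>n x. n \<ge> 1 \<Longrightarrow> x \<in> tpow V n \<Longrightarrow> \<epsilon> x = 0"
    using conjunct1[OF assms(3)[unfolded tensor_bialgebra_def]] by auto
  have "braided_vector_space V c" using assms(4) unfolding braided_Lie_algebra_def by blast
  then interpret braided_space s V c
    by (intro braided_space.intro) (simp_all only: V_def assms(2))
  interpret tensor_bialg s V c cT \<Delta> \<epsilon>
    by (intro tensor_bialg.intro tensor_bialg_axioms.intro braided_space_axioms assms(3) \<epsilon>)
  interpret braided_lie s V c cT \<Delta> \<epsilon> b
    by (intro braided_lie.intro braided_lie_axioms.intro tensor_bialg_axioms assms(4))
  have "env_ideal V (E_all V \<Delta>) b = env_ideal V E2 \<beta>"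
    by (rule main_reduction) (rule J_quadratic[OF assms(5)])
  then show ?thesis using QLie by (simp add: U_alg_def UQ_alg_def \<beta>_def)
qed

end
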